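(* Let $g\ge1$ be a fixed integer. For each integer $k\ge 1$ and each real $0\le r<1$ there is a number $C(r,k)$ such that for all $d\ge 1$ and all vectors $x=(x_1,\dots,x_g)\in\mathbb{C}^g$ with $\|x\|_2\le r$, $$\int_{U(d)^g}\Big|\det\Big(I_d+\sum_{j=1}^gx_jU_j\Big)\Big|^{2k}\,d\mathcal{U}\le C(r,k).$$
   Context: $U(d)$ is the group of $d\times d$ complex unitary matrices with its normalized Haar probability measure, and $d\mathcal{U}=dU_1\times\cdots\times dU_g$ is the product measure on $U(d)^g$, $\mathcal{U}=(U_1,\dots,U_g)$. $\|\cdot\|_2$ is the Euclidean norm on $\mathbb{C}^g$. *)

theory Defs
  imports
    "HOL-Analysis.Finite_Product_Measure"
    "HOL-Analysis.L2_Norm"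
    "HOL-Probability.Probability_Measure"
    "Jordan_Normal_Form.Determinant"
    "Jordan_Normal_Form.Schur_Decomposition"
begin

text \<open>The bound in the main statement is uniform in the dimension \<open>d\<close>, which is therefore a natural
  number that can be quantified inside a formula; matrices are those of \<open>Jordan_Normal_Form\<close>.\<close>

definition unitary_group :: "nat \<Rightarrow> complex mat set" where
  "unitary_group d = {U \<in> carrier_mat d d. U * mat_adjoint U = 1\<^sub>m d \<and> mat_adjoint U * U = 1\<^sub>m d}"

text \<open>The subspace topology of $U(d)$ in $C^{d \times d}$. The type of matrices carries no topology,
  so it is pulled back along the map to the family of entries. That map is restricted to
  the valid index pairs because entries out of bounds are unspecified.\<close>

definition unitary_topology :: "nat \<Rightarrow> complex mat topology" where
  "unitary_topology d =
     pullback_topology (unitary_group d)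
       (\<lambda>A. \<lambda>ij\<in>{..<d} \<times> {..<d}. A $$ ij)
       (product_topology (\<lambda>_. euclidean) ({..<d} \<times> {..<d}))"

definition unitary_borel :: "nat \<Rightarrow> complex mat measure" where
  "unitary_borel d = sigma (unitary_group d) {S. openin (unitary_topology d) S}"

text \<open>As $U(d)$ is a compact group, exactly one measure satisfies this predicate.\<close>

definition is_unitary_haar :: "nat \<Rightarrow> complex mat measure \<Rightarrow> bool" where
  "is_unitary_haar d \<mu> \<longleftrightarrow>
     prob_space \<mu> \<and> sets \<mu> = sets (unitary_borel d) \<and>
     (\<forall>V \<in> unitary_group d. \<forall>S \<in> sets \<mu>. emeasure \<mu> ((\<lambda>U. V * U) ` S) = emeasure \<mu> S)"

definition matrix_combination ::
  "nat \<Rightarrow> nat \<Rightarrow> (nat \<Rightarrow> complex) \<Rightarrow> (nat \<Rightarrow> complex mat) \<Rightarrow> complex mat" where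
  "matrix_combination d g x U =
     finsum (module_mat TYPE(complex) d d) (\<lambda>j. x j \<cdot>\<^sub>m U j) {1..g}"

lemma matrix_combination_entries:
  assumes "\<And>j. j \<in> {1..g} \<Longrightarrow> U j \<in> carrier_mat d d"
  shows "matrix_combination d g x U = mat d d (\<lambda>ab. \<Sum>j=1..g. x j * U j $$ ab)"
  using assms
proof (induction g)
  case 0
  interpret M: abelian_group "module_mat TYPE(complex) d d" by (rule abelian_group_mat)
  have "matrix_combination d 0 x U = 0\<^sub>m d d"
    by (simp add: matrix_combination_def) (simp add: module_mat_def)
  then show ?case by (intro eq_matI) auto
next
  case (Suc g)
  interpret M: abelian_group "module_mat TYPE(complex) d d" by (rule abelian_group_mat)
  have U: "U j \<in> carrier_mat d d" if "j \<in> {1..Suc g}" for j using Suc.prems that by blast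
  have "matrix_combination d (Suc g) x U = x (Suc g) \<cdot>\<^sub>m U (Suc g) + matrix_combination d g x U"
  proof -
    have "{1..Suc g} = insert (Suc g) {1..g}" by auto
    moreover have "x j \<cdot>\<^sub>m U j \<in> carrier (module_mat TYPE(complex) d d)" if "j \<in> {1..Suc g}" for j
      using U[OF that] by (simp add: module_mat_def)
    ultimately show ?thesis
      unfolding matrix_combination_def
      by (simp add: M.finsum_insert Pi_def) (simp add: module_mat_def)
  qed
  also have "matrix_combination d g x U = mat d d (\<lambda>ab. \<Sum>j=1..g. x j * U j $$ ab)"
    using Suc by simp
  finally show ?case using U[of "Suc g"] by (intro eq_matI) auto
qed

end

theory Submission
  imports Defs
    "HOL-Probability.Distributions"
    "HOL-Probability.Probability_Mass_Function"
    "HOL-Probability.Infinite_Product_Measure"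
begin

text \<open>
  For a fixed invertible matrix \<open>A\<close>, the Haar average of \<open>\<bar>det (1 + V A)\<bar>\<^sup>2\<^sup>k\<close> over \<open>V\<close> is dual to a
  Gaussian average: for a \<open>2k \<times> k\<close> complex Gaussian matrix with blocks \<open>T\<close>, \<open>W\<close> and the eigenvalues
  \<open>y\<^sub>i\<close> of \<open>A A\<^sup>*\<close> it equals the mean of \<open>\<Prod>\<^sub>i det (W\<^sup>* W + y\<^sub>i T\<^sup>* T)\<close> divided by the mean of
  \<open>\<bar>det W\<bar>\<^sup>2\<^sup>d\<close>. As each factor is log-concave in \<open>y\<^sub>i\<close>, all \<open>y\<^sub>i\<close> may be replaced by their mean
  \<open>\<rho> = tr (A A\<^sup>*) / d\<close>. The coefficient of \<open>\<rho>\<^sup>n\<close> in the result is the trace of a reproducing kernel, that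
  is, the dimension of a space of polynomials of degree \<open>n\<close> in \<open>k\<^sup>2\<close> variables, so that the moment is at
  most \<open>\<Sum>\<^sub>n \<rho>\<^sup>n (n + 1) ^ (k * k)\<close>, uniformly in \<open>d\<close>.

  By left invariance the integrand may be averaged over \<open>V\<close> with \<open>A = \<Sum>\<^sub>j x\<^sub>j U\<^sub>j\<close>. Then
  \<open>\<rho> = \<parallel>x\<parallel>\<^sup>2 + (1 / d) \<Sum>\<^sub>i\<^sub>\<noteq>\<^sub>j cnj x\<^sub>i x\<^sub>j tr (U\<^sub>i\<^sup>* U\<^sub>j)\<close>, where \<open>\<parallel>x\<parallel> < 1\<close>, and the event that \<open>\<rho>\<close>
  comes close to \<open>1\<close> is controlled by the exponential moments of \<open>tr V\<close>. Since
  \<open>exp (Re (w tr V))\<close> is at most \<open>exp (5 \<bar>w\<bar>\<^sup>2 d) \<bar>det (1 + w V)\<bar>\<close> for small \<open>w\<close>, these are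
  bounded by the moments above for \<open>A = w\<close> and a larger \<open>k\<close>.
\<close>

section \<open>Determinants over index sets\<close>

text \<open>The only property of Haar measure at hand is left invariance. The duality therefore
  rests on one identity, \<open>avg_det\<close>: the average over V of a product of determinants det
  (1 + Q X V) times cnj (det V) ^ k depends on X through det X ^ k alone. It applies to |det (1 + A
  V)| ^ (2k) because the conjugate of det (1 + A V) is cnj (det V) cnj (det A) det (1 + C V), where
  C inverts the adjoint of A; singular A is reached by a limit. Expanding the Gaussian means is then
  combinatorics: they become sums over maps \<phi> on \<open>grid k d\<close> with common weights
  \<open>tsum\<close>. The obstacle to uniformity in d is that \<rho> can be as large as the square
  of the sum of the |x_j|, which may exceed 1. Above a threshold t < 1 the bound for fixed A grows
  like exp (k d (\<rho> / t - 1)), so deviations of \<rho> must be controlled at an exponential rate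
  in d. The gap between the squared norm of x and t supplies a factor exp (- \<delta> d), and the
  larger power of the determinant is chosen so that the exponential moments of the traces grow no
  faster than exp (\<delta> d).\<close>

definition sdet :: "'a set \<Rightarrow> ('a \<Rightarrow> 'a \<Rightarrow> 'b::comm_ring_1) \<Rightarrow> 'b" where
  "sdet J M = (\<Sum>p | p permutes J. of_int (sign p) * (\<Prod>i\<in>J. M i (p i)))"

lemma det_eq_sdet: "det (mat n n f) = sdet {..<n} (\<lambda>i j. f (i, j))"
proof -
  have "(\<Prod>i = 0..<n. mat n n f $$ (i, p i)) = (\<Prod>i\<in>{..<n}. f (i, p i))" if "p permutes {0..<n}" for p
    using that by (intro prod.cong) (auto simp: permutes_in_image)
  then show ?thesis
    unfolding sdet_def by (subst det_def') (auto simp: atLeast0LessThan intro!: sum.cong)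
qed

lemma sdet_cong:
  assumes "J = J'" "\<And>i j. i \<in> J' \<Longrightarrow> j \<in> J' \<Longrightarrow> M i j = N i j"
  shows "sdet J M = sdet J' N"
  unfolding sdet_def assms(1)
  by (intro sum.cong refl arg_cong2[of _ _ _ _ "(*)"] prod.cong) (auto simp: assms(2) permutes_in_image)

lemma sdet_empty [simp]: "sdet {} M = 1"
  by (simp add: sdet_def)

lemma bij_betw_map_permutation:
  assumes "bij_betw f A B"
  shows "bij_betw (map_permutation A f) {p. p permutes A} {p. p permutes B}"
proof (rule bij_betw_byWitness[where f' = "map_permutation B (inv_into A f)"])
  let ?g = "inv_into A f"
  have g: "bij_betw ?g B A" by (rule bij_betw_inv_into[OF assms])
  show "\<forall>p\<in>{p. p permutes A}. map_permutation B ?g (map_permutation A f p) = p"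
    using assms by (auto intro!: map_permutation_compose_inv simp: bij_betw_inv_into_left)
  show "\<forall>p\<in>{p. p permutes B}. map_permutation A f (map_permutation B ?g p) = p"
    using assms g by (auto intro!: map_permutation_compose_inv simp: bij_betw_inv_into_right)
  show "map_permutation A f ` {p. p permutes A} \<subseteq> {p. p permutes B}"
    using map_permutation_permutes[OF assms] by auto
  show "map_permutation B ?g ` {p. p permutes B} \<subseteq> {p. p permutes A}"
    using map_permutation_permutes[OF g] by auto
qed

lemma map_permutation_apply:
  assumes "bij_betw f A B" "p permutes A" "x \<in> A"
  shows "map_permutation A f p (f x) = f (p x)"
  using assms unfolding map_permutation_def restrict_id_def bij_betw_def by auto

lemma sum_sign_bij:
  assumes "bij_betw f A B" "finite A"
  shows "(\<Sum>p | p permutes B. of_int (sign p) * h p)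
    = (\<Sum>p | p permutes A. of_int (sign p) * h (map_permutation A f p) :: 'b::comm_ring_1)"
proof -
  have "(\<Sum>p | p permutes B. of_int (sign p) * h p)
    = (\<Sum>p | p permutes A. of_int (sign (map_permutation A f p)) * h (map_permutation A f p))"
    by (rule sum.reindex_bij_betw[OF bij_betw_map_permutation[OF assms(1)], symmetric])
  also have "\<dots> = (\<Sum>p | p permutes A. of_int (sign p) * h (map_permutation A f p))"
    using assms by (intro sum.cong) (auto simp: sign_map_permutation bij_betw_def)
  finally show ?thesis .
qed

lemma sdet_bij:
  assumes "bij_betw f A B" "finite A"
  shows "sdet B M = sdet A (\<lambda>i j. M (f i) (f j))"
proof -
  have "(\<Prod>i\<in>B. M i (map_permutation A f p i)) = (\<Prod>i\<in>A. M (f i) (f (p i)))" if "p permutes A" for p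
    using that by (subst prod.reindex_bij_betw[OF assms(1), symmetric])
      (auto intro!: prod.cong simp: map_permutation_apply[OF assms(1)])
  then show ?thesis
    unfolding sdet_def by (subst sum_sign_bij[OF assms]) (auto intro!: sum.cong)
qed

section \<open>Block decompositions and expansions of determinants\<close>

text \<open>A permutation p with p i in B for some i in A contributes a zero factor, so only those p
  survive that map the finite set A onto itself. Such a p splits uniquely into a permutation of A
  and one of B, and the signs multiply.\<close>

lemma sdet_Un:
  assumes fin: "finite A" "finite B" and disj: "A \<inter> B = {}"
    and zero: "\<And>i j. i \<in> A \<Longrightarrow> j \<in> B \<Longrightarrow> M i j = 0"
  shows "sdet (A \<union> B) M = sdet A M * sdet B M"
proof -
  let ?P = "\<lambda>S. {p. p permutes S}"
  let ?Q = "{p. p permutes (A \<union> B) \<and> p ` A = A}"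
  let ?t = "\<lambda>S p. of_int (sign p) * (\<Prod>i\<in>S. M i (p i))"
  have "sdet (A \<union> B) M = (\<Sum>p\<in>?Q. ?t (A \<union> B) p)"
    unfolding sdet_def
  proof (rule sum.mono_neutral_right)
    show "\<forall>p\<in>?P (A \<union> B) - ?Q. ?t (A \<union> B) p = 0"
    proof
      fix p assume p: "p \<in> ?P (A \<union> B) - ?Q"
      have "\<not> p ` A \<subseteq> A"
      proof
        assume "p ` A \<subseteq> A"
        moreover have "inj_on p A" using p by (auto simp: permutes_inj_on)
        ultimately have "p ` A = A" using fin(1) by (simp add: endo_inj_surj)
        then show False using p by simp
      qed
      then obtain i where i: "i \<in> A" "p i \<notin> A" by auto
      then have "p i \<in> B" using p by (auto dest: permutes_in_image[of p "A \<union> B" i])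
      then have "M i (p i) = 0" using zero i by auto
      then have "(\<Prod>i\<in>A \<union> B. M i (p i)) = 0"
        using fin i by (intro prod_zero) auto
      then show "?t (A \<union> B) p = 0" by simp
    qed
  qed (use fin in \<open>auto simp: finite_permutations\<close>)
  also have "\<dots> = (\<Sum>(p, q)\<in>?P A \<times> ?P B. ?t A p * ?t B q)"
  proof (rule sum.reindex_bij_witness[where
        j = "\<lambda>p. (restrict_id p A, restrict_id p B)" and i = "\<lambda>(p, q). p \<circ> q"])
    fix p assume "p \<in> ?Q"
    then have p: "p permutes (A \<union> B)" "p ` A = A" by auto
    have pB: "p ` B = B"
    proof -
      have "p ` (A \<union> B) = A \<union> B" using p(1) by (rule permutes_image)
      moreover have "p ` A \<inter> p ` B = {}"
        using permutes_inj[OF p(1)] disj by (auto simp: inj_eq)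
      ultimately show ?thesis using p(2) disj by (auto simp: image_Un)
    qed
    have inj: "inj_on p X" for X using permutes_inj_on[OF p(1)] .
    have a: "restrict_id p A permutes A"
      by (rule permutes_restrict_id) (use p inj in \<open>auto simp: bij_betw_def\<close>)
    have b: "restrict_id p B permutes B"
      by (rule permutes_restrict_id) (use pB inj in \<open>auto simp: bij_betw_def\<close>)
    show "(restrict_id p A, restrict_id p B) \<in> ?P A \<times> ?P B" using a b by simp
    show comp: "(case (restrict_id p A, restrict_id p B) of (p, q) \<Rightarrow> p \<circ> q) = p"
      using p pB disj by (force simp: restrict_id_def fun_eq_iff permutes_def)
    have "sign p = sign (restrict_id p A) * sign (restrict_id p B)"
      using comp sign_compose[OF permutes_imp_permutation[OF fin(1) a] permutes_imp_permutation[OF fin(2) b]]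
      by simp
    then show "(case (restrict_id p A, restrict_id p B) of (p, q) \<Rightarrow> ?t A p * ?t B q) = ?t (A \<union> B) p"
      using fin disj by (simp add: prod.union_disjoint restrict_id_def ac_simps)
  next
    fix pq assume "pq \<in> ?P A \<times> ?P B"
    then obtain p q where pq: "pq = (p, q)" "p permutes A" "q permutes B" by auto
    have 1: "(p \<circ> q) i = p i" if "i \<in> A" for i
      using that pq disj by (auto simp: permutes_def)
    have 2: "(p \<circ> q) i = q i" if "i \<in> B" for i
      using that pq disj permutes_in_image[OF pq(3), of i] by (auto simp: permutes_def)
    have 3: "p i = i" if "i \<notin> A" for i using that pq by (auto simp: permutes_def)
    have 4: "q i = i" if "i \<notin> B" for i using that pq by (auto simp: permutes_def)
    show "(restrict_id (case pq of (p, q) \<Rightarrow> p \<circ> q) A, restrict_id (case pq of (p, q) \<Rightarrow> p \<circ> q) B) = pq"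
      using 1 2 3 4 by (auto simp: pq(1) restrict_id_def fun_eq_iff)
    show "(case pq of (p, q) \<Rightarrow> p \<circ> q) \<in> ?Q"
      using pq permutes_compose[of q "A \<union> B" p] permutes_subset[of p A "A \<union> B"] permutes_subset[of q B "A \<union> B"]
        permutes_image[OF pq(2)] image_cong[OF refl 1, of A]
      by auto
  qed
  also have "\<dots> = sdet A M * sdet B M"
    by (simp add: sdet_def sum_product sum.cartesian_product)
  finally show ?thesis .
qed

lemma sdet_UN:
  assumes "finite L" "\<And>l. l \<in> L \<Longrightarrow> finite (F l)"
    and "\<And>l l'. l \<in> L \<Longrightarrow> l' \<in> L \<Longrightarrow> l \<noteq> l' \<Longrightarrow> F l \<inter> F l' = {}"
    and "\<And>l l' i j. l \<in> L \<Longrightarrow> l' \<in> L \<Longrightarrow> l \<noteq> l' \<Longrightarrow> i \<in> F l \<Longrightarrow> j \<in> F l' \<Longrightarrow> M i j = 0"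
  shows "sdet (\<Union>l\<in>L. F l) M = (\<Prod>l\<in>L. sdet (F l) M)"
  using assms
proof (induction L rule: finite_induct)
  case (insert l L)
  have "sdet (F l \<union> (\<Union>l\<in>L. F l)) M = sdet (F l) M * sdet (\<Union>l\<in>L. F l) M"
  proof (rule sdet_Un)
    show "F l \<inter> (\<Union>l\<in>L. F l) = {}" using insert.hyps insert.prems(2)[of l] by fastforce
    show "M i j = 0" if "i \<in> F l" "j \<in> (\<Union>l\<in>L. F l)" for i j
      using that insert.hyps insert.prems(3)[of l] by fastforce
  qed (use insert in auto)
  also have "sdet (\<Union>l\<in>L. F l) M = (\<Prod>l\<in>L. sdet (F l) M)"
    using insert.prems by (intro insert.IH) blast+
  finally show ?case using insert.hyps by simp
qed simp

text \<open>Used to read a product of k determinants of size d as one signed sum over permutations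
  of \<open>grid k d\<close>, to which Wick's formula applies in one go.\<close>

lemma sdet_fst_blocks:
  fixes k d :: nat
  shows "sdet ({..<k} \<times> {..<d}) (\<lambda>e e'. if fst e = fst e' then N (fst e) (snd e) (snd e') else 0)
    = (\<Prod>b<k. sdet {..<d} (N b))" (is "sdet _ ?M = _")
proof -
  have "{..<k} \<times> {..<d} = (\<Union>b\<in>{..<k}. {b} \<times> {..<d})" by auto
  then have "sdet ({..<k} \<times> {..<d}) ?M = sdet (\<Union>b\<in>{..<k}. {b} \<times> {..<d}) ?M" by simp
  also have "\<dots> = (\<Prod>b<k. sdet ({b} \<times> {..<d}) ?M)"
    by (rule sdet_UN) auto
  also have "\<dots> = (\<Prod>b<k. sdet {..<d} (N b))"
  proof (rule prod.cong[OF refl])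
    fix b :: nat
    have "bij_betw (Pair b) {..<d} ({b} \<times> {..<d})" by (auto simp: bij_betw_def inj_on_def)
    then show "sdet ({b} \<times> {..<d}) ?M = sdet {..<d} (N b)" by (subst sdet_bij) auto
  qed
  finally show ?thesis .
qed

lemma sdet_snd_blocks:
  fixes k d :: nat
  shows "sdet ({..<k} \<times> {..<d}) (\<lambda>e e'. if snd e = snd e' then N (snd e) (fst e) (fst e') else 0)
    = (\<Prod>i<d. sdet {..<k} (N i))" (is "sdet _ ?M = _")
proof -
  have bij: "bij_betw prod.swap ({..<d} \<times> {..<k}) ({..<k} \<times> {..<d})"
    by (auto simp: bij_betw_def inj_on_def)
  have "sdet ({..<k} \<times> {..<d}) ?M
    = sdet ({..<d} \<times> {..<k}) (\<lambda>e e'. if fst e = fst e' then N (fst e) (snd e) (snd e') else 0)"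
    by (subst sdet_bij[OF bij]) (auto intro!: sdet_cong)
  then show ?thesis by (simp only: sdet_fst_blocks)
qed

text \<open>Expand every row product by the set E of rows in which N is chosen; the remaining
  Kronecker factors force the permutation to fix J - E pointwise. This is the expansion of det (1 +
  N) into principal minors.\<close>

lemma sdet_one_plus:
  assumes "finite J"
  shows "sdet J (\<lambda>i j. of_bool (i = j) + N i j) = (\<Sum>E\<in>Pow J. sdet E N)"
proof -
  let ?P = "\<lambda>S. {p. p permutes S}"
  have "sdet J (\<lambda>i j. of_bool (i = j) + N i j)
    = (\<Sum>p\<in>?P J. \<Sum>E\<in>Pow J. of_int (sign p) * ((\<Prod>i\<in>E. N i (p i)) * (\<Prod>i\<in>J - E. of_bool (i = p i))))"
    unfolding sdet_def
  proof (rule sum.cong[OF refl])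
    fix p
    have "(\<Prod>i\<in>J. of_bool (i = p i) + N i (p i)) = (\<Prod>i\<in>J. N i (p i) + of_bool (i = p i))"
      by (simp add: add.commute)
    then show "of_int (sign p) * (\<Prod>i\<in>J. of_bool (i = p i) + N i (p i)) =
      (\<Sum>E\<in>Pow J. of_int (sign p) * ((\<Prod>i\<in>E. N i (p i)) * (\<Prod>i\<in>J - E. of_bool (i = p i))))"
      by (simp only: prod_add[OF assms] sum_distrib_left)
  qed
  also have "\<dots> = (\<Sum>E\<in>Pow J. \<Sum>p\<in>?P J.
      of_int (sign p) * ((\<Prod>i\<in>E. N i (p i)) * (\<Prod>i\<in>J - E. of_bool (i = p i))))"
    by (rule sum.swap)
  also have "\<dots> = (\<Sum>E\<in>Pow J. sdet E N)"
  proof (rule sum.cong[OF refl])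
    fix E assume "E \<in> Pow J"
    then have E: "E \<subseteq> J" by simp
    have "(\<Sum>p\<in>?P J. of_int (sign p) * ((\<Prod>i\<in>E. N i (p i)) * (\<Prod>i\<in>J - E. of_bool (i = p i))))
      = (\<Sum>p\<in>?P E. of_int (sign p) * ((\<Prod>i\<in>E. N i (p i)) * (\<Prod>i\<in>J - E. of_bool (i = p i))))"
    proof (rule sum.mono_neutral_right)
      show "?P E \<subseteq> ?P J" using E permutes_subset by blast
      show "\<forall>p\<in>?P J - ?P E. of_int (sign p) * ((\<Prod>i\<in>E. N i (p i)) * (\<Prod>i\<in>J - E. of_bool (i = p i))) = 0"
      proof
        fix p assume p: "p \<in> ?P J - ?P E"
        then have "\<not> p permutes E" "p permutes J" by auto
        then obtain i where "i \<in> J - E" "p i \<noteq> i"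
          using permutes_superset[of p J E] by blast
        then have "(\<Prod>i\<in>J - E. of_bool (i = p i)) = (0::'b)"
          using assms by (intro prod_zero bexI[of _ i]) auto
        then show "of_int (sign p) * ((\<Prod>i\<in>E. N i (p i)) * (\<Prod>i\<in>J - E. of_bool (i = p i))) = 0"
          by simp
      qed
    qed (use assms in \<open>auto simp: finite_permutations\<close>)
    also have "\<dots> = sdet E N"
      unfolding sdet_def by (intro sum.cong) (auto simp: permutes_def)
    finally show "(\<Sum>p\<in>?P J. of_int (sign p) * ((\<Prod>i\<in>E. N i (p i)) * (\<Prod>i\<in>J - E. of_bool (i = p i))))
      = sdet E N" .
  qed
  finally show ?thesis .
qed

section \<open>Wick's formula\<close>

text \<open>The pairings of Wick's formula, between the conjugated and the holomorphic factors.
  Functions are taken extensional so that there are finitely many.\<close>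

definition bijs :: "'a set \<Rightarrow> 'b set \<Rightarrow> ('a \<Rightarrow> 'b) set" where
  "bijs T S = {f \<in> T \<rightarrow>\<^sub>E S. bij_betw f T S}"

lemma finite_bijs [simp]: "finite T \<Longrightarrow> finite S \<Longrightarrow> finite (bijs T S)"
  unfolding bijs_def by (rule finite_subset[OF _ finite_PiE[of T "\<lambda>_. S"]]) auto

lemma bijs_empty: "finite S \<Longrightarrow> bijs {} S = (if S = {} then {\<lambda>_. undefined} else {})"
  by (auto simp: bijs_def bij_betw_def)

lemma sum_bijs_insert:
  assumes t: "t \<notin> T" and fin: "finite T" "finite S"
  shows "(\<Sum>f\<in>bijs (insert t T) S. F f) = (\<Sum>s\<in>S. \<Sum>f\<in>bijs T (S - {s}). F (f(t := s)))"
proof -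
  have "(\<Sum>s\<in>S. \<Sum>f\<in>bijs T (S - {s}). F (f(t := s)))
    = (\<Sum>(s, f)\<in>Sigma S (\<lambda>s. bijs T (S - {s})). F (f(t := s)))"
    using fin by (subst sum.Sigma) auto
  also have "\<dots> = (\<Sum>f\<in>bijs (insert t T) S. F f)"
  proof (rule sum.reindex_bij_witness[where i = "\<lambda>f. (f t, f(t := undefined))" and j = "\<lambda>(s, f). f(t := s)"])
    fix a assume "a \<in> (SIGMA s:S. bijs T (S - {s}))"
    then obtain s f where a: "a = (s, f)" "s \<in> S" "f \<in> T \<rightarrow>\<^sub>E (S - {s})" "bij_betw f T (S - {s})"
      by (auto simp: bijs_def)
    show "((case a of (s, f) \<Rightarrow> f(t := s)) t, (case a of (s, f) \<Rightarrow> f(t := s))(t := undefined)) = a"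
      using a t by (auto simp: fun_eq_iff PiE_def extensional_def)
    have "bij_betw (f(t := s)) T (S - {s})"
      using a(4) t by (subst bij_betw_cong[of _ _ f]) auto
    then have "bij_betw (f(t := s)) (insert t T) (insert s (S - {s}))"
      using t by (auto simp: bij_betw_def inj_on_def)
    then show "(case a of (s, f) \<Rightarrow> f(t := s)) \<in> bijs (insert t T) S"
      using a t by (auto simp: bijs_def insert_absorb PiE_def extensional_def)
  next
    fix f assume "f \<in> bijs (insert t T) S"
    then have f: "f \<in> insert t T \<rightarrow>\<^sub>E S" "bij_betw f (insert t T) S" by (auto simp: bijs_def)
    then have ft: "f t \<in> S" by auto
    have "bij_betw f T (S - {f t})"
      using f(2) t by (auto simp: bij_betw_def inj_on_def)
    then have "bij_betw (f(t := undefined)) T (S - {f t})"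
      using t by (subst bij_betw_cong[of _ _ f]) auto
    moreover have "f(t := undefined) \<in> T \<rightarrow>\<^sub>E (S - {f t})"
      using f t by (auto simp: PiE_def extensional_def bij_betw_def inj_on_def)
    ultimately show "(f t, f(t := undefined)) \<in> (SIGMA s:S. bijs T (S - {s}))"
      using ft by (auto simp: bijs_def)
  qed auto
  finally show ?thesis by simp
qed

lemma card_fibre_Diff:
  assumes "finite S" "s \<in> S"
  shows "card {x \<in> S - {s}. f x = v} = card {x \<in> S. f x = v} - (if f s = v then 1 else 0)"
proof (cases "f s = v")
  case True
  then have "{x \<in> S - {s}. f x = v} = {x \<in> S. f x = v} - {s}" by auto
  then show ?thesis using True assms by simp
next
  case False
  then have "{x \<in> S - {s}. f x = v} = {x \<in> S. f x = v}" by auto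
  then show ?thesis using False by simp
qed

text \<open>The left-hand side counts the bijections p with f o p = g on T, that is, the ways to
  match the fibres of g with those of f; there are none unless all fibre sizes agree. In Wick's
  formula v runs over the Gaussian variables, and the factorial of n is the mean of |z v| ^
  (2n).\<close>

lemma sum_bijs_fibres:
  fixes f :: "'s \<Rightarrow> 'v" and g :: "'t \<Rightarrow> 'v"
  assumes "finite Z" "finite T" "finite S" "f \<in> S \<rightarrow> Z" "g \<in> T \<rightarrow> Z"
  shows "(\<Sum>p\<in>bijs T S. \<Prod>t\<in>T. of_bool (f (p t) = g t)) =
    (\<Prod>v\<in>Z. if card {s \<in> S. f s = v} = card {t \<in> T. g t = v} then fact (card {s \<in> S. f s = v}) else 0 :: complex)"
  using assms(2-5)
proof (induction T arbitrary: S rule: finite_induct)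
  case empty
  show ?case
  proof (cases "S = {}")
    case False
    then obtain s where s: "s \<in> S" by auto
    then have "card {x \<in> S. f x = f s} \<noteq> 0" "f s \<in> Z" using empty by auto
    then have "(\<Prod>v\<in>Z. if card {s \<in> S. f s = v} = card {t \<in> {}. g t = v} then fact (card {s \<in> S. f s = v}) else 0 :: complex) = 0"
      using assms(1) by (intro prod_zero bexI[of _ "f s"]) auto
    then show ?thesis using False empty by (simp add: bijs_empty)
  qed (simp add: bijs_empty)
next
  case (insert t T)
  let ?a = "\<lambda>S v. card {s \<in> S. f s = v}" and ?b = "\<lambda>T v. card {t \<in> T. g t = v}"
  let ?m = "\<lambda>S T v. if ?a S v = ?b T v then fact (?a S v) else 0 :: complex"
  have gt: "g t \<in> Z" using insert.prems by auto
  have b: "?b (insert t T) v = ?b T v + (if g t = v then 1 else 0)" for v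
  proof -
    have "{x \<in> insert t T. g x = v} = (if g t = v then insert t {x \<in> T. g x = v} else {x \<in> T. g x = v})"
      by auto
    then show ?thesis using insert.hyps by auto
  qed
  have "(\<Sum>p\<in>bijs (insert t T) S. \<Prod>t\<in>insert t T. of_bool (f (p t) = g t))
    = (\<Sum>s\<in>S. \<Sum>p\<in>bijs T (S - {s}). of_bool (f s = g t) * (\<Prod>t\<in>T. of_bool (f (p t) = g t)) :: complex)"
    using insert.hyps insert.prems
    by (subst sum_bijs_insert) (auto intro!: sum.cong prod.cong)
  also have "\<dots> = (\<Sum>s\<in>S. of_bool (f s = g t) * (\<Prod>v\<in>Z. ?m (S - {s}) T v))"
    using insert.prems by (intro sum.cong refl) (auto simp: sum_distrib_left[symmetric] insert.IH Pi_def)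
  \<comment> \<open>The partner s of t has to lie in the fibre over \<open>g t\<close>. All such s
    give the same value, and their number supplies the missing factor of the factorial.\<close>
  also have "\<dots> = (\<Sum>s\<in>{s \<in> S. f s = g t}. \<Prod>v\<in>Z. ?m (S - {s}) T v)"
    using insert.prems by (intro sum.mono_neutral_cong_right) auto
  also have "\<dots> = (\<Sum>s\<in>{s \<in> S. f s = g t}.
      (if ?a S (g t) = Suc (?b T (g t)) then fact (?b T (g t)) else 0) * (\<Prod>v\<in>Z - {g t}. ?m S T v))"
  proof (rule sum.cong[OF refl])
    fix s assume "s \<in> {s \<in> S. f s = g t}"
    then have s: "s \<in> S" "f s = g t" by auto
    have pos: "?a S (g t) > 0" using s insert.prems by (auto simp: card_gt_0_iff)
    have "(\<Prod>v\<in>Z. ?m (S - {s}) T v) = ?m (S - {s}) T (g t) * (\<Prod>v\<in>Z - {g t}. ?m (S - {s}) T v)"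
      using assms(1) gt by (rule prod.remove)
    also have "?m (S - {s}) T (g t) = (if ?a S (g t) = Suc (?b T (g t)) then fact (?b T (g t)) else 0)"
    proof -
      have "?a (S - {s}) (g t) = ?a S (g t) - 1"
        using card_fibre_Diff[of S s f "g t"] s insert.prems by simp
      then show ?thesis using pos by auto
    qed
    also have "(\<Prod>v\<in>Z - {g t}. ?m (S - {s}) T v) = (\<Prod>v\<in>Z - {g t}. ?m S T v)"
    proof (rule prod.cong[OF refl])
      fix v assume "v \<in> Z - {g t}"
      then have "?a (S - {s}) v = ?a S v"
        using card_fibre_Diff[of S s f v] s insert.prems by auto
      then show "?m (S - {s}) T v = ?m S T v" by (simp only:)
    qed
    finally show "(\<Prod>v\<in>Z. ?m (S - {s}) T v) =
      (if ?a S (g t) = Suc (?b T (g t)) then fact (?b T (g t)) else 0) * (\<Prod>v\<in>Z - {g t}. ?m S T v)" .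
  qed
  also have "\<dots> = ?m S (insert t T) (g t) * (\<Prod>v\<in>Z - {g t}. ?m S T v)"
    unfolding b by (simp add: algebra_simps)
  also have "(\<Prod>v\<in>Z - {g t}. ?m S T v) = (\<Prod>v\<in>Z - {g t}. ?m S (insert t T) v)"
    unfolding b by (intro prod.cong refl) auto
  also have "?m S (insert t T) (g t) * (\<Prod>v\<in>Z - {g t}. ?m S (insert t T) v) = (\<Prod>v\<in>Z. ?m S (insert t T) v)"
    using assms(1) gt by (rule prod.remove[symmetric])
  finally show ?case .
qed

text \<open>\<open>H F c\<close> abstracts that F has Gaussian mean c. As a relation it covers
  \<open>has_bochner_integral\<close>, where integrability is part of the claim, as well as finite
  weighted sums. Moments are prescribed only up to order K in z and in its conjugate, since the
  finite signed measures constructed below provide no more.\<close>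

locale wick =
  fixes Z :: "'v set" and K :: nat and H :: "(('v \<Rightarrow> complex) \<Rightarrow> complex) \<Rightarrow> complex \<Rightarrow> bool"
  assumes fin_Z: "finite Z"
    and H_zero: "H (\<lambda>z. 0) 0"
    and H_add: "H F1 c1 \<Longrightarrow> H F2 c2 \<Longrightarrow> H (\<lambda>z. F1 z + F2 z) (c1 + c2)"
    and H_mult: "H F' c' \<Longrightarrow> H (\<lambda>z. a * F' z) (a * c')"
    and H_moment: "sum p Z \<le> K \<Longrightarrow> sum q Z \<le> K \<Longrightarrow>
      H (\<lambda>z. \<Prod>v\<in>Z. z v ^ p v * cnj (z v) ^ q v) (\<Prod>v\<in>Z. if p v = q v then fact (p v) else 0)"
begin

lemma H_sum:
  assumes "finite I" "\<And>i. i \<in> I \<Longrightarrow> H (F i) (c i)"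
  shows "H (\<lambda>z. \<Sum>i\<in>I. F i z) (\<Sum>i\<in>I. c i)"
  using assms by (induction I rule: finite_induct) (auto intro: H_zero H_add)

definition lin :: "('v \<Rightarrow> complex) \<Rightarrow> ('v \<Rightarrow> complex) \<Rightarrow> complex" where
  "lin u z = (\<Sum>v\<in>Z. u v * z v)"

text \<open>The covariance of \<open>lin u z\<close> and \<open>lin w z\<close> for independent
  standard complex Gaussian coordinates.\<close>

definition gram :: "('v \<Rightarrow> complex) \<Rightarrow> ('v \<Rightarrow> complex) \<Rightarrow> complex" where
  "gram u w = (\<Sum>v\<in>Z. u v * cnj (w v))"

lemma H_monomial:
  assumes "finite S" "finite T" "card S \<le> K" "card T \<le> K" "f \<in> S \<rightarrow> Z" "g \<in> T \<rightarrow> Z"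
  shows "H (\<lambda>z. (\<Prod>s\<in>S. z (f s)) * (\<Prod>t\<in>T. cnj (z (g t))))
    (\<Sum>p\<in>bijs T S. \<Prod>t\<in>T. of_bool (f (p t) = g t))"
proof -
  let ?a = "\<lambda>v. card {s \<in> S. f s = v}" and ?b = "\<lambda>v. card {t \<in> T. g t = v}"
  have group: "(\<Prod>s\<in>A. h (e s)) = (\<Prod>v\<in>Z. h v ^ card {s \<in> A. e s = v})"
    if "finite A" "e \<in> A \<rightarrow> Z" for A :: "'s set" and e and h :: "'v \<Rightarrow> complex"
  proof -
    have "(\<Prod>s\<in>A. h (e s)) = (\<Prod>v\<in>Z. \<Prod>s\<in>{s \<in> A. e s = v}. h (e s))"
      using that fin_Z by (subst prod.group) auto
    then show ?thesis by simp
  qed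
  have eq: "(\<Prod>s\<in>S. z (f s)) * (\<Prod>t\<in>T. cnj (z (g t))) = (\<Prod>v\<in>Z. z v ^ ?a v * cnj (z v) ^ ?b v)" for z
  proof -
    have "(\<Prod>t\<in>T. cnj (z (g t))) = (\<Prod>v\<in>Z. \<Prod>s\<in>{s \<in> T. g s = v}. cnj (z (g s)))"
      using assms fin_Z by (subst prod.group) auto
    then show ?thesis using assms by (subst group) (auto simp: prod.distrib)
  qed
  have card: "(\<Sum>v\<in>Z. ?a v) = card S" "(\<Sum>v\<in>Z. ?b v) = card T"
  proof -
    show "(\<Sum>v\<in>Z. ?a v) = card S"
      using assms fin_Z sum.group[of S Z f "\<lambda>_. 1 :: nat"] by auto
    show "(\<Sum>v\<in>Z. ?b v) = card T"
      using assms fin_Z sum.group[of T Z g "\<lambda>_. 1 :: nat"] by auto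
  qed
  have "H (\<lambda>z. \<Prod>v\<in>Z. z v ^ ?a v * cnj (z v) ^ ?b v) (\<Prod>v\<in>Z. if ?a v = ?b v then fact (?a v) else 0)"
    by (rule H_moment) (use card assms in auto)
  then show ?thesis using assms fin_Z by (simp only: eq sum_bijs_fibres)
qed

text \<open>Multilinear expansion into coordinates reduces the claim to \<open>H_monomial\<close>,
  where \<open>sum_bijs_fibres\<close> has already rewritten the moment as a sum over
  pairings.\<close>

theorem wick_formula:
  assumes fin: "finite S" "finite T" and card: "card S \<le> K" "card T \<le> K"
  shows "H (\<lambda>z. (\<Prod>s\<in>S. lin (u s) z) * (\<Prod>t\<in>T. cnj (lin (w t) z)))
    (\<Sum>p\<in>bijs T S. \<Prod>t\<in>T. gram (u (p t)) (w t))"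
proof -
  let ?S = "S \<rightarrow>\<^sub>E Z" and ?T = "T \<rightarrow>\<^sub>E Z"
  let ?c = "\<lambda>f g. (\<Prod>s\<in>S. u s (f s)) * (\<Prod>t\<in>T. cnj (w t (g t)))"
  let ?e = "\<lambda>f g. \<Sum>p\<in>bijs T S. \<Prod>t\<in>T. of_bool (f (p t) = g t)"
  have finS: "finite ?S" and finT: "finite ?T" using fin fin_Z by (auto intro: finite_PiE)
  have expand: "(\<Prod>s\<in>S. lin (u s) z) * (\<Prod>t\<in>T. cnj (lin (w t) z))
    = (\<Sum>f\<in>?S. \<Sum>g\<in>?T. ?c f g * ((\<Prod>s\<in>S. z (f s)) * (\<Prod>t\<in>T. cnj (z (g t)))))" for z
  proof -
    have "(\<Prod>s\<in>S. lin (u s) z) = (\<Sum>f\<in>?S. \<Prod>s\<in>S. u s (f s) * z (f s))"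
      unfolding lin_def using fin fin_Z by (subst prod_sum_PiE) auto
    moreover have "(\<Prod>t\<in>T. cnj (lin (w t) z)) = (\<Sum>g\<in>?T. \<Prod>t\<in>T. cnj (w t (g t)) * cnj (z (g t)))"
      unfolding lin_def using fin fin_Z by (subst prod_sum_PiE[symmetric]) auto
    ultimately show ?thesis by (simp add: sum_product prod.distrib ac_simps)
  qed
  have "H (\<lambda>z. \<Sum>f\<in>?S. \<Sum>g\<in>?T. ?c f g * ((\<Prod>s\<in>S. z (f s)) * (\<Prod>t\<in>T. cnj (z (g t)))))
    (\<Sum>f\<in>?S. \<Sum>g\<in>?T. ?c f g * ?e f g)"
    by (intro H_sum[OF finS] H_sum[OF finT] H_mult H_monomial[OF fin card]) auto
  moreover have "(\<Sum>f\<in>?S. \<Sum>g\<in>?T. ?c f g * ?e f g) = (\<Sum>p\<in>bijs T S. \<Prod>t\<in>T. gram (u (p t)) (w t))"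
  proof -
    have "(\<Sum>f\<in>?S. \<Sum>g\<in>?T. ?c f g * ?e f g)
      = (\<Sum>f\<in>?S. \<Sum>g\<in>?T. \<Sum>p\<in>bijs T S. ?c f g * (\<Prod>t\<in>T. of_bool (f (p t) = g t)))"
      by (simp add: sum_distrib_left)
    also have "\<dots> = (\<Sum>p\<in>bijs T S. \<Sum>g\<in>?T. \<Sum>f\<in>?S. ?c f g * (\<Prod>t\<in>T. of_bool (f (p t) = g t)))"
      (is "?l = _")
    proof -
      have "?l = (\<Sum>g\<in>?T. \<Sum>f\<in>?S. \<Sum>p\<in>bijs T S. ?c f g * (\<Prod>t\<in>T. of_bool (f (p t) = g t)))"
        by (rule sum.swap)
      also have "\<dots> = (\<Sum>g\<in>?T. \<Sum>p\<in>bijs T S. \<Sum>f\<in>?S. ?c f g * (\<Prod>t\<in>T. of_bool (f (p t) = g t)))"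
        by (intro sum.cong refl sum.swap)
      finally show ?thesis by (simp only: sum.swap[of _ "bijs T S" ?T])
    qed
    also have "\<dots> = (\<Sum>p\<in>bijs T S. \<Sum>g\<in>?T. \<Prod>t\<in>T. u (p t) (g t) * cnj (w t (g t)))"
    proof (intro sum.cong refl)
      fix p g assume "p \<in> bijs T S" and g: "g \<in> ?T"
      then have p: "bij_betw p T S" by (simp add: bijs_def)
      define q where "q = inv_into T p"
      have q: "q s \<in> T" "p (q s) = s" if "s \<in> S" for s
        using that p bij_betw_inv_into_right[OF p] bij_betw_inv_into[OF p]
        unfolding q_def by (auto simp: bij_betw_def)
      have qp: "q (p t) = t" if "t \<in> T" for t
        unfolding q_def using p that by (rule bij_betw_inv_into_left)
      have pS: "p t \<in> S" if "t \<in> T" for t using p that by (auto simp: bij_betw_def)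
      \<comment> \<open>For a fixed pairing p the indicator forces f o p = g on T, so the sum over f
        collapses to one term, g composed with the inverse of p.\<close>
      define f0 where "f0 = (\<lambda>s\<in>S. g (q s))"
      have f0: "f0 \<in> ?S" using q g by (auto simp: f0_def)
      have "(\<Sum>f\<in>?S. ?c f g * (\<Prod>t\<in>T. of_bool (f (p t) = g t)))
        = (\<Sum>f\<in>{f0}. ?c f g * (\<Prod>t\<in>T. of_bool (f (p t) = g t)))"
      proof (rule sum.mono_neutral_right)
        show "\<forall>f\<in>?S - {f0}. ?c f g * (\<Prod>t\<in>T. of_bool (f (p t) = g t)) = 0"
        proof
          fix f assume f: "f \<in> ?S - {f0}"
          have "\<exists>s\<in>S. f s \<noteq> f0 s"
          proof (rule ccontr)
            assume "\<not> ?thesis"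
            then have "f = f0" using f f0 by (intro PiE_ext[of f S "\<lambda>_. Z" f0]) auto
            then show False using f by simp
          qed
          then obtain s where s: "s \<in> S" "f s \<noteq> g (q s)" by (auto simp: f0_def)
          then have "(\<Prod>t\<in>T. of_bool (f (p t) = g t)) = (0::complex)"
            using q fin by (intro prod_zero bexI[of _ "q s"]) auto
          then show "?c f g * (\<Prod>t\<in>T. of_bool (f (p t) = g t)) = 0" by simp
        qed
      qed (use f0 finS in auto)
      also have "\<dots> = ?c f0 g"
        using qp pS by (simp add: f0_def)
      also have "(\<Prod>s\<in>S. u s (f0 s)) = (\<Prod>t\<in>T. u (p t) (g t))"
        using qp pS by (subst prod.reindex_bij_betw[OF p, symmetric]) (auto simp: f0_def intro!: prod.cong)
      finally show "(\<Sum>f\<in>?S. ?c f g * (\<Prod>t\<in>T. of_bool (f (p t) = g t)))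
        = (\<Prod>t\<in>T. u (p t) (g t) * cnj (w t (g t)))"
        by (simp add: prod.distrib)
    qed
    also have "\<dots> = (\<Sum>p\<in>bijs T S. \<Prod>t\<in>T. gram (u (p t)) (w t))"
      unfolding gram_def using fin fin_Z by (intro sum.cong refl) (subst prod_sum_PiE, auto)
    finally show ?thesis .
  qed
  ultimately show ?thesis by (simp add: expand)
qed

end

section \<open>Moments of minors of Gaussian matrices\<close>

text \<open>Members of \<open>bijs\<close> are undefined outside J, permutations are the identity
  there; the hypothesis makes F insensitive to the difference.\<close>

lemma sum_bijs_self:
  assumes "finite J" "\<And>p. F (restrict p J) = F p"
  shows "(\<Sum>p\<in>bijs J J. F p) = (\<Sum>p | p permutes J. F p)"
proof (rule sum.reindex_bij_witness[where i = "\<lambda>p. restrict p J" and j = "\<lambda>p. restrict_id p J"])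
  fix p assume p: "p \<in> bijs J J"
  then show "restrict (restrict_id p J) J = p"
    by (auto simp: bijs_def restrict_id_def fun_eq_iff PiE_def extensional_def restrict_def)
  have "bij_betw p J J" using p by (simp add: bijs_def)
  then show "restrict_id p J \<in> {p. p permutes J}"
    using permutes_restrict_id by auto
  have "restrict (restrict_id p J) J = restrict p J"
    by (auto simp: restrict_id_def fun_eq_iff restrict_def)
  then show "F (restrict_id p J) = F p" using assms(2)[of p] assms(2)[of "restrict_id p J"] by simp
next
  fix p assume "p \<in> {p. p permutes J}"
  then have p: "p permutes J" by simp
  show "restrict_id (restrict p J) J = p"
    using p by (auto simp: restrict_id_def fun_eq_iff permutes_def)
  have "bij_betw (restrict p J) J J"
    using permutes_imp_bij[OF p] by (subst bij_betw_cong[of _ _ p]) auto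
  then show "restrict p J \<in> bijs J J" using p by (auto simp: bijs_def permutes_in_image)
qed

lemma prod_of_bool:
  assumes "finite A"
  shows "(\<Prod>x\<in>A. of_bool (P x)) = (of_bool (\<forall>x\<in>A. P x) :: 'a::comm_semiring_1)"
  using assms by (induction A rule: finite_induct) auto

lemma prod_if_zero:
  assumes "finite A"
  shows "(\<Prod>x\<in>A. if P x then f x else 0) = (of_bool (\<forall>x\<in>A. P x) * (\<Prod>x\<in>A. f x) :: 'a::comm_semiring_1)"
  using assms by (induction A rule: finite_induct) auto

abbreviation grid :: "nat \<Rightarrow> nat \<Rightarrow> (nat \<times> nat) set" where
  "grid k d \<equiv> {..<k} \<times> {..<d}"

text \<open>Both sides of the duality below are sums over maps \<open>\<phi>\<close> on \<open>grid k d\<close>, weighted by this number.\<close>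

definition tsum :: "nat \<Rightarrow> nat \<Rightarrow> (nat \<times> nat \<Rightarrow> nat) \<Rightarrow> complex" where
  "tsum k d \<phi> = (\<Sum>\<beta> | \<beta> permutes grid k d. \<Sum>\<sigma> | \<sigma> permutes grid k d.
     of_int (sign \<beta>) * of_int (sign \<sigma>) * of_bool (\<forall>e\<in>grid k d. \<phi> (\<beta> e) = \<phi> e) *
     of_bool (\<forall>e\<in>grid k d. fst (\<sigma> e) = fst e \<and> snd (\<sigma> e) = snd (\<beta> e)))"

lemma tsum_cong:
  assumes "\<And>e. e \<in> grid k d \<Longrightarrow> \<phi> e = \<psi> e"
  shows "tsum k d \<phi> = tsum k d \<psi>"
proof -
  have "(\<forall>e\<in>grid k d. \<phi> (\<beta> e) = \<phi> e) = (\<forall>e\<in>grid k d. \<psi> (\<beta> e) = \<psi> e)"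
    if "\<beta> permutes grid k d" for \<beta>
    by (intro ball_cong refl) (simp add: assms permutes_in_image[OF that] del: mem_Sigma_iff)
  then show ?thesis unfolding tsum_def by (intro sum.cong refl) simp
qed

text \<open>Two cells with the same second component and the same value of \<phi> are exchanged by
  s. Then \<beta> and s o \<beta> have opposite signs and pass the same tests, so the sum equals its
  own negative.\<close>

lemma tsum_not_inj:
  assumes "\<not> inj_on (\<lambda>e. (\<phi> e, snd e)) (grid k d)"
  shows "tsum k d \<phi> = 0"
proof -
  obtain e1 e2 where e: "e1 \<in> grid k d" "e2 \<in> grid k d" "e1 \<noteq> e2" "\<phi> e1 = \<phi> e2" "snd e1 = snd e2"
    using assms by (force simp: inj_on_def)
  define s where "s = Transposition.transpose e1 e2"
  have s: "s permutes grid k d" unfolding s_def using e by (intro permutes_swap_id) auto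
  have inv: "\<phi> (s x) = \<phi> x" "snd (s x) = snd x" for x
    using e by (auto simp: s_def Transposition.transpose_def)
  let ?G = "\<lambda>\<beta>. \<Sum>\<sigma> | \<sigma> permutes grid k d.
     of_int (sign \<beta>) * of_int (sign \<sigma>) * of_bool (\<forall>e\<in>grid k d. \<phi> (\<beta> e) = \<phi> e) *
     (of_bool (\<forall>e\<in>grid k d. fst (\<sigma> e) = fst e \<and> snd (\<sigma> e) = snd (\<beta> e)) :: complex)"
  have perm: "permutation p" if "p permutes grid k d" for p
    using that by (intro permutes_imp_permutation[of "grid k d"]) auto
  have "sum ?G {\<beta>. \<beta> permutes grid k d} = (\<Sum>\<beta> | \<beta> permutes grid k d. ?G (s \<circ> \<beta>))"
    by (rule setum_permutations_compose_left[OF s])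
  also have "\<dots> = (\<Sum>\<beta> | \<beta> permutes grid k d. - ?G \<beta>)"
  proof (rule sum.cong[OF refl])
    fix \<beta> assume "\<beta> \<in> {\<beta>. \<beta> permutes grid k d}"
    then have "sign (s \<circ> \<beta>) = - sign \<beta>"
      using e perm[OF s] perm by (simp add: sign_compose s_def sign_swap_id)
    then show "?G (s \<circ> \<beta>) = - ?G \<beta>"
      by (simp only: o_apply inv of_int_minus mult_minus_left sum_negf)
  qed
  finally have "sum ?G {\<beta>. \<beta> permutes grid k d} = - sum ?G {\<beta>. \<beta> permutes grid k d}"
    by (simp only: sum_negf)
  then show ?thesis unfolding tsum_def by simp
qed

text \<open>The Gaussian mean of the antisymmetrised monomial attached to \<phi> times the conjugate
  of the plain monomial attached to \<psi> (\<open>kern_wick\<close>). Only one side is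
  antisymmetrised, as happens when a Gram determinant is expanded.\<close>

definition kern :: "nat \<Rightarrow> nat \<Rightarrow> (nat \<times> nat \<Rightarrow> nat) \<Rightarrow> (nat \<times> nat \<Rightarrow> nat) \<Rightarrow> complex" where
  "kern k d \<phi> \<psi> = (\<Sum>\<tau> | \<tau> permutes grid k d. of_int (sign \<tau>) * of_bool (\<forall>e\<in>grid k d. snd e = snd (\<tau> e)) *
  (\<Sum>\<beta> | \<beta> permutes grid k d. of_bool (\<forall>e\<in>grid k d. \<phi> (\<beta> e) = \<psi> e \<and> fst (\<tau> (\<beta> e)) = fst e)))"

text \<open>Substitute \<sigma> = \<tau> o \<beta>: the test on \<tau> becomes one on the second
  components of \<sigma> and \<beta>, the test on first components becomes one on \<sigma> alone,
  and sign \<tau> = sign \<beta> * sign \<sigma>.\<close>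

lemma kern_self: "kern k d \<phi> \<phi> = tsum k d \<phi>"
proof -
  let ?J = "grid k d"
  let ?P = "{p. p permutes ?J}"
  let ?q = "\<lambda>\<tau>. of_bool (\<forall>e\<in>?J. snd e = snd (\<tau> e)) :: complex"
  let ?G = "\<lambda>\<beta> \<tau>. of_int (sign \<tau>) * ?q \<tau> *
      of_bool (\<forall>e\<in>?J. \<phi> (\<beta> e) = \<phi> e \<and> fst (\<tau> (\<beta> e)) = fst e) :: complex"
  have "kern k d \<phi> \<phi> = (\<Sum>\<tau>\<in>?P. \<Sum>\<beta>\<in>?P. ?G \<beta> \<tau>)"
    by (simp add: kern_def sum_distrib_left del: sum_of_bool_eq)
  also have "(\<Sum>\<tau>\<in>?P. \<Sum>\<beta>\<in>?P. ?G \<beta> \<tau>) = (\<Sum>\<beta>\<in>?P. \<Sum>\<tau>\<in>?P. ?G \<beta> \<tau>)"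
    by (rule sum.swap)
  also have "\<dots> = tsum k d \<phi>"
    unfolding tsum_def
  proof (rule sum.cong[OF refl])
    fix \<beta> assume "\<beta> \<in> ?P"
    then have \<beta>: "\<beta> permutes ?J" by simp
    have i\<beta>: "Hilbert_Choice.inv \<beta> permutes ?J" using \<beta> by (rule permutes_inv)
    have "(\<Sum>\<tau>\<in>?P. ?G \<beta> \<tau>) = (\<Sum>\<sigma>\<in>?P. ?G \<beta> (\<sigma> \<circ> Hilbert_Choice.inv \<beta>))"
      by (rule sum_permutations_compose_right[OF i\<beta>])
    also have "\<dots> = (\<Sum>\<sigma>\<in>?P. of_int (sign \<beta>) * of_int (sign \<sigma>) * of_bool (\<forall>e\<in>?J. \<phi> (\<beta> e) = \<phi> e) *
      of_bool (\<forall>e\<in>?J. fst (\<sigma> e) = fst e \<and> snd (\<sigma> e) = snd (\<beta> e)))"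
    proof (rule sum.cong[OF refl])
      fix \<sigma> assume "\<sigma> \<in> ?P"
      then have \<sigma>: "\<sigma> permutes ?J" by simp
      have perm: "permutation p" if "p permutes ?J" for p
        using that by (intro permutes_imp_permutation[of ?J]) auto
      have "sign (\<sigma> \<circ> Hilbert_Choice.inv \<beta>) = sign \<beta> * sign \<sigma>"
        using perm[OF \<sigma>] perm[OF i\<beta>] perm[OF \<beta>] by (simp add: sign_compose sign_inverse)
      moreover have "(\<forall>e\<in>?J. snd e = snd ((\<sigma> \<circ> Hilbert_Choice.inv \<beta>) e)) = (\<forall>e\<in>?J. snd (\<sigma> e) = snd (\<beta> e))"
      proof -
        have "(\<forall>e\<in>?J. Q e) = (\<forall>e\<in>?J. Q (\<beta> e))" for Q
          using permutes_image[OF \<beta>] by (metis (no_types, lifting) imageE image_eqI)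
        from this[of "\<lambda>e. snd e = snd ((\<sigma> \<circ> Hilbert_Choice.inv \<beta>) e)"] show ?thesis
          using permutes_inverses(2)[OF \<beta>] by auto
      qed
      moreover have "fst ((\<sigma> \<circ> Hilbert_Choice.inv \<beta>) (\<beta> e)) = fst (\<sigma> e)" for e
        using permutes_inverses(2)[OF \<beta>] by simp
      ultimately show "?G \<beta> (\<sigma> \<circ> Hilbert_Choice.inv \<beta>) = of_int (sign \<beta>) * of_int (sign \<sigma>) *
        of_bool (\<forall>e\<in>?J. \<phi> (\<beta> e) = \<phi> e) * of_bool (\<forall>e\<in>?J. fst (\<sigma> e) = fst e \<and> snd (\<sigma> e) = snd (\<beta> e))"
        by (simp only:) (auto simp: of_bool_def)
    qed
    finally show "(\<Sum>\<tau>\<in>?P. ?G \<beta> \<tau>) = (\<Sum>\<sigma>\<in>?P. of_int (sign \<beta>) * of_int (sign \<sigma>) *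
      of_bool (\<forall>e\<in>?J. \<phi> (\<beta> e) = \<phi> e) *
      of_bool (\<forall>e\<in>?J. fst (\<sigma> e) = fst e \<and> snd (\<sigma> e) = snd (\<beta> e)))" .
  qed
  finally show ?thesis .
qed

lemma kern_wick:
  assumes "wick (grid m k) K H" and K: "k * d \<le> K"
    and \<phi>: "\<phi> \<in> grid k d \<rightarrow>\<^sub>E {..<m}" "\<psi> \<in> grid k d \<rightarrow>\<^sub>E {..<m}"
  shows "H (\<lambda>z. (\<Sum>\<tau> | \<tau> permutes grid k d. of_int (sign \<tau>) * of_bool (\<forall>e\<in>grid k d. snd e = snd (\<tau> e)) *
      (\<Prod>e\<in>grid k d. z (\<phi> e, fst (\<tau> e)))) * (\<Prod>e\<in>grid k d. cnj (z (\<psi> e, fst e)))) (kern k d \<phi> \<psi>)"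
proof -
  interpret wick "grid m k" K H by fact
  let ?J = "grid k d"
  let ?P = "{p. p permutes ?J}"
  let ?q = "\<lambda>\<tau>. of_bool (\<forall>e\<in>?J. snd e = snd (\<tau> e)) :: complex"
  have [simp]: "finite ?P" by (auto intro: finite_permutations)
  have finJ: "finite ?J" by simp
  have mono: "H (\<lambda>z. (\<Prod>e\<in>?J. z (\<phi> e, fst (\<tau> e))) * (\<Prod>e\<in>?J. cnj (z (\<psi> e, fst e))))
    (\<Sum>\<beta>\<in>?P. of_bool (\<forall>e\<in>?J. \<phi> (\<beta> e) = \<psi> e \<and> fst (\<tau> (\<beta> e)) = fst e))" if "\<tau> \<in> ?P" for \<tau>
  proof -
    have \<tau>: "fst (\<tau> e) < k" if "e \<in> ?J" for e
      using that \<open>\<tau> \<in> ?P\<close> permutes_in_image[of \<tau> ?J e] by (auto simp: mem_Times_iff)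
    have "H (\<lambda>z. (\<Prod>e\<in>?J. z (\<phi> e, fst (\<tau> e))) * (\<Prod>e\<in>?J. cnj (z (\<psi> e, fst e))))
      (\<Sum>\<beta>\<in>bijs ?J ?J. \<Prod>e\<in>?J. of_bool ((\<phi> (\<beta> e), fst (\<tau> (\<beta> e))) = (\<psi> e, fst e)))"
      using \<phi> K \<tau> by (intro H_monomial) auto
    also have "(\<Sum>\<beta>\<in>bijs ?J ?J. \<Prod>e\<in>?J. of_bool ((\<phi> (\<beta> e), fst (\<tau> (\<beta> e))) = (\<psi> e, fst e)) :: complex)
      = (\<Sum>\<beta>\<in>?P. \<Prod>e\<in>?J. of_bool ((\<phi> (\<beta> e), fst (\<tau> (\<beta> e))) = (\<psi> e, fst e)))"
    proof (rule sum_bijs_self)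
      show "(\<Prod>e\<in>?J. of_bool ((\<phi> (restrict p ?J e), fst (\<tau> (restrict p ?J e))) = (\<psi> e, fst e)))
        = (\<Prod>e\<in>?J. of_bool ((\<phi> (p e), fst (\<tau> (p e))) = (\<psi> e, fst e)))" for p
        by (rule prod.cong) simp_all
    qed simp
    also have "\<dots> = (\<Sum>\<beta>\<in>?P. of_bool (\<forall>e\<in>?J. \<phi> (\<beta> e) = \<psi> e \<and> fst (\<tau> (\<beta> e)) = fst e))"
      unfolding prod.inject by (rule sum.cong[OF refl]) (rule prod_of_bool[OF finJ])
    finally show ?thesis .
  qed
  have "H (\<lambda>z. \<Sum>\<tau>\<in>?P. of_int (sign \<tau>) * ?q \<tau> * ((\<Prod>e\<in>?J. z (\<phi> e, fst (\<tau> e))) * (\<Prod>e\<in>?J. cnj (z (\<psi> e, fst e)))))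
    (kern k d \<phi> \<psi>)"
    unfolding kern_def by (intro H_sum H_mult mono) auto
  then show ?thesis by (simp only: sum_distrib_right mult.assoc)
qed

text \<open>Expanding the determinants over permutations \<tau> and every entry over its summation
  index c attaches an index \<phi> e to each cell e. The weights r factor out, and the mean that
  remains is \<open>kern k d \<phi> \<phi>\<close>.\<close>

lemma wick_gram_dets:
  assumes "wick (grid m k) K H" and K: "k * d \<le> K"
  shows "H (\<lambda>z. \<Prod>i<d. det (mat k k (\<lambda>(b, b'). \<Sum>c<m. r c i * cnj (z (c, b)) * z (c, b'))))
    (\<Sum>\<phi>\<in>grid k d \<rightarrow>\<^sub>E {..<m}. (\<Prod>e\<in>grid k d. r (\<phi> e) (snd e)) * tsum k d \<phi>)"
proof -
  interpret wick "grid m k" K H by fact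
  let ?J = "grid k d"
  let ?P = "{p. p permutes ?J}" and ?F = "?J \<rightarrow>\<^sub>E {..<m}"
  let ?r = "\<lambda>\<phi>. \<Prod>e\<in>?J. r (\<phi> e) (snd e)"
  let ?q = "\<lambda>\<tau>. of_bool (\<forall>e\<in>?J. snd e = snd (\<tau> e)) :: complex"
  have [simp]: "finite ?P" "finite ?F" by (auto intro: finite_permutations finite_PiE)
  have expand: "(\<Prod>i<d. det (mat k k (\<lambda>(b, b'). \<Sum>c<m. r c i * cnj (z (c, b)) * z (c, b'))))
    = (\<Sum>\<phi>\<in>?F. \<Sum>\<tau>\<in>?P. of_int (sign \<tau>) * ?q \<tau> * ?r \<phi> *
        ((\<Prod>e\<in>?J. z (\<phi> e, fst (\<tau> e))) * (\<Prod>e\<in>?J. cnj (z (\<phi> e, fst e)))))" for z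
  proof -
    have "(\<Prod>i<d. det (mat k k (\<lambda>(b, b'). \<Sum>c<m. r c i * cnj (z (c, b)) * z (c, b'))))
      = sdet ?J (\<lambda>e e'. if snd e = snd e'
          then \<Sum>c<m. r c (snd e) * cnj (z (c, fst e)) * z (c, fst e') else 0)"
      by (subst sdet_snd_blocks) (simp add: det_eq_sdet)
    also have "\<dots> = (\<Sum>\<tau>\<in>?P. of_int (sign \<tau>) * (?q \<tau> *
        (\<Sum>\<phi>\<in>?F. \<Prod>e\<in>?J. r (\<phi> e) (snd e) * cnj (z (\<phi> e, fst e)) * z (\<phi> e, fst (\<tau> e)))))"
      unfolding sdet_def by (simp add: prod_if_zero prod_sum_PiE)
    also have "\<dots> = (\<Sum>\<tau>\<in>?P. \<Sum>\<phi>\<in>?F. of_int (sign \<tau>) * ?q \<tau> * ?r \<phi> *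
        ((\<Prod>e\<in>?J. z (\<phi> e, fst (\<tau> e))) * (\<Prod>e\<in>?J. cnj (z (\<phi> e, fst e)))))"
      by (simp add: sum_distrib_left prod.distrib ac_simps)
    also have "\<dots> = (\<Sum>\<phi>\<in>?F. \<Sum>\<tau>\<in>?P. of_int (sign \<tau>) * ?q \<tau> * ?r \<phi> *
        ((\<Prod>e\<in>?J. z (\<phi> e, fst (\<tau> e))) * (\<Prod>e\<in>?J. cnj (z (\<phi> e, fst e)))))"
      by (rule sum.swap)
    finally show ?thesis .
  qed
  have "H (\<lambda>z. \<Sum>\<phi>\<in>?F. ?r \<phi> * ((\<Sum>\<tau>\<in>?P. of_int (sign \<tau>) * ?q \<tau> * (\<Prod>e\<in>?J. z (\<phi> e, fst (\<tau> e)))) *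
      (\<Prod>e\<in>?J. cnj (z (\<phi> e, fst e))))) (\<Sum>\<phi>\<in>?F. ?r \<phi> * kern k d \<phi> \<phi>)"
    by (intro H_sum H_mult kern_wick[OF assms(1) K]) auto
  moreover have "(\<Sum>\<phi>\<in>?F. ?r \<phi> * ((\<Sum>\<tau>\<in>?P. of_int (sign \<tau>) * ?q \<tau> * (\<Prod>e\<in>?J. z (\<phi> e, fst (\<tau> e)))) *
      (\<Prod>e\<in>?J. cnj (z (\<phi> e, fst e)))))
    = (\<Sum>\<phi>\<in>?F. \<Sum>\<tau>\<in>?P. of_int (sign \<tau>) * ?q \<tau> * ?r \<phi> *
        ((\<Prod>e\<in>?J. z (\<phi> e, fst (\<tau> e))) * (\<Prod>e\<in>?J. cnj (z (\<phi> e, fst e)))))" for z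
    unfolding sum_distrib_left sum_distrib_right by (intro sum.cong refl) (simp only: mult_ac)
  ultimately show ?thesis by (simp only: expand kern_self)
qed

section \<open>Principal minors of Gaussian matrices paired with a power of a determinant\<close>

context wick
begin

text \<open>Wick's formula pairs \<open>grid k d\<close> with E through a bijection p. Triangularity
  of R forces p to preserve second components, so that p e = (\<phi> e, snd e) for a map \<phi>;
  carrying the permutations of E back along p produces \<open>tsum\<close>.\<close>

lemma minor_times_det:
  fixes L :: "nat \<Rightarrow> nat \<Rightarrow> nat \<Rightarrow> 'v \<Rightarrow> complex" and M :: "nat \<Rightarrow> nat \<Rightarrow> 'v \<Rightarrow> complex"
  assumes gram: "\<And>a i j i' j'. a < m \<Longrightarrow> i < d \<Longrightarrow> j < d \<Longrightarrow> i' < d \<Longrightarrow> j' < d \<Longrightarrow>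
      gram (L a i j) (M i' j') = R a i i' * of_bool (j = j')"
    and tri: "\<And>a i i'. i' < i \<Longrightarrow> R a i i' = 0"
    and E: "E \<subseteq> grid m d" and K: "m * d \<le> K" "k * d \<le> K"
  shows "H (\<lambda>z. sdet E (\<lambda>e e'. if fst e = fst e' then lin (L (fst e) (snd e) (snd e')) z else 0) *
      cnj (sdet (grid k d) (\<lambda>e e'. if fst e = fst e' then lin (M (snd e) (snd e')) z else 0)))
    (\<Sum>\<phi>\<in>{\<phi> \<in> grid k d \<rightarrow>\<^sub>E {..<m}. inj_on (\<lambda>e. (\<phi> e, snd e)) (grid k d) \<and>
        (\<lambda>e. (\<phi> e, snd e)) ` grid k d = E}. (\<Prod>e\<in>grid k d. R (\<phi> e) (snd e) (snd e)) * tsum k d \<phi>)"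
proof -
  let ?J = "grid k d"
  let ?P = "\<lambda>S. {p. p permutes S}"
  let ?f = "\<lambda>S p. of_bool (\<forall>e\<in>S. fst e = fst (p e)) :: complex"
  let ?w = "\<lambda>p. \<Prod>e\<in>?J. R (fst (p e)) (snd e) (snd e)"
  let ?b = "\<lambda>\<beta> \<sigma> p. \<Prod>e\<in>?J. of_bool (snd (p e) = snd e \<and> snd (\<beta> (p e)) = snd (\<sigma> e)) :: complex"
  let ?v = "\<lambda>\<beta> \<sigma> p. ?w p * ?b \<beta> \<sigma> p"
  have finE: "finite E" using E by (rule finite_subset) auto
  have cardE: "card E \<le> K" using card_mono[OF _ E] K by simp
  have [simp]: "finite (?P S)" if "finite S" for S :: "(nat \<times> nat) set"
    using that by (simp add: finite_permutations)
  have expand: "sdet E (\<lambda>e e'. if fst e = fst e' then lin (L (fst e) (snd e) (snd e')) z else 0) *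
      cnj (sdet ?J (\<lambda>e e'. if fst e = fst e' then lin (M (snd e) (snd e')) z else 0))
    = (\<Sum>\<beta>\<in>?P E. \<Sum>\<sigma>\<in>?P ?J. (of_int (sign \<beta>) * ?f E \<beta> * (of_int (sign \<sigma>) * ?f ?J \<sigma>)) *
      ((\<Prod>e\<in>E. lin (L (fst e) (snd e) (snd (\<beta> e))) z) * (\<Prod>e\<in>?J. cnj (lin (M (snd e) (snd (\<sigma> e))) z))))" for z
  proof -
    have 1: "sdet E (\<lambda>e e'. if fst e = fst e' then lin (L (fst e) (snd e) (snd e')) z else 0)
      = (\<Sum>\<beta>\<in>?P E. of_int (sign \<beta>) * ?f E \<beta> * (\<Prod>e\<in>E. lin (L (fst e) (snd e) (snd (\<beta> e))) z))"
      unfolding sdet_def prod_if_zero[OF finE] by (simp only: mult.assoc)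
    have "cnj (of_int n * (of_bool P * x)) = of_int n * of_bool P * cnj x" for n P x by simp
    then have 2: "cnj (sdet ?J (\<lambda>e e'. if fst e = fst e' then lin (M (snd e) (snd e')) z else 0))
      = (\<Sum>\<sigma>\<in>?P ?J. of_int (sign \<sigma>) * ?f ?J \<sigma> * (\<Prod>e\<in>?J. cnj (lin (M (snd e) (snd (\<sigma> e))) z)))"
      unfolding sdet_def prod_if_zero[OF finite_cartesian_product[OF finite_lessThan finite_lessThan]]
      by (simp only: cnj_sum cnj_prod)
    show ?thesis
      unfolding 1 2 sum_product by (intro sum.cong refl) (simp only: mult.assoc mult.left_commute)
  qed
  have mono: "H (\<lambda>z. (\<Prod>e\<in>E. lin (L (fst e) (snd e) (snd (\<beta> e))) z) * (\<Prod>e\<in>?J. cnj (lin (M (snd e) (snd (\<sigma> e))) z)))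
    (\<Sum>p\<in>bijs ?J E. ?v \<beta> \<sigma> p)" if "\<beta> \<in> ?P E" "\<sigma> \<in> ?P ?J" for \<beta> \<sigma>
  proof -
    have sndE: "snd e < d" if "e \<in> E" for e using that E by auto
    have "H (\<lambda>z. (\<Prod>e\<in>E. lin (L (fst e) (snd e) (snd (\<beta> e))) z) * (\<Prod>e\<in>?J. cnj (lin (M (snd e) (snd (\<sigma> e))) z)))
      (\<Sum>p\<in>bijs ?J E. \<Prod>e\<in>?J. gram (L (fst (p e)) (snd (p e)) (snd (\<beta> (p e)))) (M (snd e) (snd (\<sigma> e))))"
      using finE cardE K by (intro wick_formula) auto
    also have "(\<Sum>p\<in>bijs ?J E. \<Prod>e\<in>?J. gram (L (fst (p e)) (snd (p e)) (snd (\<beta> (p e)))) (M (snd e) (snd (\<sigma> e))))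
      = (\<Sum>p\<in>bijs ?J E. ?v \<beta> \<sigma> p)"
    proof (rule sum.cong[OF refl])
      fix p assume "p \<in> bijs ?J E"
      then have p: "bij_betw p ?J E" by (simp add: bijs_def)
      have \<beta>: "\<beta> permutes E" and \<sigma>: "\<sigma> permutes ?J" using that by auto
      have eq: "gram (L (fst (p e)) (snd (p e)) (snd (\<beta> (p e)))) (M (snd e) (snd (\<sigma> e)))
        = R (fst (p e)) (snd (p e)) (snd e) * of_bool (snd (\<beta> (p e)) = snd (\<sigma> e))" if e: "e \<in> ?J" for e
      proof -
        have pe: "p e \<in> E" using p e by (rule bij_betw_apply)
        then have "fst (p e) < m" using E by (auto simp: mem_Times_iff)
        moreover have "snd (\<beta> (p e)) < d"
          using pe by (intro sndE) (simp only: permutes_in_image[OF \<beta>])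
        moreover have "\<sigma> e \<in> ?J" using e by (simp only: permutes_in_image[OF \<sigma>])
        then have "snd e < d" "snd (\<sigma> e) < d" using e by (simp_all only: mem_Times_iff lessThan_iff)
        ultimately show ?thesis using sndE[OF pe] by (intro gram)
      qed
      have "(\<Prod>e\<in>?J. R (fst (p e)) (snd (p e)) (snd e) * of_bool (snd (\<beta> (p e)) = snd (\<sigma> e))) = ?v \<beta> \<sigma> p"
      proof (cases "\<forall>e\<in>?J. snd (p e) = snd e")
        case True
        have "R (fst (p e)) (snd (p e)) (snd e) * of_bool (snd (\<beta> (p e)) = snd (\<sigma> e))
          = R (fst (p e)) (snd e) (snd e) * of_bool (snd (p e) = snd e \<and> snd (\<beta> (p e)) = snd (\<sigma> e))"
          if "e \<in> ?J" for e
          using bspec[OF True that] by simp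
        then show ?thesis unfolding prod.distrib[symmetric] by (intro prod.cong refl)
      next
        case False
        then obtain e0 where e0: "e0 \<in> ?J" "snd (p e0) \<noteq> snd e0" by blast
        then have "?b \<beta> \<sigma> p = 0" by (intro prod_zero bexI[of _ e0]) simp_all
        \<comment> \<open>If no factor vanished, triangularity would give snd (p e) \<le> snd e for
          all e. The Kronecker conditions and the bijections \<beta>, \<sigma>, p make both sides
          have the same sum, so equality would hold everywhere, against the choice of e0.\<close>
        moreover have "\<exists>e\<in>?J. R (fst (p e)) (snd (p e)) (snd e) * of_bool (snd (\<beta> (p e)) = snd (\<sigma> e)) = 0"
        proof (rule ccontr)
          assume "\<not> ?thesis"
          then have nz: "R (fst (p e)) (snd (p e)) (snd e) \<noteq> 0" "snd (\<beta> (p e)) = snd (\<sigma> e)" if "e \<in> ?J" for e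
            using that by force+
          have le: "snd (p e) \<le> snd e" if "e \<in> ?J" for e
            using nz(1)[OF that] tri[of "snd e" "snd (p e)" "fst (p e)"] not_le by blast
          have "(\<Sum>e\<in>?J. snd (p e)) = (\<Sum>e\<in>E. snd e)"
            by (rule sum.reindex_bij_betw[OF p])
          also have "\<dots> = (\<Sum>e\<in>E. snd (\<beta> e))"
            by (rule sum.reindex_bij_betw[OF permutes_imp_bij[OF \<beta>], symmetric])
          also have "\<dots> = (\<Sum>e\<in>?J. snd (\<beta> (p e)))"
            by (rule sum.reindex_bij_betw[OF p, symmetric])
          also have "\<dots> = (\<Sum>e\<in>?J. snd (\<sigma> e))"
            by (intro sum.cong refl nz(2))
          also have "\<dots> = (\<Sum>e\<in>?J. snd e)"
            by (rule sum.reindex_bij_betw[OF permutes_imp_bij[OF \<sigma>]])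
          finally have "(\<Sum>e\<in>?J. snd (p e)) = (\<Sum>e\<in>?J. snd e)" .
          moreover have "(\<Sum>e\<in>?J. snd (p e)) < (\<Sum>e\<in>?J. snd e)"
          proof (rule sum_strict_mono_ex1)
            show "\<exists>e\<in>?J. snd (p e) < snd e" using e0 le[OF e0(1)] by (intro bexI[of _ e0]) simp_all
          qed (use le in blast)+
          ultimately show False by simp
        qed
        then have "(\<Prod>e\<in>?J. R (fst (p e)) (snd (p e)) (snd e) * of_bool (snd (\<beta> (p e)) = snd (\<sigma> e))) = 0"
          by (intro prod_zero finite_cartesian_product finite_lessThan)
        ultimately show ?thesis by (simp only: mult_zero_right)
      qed
      then show "(\<Prod>e\<in>?J. gram (L (fst (p e)) (snd (p e)) (snd (\<beta> (p e)))) (M (snd e) (snd (\<sigma> e)))) = ?v \<beta> \<sigma> p"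
        using eq by (simp cong: prod.cong)
    qed
    finally show ?thesis .
  qed
  have "H (\<lambda>z. \<Sum>\<beta>\<in>?P E. \<Sum>\<sigma>\<in>?P ?J. (of_int (sign \<beta>) * ?f E \<beta> * (of_int (sign \<sigma>) * ?f ?J \<sigma>)) *
      ((\<Prod>e\<in>E. lin (L (fst e) (snd e) (snd (\<beta> e))) z) * (\<Prod>e\<in>?J. cnj (lin (M (snd e) (snd (\<sigma> e))) z))))
    (\<Sum>\<beta>\<in>?P E. \<Sum>\<sigma>\<in>?P ?J. (of_int (sign \<beta>) * ?f E \<beta> * (of_int (sign \<sigma>) * ?f ?J \<sigma>)) * (\<Sum>p\<in>bijs ?J E. ?v \<beta> \<sigma> p))"
    using finE by (intro H_sum H_mult mono) auto
  moreover have "(\<Sum>\<beta>\<in>?P E. \<Sum>\<sigma>\<in>?P ?J. (of_int (sign \<beta>) * ?f E \<beta> * (of_int (sign \<sigma>) * ?f ?J \<sigma>)) * (\<Sum>p\<in>bijs ?J E. ?v \<beta> \<sigma> p))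
    = (\<Sum>\<phi>\<in>{\<phi> \<in> ?J \<rightarrow>\<^sub>E {..<m}. inj_on (\<lambda>e. (\<phi> e, snd e)) ?J \<and> (\<lambda>e. (\<phi> e, snd e)) ` ?J = E}. (\<Prod>e\<in>?J. R (\<phi> e) (snd e) (snd e)) * tsum k d \<phi>)"
    (is "?l = _")
  proof -
    let ?h = "\<lambda>p \<beta>. \<Sum>\<sigma>\<in>?P ?J. ?f E \<beta> * (of_int (sign \<sigma>) * ?f ?J \<sigma>) * ?b \<beta> \<sigma> p"
    have "?l = (\<Sum>\<beta>\<in>?P E. \<Sum>\<sigma>\<in>?P ?J. \<Sum>p\<in>bijs ?J E. ?w p * (of_int (sign \<beta>) * (?f E \<beta> * (of_int (sign \<sigma>) * ?f ?J \<sigma>) * ?b \<beta> \<sigma> p)))"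
      by (simp add: sum_distrib_left ac_simps)
    also have "\<dots> = (\<Sum>\<beta>\<in>?P E. \<Sum>p\<in>bijs ?J E. \<Sum>\<sigma>\<in>?P ?J. ?w p * (of_int (sign \<beta>) * (?f E \<beta> * (of_int (sign \<sigma>) * ?f ?J \<sigma>) * ?b \<beta> \<sigma> p)))"
      by (intro sum.cong refl sum.swap)
    also have "\<dots> = (\<Sum>p\<in>bijs ?J E. ?w p * (\<Sum>\<beta>\<in>?P E. of_int (sign \<beta>) * ?h p \<beta>))"
      by (subst sum.swap) (simp only: sum_distrib_left)
    also have "\<dots> = (\<Sum>p\<in>bijs ?J E. ?w p * (of_bool (\<forall>e\<in>?J. snd (p e) = snd e) * tsum k d (fst \<circ> p)))"
    proof (rule sum.cong[OF refl], rule arg_cong[of _ _ "(*) _"])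
      fix p assume "p \<in> bijs ?J E"
      then have p: "bij_betw p ?J E" by (simp add: bijs_def)
      \<comment> \<open>Conjugation by p turns the permutations of E into those of
        \<open>grid k d\<close> and preserves signs.\<close>
      have "(\<Sum>\<beta>\<in>?P E. of_int (sign \<beta>) * ?h p \<beta>)
        = (\<Sum>\<beta>\<in>?P ?J. of_int (sign \<beta>) * ?h p (map_permutation ?J p \<beta>))"
        by (rule sum_sign_bij[OF p]) simp
      also have "\<dots> = (\<Sum>\<beta>\<in>?P ?J. \<Sum>\<sigma>\<in>?P ?J. of_bool (\<forall>e\<in>?J. snd (p e) = snd e) *
        (of_int (sign \<beta>) * of_int (sign \<sigma>) * of_bool (\<forall>e\<in>?J. (fst \<circ> p) (\<beta> e) = (fst \<circ> p) e) *
        of_bool (\<forall>e\<in>?J. fst (\<sigma> e) = fst e \<and> snd (\<sigma> e) = snd (\<beta> e))))"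
        unfolding sum_distrib_left
      proof (intro sum.cong refl)
        fix \<beta> \<sigma> assume "\<beta> \<in> ?P ?J" "\<sigma> \<in> ?P ?J"
        then have \<beta>: "\<beta> permutes ?J" by simp
        have mp: "map_permutation ?J p \<beta> (p e) = p (\<beta> e)" if "e \<in> ?J" for e
          using p \<beta> that by (rule map_permutation_apply)
        have 1: "(\<forall>e\<in>E. fst e = fst (map_permutation ?J p \<beta> e)) = (\<forall>e\<in>?J. fst (p e) = fst (p (\<beta> e)))"
        proof -
          have "E = p ` ?J" using p by (simp add: bij_betw_def)
          then have "(\<forall>e\<in>E. fst e = fst (map_permutation ?J p \<beta> e))
            = (\<forall>e\<in>?J. fst (p e) = fst (map_permutation ?J p \<beta> (p e)))" by simp
          also have "\<dots> = (\<forall>e\<in>?J. fst (p e) = fst (p (\<beta> e)))"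
            by (intro ball_cong refl) (simp only: mp)
          finally show ?thesis .
        qed
        have 2: "(\<forall>e\<in>?J. snd (p e) = snd e \<and> snd (map_permutation ?J p \<beta> (p e)) = snd (\<sigma> e))
          = ((\<forall>e\<in>?J. snd (p e) = snd e) \<and> (\<forall>e\<in>?J. snd (\<sigma> e) = snd (\<beta> e)))"
        proof -
          have "(\<forall>e\<in>?J. snd (p e) = snd e \<and> snd (map_permutation ?J p \<beta> (p e)) = snd (\<sigma> e))
            = (\<forall>e\<in>?J. snd (p e) = snd e \<and> snd (p (\<beta> e)) = snd (\<sigma> e))"
            by (intro ball_cong refl) (simp only: mp)
          also have "\<dots> = ((\<forall>e\<in>?J. snd (p e) = snd e) \<and> (\<forall>e\<in>?J. snd (\<sigma> e) = snd (\<beta> e)))"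
          proof (cases "\<forall>e\<in>?J. snd (p e) = snd e")
            case True
            have "snd (p (\<beta> e)) = snd (\<beta> e)" if "e \<in> ?J" for e
            proof -
              have "\<beta> e \<in> ?J" using that by (simp only: permutes_in_image[OF \<beta>])
              then show ?thesis using True by (rule bspec[rotated])
            qed
            then have "(\<forall>e\<in>?J. snd (p e) = snd e \<and> snd (p (\<beta> e)) = snd (\<sigma> e))
              = (\<forall>e\<in>?J. snd (p e) = snd e \<and> snd (\<beta> e) = snd (\<sigma> e))"
              by (intro ball_cong refl) (simp only:)
            then show ?thesis by (simp only: ball_conj_distrib eq_commute)
          next
            case False
            then show ?thesis by blast
          qed
          finally show ?thesis .
        qed
        show "of_int (sign \<beta>) * (?f E (map_permutation ?J p \<beta>) * (of_int (sign \<sigma>) * ?f ?J \<sigma>) * ?b (map_permutation ?J p \<beta>) \<sigma> p)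
          = of_bool (\<forall>e\<in>?J. snd (p e) = snd e) *
        (of_int (sign \<beta>) * of_int (sign \<sigma>) * of_bool (\<forall>e\<in>?J. (fst \<circ> p) (\<beta> e) = (fst \<circ> p) e) *
        of_bool (\<forall>e\<in>?J. fst (\<sigma> e) = fst e \<and> snd (\<sigma> e) = snd (\<beta> e)))"
          by (simp only: prod_of_bool finite_cartesian_product finite_lessThan 1 2) (auto simp: of_bool_def)
      qed
      also have "\<dots> = of_bool (\<forall>e\<in>?J. snd (p e) = snd e) * tsum k d (fst \<circ> p)"
        unfolding tsum_def by (simp only: sum_distrib_left)
      finally show "(\<Sum>\<beta>\<in>?P E. of_int (sign \<beta>) * ?h p \<beta>)
        = of_bool (\<forall>e\<in>?J. snd (p e) = snd e) * tsum k d (fst \<circ> p)" .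
    qed
    also have "\<dots> = (\<Sum>p\<in>{p \<in> bijs ?J E. \<forall>e\<in>?J. snd (p e) = snd e}. ?w p * tsum k d (fst \<circ> p))"
      using finE by (intro sum.mono_neutral_cong_right) auto
    also have "\<dots> = (\<Sum>\<phi>\<in>{\<phi> \<in> ?J \<rightarrow>\<^sub>E {..<m}. inj_on (\<lambda>e. (\<phi> e, snd e)) ?J \<and> (\<lambda>e. (\<phi> e, snd e)) ` ?J = E}. (\<Prod>e\<in>?J. R (\<phi> e) (snd e) (snd e)) * tsum k d \<phi>)"
    proof (rule sum.reindex_bij_witness[where i = "\<lambda>\<phi>. \<lambda>e\<in>?J. (\<phi> e, snd e)" and j = "\<lambda>p. restrict (fst \<circ> p) ?J"])
      fix p assume "p \<in> {p \<in> bijs ?J E. \<forall>e\<in>?J. snd (p e) = snd e}"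
      then have p: "p \<in> ?J \<rightarrow>\<^sub>E E" "bij_betw p ?J E" "\<And>e. e \<in> ?J \<Longrightarrow> snd (p e) = snd e"
        by (auto simp: bijs_def)
      have pe: "(restrict (fst \<circ> p) ?J e, snd e) = p e" if "e \<in> ?J" for e
        using p(3)[OF that] that by (auto simp: prod_eq_iff)
      show "(\<lambda>e\<in>?J. (restrict (fst \<circ> p) ?J e, snd e)) = p"
        using pe p(1) by (intro PiE_ext[OF _ p(1)]) (auto simp: PiE_def Pi_def)
      have "restrict (fst \<circ> p) ?J \<in> ?J \<rightarrow>\<^sub>E {..<m}"
      proof (rule PiE_I)
        fix e assume "e \<in> ?J"
        then have "p e \<in> grid m d" using p(1) E by auto
        then show "restrict (fst \<circ> p) ?J e \<in> {..<m}" using \<open>e \<in> ?J\<close> by (simp add: mem_Times_iff)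
      qed simp
      moreover have "bij_betw (\<lambda>e. (restrict (fst \<circ> p) ?J e, snd e)) ?J E"
        using p(2) pe by (subst bij_betw_cong[of _ _ p]) auto
      ultimately show "restrict (fst \<circ> p) ?J \<in> {\<phi> \<in> ?J \<rightarrow>\<^sub>E {..<m}. inj_on (\<lambda>e. (\<phi> e, snd e)) ?J \<and> (\<lambda>e. (\<phi> e, snd e)) ` ?J = E}"
        by (simp add: bij_betw_def)
      have "tsum k d (restrict (fst \<circ> p) ?J) = tsum k d (fst \<circ> p)"
        by (rule tsum_cong) simp
      then show "(\<Prod>e\<in>?J. R (restrict (fst \<circ> p) ?J e) (snd e) (snd e)) * tsum k d (restrict (fst \<circ> p) ?J)
        = ?w p * tsum k d (fst \<circ> p)" by (simp cong: prod.cong)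
    next
      fix \<phi> assume "\<phi> \<in> {\<phi> \<in> ?J \<rightarrow>\<^sub>E {..<m}. inj_on (\<lambda>e. (\<phi> e, snd e)) ?J \<and> (\<lambda>e. (\<phi> e, snd e)) ` ?J = E}"
      then have \<phi>: "\<phi> \<in> ?J \<rightarrow>\<^sub>E {..<m}" "bij_betw (\<lambda>e. (\<phi> e, snd e)) ?J E" by (auto simp: bij_betw_def)
      show "restrict (fst \<circ> (\<lambda>e\<in>?J. (\<phi> e, snd e))) ?J = \<phi>"
        using \<phi>(1) by (intro PiE_ext[OF _ \<phi>(1)]) auto
      have "bij_betw (\<lambda>e\<in>?J. (\<phi> e, snd e)) ?J E"
        using \<phi>(2) by (subst bij_betw_cong[of _ _ "\<lambda>e. (\<phi> e, snd e)"]) auto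
      then show "(\<lambda>e\<in>?J. (\<phi> e, snd e)) \<in> {p \<in> bijs ?J E. \<forall>e\<in>?J. snd (p e) = snd e}"
        by (auto simp: bijs_def bij_betw_def)
    qed
    finally show ?thesis .
  qed
  ultimately show ?thesis by (simp only: expand)
qed

end

section \<open>A finite signed measure with Gaussian moments\<close>

lemma det_one_plus_eq_sdet:
  "det (1\<^sub>m d + mat d d (\<lambda>(i, j). N i j)) = sdet {..<d} (\<lambda>i j. of_bool (i = j) + N i j)"
proof -
  have "1\<^sub>m d + mat d d (\<lambda>(i, j). N i j) = mat d d (\<lambda>(i, j). of_bool (i = j) + N i j)"
    by (intro eq_matI) auto
  then show ?thesis by (simp add: det_eq_sdet)
qed

text \<open>The product of the det (1 + L a) expands into principal minors over subsets E of
  \<open>grid m d\<close>, each evaluated by \<open>minor_times_det\<close>. Every \<phi> for which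
  e -> (\<phi> e, snd e) is injective is counted for exactly one E, its image; the other \<phi> may
  be added because their \<open>tsum\<close> vanishes.\<close>

lemma (in wick) dets_times_conj_det_power:
  fixes L :: "nat \<Rightarrow> nat \<Rightarrow> nat \<Rightarrow> 'v \<Rightarrow> complex" and M :: "nat \<Rightarrow> nat \<Rightarrow> 'v \<Rightarrow> complex"
  assumes gram: "\<And>a i j i' j'. a < m \<Longrightarrow> i < d \<Longrightarrow> j < d \<Longrightarrow> i' < d \<Longrightarrow> j' < d \<Longrightarrow>
      gram (L a i j) (M i' j') = R a i i' * of_bool (j = j')"
    and tri: "\<And>a i i'. i' < i \<Longrightarrow> R a i i' = 0"
    and K: "m * d \<le> K" "k * d \<le> K"
  shows "H (\<lambda>z. (\<Prod>a<m. det (1\<^sub>m d + mat d d (\<lambda>(i, j). lin (L a i j) z))) *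
      cnj (det (mat d d (\<lambda>(i, j). lin (M i j) z)) ^ k))
    (\<Sum>\<phi>\<in>grid k d \<rightarrow>\<^sub>E {..<m}. (\<Prod>e\<in>grid k d. R (\<phi> e) (snd e) (snd e)) * tsum k d \<phi>)"
proof -
  let ?J = "grid k d"
  let ?s = "\<lambda>\<phi> e. (\<phi> e, snd e)"
  let ?A = "\<lambda>E. {\<phi> \<in> ?J \<rightarrow>\<^sub>E {..<m}. inj_on (?s \<phi>) ?J \<and> ?s \<phi> ` ?J = E}"
  let ?d = "\<lambda>E z. sdet E (\<lambda>e e'. if fst e = fst e' then lin (L (fst e) (snd e) (snd e')) z else 0)"
  let ?c = "\<lambda>z. cnj (sdet ?J (\<lambda>e e'. if fst e = fst e' then lin (M (snd e) (snd e')) z else 0))"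
  have finP: "finite (Pow (grid m d))" by simp
  have 1: "(\<Prod>a<m. det (1\<^sub>m d + mat d d (\<lambda>(i, j). lin (L a i j) z))) = (\<Sum>E\<in>Pow (grid m d). ?d E z)" for z
  proof -
    have "(\<Prod>a<m. det (1\<^sub>m d + mat d d (\<lambda>(i, j). lin (L a i j) z)))
      = sdet (grid m d) (\<lambda>e e'. if fst e = fst e'
          then of_bool (snd e = snd e') + lin (L (fst e) (snd e) (snd e')) z else 0)"
      unfolding det_one_plus_eq_sdet by (rule sdet_fst_blocks[symmetric])
    also have "\<dots> = sdet (grid m d) (\<lambda>e e'. of_bool (e = e') +
        (if fst e = fst e' then lin (L (fst e) (snd e) (snd e')) z else 0))"
      by (intro sdet_cong refl) (auto simp: prod_eq_iff)
    also have "\<dots> = (\<Sum>E\<in>Pow (grid m d). sdet E (\<lambda>e e'.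
        if fst e = fst e' then lin (L (fst e) (snd e) (snd e')) z else 0))"
      by (rule sdet_one_plus) simp
    finally show ?thesis .
  qed
  have 2: "cnj (det (mat d d (\<lambda>(i, j). lin (M i j) z)) ^ k) = ?c z" for z
    unfolding sdet_fst_blocks[of k d "\<lambda>_ i j. lin (M i j) z"] by (simp add: det_eq_sdet)
  have "H (\<lambda>z. \<Sum>E\<in>Pow (grid m d). ?d E z * ?c z) (\<Sum>E\<in>Pow (grid m d). \<Sum>\<phi>\<in>?A E. (\<Prod>e\<in>?J. R (\<phi> e) (snd e) (snd e)) * tsum k d \<phi>)"
  proof (rule H_sum[OF finP])
    fix E assume "E \<in> Pow (grid m d)"
    then show "H (\<lambda>z. ?d E z * ?c z) (\<Sum>\<phi>\<in>?A E. (\<Prod>e\<in>?J. R (\<phi> e) (snd e) (snd e)) * tsum k d \<phi>)"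
      by (intro minor_times_det[of m d L M R E k]) (simp_all add: gram tri K)
  qed
  moreover have "(\<Sum>E\<in>Pow (grid m d). \<Sum>\<phi>\<in>?A E. (\<Prod>e\<in>?J. R (\<phi> e) (snd e) (snd e)) * tsum k d \<phi>)
    = (\<Sum>\<phi>\<in>?J \<rightarrow>\<^sub>E {..<m}. (\<Prod>e\<in>?J. R (\<phi> e) (snd e) (snd e)) * tsum k d \<phi>)" (is "?l = _")
  proof -
    let ?I = "{\<phi> \<in> ?J \<rightarrow>\<^sub>E {..<m}. inj_on (?s \<phi>) ?J}"
    have finF: "finite (?J \<rightarrow>\<^sub>E {..<m})" by (intro finite_PiE) auto
    have "?l = (\<Sum>E\<in>Pow (grid m d). \<Sum>\<phi>\<in>{\<phi> \<in> ?I. ?s \<phi> ` ?J = E}. (\<Prod>e\<in>?J. R (\<phi> e) (snd e) (snd e)) * tsum k d \<phi>)"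
    proof (intro sum.cong refl)
      fix E show "?A E = {\<phi> \<in> ?I. ?s \<phi> ` ?J = E}" by auto
    qed
    also have "\<dots> = (\<Sum>\<phi>\<in>?I. (\<Prod>e\<in>?J. R (\<phi> e) (snd e) (snd e)) * tsum k d \<phi>)"
    proof (rule sum.group)
      show "finite ?I" using finF by (rule rev_finite_subset) auto
      show "(\<lambda>\<phi>. ?s \<phi> ` ?J) ` ?I \<subseteq> Pow (grid m d)"
      proof (intro image_subsetI PowI)
        fix \<phi> e assume "\<phi> \<in> ?I" and e: "e \<in> ?J"
        then have "\<phi> \<in> ?J \<rightarrow>\<^sub>E {..<m}" by simp
        then have "\<phi> e \<in> {..<m}" using e by (rule PiE_mem)
        moreover have "snd e < d" using e by (simp only: mem_Times_iff lessThan_iff)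
        ultimately show "(\<phi> e, snd e) \<in> grid m d" by simp
      qed
    qed simp
    also have "\<dots> = (\<Sum>\<phi>\<in>?J \<rightarrow>\<^sub>E {..<m}. (\<Prod>e\<in>?J. R (\<phi> e) (snd e) (snd e)) * tsum k d \<phi>)"
      using finF by (intro sum.mono_neutral_left) (auto simp: tsum_not_inj)
    finally show ?thesis .
  qed
  ultimately show ?thesis by (simp only: 1 2 sum_distrib_right)
qed

text \<open>Here E is the whole grid and R the identity. An injective map of the finite grid into
  itself is onto, and the \<phi> without injectivity have vanishing \<open>tsum\<close>.\<close>

lemma (in wick) det_power_times_conj_det_power:
  fixes L M :: "nat \<Rightarrow> nat \<Rightarrow> 'v \<Rightarrow> complex"
  assumes gram: "\<And>i j i' j'. i < d \<Longrightarrow> j < d \<Longrightarrow> i' < d \<Longrightarrow> j' < d \<Longrightarrow>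
      gram (L i j) (M i' j') = of_bool (i = i' \<and> j = j')"
    and K: "k * d \<le> K"
  shows "H (\<lambda>z. det (mat d d (\<lambda>(i, j). lin (L i j) z)) ^ k * cnj (det (mat d d (\<lambda>(i, j). lin (M i j) z)) ^ k))
    (\<Sum>\<phi>\<in>grid k d \<rightarrow>\<^sub>E {..<k}. tsum k d \<phi>)"
proof -
  let ?J = "grid k d"
  let ?s = "\<lambda>\<phi> e. (\<phi> e, snd e)"
  have eq: "det (mat d d (\<lambda>(i, j). lin (N i j) z)) ^ k
    = sdet ?J (\<lambda>e e'. if fst e = fst e' then lin (N (snd e) (snd e')) z else 0)" for N z
    unfolding sdet_fst_blocks[of k d "\<lambda>_ i j. lin (N i j) z"] by (simp add: det_eq_sdet)
  have "(\<Sum>\<phi>\<in>{\<phi> \<in> ?J \<rightarrow>\<^sub>E {..<k}. inj_on (?s \<phi>) ?J \<and> ?s \<phi> ` ?J = ?J}. tsum k d \<phi>)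
    = (\<Sum>\<phi>\<in>?J \<rightarrow>\<^sub>E {..<k}. tsum k d \<phi>)"
  proof (rule sum.mono_neutral_left)
    show "\<forall>\<phi>\<in>(?J \<rightarrow>\<^sub>E {..<k}) - {\<phi> \<in> ?J \<rightarrow>\<^sub>E {..<k}. inj_on (?s \<phi>) ?J \<and> ?s \<phi> ` ?J = ?J}. tsum k d \<phi> = 0"
    proof
      fix \<phi> assume \<phi>: "\<phi> \<in> (?J \<rightarrow>\<^sub>E {..<k}) - {\<phi> \<in> ?J \<rightarrow>\<^sub>E {..<k}. inj_on (?s \<phi>) ?J \<and> ?s \<phi> ` ?J = ?J}"
      have "?s \<phi> ` ?J \<subseteq> ?J"
      proof (rule image_subsetI)
        fix e assume e: "e \<in> ?J"
        have "\<phi> \<in> ?J \<rightarrow>\<^sub>E {..<k}" using \<phi> by simp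
        then have "\<phi> e \<in> {..<k}" using e by (rule PiE_mem)
        moreover have "snd e < d" using e by (simp only: mem_Times_iff lessThan_iff)
        ultimately show "(\<phi> e, snd e) \<in> ?J" by simp
      qed
      then have "\<not> inj_on (?s \<phi>) ?J" using \<phi> endo_inj_surj[of ?J "?s \<phi>"] by auto
      then show "tsum k d \<phi> = 0" by (rule tsum_not_inj)
    qed
    show "finite (?J \<rightarrow>\<^sub>E {..<k})" by (intro finite_PiE) auto
  qed (rule Collect_subset)
  moreover have "H (\<lambda>z. sdet ?J (\<lambda>e e'. if fst e = fst e' then lin (L (snd e) (snd e')) z else 0) *
      cnj (sdet ?J (\<lambda>e e'. if fst e = fst e' then lin (M (snd e) (snd e')) z else 0)))
    (\<Sum>\<phi>\<in>{\<phi> \<in> ?J \<rightarrow>\<^sub>E {..<k}. inj_on (?s \<phi>) ?J \<and> ?s \<phi> ` ?J = ?J}. tsum k d \<phi>)"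
  proof -
    have "(\<Prod>e\<in>?J. of_bool (snd e = snd e)) = (1 :: complex)" by simp
    then show ?thesis
      using minor_times_det[of k d "\<lambda>_. L" M "\<lambda>_ i i'. of_bool (i = i')" ?J k] gram K
      by (simp only: of_bool_conj mult_1_left of_bool_eq(1)) simp
  qed
  ultimately show ?thesis by (simp only: eq)
qed

section \<open>Lagrange interpolation and roots of unity\<close>

text \<open>The basis polynomials \<open>l a\<close> depend on the nodes only. Thus a linear
  operation on polynomials of bounded degree becomes a finite combination of point evaluations,
  whether it is a moment functional, an integral or an evaluation at a singular point.\<close>

lemma lagrange_interpolation:
  fixes A :: "'a::field set"
  assumes "finite A" "card A = Suc K"
  obtains l where "\<And>p. degree p \<le> K \<Longrightarrow> p = (\<Sum>a\<in>A. Polynomial.smult (poly p a) (l a))"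
    and "\<And>a. degree (l a) \<le> K"
proof -
  define l where "l = (\<lambda>a. if a \<in> A then Polynomial.smult (inverse (\<Prod>b\<in>A - {a}. a - b)) (\<Prod>b\<in>A - {a}. [:-b, 1:]) else 0)"
  have deg: "degree (l a) \<le> K" for a
  proof (cases "a \<in> A")
    case True
    have "degree (l a) \<le> degree (\<Prod>b\<in>A - {a}. [:-b, 1:])"
      using True by (simp add: l_def degree_smult_le)
    also have "\<dots> \<le> (\<Sum>b\<in>A - {a}. degree [:-b, 1:])"
      using degree_prod_sum_le[of "A - {a}" "\<lambda>b. [:-b, 1:]"] assms by (simp add: o_def)
    also have "\<dots> = K" using True assms by simp
    finally show ?thesis .
  qed (simp add: l_def)
  have l: "poly (l a) b = of_bool (a = b)" if "a \<in> A" "b \<in> A" for a b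
  proof (cases "a = b")
    case True
    have "(\<Prod>c\<in>A - {b}. b - c) \<noteq> 0" using assms by (auto simp: prod_zero_iff)
    then show ?thesis using that True by (simp add: l_def poly_prod)
  next
    case False
    then have "(\<Prod>c\<in>A - {a}. b - c) = 0" using that assms by (intro prod_zero) auto
    then show ?thesis using that False by (simp add: l_def poly_prod)
  qed
  have "p = (\<Sum>a\<in>A. Polynomial.smult (poly p a) (l a))" if p: "degree p \<le> K" for p
  proof (rule ccontr)
    define q where "q = p - (\<Sum>a\<in>A. Polynomial.smult (poly p a) (l a))"
    assume "\<not> ?thesis"
    then have q: "q \<noteq> 0" by (simp add: q_def)
    have "degree (\<Sum>a\<in>A. Polynomial.smult (poly p a) (l a)) \<le> K"
      by (intro degree_sum_le assms(1) order_trans[OF degree_smult_le] deg)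
    then have "degree q \<le> K" unfolding q_def using p by (intro degree_diff_le)
    moreover have "A \<subseteq> {x. poly q x = 0}"
    proof
      fix b assume b: "b \<in> A"
      have "(\<Sum>a\<in>A. poly p a * poly (l a) b) = (\<Sum>a\<in>A. if a = b then poly p a else 0)"
        using b l by (intro sum.cong) auto
      then show "b \<in> {x. poly q x = 0}" using b assms by (simp add: q_def poly_sum)
    qed
    then have "Suc K \<le> card {x. poly q x = 0}"
      using card_mono[OF poly_roots_finite[OF q], of A] assms by simp
    then have "Suc K \<le> degree q" using card_poly_roots_bound[OF q] by linarith
    ultimately show False by simp
  qed
  then show ?thesis using that deg by blast
qed

text \<open>A geometric sum in x = exp (2 pi i (p - q) / (K + 1)); if p and q differ, x is not 1
  because 0 < |p - q| \<le> K.\<close>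

lemma sum_roots_of_unity:
  assumes "p \<le> K" "q \<le> K"
  shows "(\<Sum>l<Suc K. cis (2 * pi * real l / real (Suc K)) ^ p * cnj (cis (2 * pi * real l / real (Suc K))) ^ q)
    = (if p = q then of_nat (Suc K) else 0)"
proof -
  define x where "x = cis (2 * pi * (real p - real q) / real (Suc K))"
  have eq: "cis (2 * pi * real l / real (Suc K)) ^ p * cnj (cis (2 * pi * real l / real (Suc K))) ^ q = x ^ l" for l
  proof -
    have "real p * (2 * pi * real l / L) + real q * (- (2 * pi * real l / L)) = real l * (2 * pi * (real p - real q) / L)" for L
      by (simp add: right_diff_distrib left_diff_distrib diff_divide_distrib mult_ac)
    then show ?thesis by (simp only: x_def cis_cnj Complex.DeMoivre cis_mult)
  qed
  show ?thesis
  proof (cases "p = q")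
    case True
    then show ?thesis unfolding eq by (simp add: x_def)
  next
    case False
    have "x \<noteq> 1"
    proof
      assume "x = 1"
      then have "cos (2 * pi * (real p - real q) / real (Suc K)) = 1" by (simp add: x_def complex_eq_iff)
      then obtain n :: int where "2 * pi * (real p - real q) / real (Suc K) = of_int n * 2 * pi"
        using cos_one_2pi_int by blast
      then have "2 * pi * ((real p - real q) / real (Suc K)) = 2 * pi * of_int n" by (simp only: times_divide_eq_right mult_ac)
      then have "(real p - real q) / real (Suc K) = of_int n" by (simp only: mult_cancel_left) simp
      then have "real p - real q = of_int n * real (Suc K)" by (simp add: divide_eq_eq)
      then have "real_of_int (int p - int q) = real_of_int (n * int (Suc K))" by simp
      then have *: "int p - int q = n * int (Suc K)" by linarith
      then have "n \<noteq> 0" using False by auto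
      then have "int (Suc K) \<le> \<bar>n\<bar> * int (Suc K)" by (simp add: mult_le_cancel_right1)
      then have "int (Suc K) \<le> \<bar>int p - int q\<bar>" using * by (simp add: abs_mult)
      then show False using assms by linarith
    qed
    moreover have "x ^ Suc K = 1"
    proof -
      have "x ^ Suc K = cis (2 * pi * real_of_int (int p - int q))"
        unfolding x_def Complex.DeMoivre by (simp del: of_nat_Suc)
      then show ?thesis by (simp only: cis_multiple_2pi Ints_of_int)
    qed
    ultimately show ?thesis unfolding eq using False geometric_sum[of x "Suc K"] by simp
  qed
qed

text \<open>A finitely supported complex measure with the moments of the standard complex Gaussian
  up to order \<open>K\<close>. It is not positive, but averaging against it is a finite sum.\<close>

lemma finite_gaussian_moments:
  obtains I :: "(nat \<times> nat) set" and w x where "finite I"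
    "\<And>p q. p \<le> K \<Longrightarrow> q \<le> K \<Longrightarrow>
      (\<Sum>s\<in>I. w s * (x s ^ p * cnj (x s) ^ q)) = (if p = q then fact p else 0 :: complex)"
proof -
  have "card (of_nat ` {..K} :: complex set) = Suc K"
    by (subst card_image) (auto simp: inj_on_def)
  then obtain l :: "complex \<Rightarrow> complex poly" where l: "\<And>p. degree p \<le> K \<Longrightarrow>
      p = (\<Sum>a\<in>of_nat ` {..K}. Polynomial.smult (poly p a) (l a))" and deg: "\<And>a. degree (l a) \<le> K"
    using lagrange_interpolation[of "of_nat ` {..K} :: complex set" K] by blast
  \<comment> \<open>Weights at the nodes 0, ..., K of the linear functional that sends the monomial
    of degree n \<le> K to n!.\<close>
  define v where "v = (\<lambda>j. \<Sum>n\<le>K. coeff (l (of_nat j)) n * fact n)"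
  have v: "(\<Sum>j\<le>K. v j * of_nat j ^ p) = fact p" if "p \<le> K" for p
  proof -
    have "monom 1 p = (\<Sum>j\<le>K. Polynomial.smult (of_nat j ^ p) (l (of_nat j)))"
    proof -
      have "monom 1 p = (\<Sum>a\<in>of_nat ` {..K}. Polynomial.smult (poly (monom 1 p) a) (l a))"
        using that by (intro l) (simp add: degree_monom_eq)
      also have "\<dots> = (\<Sum>j\<le>K. Polynomial.smult (of_nat j ^ p) (l (of_nat j)))"
        by (subst sum.reindex) (auto simp: inj_on_def poly_monom)
      finally show ?thesis .
    qed
    then have c: "(\<Sum>j\<le>K. of_nat j ^ p * coeff (l (of_nat j)) n) = of_bool (p = n)" for n
    proof -
      have "coeff (monom 1 p) n = (\<Sum>j\<le>K. of_nat j ^ p * coeff (l (of_nat j)) n)"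
        by (subst \<open>monom 1 p = _\<close>) (simp add: coeff_sum)
      then show ?thesis by (simp add: of_bool_def)
    qed
    have "(\<Sum>j\<le>K. v j * of_nat j ^ p) = (\<Sum>n\<le>K. fact n * (\<Sum>j\<le>K. of_nat j ^ p * coeff (l (of_nat j)) n))"
      unfolding v_def sum_distrib_left sum_distrib_right by (subst sum.swap) (simp add: ac_simps)
    also have "\<dots> = fact p" using that by (simp add: c of_bool_def if_distrib cong: if_cong)
    finally show ?thesis .
  qed
  define w where "w = (\<lambda>s :: nat \<times> nat. v (fst s) / of_nat (Suc K))"
  \<comment> \<open>The squared radius j carries the weights v and so has the moments p!; the
    average over the roots of unity removes all terms with different p and q.\<close>
  define x where "x = (\<lambda>s :: nat \<times> nat. complex_of_real (sqrt (real (fst s))) * cis (2 * pi * real (snd s) / real (Suc K)))"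
  have "(\<Sum>s\<in>{..K} \<times> {..<Suc K :: nat}. w s * (x s ^ p * cnj (x s) ^ q)) = (if p = q then fact p else 0)"
    if pq: "p \<le> K" "q \<le> K" for p q
  proof -
    have "(\<Sum>s\<in>{..K} \<times> {..<Suc K :: nat}. w s * (x s ^ p * cnj (x s) ^ q))
      = (\<Sum>j\<le>K. \<Sum>t<Suc K. v j / of_nat (Suc K) * of_real (sqrt (real j)) ^ (p + q) *
          (cis (2 * pi * real t / real (Suc K)) ^ p * cnj (cis (2 * pi * real t / real (Suc K))) ^ q))"
      unfolding sum.cartesian_product
    proof (rule sum.cong[OF refl], clarify)
      fix j t :: nat
      show "w (j, t) * (x (j, t) ^ p * cnj (x (j, t)) ^ q)
        = v j / of_nat (Suc K) * of_real (sqrt (real j)) ^ (p + q) *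
          (cis (2 * pi * real t / real (Suc K)) ^ p * cnj (cis (2 * pi * real t / real (Suc K))) ^ q)"
        by (simp only: w_def x_def fst_conv snd_conv complex_cnj_mult complex_cnj_complex_of_real
            power_mult_distrib power_add mult_ac)
    qed
    also have "\<dots> = (\<Sum>j\<le>K. v j / of_nat (Suc K) * of_real (sqrt (real j)) ^ (p + q) *
        (if p = q then of_nat (Suc K) else 0))"
      by (simp only: sum_distrib_left[symmetric] sum_roots_of_unity[OF pq])
    also have "\<dots> = (if p = q then \<Sum>j\<le>K. v j * of_nat j ^ p else 0)"
    proof -
      have "complex_of_real (sqrt (real j)) ^ (p + p) = of_nat j ^ p" for j
      proof -
        have "sqrt (real j) ^ (p + p) = real j ^ p"
          by (simp add: mult_2[symmetric] power_mult)
        then show ?thesis by (metis of_real_of_nat_eq of_real_power)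
      qed
      then show ?thesis by (auto simp: simp del: of_nat_Suc)
    qed
    also have "\<dots> = (if p = q then fact p else 0)" using v[OF pq(1)] by (simp only:)
    finally show ?thesis .
  qed
  moreover have "finite ({..K} \<times> {..<Suc K})"
    by (intro finite_cartesian_product finite_lessThan finite_atMost)
  ultimately show ?thesis by (rule that[of "{..K} \<times> {..<Suc K}" w x, rotated])
qed

text \<open>Independent copies of the one-variable measure: points are tuples, weights are
  products.\<close>

lemma finite_wick:
  fixes Z :: "'v set"
  assumes "finite Z"
  obtains I and c :: "('v \<Rightarrow> nat \<times> nat) \<Rightarrow> complex" and z :: "('v \<Rightarrow> nat \<times> nat) \<Rightarrow> 'v \<Rightarrow> complex"
  where "finite I" "wick Z K (\<lambda>F a. (\<Sum>s\<in>I. c s * F (z s)) = a)"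
proof -
  obtain I0 :: "(nat \<times> nat) set" and w x where I0: "finite I0" and
    m: "\<And>p q. p \<le> K \<Longrightarrow> q \<le> K \<Longrightarrow>
      (\<Sum>s\<in>I0. w s * (x s ^ p * cnj (x s) ^ q)) = (if p = q then fact p else 0 :: complex)"
    by (rule finite_gaussian_moments[of K]) blast
  let ?I = "Z \<rightarrow>\<^sub>E I0"
  have "wick Z K (\<lambda>F a. (\<Sum>s\<in>?I. (\<Prod>v\<in>Z. w (s v)) * F (\<lambda>v. x (s v))) = a)"
  proof
    fix p q :: "'v \<Rightarrow> nat" assume pq: "sum p Z \<le> K" "sum q Z \<le> K"
    have le: "p v \<le> K" "q v \<le> K" if "v \<in> Z" for v
      using member_le_sum[OF that, of p] member_le_sum[OF that, of q] assms pq by simp_all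
    have "(\<Sum>s\<in>?I. (\<Prod>v\<in>Z. w (s v)) * (\<Prod>v\<in>Z. x (s v) ^ p v * cnj (x (s v)) ^ q v))
      = (\<Sum>s\<in>?I. \<Prod>v\<in>Z. w (s v) * (x (s v) ^ p v * cnj (x (s v)) ^ q v))"
      by (simp add: prod.distrib)
    also have "\<dots> = (\<Prod>v\<in>Z. \<Sum>s\<in>I0. w s * (x s ^ p v * cnj (x s) ^ q v))"
      by (rule prod_sum_PiE[symmetric]) (simp_all add: assms I0)
    also have "\<dots> = (\<Prod>v\<in>Z. if p v = q v then fact (p v) else 0)"
      by (intro prod.cong refl m le)
    finally show "(\<Sum>s\<in>?I. (\<Prod>v\<in>Z. w (s v)) * (\<Prod>v\<in>Z. x (s v) ^ p v * cnj (x (s v)) ^ q v))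
      = (\<Prod>v\<in>Z. if p v = q v then fact (p v) else 0)" .
  next
    fix F1 F2 :: "('v \<Rightarrow> complex) \<Rightarrow> complex" and c1 c2
    assume "(\<Sum>s\<in>?I. (\<Prod>v\<in>Z. w (s v)) * F1 (\<lambda>v. x (s v))) = c1"
      "(\<Sum>s\<in>?I. (\<Prod>v\<in>Z. w (s v)) * F2 (\<lambda>v. x (s v))) = c2"
    then show "(\<Sum>s\<in>?I. (\<Prod>v\<in>Z. w (s v)) * (F1 (\<lambda>v. x (s v)) + F2 (\<lambda>v. x (s v)))) = c1 + c2"
      by (simp add: distrib_left sum.distrib)
  next
    fix F :: "('v \<Rightarrow> complex) \<Rightarrow> complex" and c a
    assume "(\<Sum>s\<in>?I. (\<Prod>v\<in>Z. w (s v)) * F (\<lambda>v. x (s v))) = c"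
    then show "(\<Sum>s\<in>?I. (\<Prod>v\<in>Z. w (s v)) * (a * F (\<lambda>v. x (s v)))) = a * c"
      by (simp only: mult.left_commute[of _ a] sum_distrib_left[symmetric])
  qed (use assms in simp_all)
  moreover have "finite ?I" by (rule finite_PiE[OF assms I0])
  ultimately show ?thesis by (rule that[of ?I "\<lambda>s. \<Prod>v\<in>Z. w (s v)" "\<lambda>s v. x (s v)", rotated])
qed

section \<open>The complex Gaussian measure\<close>

lemma has_bochner_integral_pair_mult:
  fixes f :: "'a \<Rightarrow> complex" and g :: "'b \<Rightarrow> complex"
  assumes "prob_space M1" "prob_space M2" and f: "integrable M1 f" and g: "integrable M2 g"
  shows "has_bochner_integral (M1 \<Otimes>\<^sub>M M2) (\<lambda>(x, y). f x * g y) (integral\<^sup>L M1 f * integral\<^sup>L M2 g)"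
proof -
  interpret M1: prob_space M1 by fact
  interpret M2: prob_space M2 by fact
  interpret pair_prob_space M1 M2 ..
  note [measurable] = borel_measurable_integrable[OF f] borel_measurable_integrable[OF g]
  have int: "integrable (M1 \<Otimes>\<^sub>M M2) (\<lambda>(x, y). f x * g y)"
  proof (rule Fubini_integrable)
    have "integrable M1 (\<lambda>x. norm (f x) * (\<integral>y. norm (g y) \<partial>M2))"
      using f by (intro integrable_mult_left integrable_norm)
    then show "integrable M1 (\<lambda>x. \<integral>y. norm (case (x, y) of (x, y) \<Rightarrow> f x * g y) \<partial>M2)"
      by (simp add: norm_mult)
    show "AE x in M1. integrable M2 (\<lambda>y. case (x, y) of (x, y) \<Rightarrow> f x * g y)"
      using g by simp
  qed simp
  have "integral\<^sup>L (M1 \<Otimes>\<^sub>M M2) (\<lambda>(x, y). f x * g y) = (\<integral>x. (\<integral>y. f x * g y \<partial>M2) \<partial>M1)"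
    by (rule integral_fst[OF int, symmetric])
  also have "\<dots> = integral\<^sup>L M1 f * integral\<^sup>L M2 g" by simp
  finally show ?thesis using int by (simp add: has_bochner_integral_iff)
qed

lemma exponential_moment:
  "has_bochner_integral (density lborel (exponential_density 1)) (\<lambda>x. x ^ n) (fact n)"
proof -
  interpret prob_space "density lborel (exponential_density 1)"
    by (rule prob_space_exponential_density) simp
  \<comment> \<open>The identity is viewed as an exponentially distributed random variable, the case
    of shape parameter 0 of the Erlang distribution.\<close>
  have "distr (density lborel (exponential_density 1)) lborel (\<lambda>x. x) = distr (density lborel (exponential_density 1)) (density lborel (exponential_density 1)) (\<lambda>x. x)"
    by (rule distr_cong) simp_all
  then have "distributed (density lborel (exponential_density 1)) lborel (\<lambda>x. x) (exponential_density 1)"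
    unfolding distributed_def by (simp add: distr_id)
  from has_bochner_integral_erlang_ith_moment[OF _ this, of n] show ?thesis by simp
qed

lemma integrable_sqrt_power:
  "integrable (density lborel (exponential_density 1)) (\<lambda>x. sqrt x ^ n)"
proof (rule Bochner_Integration.integrable_bound)
  interpret prob_space "density lborel (exponential_density 1)"
    by (rule prob_space_exponential_density) simp
  show "integrable (density lborel (exponential_density 1)) (\<lambda>x. 1 + \<bar>x ^ n\<bar>)"
      proof (rule Bochner_Integration.integrable_add)
    have "integrable (density lborel (exponential_density 1)) (\<lambda>x. x ^ n)"
      using exponential_moment[of n] by (simp only: has_bochner_integral_iff)
    then show "integrable (density lborel (exponential_density 1)) (\<lambda>x. \<bar>x ^ n\<bar>)"
      by (rule integrable_abs)
  qed simp
  have "norm (sqrt x ^ n) \<le> norm (1 + \<bar>x ^ n\<bar>)" for x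
  proof -
    \<comment> \<open>The real \<open>sqrt\<close> is odd, hence negative at negative x; the
      absolute value treats both signs at once.\<close>
    define y where "y = \<bar>sqrt x\<bar>"
    have y: "y * y = \<bar>x\<bar>" "0 \<le> y" by (simp_all add: y_def abs_mult[symmetric])
    have "y ^ n \<le> 1 + \<bar>x\<bar> ^ n"
    proof (cases "y \<le> 1")
      case True
      then have "y ^ n \<le> 1" using y by (simp add: power_le_one)
      then show ?thesis by (simp add: add_increasing2)
    next
      case False
      then have "y \<le> \<bar>x\<bar>" using mult_left_mono[of 1 y y] y by simp
      then have "y ^ n \<le> \<bar>x\<bar> ^ n" using y by (intro power_mono)
      then show ?thesis by simp
    qed
    then show ?thesis by (simp add: y_def power_abs)
  qed
  then show "AE x in density lborel (exponential_density 1). norm (sqrt x ^ n) \<le> norm (1 + \<bar>x ^ n\<bar>)" by simp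
qed simp

text \<open>Squared modulus exponentially distributed, argument uniform among the roots of unity of
  order \<open>Suc K\<close>: this is as good as the complex Gaussian for moments of order at most \<open>K\<close>.\<close>

definition gauss :: "nat \<Rightarrow> complex measure" where
  "gauss K = distr (density lborel (exponential_density 1) \<Otimes>\<^sub>M measure_pmf (pmf_of_set {..<Suc K})) borel
     (\<lambda>(r, t). of_real (sqrt r) * cis (2 * pi * real t / real (Suc K)))"

lemma sets_gauss [simp, measurable_cong]: "sets (gauss K) = sets borel"
  by (simp add: gauss_def)

lemma gauss_map_measurable:
  "(\<lambda>(r, t). complex_of_real (sqrt r) * cis (2 * pi * real t / real (Suc K)))
    \<in> borel_measurable (density lborel (exponential_density 1) \<Otimes>\<^sub>M measure_pmf (pmf_of_set {..<Suc K}))"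
proof -
  have "(\<lambda>t::nat. cis (2 * pi * real t / real (Suc K))) \<in> borel_measurable (measure_pmf (pmf_of_set {..<Suc K}))"
    by simp
  then show ?thesis by measurable
qed

lemma prob_space_gauss: "prob_space (gauss K)"
proof -
  interpret M1: prob_space "density lborel (exponential_density 1)"
    by (rule prob_space_exponential_density) simp
  interpret pair_prob_space "density lborel (exponential_density 1)" "measure_pmf (pmf_of_set {..<Suc K})" ..
  show ?thesis unfolding gauss_def by (rule prob_space_distr[OF gauss_map_measurable])
qed

lemma gauss_moment:
  assumes "p \<le> K" "q \<le> K"
  shows "has_bochner_integral (gauss K) (\<lambda>z. z ^ p * cnj z ^ q) (if p = q then fact p else 0)"
proof -
  let ?M1 = "density lborel (exponential_density 1)" and ?M2 = "measure_pmf (pmf_of_set {..<Suc K})"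
  let ?c = "\<lambda>t. cis (2 * pi * real t / real (Suc K))"
  let ?f = "\<lambda>r. complex_of_real (sqrt r ^ (p + q))" and ?g = "\<lambda>t. ?c t ^ p * cnj (?c t) ^ q"
  have ne: "{..<Suc K} \<noteq> {}" by auto
  have int_g: "integrable ?M2 ?g"
    by (rule integrable_measure_pmf_finite) (simp add: set_pmf_of_set ne)
  have g: "integral\<^sup>L ?M2 ?g = (if p = q then 1 else 0)"
  proof -
    have "integral\<^sup>L ?M2 ?g = (\<Sum>t<Suc K. pmf (pmf_of_set {..<Suc K}) t *\<^sub>R ?g t)"
      by (rule integral_measure_pmf) (auto simp: set_pmf_of_set ne)
    also have "\<dots> = (\<Sum>t<Suc K. inverse (of_nat (Suc K)) * ?g t)"
      by (intro sum.cong refl) (simp add: ne scaleR_conv_of_real inverse_eq_divide)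
    also have "\<dots> = (if p = q then 1 else 0)"
      by (simp add: sum_distrib_left[symmetric] sum_roots_of_unity[OF assms] del: of_nat_Suc sum.lessThan_Suc)
    finally show ?thesis .
  qed
  have int_f: "integrable ?M1 ?f"
    by (rule integrable_bounded_linear[OF bounded_linear_of_real integrable_sqrt_power])
  have f: "integral\<^sup>L ?M1 ?f = fact p" if "p = q"
  proof -
    have "integral\<^sup>L ?M1 ?f = complex_of_real (\<integral>r. sqrt r ^ (p + q) \<partial>?M1)"
      by (rule integral_of_real[OF integrable_sqrt_power])
    also have "(\<integral>r. sqrt r ^ (p + q) \<partial>?M1) = (\<integral>r. r ^ p \<partial>?M1)"
    proof (rule integral_cong_AE)
      \<comment> \<open>For r < 0 the two sides may differ, as \<open>sqrt\<close> is odd, but the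
        exponential density vanishes there.\<close>
      have "AE r in lborel. 0 < exponential_density 1 r \<longrightarrow> sqrt r ^ (p + q) = r ^ p"
        using that by (intro AE_I2) (auto simp: exponential_density_def mult_2[symmetric] power_mult split: if_splits)
      then show "AE r in ?M1. sqrt r ^ (p + q) = r ^ p"
        by (simp add: AE_density)
    qed simp_all
    also have "\<dots> = fact p" using exponential_moment[of p] by (simp add: has_bochner_integral_iff)
    finally show ?thesis by simp
  qed
  have "prob_space ?M1" by (rule prob_space_exponential_density) simp
  then have "has_bochner_integral (?M1 \<Otimes>\<^sub>M ?M2) (\<lambda>(r, t). ?f r * ?g t) (integral\<^sup>L ?M1 ?f * integral\<^sup>L ?M2 ?g)"
    by (intro has_bochner_integral_pair_mult int_f int_g prob_space_measure_pmf)
  also have "(\<lambda>(r, t). ?f r * ?g t) = (\<lambda>x. (\<lambda>z. z ^ p * cnj z ^ q) (case x of (r, t) \<Rightarrow> complex_of_real (sqrt r) * ?c t))"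
    by (auto simp: fun_eq_iff power_mult_distrib power_add)
  finally have "has_bochner_integral (?M1 \<Otimes>\<^sub>M ?M2) (\<lambda>x. (\<lambda>z. z ^ p * cnj z ^ q) (case x of (r, t) \<Rightarrow> complex_of_real (sqrt r) * ?c t))
    (if p = q then fact p else 0)"
    using f g by (auto split: if_splits)
  moreover have "(\<lambda>z :: complex. z ^ p * cnj z ^ q) \<in> borel_measurable borel"
    by (intro borel_measurable_continuous_onI continuous_intros)
  ultimately show ?thesis
    unfolding gauss_def by (simp only: has_bochner_integral_distr[OF _ gauss_map_measurable])
qed

abbreviation gaussian :: "'v set \<Rightarrow> nat \<Rightarrow> ('v \<Rightarrow> complex) measure" where
  "gaussian Z K \<equiv> PiM Z (\<lambda>_. gauss K)"

lemma gaussian_wick: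
  assumes "finite Z"
  shows "wick Z K (has_bochner_integral (gaussian Z K))"
proof
  interpret product_prob_space "\<lambda>_. gauss K" Z
    by (intro product_prob_spaceI prob_space_gauss)
  fix p q :: "'a \<Rightarrow> nat" assume pq: "sum p Z \<le> K" "sum q Z \<le> K"
  have m: "has_bochner_integral (gauss K) (\<lambda>z. z ^ p v * cnj z ^ q v) (if p v = q v then fact (p v) else 0)" if "v \<in> Z" for v
    using member_le_sum[OF that, of p] member_le_sum[OF that, of q] assms pq by (intro gauss_moment) simp_all
  then have int: "integrable (gauss K) (\<lambda>z. z ^ p v * cnj z ^ q v)" if "v \<in> Z" for v
    using that by (simp add: has_bochner_integral_iff)
  have "integrable (gaussian Z K) (\<lambda>z. \<Prod>v\<in>Z. z v ^ p v * cnj (z v) ^ q v)"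
    using int by (intro product_integrable_prod[OF assms])
  moreover have "integral\<^sup>L (gaussian Z K) (\<lambda>z. \<Prod>v\<in>Z. z v ^ p v * cnj (z v) ^ q v)
    = (\<Prod>v\<in>Z. if p v = q v then fact (p v) else 0)"
    using m by (subst product_integral_prod[OF assms int]) (auto simp: has_bochner_integral_iff intro!: prod.cong)
  ultimately show "has_bochner_integral (gaussian Z K) (\<lambda>z. \<Prod>v\<in>Z. z v ^ p v * cnj (z v) ^ q v)
    (\<Prod>v\<in>Z. if p v = q v then fact (p v) else 0)"
    by (simp add: has_bochner_integral_iff)
qed (auto intro: assms has_bochner_integral_zero has_bochner_integral_add has_bochner_integral_mult_right)

section \<open>Unitary matrices and Haar measure\<close>

lemma mat_adjoint_carrier: "A \<in> carrier_mat n m \<Longrightarrow> mat_adjoint A \<in> carrier_mat m n"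
  by (rule carrier_matI) (simp_all add: mat_adjoint_def)

lemma mat_adjoint_index:
  assumes "A \<in> carrier_mat n m" "i < m" "j < n"
  shows "mat_adjoint (A :: complex mat) $$ (i, j) = cnj (A $$ (j, i))"
  using assms by (auto simp: mat_adjoint_def mat_of_rows_index conjugate_complex_def)

lemma mat_adjoint_mult:
  assumes "A \<in> carrier_mat n m" "B \<in> carrier_mat m l"
  shows "mat_adjoint (A * B :: complex mat) = mat_adjoint B * mat_adjoint A"
proof (rule eq_matI)
  note c = mat_adjoint_carrier[OF assms(1)] mat_adjoint_carrier[OF assms(2)]
    mat_adjoint_carrier[OF mult_carrier_mat[OF assms]]
  fix i j assume "i < dim_row (mat_adjoint B * mat_adjoint A)" "j < dim_col (mat_adjoint B * mat_adjoint A)"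
  then have ij: "i < l" "j < n" using c by auto
  show "mat_adjoint (A * B) $$ (i, j) = (mat_adjoint B * mat_adjoint A) $$ (i, j)"
    using assms c ij
    by (subst mat_adjoint_index[OF mult_carrier_mat[OF assms]])
      (auto simp: scalar_prod_def mat_adjoint_index[OF assms(1)] mat_adjoint_index[OF assms(2)] intro!: sum.cong)
qed (use assms in \<open>auto simp: mat_adjoint_def\<close>)

lemma mat_adjoint_adjoint:
  assumes "A \<in> carrier_mat n m"
  shows "mat_adjoint (mat_adjoint A) = (A :: complex mat)"
proof (rule eq_matI)
  note c = mat_adjoint_carrier[OF assms] mat_adjoint_carrier[OF mat_adjoint_carrier[OF assms]]
  fix i j assume "i < dim_row A" "j < dim_col A"
  then show "mat_adjoint (mat_adjoint A) $$ (i, j) = A $$ (i, j)"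
    using assms c by (simp add: mat_adjoint_index[OF mat_adjoint_carrier[OF assms]] mat_adjoint_index[OF assms])
qed (use assms in \<open>auto simp: mat_adjoint_def\<close>)

lemma mat_adjoint_one: "mat_adjoint (1\<^sub>m n :: complex mat) = 1\<^sub>m n"
  using mat_adjoint_carrier[OF one_carrier_mat[of n]]
  by (intro eq_matI) (auto simp: mat_adjoint_index[OF one_carrier_mat])

lemma det_mat_adjoint:
  assumes "A \<in> carrier_mat n n"
  shows "det (mat_adjoint A) = cnj (det (A :: complex mat))"
proof -
  have "mat_adjoint A = transpose_mat (map_mat cnj A)"
    using assms mat_adjoint_carrier[OF assms] by (intro eq_matI) (auto simp: mat_adjoint_index)
  then have "det (mat_adjoint A) = det (map_mat cnj A)"
    using assms by (simp add: det_transpose[of "map_mat cnj A" n])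
  also have "\<dots> = cnj (det A)"
    using assms by (simp add: det_def'[of _ n])
  finally show ?thesis .
qed

lemma unitaryD:
  assumes "U \<in> unitary_group d"
  shows "U \<in> carrier_mat d d" "U * mat_adjoint U = 1\<^sub>m d" "mat_adjoint U * U = 1\<^sub>m d"
  using assms by (auto simp: unitary_group_def)

lemma unitary_adjoint: "U \<in> unitary_group d \<Longrightarrow> mat_adjoint U \<in> unitary_group d"
  by (auto simp: unitary_group_def mat_adjoint_adjoint mat_adjoint_carrier)

lemma unitary_mult:
  assumes "U \<in> unitary_group d" "V \<in> unitary_group d"
  shows "U * V \<in> unitary_group d"
proof -
  note U = unitaryD[OF assms(1)] and V = unitaryD[OF assms(2)]
  note c = U(1) V(1) mat_adjoint_carrier[OF U(1)] mat_adjoint_carrier[OF V(1)]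
  have "U * V * (mat_adjoint V * mat_adjoint U) = U * (V * mat_adjoint V) * mat_adjoint U"
    using c by (simp add: assoc_mult_mat[of _ d d _ d _ d])
  moreover have "mat_adjoint V * mat_adjoint U * (U * V) = mat_adjoint V * (mat_adjoint U * U) * V"
    using c by (simp add: assoc_mult_mat[of _ d d _ d _ d])
  ultimately show ?thesis
    using c U V by (simp add: unitary_group_def mat_adjoint_mult[OF U(1) V(1)])
qed

lemma unitary_cancel:
  assumes "U \<in> unitary_group d" "A \<in> carrier_mat d d"
  shows "mat_adjoint U * (U * A) = A" "U * (mat_adjoint U * A) = A"
  using unitaryD[OF assms(1)] assms(2) mat_adjoint_carrier[OF unitaryD(1)[OF assms(1)]]
  by (simp_all add: assoc_mult_mat[symmetric, of _ d d _ d _ d])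

lemma unitary_det:
  assumes "U \<in> unitary_group d"
  shows "det U * cnj (det U) = 1" "det U \<noteq> 0"
proof -
  note U = unitaryD[OF assms]
  show "det U * cnj (det U) = 1"
    using det_mult[OF U(1) mat_adjoint_carrier[OF U(1)]] U by (simp add: det_mat_adjoint)
  then show "det U \<noteq> 0" by auto
qed

text \<open>The rows of U are unit vectors.\<close>

lemma unitary_entry_le:
  assumes "U \<in> unitary_group d" "i < d" "j < d"
  shows "norm (U $$ (i, j)) \<le> 1"
proof -
  note U = unitaryD[OF assms(1)]
  have "(1 :: complex) = (U * mat_adjoint U) $$ (i, i)" unfolding U(2) using assms by simp
  also have "\<dots> = (\<Sum>l\<in>{0..<d}. U $$ (i, l) * mat_adjoint U $$ (l, i))"
    using assms(2) U(1) mat_adjoint_carrier[OF U(1)] by (simp add: scalar_prod_def)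
  also have "\<dots> = (\<Sum>l<d. complex_of_real ((norm (U $$ (i, l)))\<^sup>2))"
    unfolding atLeast0LessThan
  proof (rule sum.cong[OF refl])
    fix l assume "l \<in> {..<d}"
    then have "mat_adjoint U $$ (l, i) = cnj (U $$ (i, l))"
      using assms(2) by (intro mat_adjoint_index[OF U(1)]) simp_all
    then show "U $$ (i, l) * mat_adjoint U $$ (l, i) = complex_of_real ((norm (U $$ (i, l)))\<^sup>2)"
      by (simp only: complex_norm_square)
  qed
  also have "\<dots> = complex_of_real (\<Sum>l<d. (norm (U $$ (i, l)))\<^sup>2)"
    by (rule of_real_sum[symmetric])
  finally have "complex_of_real (\<Sum>l<d. (norm (U $$ (i, l)))\<^sup>2) = 1" by (rule sym)
  then have "(\<Sum>l<d. (norm (U $$ (i, l)))\<^sup>2) = 1" by (simp only: of_real_eq_1_iff)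
  moreover have "(norm (U $$ (i, j)))\<^sup>2 \<le> (\<Sum>l<d. (norm (U $$ (i, l)))\<^sup>2)"
    using assms by (intro member_le_sum[of j "{..<d}" "\<lambda>l. (norm (U $$ (i, l)))\<^sup>2"]) simp_all
  ultimately have "(norm (U $$ (i, j)))\<^sup>2 \<le> 1\<^sup>2" by simp
  then show ?thesis by (rule power2_le_imp_le) simp
qed

section \<open>Topology of U(d) and left translations\<close>

lemma topspace_unitary: "topspace (unitary_topology d) = unitary_group d"
  by (auto simp: unitary_topology_def topspace_pullback_topology)

lemma continuous_map_unitary_entry:
  assumes "i < d" "j < d"
  shows "continuous_map (unitary_topology d) euclidean (\<lambda>U. U $$ (i, j))"
proof -
  let ?I = "{..<d} \<times> {..<d}"
  have "continuous_map (product_topology (\<lambda>_. euclidean) ?I) euclidean (\<lambda>f. f (i, j) :: complex)"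
    using assms by (intro continuous_map_product_projection) auto
  from continuous_map_pullback[OF this, of "unitary_group d" "\<lambda>A. \<lambda>ij\<in>?I. A $$ ij"]
  have "continuous_map (unitary_topology d) euclidean ((\<lambda>f. f (i, j)) \<circ> (\<lambda>A :: complex mat. \<lambda>ij\<in>?I. A $$ ij))"
    by (simp add: unitary_topology_def)
  moreover have "(\<lambda>f. f (i, j)) \<circ> (\<lambda>A :: complex mat. \<lambda>ij\<in>?I. A $$ ij) = (\<lambda>U. U $$ (i, j))"
    using assms by (auto simp: fun_eq_iff)
  ultimately show ?thesis by simp
qed

lemma continuous_map_unitary_mult:
  assumes W: "W \<in> unitary_group d"
  shows "continuous_map (unitary_topology d) (unitary_topology d) (\<lambda>U. W * U)"
proof -
  let ?I = "{..<d} \<times> {..<d}"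
  let ?T = "product_topology (\<lambda>_. euclidean) ?I :: (nat \<times> nat \<Rightarrow> complex) topology"
  let ?f = "\<lambda>A :: complex mat. \<lambda>ij\<in>?I. A $$ ij"
  have "continuous_map (unitary_topology d) ?T (?f \<circ> (\<lambda>U. W * U))"
    unfolding continuous_map_componentwise
  proof (intro conjI ballI)
    show "(?f \<circ> (\<lambda>U. W * U)) ` topspace (unitary_topology d) \<subseteq> extensional ?I" by auto
    fix ij assume "ij \<in> ?I"
    then obtain i j where ij: "ij = (i, j)" "i < d" "j < d" by auto
    have "continuous_map (unitary_topology d) euclidean (\<lambda>U. \<Sum>l<d. W $$ (i, l) * U $$ (l, j))"
    proof (rule continuous_map_sum)
      fix l assume "l \<in> {..<d}"
      then have "continuous_map (unitary_topology d) euclidean (\<lambda>U. U $$ (l, j))"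
        using ij by (intro continuous_map_unitary_entry) auto
      moreover have "continuous_map euclidean euclidean (\<lambda>z. W $$ (i, l) * z)"
        by (simp add: continuous_intros)
      ultimately have "continuous_map (unitary_topology d) euclidean ((\<lambda>z. W $$ (i, l) * z) \<circ> (\<lambda>U. U $$ (l, j)))"
        by (rule continuous_map_compose)
      then show "continuous_map (unitary_topology d) euclidean (\<lambda>U. W $$ (i, l) * U $$ (l, j))"
        by (simp add: o_def)
    qed simp
    moreover have "(\<Sum>l<d. W $$ (i, l) * U $$ (l, j)) = (?f \<circ> (\<lambda>U. W * U)) U ij"
      if "U \<in> topspace (unitary_topology d)" for U
      using that ij unitaryD(1)[OF W] unitaryD(1)[of U d]
      by (auto simp: topspace_unitary scalar_prod_def lessThan_atLeast0 intro!: sum.cong)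
    ultimately show "continuous_map (unitary_topology d) euclidean (\<lambda>U. (?f \<circ> (\<lambda>U. W * U)) U ij)"
      by (rule continuous_map_eq)
  qed
  moreover have "topspace (unitary_topology d) \<subseteq> (\<lambda>U. W * U) -` unitary_group d"
    using unitary_mult[OF W] by (auto simp: topspace_unitary)
  ultimately have "continuous_map (unitary_topology d) (pullback_topology (unitary_group d) ?f ?T) (\<lambda>U. W * U)"
    by (rule continuous_map_pullback')
  then show ?thesis by (simp add: unitary_topology_def)
qed

locale haar =
  fixes d :: nat and \<mu> :: "complex mat measure"
  assumes haar: "is_unitary_haar d \<mu>"
begin

sublocale prob_space \<mu>
  using haar by (simp add: is_unitary_haar_def)

lemma open_subset: "{S. openin (unitary_topology d) S} \<subseteq> Pow (unitary_group d)"
  using openin_subset[of "unitary_topology d"] by (auto simp: topspace_unitary)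

lemma sets_haar: "sets \<mu> = sigma_sets (unitary_group d) {S. openin (unitary_topology d) S}"
  using haar open_subset by (simp add: is_unitary_haar_def unitary_borel_def sets_measure_of)

lemma space_haar [simp]: "space \<mu> = unitary_group d"
proof -
  have "space \<mu> = space (unitary_borel d)"
    using haar by (intro sets_eq_imp_space_eq) (simp add: is_unitary_haar_def)
  then show ?thesis by (simp add: unitary_borel_def space_measure_of_conv)
qed

lemma entry_measurable:
  assumes "i < d" "j < d"
  shows "(\<lambda>U. U $$ (i, j)) \<in> borel_measurable \<mu>"
proof (rule borel_measurableI)
  fix S :: "complex set" assume "open S"
  then have "openin (unitary_topology d) {U \<in> topspace (unitary_topology d). U $$ (i, j) \<in> S}"
    using continuous_map_unitary_entry[OF assms] by (auto simp: continuous_map_def)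
  moreover have "{U \<in> topspace (unitary_topology d). U $$ (i, j) \<in> S} = (\<lambda>U. U $$ (i, j)) -` S \<inter> space \<mu>"
    by (auto simp: topspace_unitary)
  ultimately show "(\<lambda>U. U $$ (i, j)) -` S \<inter> space \<mu> \<in> sets \<mu>"
    by (auto simp: sets_haar)
qed

lemma left_mult_measurable:
  assumes W: "W \<in> unitary_group d"
  shows "(\<lambda>U. W * U) \<in> measurable \<mu> \<mu>"
proof (rule measurable_sigma_sets[OF sets_haar open_subset])
  show "(\<lambda>U. W * U) \<in> space \<mu> \<rightarrow> unitary_group d" using unitary_mult[OF W] by auto
  fix S assume "S \<in> {S. openin (unitary_topology d) S}"
  then have "openin (unitary_topology d) {U \<in> topspace (unitary_topology d). W * U \<in> S}"
    using continuous_map_unitary_mult[OF W] by (auto simp: continuous_map_def)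
  moreover have "{U \<in> topspace (unitary_topology d). W * U \<in> S} = (\<lambda>U. W * U) -` S \<inter> space \<mu>"
    by (auto simp: topspace_unitary)
  ultimately show "(\<lambda>U. W * U) -` S \<inter> space \<mu> \<in> sets \<mu>"
    by (auto simp: sets_haar)
qed

lemma distr_left_mult:
  assumes W: "W \<in> unitary_group d"
  shows "distr \<mu> \<mu> (\<lambda>U. W * U) = \<mu>"
proof (rule measure_eqI)
  fix S assume "S \<in> sets (distr \<mu> \<mu> (\<lambda>U. W * U))"
  then have S: "S \<in> sets \<mu>" by simp
  then have "S \<subseteq> unitary_group d" using sets.sets_into_space by fastforce
  \<comment> \<open>Invariance is given for images; the preimage under left multiplication by W is
    the image under its adjoint.\<close>
  then have "(\<lambda>U. W * U) -` S \<inter> space \<mu> = (\<lambda>U. mat_adjoint W * U) ` S"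
  proof (intro equalityI subsetI)
    fix U assume "U \<in> (\<lambda>U. W * U) -` S \<inter> space \<mu>"
    then have "W * U \<in> S" "U = mat_adjoint W * (W * U)"
      using unitary_cancel(1)[OF W unitaryD(1)] by auto
    then show "U \<in> (\<lambda>U. mat_adjoint W * U) ` S" by blast
  next
    fix U assume "U \<in> (\<lambda>U. mat_adjoint W * U) ` S" "S \<subseteq> unitary_group d"
    then show "U \<in> (\<lambda>U. W * U) -` S \<inter> space \<mu>"
      using unitary_cancel(2)[OF W unitaryD(1)] unitary_mult[OF unitary_adjoint[OF W]] by auto
  qed
  then show "emeasure (distr \<mu> \<mu> (\<lambda>U. W * U)) S = emeasure \<mu> S"
    using S haar unitary_adjoint[OF W] left_mult_measurable[OF W]
    by (simp add: emeasure_distr is_unitary_haar_def)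
qed simp

text \<open>The class contains the matrix entries and is closed under sums, products and
  conjugation, so it contains all polynomials in the entries and their conjugates; since \<mu> is a
  probability measure, all of these are integrable.\<close>

definition bm :: "(complex mat \<Rightarrow> complex) \<Rightarrow> bool" where
  "bm f \<longleftrightarrow> f \<in> borel_measurable \<mu> \<and> (\<exists>B. \<forall>V\<in>unitary_group d. norm (f V) \<le> B)"

lemma bm_cong: "bm f \<Longrightarrow> (\<And>V. V \<in> unitary_group d \<Longrightarrow> f V = g V) \<Longrightarrow> bm g"
  unfolding bm_def using measurable_cong[of \<mu> f g borel] by auto

lemma bm_const: "bm (\<lambda>_. c)"
  by (auto simp: bm_def)

lemma bm_add:
  assumes "bm f" "bm g" shows "bm (\<lambda>V. f V + g V)"
proof -
  obtain B C where "\<forall>V\<in>unitary_group d. norm (f V) \<le> B" "\<forall>V\<in>unitary_group d. norm (g V) \<le> C"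
    using assms by (auto simp: bm_def)
  then have "\<forall>V\<in>unitary_group d. norm (f V + g V) \<le> B + C" by (auto intro: norm_triangle_mono)
  then show ?thesis using assms by (auto simp: bm_def)
qed

lemma bm_mult:
  assumes "bm f" "bm g" shows "bm (\<lambda>V. f V * g V)"
proof -
  obtain B C where BC: "\<forall>V\<in>unitary_group d. norm (f V) \<le> B" "\<forall>V\<in>unitary_group d. norm (g V) \<le> C"
    using assms by (auto simp: bm_def)
  have "norm (f V * g V) \<le> B * C" if "V \<in> unitary_group d" for V
    using BC that order_trans[OF norm_ge_zero bspec[OF BC(1) that]] unfolding norm_mult by (intro mult_mono) auto
  then show ?thesis using assms by (auto simp: bm_def)
qed

lemma bm_cnj: "bm f \<Longrightarrow> bm (\<lambda>V. cnj (f V))"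
  unfolding bm_def by (simp add: borel_measurable_continuous_on[OF continuous_on_cnj[OF continuous_on_id]])

lemma bm_sum: "finite I \<Longrightarrow> (\<And>i. i \<in> I \<Longrightarrow> bm (f i)) \<Longrightarrow> bm (\<lambda>V. \<Sum>i\<in>I. f i V)"
  by (induction I rule: finite_induct) (auto intro: bm_const bm_add)

lemma bm_prod: "finite I \<Longrightarrow> (\<And>i. i \<in> I \<Longrightarrow> bm (f i)) \<Longrightarrow> bm (\<lambda>V. \<Prod>i\<in>I. f i V)"
  by (induction I rule: finite_induct) (auto intro: bm_const bm_mult)

lemma bm_power: "bm f \<Longrightarrow> bm (\<lambda>V. f V ^ n)"
  by (induction n) (auto intro: bm_const bm_mult)

lemma bm_entry: "i < d \<Longrightarrow> j < d \<Longrightarrow> bm (\<lambda>V. V $$ (i, j))"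
  unfolding bm_def using entry_measurable unitary_entry_le by blast

lemma bm_det:
  assumes "\<And>V. V \<in> unitary_group d \<Longrightarrow> M V \<in> carrier_mat n n"
    and "\<And>i j. i < n \<Longrightarrow> j < n \<Longrightarrow> bm (\<lambda>V. M V $$ (i, j))"
  shows "bm (\<lambda>V. det (M V))"
proof (rule bm_cong)
  show "bm (\<lambda>V. \<Sum>p | p permutes {0..<n}. signof p * (\<Prod>i = 0..<n. M V $$ (i, p i)))"
  proof (rule bm_sum)
    fix p assume "p \<in> {p. p permutes {0..<n}}"
    then have "bm (\<lambda>V. M V $$ (i, p i))" if "i \<in> {0..<n}" for i
      using that permutes_in_image[of p "{0..<n}" i] by (intro assms(2)) auto
    then have "bm (\<lambda>V. \<Prod>i = 0..<n. M V $$ (i, p i))" by (intro bm_prod) auto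
    then show "bm (\<lambda>V. signof p * (\<Prod>i = 0..<n. M V $$ (i, p i)))" by (rule bm_mult[OF bm_const])
  qed (simp add: finite_permutations)
  show "(\<Sum>p | p permutes {0..<n}. signof p * (\<Prod>i = 0..<n. M V $$ (i, p i))) = det (M V)"
    if "V \<in> unitary_group d" for V
    using det_def'[OF assms(1)[OF that]] by simp
qed

lemma bm_integrable:
  assumes "bm f"
  shows "integrable \<mu> f"
proof -
  obtain B where "\<forall>V\<in>unitary_group d. norm (f V) \<le> B" using assms by (auto simp: bm_def)
  then have "AE V in \<mu>. norm (f V) \<le> B" by (intro AE_I2) simp
  then show ?thesis using assms by (intro integrable_const_bound[of f B]) (auto simp: bm_def)
qed

lemma integral_left_mult:
  assumes "W \<in> unitary_group d" "bm f"
  shows "(\<integral>U. f (W * U) \<partial>\<mu>) = (\<integral>U. f U \<partial>\<mu>)"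
proof -
  have "(\<integral>U. f U \<partial>distr \<mu> \<mu> (\<lambda>U. W * U)) = (\<integral>U. f (W * U) \<partial>\<mu>)"
    using assms left_mult_measurable by (intro integral_distr) (auto simp: bm_def)
  then show ?thesis using distr_left_mult[OF assms(1)] by simp
qed

end

section \<open>Polynomial functions and the Cayley transform\<close>

text \<open>The degree bound belongs to the notion because interpolation at a fixed finite set of
  nodes is what lets it survive integration.\<close>

definition polyfun :: "nat \<Rightarrow> (complex \<Rightarrow> complex) \<Rightarrow> bool" where
  "polyfun n f \<longleftrightarrow> (\<exists>P. degree P \<le> n \<and> (\<forall>t. f t = poly P t))"

lemma polyfun_const: "polyfun n (\<lambda>_. c)"
  unfolding polyfun_def by (intro exI[of _ "[:c:]"]) simp

lemma polyfun_ident: "polyfun 1 (\<lambda>t. t)"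
  unfolding polyfun_def by (intro exI[of _ "[:0, 1:]"]) simp

lemma polyfun_mono: "polyfun n f \<Longrightarrow> n \<le> m \<Longrightarrow> polyfun m f"
  unfolding polyfun_def using le_trans by blast

lemma polyfun_add: "polyfun n f \<Longrightarrow> polyfun n g \<Longrightarrow> polyfun n (\<lambda>t. f t + g t)"
  unfolding polyfun_def by (metis degree_add_le poly_add)

lemma polyfun_mult: "polyfun n f \<Longrightarrow> polyfun m g \<Longrightarrow> polyfun (n + m) (\<lambda>t. f t * g t)"
  unfolding polyfun_def by (metis add_mono degree_mult_le le_trans poly_mult)

lemma polyfun_cmult: "polyfun n f \<Longrightarrow> polyfun n (\<lambda>t. c * f t)"
  using polyfun_mult[OF polyfun_const[of 0 c], of n f] by simp

lemma polyfun_sum: "finite I \<Longrightarrow> (\<And>i. i \<in> I \<Longrightarrow> polyfun n (f i)) \<Longrightarrow> polyfun n (\<lambda>t. \<Sum>i\<in>I. f i t)"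
  by (induction I rule: finite_induct) (simp_all add: polyfun_const polyfun_add)

lemma polyfun_prod: "finite I \<Longrightarrow> (\<And>i. i \<in> I \<Longrightarrow> polyfun n (f i)) \<Longrightarrow> polyfun (card I * n) (\<lambda>t. \<Prod>i\<in>I. f i t)"
  by (induction I rule: finite_induct) (simp_all add: polyfun_const polyfun_mult)

lemma polyfun_power: "polyfun n f \<Longrightarrow> polyfun (k * n) (\<lambda>t. f t ^ k)"
  using polyfun_prod[of "{..<k}" n "\<lambda>_. f"] by simp

lemma polyfun_det:
  assumes "\<And>t. M t \<in> carrier_mat d d"
    and "\<And>i j. i < d \<Longrightarrow> j < d \<Longrightarrow> polyfun n (\<lambda>t. M t $$ (i, j))"
  shows "polyfun (d * n) (\<lambda>t. det (M t))"
proof -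
  have "polyfun (d * n) (\<lambda>t. signof p * (\<Prod>i = 0..<d. M t $$ (i, p i)))" if "p permutes {0..<d}" for p
  proof (rule polyfun_cmult)
    have "polyfun n (\<lambda>t. M t $$ (i, p i))" if "i \<in> {0..<d}" for i
      using that permutes_in_image[OF \<open>p permutes {0..<d}\<close>, of i] by (intro assms(2)) simp_all
    from polyfun_prod[of "{0..<d}" n "\<lambda>i t. M t $$ (i, p i)", OF _ this]
    show "polyfun (d * n) (\<lambda>t. \<Prod>i = 0..<d. M t $$ (i, p i))" by simp
  qed
  then have "polyfun (d * n) (\<lambda>t. \<Sum>p\<in>{p. p permutes {0..<d}}. signof p * (\<Prod>i = 0..<d. M t $$ (i, p i)))"
    by (intro polyfun_sum) (simp_all add: finite_permutations)
  then show ?thesis by (simp only: det_def'[OF assms(1)])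
qed

lemma polyfun_mat_mult:
  assumes "\<And>t. A t \<in> carrier_mat d d" "\<And>t. B t \<in> carrier_mat d d"
    and A: "\<And>i j. i < d \<Longrightarrow> j < d \<Longrightarrow> polyfun n (\<lambda>t. A t $$ (i, j))"
    and B: "\<And>i j. i < d \<Longrightarrow> j < d \<Longrightarrow> polyfun m (\<lambda>t. B t $$ (i, j))"
    and ij: "i < d" "j < d"
  shows "polyfun (n + m) (\<lambda>t. (A t * B t) $$ (i, j))"
proof -
  have "(A t * B t) $$ (i, j) = (\<Sum>l\<in>{0..<d}. A t $$ (i, l) * B t $$ (l, j))" for t
    using assms(1)[of t] assms(2)[of t] ij by (simp add: scalar_prod_def)
  moreover have "polyfun (n + m) (\<lambda>t. \<Sum>l\<in>{0..<d}. A t $$ (i, l) * B t $$ (l, j))"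
    using ij by (intro polyfun_sum polyfun_mult A B) simp_all
  ultimately show ?thesis by (simp only:)
qed

lemma polyfun_adj_mat:
  assumes "\<And>t. A t \<in> carrier_mat d d"
    and "\<And>i j. i < d \<Longrightarrow> j < d \<Longrightarrow> polyfun n (\<lambda>t. A t $$ (i, j))"
    and ij: "i < d" "j < d"
  shows "polyfun (d * n) (\<lambda>t. adj_mat (A t) $$ (i, j))"
proof -
  have "polyfun ((d - 1) * n) (\<lambda>t. det (mat_delete (A t) j i))"
  proof (rule polyfun_det)
    show "mat_delete (A t) j i \<in> carrier_mat (d - 1) (d - 1)" for t
      using assms(1) by (rule mat_delete_carrier)
    fix i' j' assume "i' < d - 1" "j' < d - 1"
    moreover have "mat_delete (A t) j i $$ (i', j')
      = A t $$ (if i' < j then i' else Suc i', if j' < i then j' else Suc j')" for t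
      using assms(1)[of t] calculation by (simp add: mat_delete_def)
    moreover have "(if i' < j then i' else Suc i') < d" "(if j' < i then j' else Suc j') < d"
      using calculation(1,2) ij by auto
    ultimately show "polyfun n (\<lambda>t. mat_delete (A t) j i $$ (i', j'))"
      by (simp only: assms(2))
  qed
  then have "polyfun (d * n) (\<lambda>t. det (mat_delete (A t) j i))"
    by (rule polyfun_mono) simp
  moreover have "adj_mat (A t) $$ (i, j) = (- 1) ^ (j + i) * det (mat_delete (A t) j i)" for t
    using assms(1)[of t] ij by (simp add: adj_mat_def cofactor_def)
  ultimately show ?thesis by (simp only: polyfun_cmult)
qed

lemma polyfun_eqI:
  assumes "polyfun n f" "polyfun m g" "infinite {t. f t = g t}"
  shows "f t = g t"
proof -
  obtain P Q where PQ: "\<And>t. f t = poly P t" "\<And>t. g t = poly Q t"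
    using assms by (auto simp: polyfun_def)
  have "P - Q = 0"
  proof (rule ccontr)
    assume "P - Q \<noteq> 0"
    then have "finite {t. poly (P - Q) t = 0}" by (rule poly_roots_finite)
    then show False using assms(3) by (simp add: PQ)
  qed
  then show ?thesis by (simp add: PQ)
qed

lemma infinite_reals: "infinite (\<real> :: complex set)"
proof
  assume "finite (\<real> :: complex set)"
  then have "finite (range complex_of_real)" by (simp add: Reals_def)
  then show False using finite_imageD[of complex_of_real UNIV] infinite_UNIV_char_0[where 'a = real]
    by (simp add: inj_def)
qed

text \<open>Interpolate at n + 1 fixed nodes: F t x is a combination of the F a x whose coefficients
  are polynomials in t independent of x, so the integral is the same combination of integrals. The
  degree bound has to be uniform in x.\<close>

lemma polyfun_integral:
  assumes int: "\<And>t. integrable M (F t)"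
    and pf: "\<And>x. x \<in> space M \<Longrightarrow> polyfun n (\<lambda>t. F t x)"
  shows "polyfun n (\<lambda>t. \<integral>x. F t x \<partial>M)"
proof -
  let ?A = "of_nat ` {..n} :: complex set"
  have "card ?A = Suc n" by (subst card_image) (auto simp: inj_on_def)
  then obtain l :: "complex \<Rightarrow> complex poly" where l: "\<And>p. degree p \<le> n \<Longrightarrow>
      p = (\<Sum>a\<in>?A. Polynomial.smult (poly p a) (l a))" and deg: "\<And>a. degree (l a) \<le> n"
    using lagrange_interpolation[of ?A n] by blast
  have eq: "F t x = (\<Sum>a\<in>?A. F a x * poly (l a) t)" if x: "x \<in> space M" for t x
  proof -
    obtain P where P: "degree P \<le> n" "\<And>t. F t x = poly P t"
      using pf[OF x] by (auto simp: polyfun_def)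
    have "poly P t = poly (\<Sum>a\<in>?A. Polynomial.smult (poly P a) (l a)) t"
      using l[OF P(1)] by (rule arg_cong)
    then show ?thesis by (simp only: P(2) poly_sum poly_smult)
  qed
  have "(\<lambda>t. \<integral>x. F t x \<partial>M) = (\<lambda>t. \<Sum>a\<in>?A. (\<integral>x. F a x \<partial>M) * poly (l a) t)"
  proof
    fix t
    have "(\<integral>x. F t x \<partial>M) = (\<integral>x. (\<Sum>a\<in>?A. F a x * poly (l a) t) \<partial>M)"
      by (rule Bochner_Integration.integral_cong[OF refl eq])
    also have "\<dots> = (\<Sum>a\<in>?A. (\<integral>x. F a x \<partial>M) * poly (l a) t)"
      using int by (subst Bochner_Integration.integral_sum) simp_all
    finally show "(\<integral>x. F t x \<partial>M) = (\<Sum>a\<in>?A. (\<integral>x. F a x \<partial>M) * poly (l a) t)" .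
  qed
  moreover have "polyfun n (\<lambda>t. \<Sum>a\<in>?A. (\<integral>x. F a x \<partial>M) * poly (l a) t)"
    by (intro polyfun_sum polyfun_cmult) (auto simp: polyfun_def intro: deg)
  ultimately show ?thesis by (rule ssubst[of _ _ "polyfun n"])
qed

section \<open>Skew-Hermitian matrices and the Cayley transform\<close>

text \<open>If (1 + H) v = 0, pairing with v gives |v|^2 + h = 0 with h = <v, H v> purely imaginary;
  the real part forces v = 0.\<close>

lemma det_one_plus_skew_hermitian:
  assumes H: "H \<in> carrier_mat d d" and skew: "\<And>i j. i < d \<Longrightarrow> j < d \<Longrightarrow> cnj (H $$ (j, i)) = - H $$ (i, j)"
  shows "det (1\<^sub>m d + H) \<noteq> (0 :: complex)"
proof
  assume "det (1\<^sub>m d + H) = 0"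
  then obtain v where v: "v \<in> carrier_vec d" "v \<noteq> 0\<^sub>v d" "(1\<^sub>m d + H) *\<^sub>v v = 0\<^sub>v d"
    using det_0_iff_vec_prod_zero[of "1\<^sub>m d + H" d] H by auto
  define h where "h = (\<Sum>i<d. \<Sum>j<d. cnj (v $ i) * H $$ (i, j) * v $ j)"
  have row: "v $ i + (\<Sum>j<d. H $$ (i, j) * v $ j) = 0" if i: "i < d" for i
  proof -
    have "((1\<^sub>m d + H) *\<^sub>v v) $ i = (1\<^sub>m d *\<^sub>v v + H *\<^sub>v v) $ i"
      using H v by (simp add: add_mult_distrib_mat_vec[of _ d d])
    also have "\<dots> = v $ i + (\<Sum>j<d. H $$ (i, j) * v $ j)"
      using H v i by (simp add: scalar_prod_def atLeast0LessThan)
    finally show ?thesis using v i by simp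
  qed
  have "0 = (\<Sum>i<d. cnj (v $ i) * (v $ i + (\<Sum>j<d. H $$ (i, j) * v $ j)))"
    by (simp add: row)
  also have "\<dots> = (\<Sum>i<d. cnj (v $ i) * v $ i) + h"
    by (simp add: h_def distrib_left sum.distrib sum_distrib_left mult.assoc)
  also have "(\<Sum>i<d. cnj (v $ i) * v $ i) = complex_of_real (\<Sum>i<d. (norm (v $ i))\<^sup>2)"
    unfolding of_real_sum complex_norm_square by (simp add: mult.commute)
  finally have 0: "complex_of_real (\<Sum>i<d. (norm (v $ i))\<^sup>2) + h = 0" by simp
  have "cnj h = (\<Sum>i<d. \<Sum>j<d. - (cnj (v $ j) * H $$ (j, i) * v $ i))"
    unfolding h_def cnj_sum by (intro sum.cong refl) (simp add: skew)
  also have "\<dots> = - h"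
    unfolding h_def sum_negf by (subst sum.swap) simp
  finally have "Re h = 0" by (simp add: complex_eq_iff)
  then have "(\<Sum>i<d. (norm (v $ i))\<^sup>2) = 0" using arg_cong[OF 0, of Re] by simp
  then have "\<forall>i<d. v $ i = 0" by (subst (asm) sum_nonneg_eq_0_iff) simp_all
  then have "v = 0\<^sub>v d" using v by (intro eq_vecI) simp_all
  then show False using v by simp
qed

lemma minus_plus_one_commute:
  assumes "H \<in> carrier_mat d d"
  shows "(1\<^sub>m d + H) * (1\<^sub>m d - H) = (1\<^sub>m d - H) * (1\<^sub>m d + H :: complex mat)"
proof -
  have 1: "(1\<^sub>m d + H) * (1\<^sub>m d - H) = 1\<^sub>m d - H + (H - H * H)"
    using assms by (subst add_mult_distrib_mat[of _ d d _ _ d]) (simp_all add: minus_carrier_mat mult_minus_distrib_mat[of _ d d _ d])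
  have 2: "(1\<^sub>m d - H) * (1\<^sub>m d + H) = (1\<^sub>m d + H) - (H + H * H)"
    using assms by (subst minus_mult_distrib_mat[of _ d d _ _ d]) (simp_all add: minus_carrier_mat mult_add_distrib_mat[of _ d d _ d])
  have 3: "1\<^sub>m d - H + (H - Q) = (1\<^sub>m d + H) - (H + Q)" if "Q \<in> carrier_mat d d" for Q
    using assms that by (intro eq_matI) auto
  show ?thesis unfolding 1 2 by (rule 3[OF mult_carrier_mat[OF assms assms]])
qed

text \<open>Taking adjoints exchanges 1 + H and 1 - H, and these two commute.\<close>

lemma cayley_unitary:
  assumes H: "H \<in> carrier_mat d d" and skew: "\<And>i j. i < d \<Longrightarrow> j < d \<Longrightarrow> cnj (H $$ (j, i)) = - H $$ (i, j)"
    and Z: "Z \<in> carrier_mat d d" "(1\<^sub>m d + H) * Z = 1\<^sub>m d"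
  shows "(1\<^sub>m d - H) * Z \<in> unitary_group d"
proof -
  let ?p = "1\<^sub>m d + H" and ?m = "1\<^sub>m d - H" and ?Z = "mat_adjoint Z"
  have c: "?p \<in> carrier_mat d d" "?m \<in> carrier_mat d d" "?Z \<in> carrier_mat d d"
    using H Z mat_adjoint_carrier[OF Z(1)] by auto
  have adj: "mat_adjoint ?p = ?m" "mat_adjoint ?m = ?p"
  proof -
    show "mat_adjoint ?p = ?m"
      using H c mat_adjoint_carrier[OF c(1)] by (intro eq_matI) (auto simp: mat_adjoint_index[OF c(1)] skew)
    show "mat_adjoint ?m = ?p"
      using H c mat_adjoint_carrier[OF c(2)] by (intro eq_matI) (auto simp: mat_adjoint_index[OF c(2)] skew)
  qed
  have Zm: "?Z * ?m = 1\<^sub>m d"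
    using mat_adjoint_mult[OF c(1) Z(1)] by (simp add: Z(2) adj mat_adjoint_one)
  have "mat_adjoint (?m * Z) * (?m * Z) = ?Z * ?p * (?m * Z)"
    by (simp add: mat_adjoint_mult[OF c(2) Z(1)] adj)
  also have "\<dots> = ?Z * (?p * ?m) * Z"
    using c Z by (simp add: assoc_mult_mat[of _ d d _ d _ d])
  also have "\<dots> = (?Z * ?m) * (?p * Z)"
    unfolding minus_plus_one_commute[OF H] using c Z by (simp add: assoc_mult_mat[of _ d d _ d _ d])
  also have "\<dots> = 1\<^sub>m d" by (simp add: Zm Z)
  finally have *: "mat_adjoint (?m * Z) * (?m * Z) = 1\<^sub>m d" .
  have cZ: "?m * Z \<in> carrier_mat d d" using c Z by simp
  show ?thesis
    unfolding unitary_group_def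
    using * cZ mat_mult_left_right_inverse[OF mat_adjoint_carrier[OF cZ] cZ *] by simp
qed

section \<open>Averages over the unitary group\<close>

lemma det_smult_mat:
  assumes "A \<in> carrier_mat d d"
  shows "det (a \<cdot>\<^sub>m A) = a ^ d * det (A :: complex mat)"
  using assms by (simp add: det_smult)

lemma smult_smult_mat: "a \<cdot>\<^sub>m (b \<cdot>\<^sub>m A) = (a * b :: complex) \<cdot>\<^sub>m A"
  by (intro eq_matI) auto

lemma one_smult_mat: "1 \<cdot>\<^sub>m A = (A :: complex mat)"
  by (intro eq_matI) auto

lemma adj_mat_inverse:
  assumes A: "A \<in> carrier_mat d d" and W: "W \<in> carrier_mat d d" "A * W = 1\<^sub>m d"
  shows "adj_mat A = det A \<cdot>\<^sub>m (W :: complex mat)"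
proof -
  note a = adj_mat[OF A]
  have "adj_mat A = adj_mat A * (A * W)" using a(1) W(2) by simp
  also have "\<dots> = (adj_mat A * A) * W" using A W a(1) by (simp add: assoc_mult_mat[of _ d d _ d _ d])
  also have "\<dots> = det A \<cdot>\<^sub>m W" unfolding a(3) mult_smult_assoc_mat[OF one_carrier_mat W(1)] left_mult_one_mat[OF W(1)] by (rule refl)
  finally show ?thesis .
qed

context haar
begin

text \<open>The scalar c homogenises the determinants: multiplying X and 1 by a common denominator c
  only produces a power of c (\<open>avg_scale\<close>), so that rational substitutions for X become
  polynomial.\<close>

definition avg :: "nat \<Rightarrow> nat \<Rightarrow> (nat \<Rightarrow> complex mat) \<Rightarrow> complex \<Rightarrow> complex mat \<Rightarrow> complex" where
  "avg m k Q c X = (\<integral>V. (\<Prod>a<m. det (c \<cdot>\<^sub>m 1\<^sub>m d + Q a * (X * V))) * cnj (det V ^ k) \<partial>\<mu>)"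

lemma mult_entry_eq:
  assumes "Q \<in> carrier_mat d d" "Y \<in> carrier_mat d d" "i < d" "j < d"
  shows "(c \<cdot>\<^sub>m 1\<^sub>m d + Q * Y) $$ (i, j) = c * of_bool (i = j) + (\<Sum>l\<in>{0..<d}. Q $$ (i, l) * (Y $$ (l, j) :: complex))"
  using assms by (simp add: scalar_prod_def)

lemma bm_mult_left:
  assumes "X \<in> carrier_mat d d" "i < d" "j < d" "\<And>V. V \<in> unitary_group d \<Longrightarrow> F V \<in> carrier_mat d d"
    "\<And>i j. i < d \<Longrightarrow> j < d \<Longrightarrow> bm (\<lambda>V. F V $$ (i, j))"
  shows "bm (\<lambda>V. (X * F V) $$ (i, j))"
proof (rule bm_cong)
  show "bm (\<lambda>V. \<Sum>l\<in>{0..<d}. X $$ (i, l) * F V $$ (l, j))"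
    using assms by (intro bm_sum bm_mult bm_const) simp_all
  show "(\<Sum>l\<in>{0..<d}. X $$ (i, l) * F V $$ (l, j)) = (X * F V) $$ (i, j)" if "V \<in> unitary_group d" for V
    using assms(1-3) assms(4)[OF that] by (simp add: scalar_prod_def)
qed

lemma bm_det_power: "bm (\<lambda>V. cnj (det V ^ k))"
  by (intro bm_cnj bm_power bm_det) (auto intro: bm_entry dest: unitaryD(1))

lemma bm_avg:
  fixes m :: nat
  assumes "X \<in> carrier_mat d d" and Q: "\<And>a. Q a \<in> carrier_mat d d"
  shows "bm (\<lambda>V. (\<Prod>a<m. det (c \<cdot>\<^sub>m 1\<^sub>m d + Q a * (X * V))) * cnj (det V ^ k))"
proof -
  have c: "Q a * (X * V) \<in> carrier_mat d d" if "V \<in> unitary_group d" for a V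
    by (rule mult_carrier_mat[OF Q mult_carrier_mat[OF assms(1) unitaryD(1)[OF that]]])
  have XV: "bm (\<lambda>V. (X * V) $$ (i, j))" if "i < d" "j < d" for i j
    by (rule bm_mult_left[OF assms(1) that unitaryD(1) bm_entry])
  have QXV: "bm (\<lambda>V. (Q a * (X * V)) $$ (i, j))" if "i < d" "j < d" for a i j
    by (rule bm_mult_left[OF Q that mult_carrier_mat[OF assms(1) unitaryD(1)] XV])
  have "bm (\<lambda>V. (c \<cdot>\<^sub>m 1\<^sub>m d + Q a * (X * V)) $$ (i, j))" if ij: "i < d" "j < d" for a i j
  proof (rule bm_cong)
    show "bm (\<lambda>V. c * of_bool (i = j) + (Q a * (X * V)) $$ (i, j))"
      by (intro bm_add bm_const QXV ij)
    fix V assume "V \<in> unitary_group d"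
    from c[OF this, of a]
    show "c * of_bool (i = j) + (Q a * (X * V)) $$ (i, j) = (c \<cdot>\<^sub>m 1\<^sub>m d + Q a * (X * V)) $$ (i, j)"
      using ij by (auto simp del: index_mult_mat)
  qed
  then have *: "bm (\<lambda>V. det (c \<cdot>\<^sub>m 1\<^sub>m d + Q a * (X * V)))" for a
    using c by (intro bm_det[where n = d]) simp_all
  show ?thesis
    by (intro bm_mult bm_prod bm_det_power finite_lessThan *)
qed

lemma polyfun_avg:
  assumes X: "\<And>t. X t \<in> carrier_mat d d" "\<And>i j. i < d \<Longrightarrow> j < d \<Longrightarrow> polyfun n (\<lambda>t. X t $$ (i, j))"
    and c: "polyfun n c" and Q: "\<And>a. Q a \<in> carrier_mat d d"
  shows "polyfun (m * (d * n)) (\<lambda>t. avg m k Q (c t) (X t))"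
  unfolding avg_def
proof (rule polyfun_integral)
  show "integrable \<mu> (\<lambda>V. (\<Prod>a<m. det (c t \<cdot>\<^sub>m 1\<^sub>m d + Q a * (X t * V))) * cnj (det V ^ k))" for t
    by (intro bm_integrable bm_avg X Q)
next
  fix V assume "V \<in> space \<mu>"
  then have V: "V \<in> carrier_mat d d" using unitaryD(1) by simp
  have "polyfun (m * (d * n)) (\<lambda>t. \<Prod>a<m. det (c t \<cdot>\<^sub>m 1\<^sub>m d + Q a * (X t * V)))"
  proof (rule polyfun_prod[of "{..<m}" "d * n", simplified])
    fix a assume a: "a < m"
    show "polyfun (d * n) (\<lambda>t. det (c t \<cdot>\<^sub>m 1\<^sub>m d + Q a * (X t * V)))"
    proof (rule polyfun_det)
      show "c t \<cdot>\<^sub>m 1\<^sub>m d + Q a * (X t * V) \<in> carrier_mat d d" for t using X(1)[of t] V Q[of a] by simp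
      fix i j assume ij: "i < d" "j < d"
      have XV: "polyfun n (\<lambda>t. (X t * V) $$ (l, j))" if "l < d" for l
        using polyfun_mat_mult[of X d "\<lambda>_. V" n 0 l j] X V that ij by (simp add: polyfun_const)
      have eq: "(c t \<cdot>\<^sub>m 1\<^sub>m d + Q a * (X t * V)) $$ (i, j)
        = of_bool (i = j) * c t + (\<Sum>l\<in>{0..<d}. Q a $$ (i, l) * (X t * V) $$ (l, j))" for t
        using mult_entry_eq[OF Q[of a] mult_carrier_mat[OF X(1)[of t] V] ij, of "c t"] by simp
      show "polyfun n (\<lambda>t. (c t \<cdot>\<^sub>m 1\<^sub>m d + Q a * (X t * V)) $$ (i, j))"
        unfolding eq by (intro polyfun_add polyfun_sum polyfun_cmult c XV) simp_all
    qed
  qed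
  from polyfun_cmult[OF this, of "cnj (det V ^ k)"]
  show "polyfun (m * (d * n)) (\<lambda>t. (\<Prod>a<m. det (c t \<cdot>\<^sub>m 1\<^sub>m d + Q a * (X t * V))) * cnj (det V ^ k))"
    by (simp only: mult.commute)
qed

lemma avg_scale:
  assumes X: "X \<in> carrier_mat d d" and Q: "\<And>a. Q a \<in> carrier_mat d d"
  shows "avg m k Q c (c \<cdot>\<^sub>m X) = c ^ (d * m) * avg m k Q 1 X"
proof -
  have "avg m k Q c (c \<cdot>\<^sub>m X)
    = (\<integral>V. c ^ (d * m) * ((\<Prod>a<m. det (1 \<cdot>\<^sub>m 1\<^sub>m d + Q a * (X * V))) * cnj (det V ^ k)) \<partial>\<mu>)"
    unfolding avg_def
  proof (rule Bochner_Integration.integral_cong[OF refl])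
    fix V assume "V \<in> space \<mu>"
    then have V: "V \<in> carrier_mat d d" using unitaryD(1) by simp
    have "det (c \<cdot>\<^sub>m 1\<^sub>m d + Q a * (c \<cdot>\<^sub>m X * V)) = c ^ d * det (1 \<cdot>\<^sub>m 1\<^sub>m d + Q a * (X * V))" if "a < m" for a
    proof -
      have "c \<cdot>\<^sub>m 1\<^sub>m d + Q a * (c \<cdot>\<^sub>m X * V) = c \<cdot>\<^sub>m (1 \<cdot>\<^sub>m 1\<^sub>m d + Q a * (X * V))"
        using X V Q[of a]
        by (simp add: mult_smult_assoc_mat[of _ d d _ d] mult_smult_distrib[of _ d d _ d] add_smult_distrib_left_mat[of _ d d] one_smult_mat)
      then show ?thesis using X V Q[of a] by (simp only: det_smult_mat add_carrier_mat mult_carrier_mat)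
    qed
    then have "(\<Prod>a<m. det (c \<cdot>\<^sub>m 1\<^sub>m d + Q a * (c \<cdot>\<^sub>m X * V))) = (\<Prod>a<m. c ^ d * det (1 \<cdot>\<^sub>m 1\<^sub>m d + Q a * (X * V)))"
      by (intro prod.cong refl) simp
    then show "(\<Prod>a<m. det (c \<cdot>\<^sub>m 1\<^sub>m d + Q a * (c \<cdot>\<^sub>m X * V))) * cnj (det V ^ k)
      = c ^ (d * m) * ((\<Prod>a<m. det (1 \<cdot>\<^sub>m 1\<^sub>m d + Q a * (X * V))) * cnj (det V ^ k))"
      by (simp add: prod.distrib power_mult)
  qed
  then show ?thesis by (simp add: avg_def)
qed

text \<open>Invariance allows V to be replaced by W V, and cnj (det V) ^ k = det W ^ k * cnj (det (W
  V)) ^ k because det W has modulus 1.\<close>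

lemma avg_unitary:
  assumes W: "W \<in> unitary_group d" and Q: "\<And>a. Q a \<in> carrier_mat d d"
  shows "avg m k Q c W = det W ^ k * avg m k Q c (1\<^sub>m d)"
proof -
  let ?f = "\<lambda>V. (\<Prod>a<m. det (c \<cdot>\<^sub>m 1\<^sub>m d + Q a * (1\<^sub>m d * V))) * cnj (det V ^ k)"
  have "avg m k Q c W = (\<integral>V. det W ^ k * ?f (W * V) \<partial>\<mu>)"
    unfolding avg_def
  proof (rule Bochner_Integration.integral_cong[OF refl])
    fix V assume "V \<in> space \<mu>"
    then have V: "V \<in> carrier_mat d d" using unitaryD(1) by simp
    note Wc = unitaryD(1)[OF W]
    have "det W ^ k * cnj (det (W * V) ^ k) = (det W * cnj (det W)) ^ k * cnj (det V ^ k)"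
      by (simp add: det_mult[OF Wc V] power_mult_distrib)
    then have *: "det W ^ k * cnj (det (W * V) ^ k) = cnj (det V ^ k)"
      by (simp add: unitary_det(1)[OF W])
    show "(\<Prod>a<m. det (c \<cdot>\<^sub>m 1\<^sub>m d + Q a * (W * V))) * cnj (det V ^ k) = det W ^ k * ?f (W * V)"
      unfolding left_mult_one_mat[OF mult_carrier_mat[OF Wc V]] by (simp only: mult.left_commute[of "det W ^ k"] *)
  qed
  also have "\<dots> = det W ^ k * (\<integral>V. ?f (W * V) \<partial>\<mu>)" by simp
  also have "(\<integral>V. ?f (W * V) \<partial>\<mu>) = (\<integral>V. ?f V \<partial>\<mu>)"
    by (rule integral_left_mult[OF W]) (intro bm_avg Q one_carrier_mat)
  finally show ?thesis by (simp add: avg_def)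
qed

text \<open>Left invariance gives the identity for unitary \<open>X\<close> only. The Cayley transform of the line of
  skew-Hermitian matrices \<open>H t\<close> (\<open>t\<close> real) is unitary, and both sides are, up to denominators, polynomial
  in \<open>t\<close>; at \<open>t = \<i>\<close> the line reaches an arbitrary matrix.\<close>

lemma avg_cayley:
  assumes M: "M \<in> carrier_mat d d" and W: "W \<in> carrier_mat d d" "(1\<^sub>m d + M) * W = 1\<^sub>m d"
    and Q: "\<And>a. Q a \<in> carrier_mat d d"
  shows "avg m k Q 1 ((1\<^sub>m d - M) * W) = det ((1\<^sub>m d - M) * W) ^ k * avg m k Q 1 (1\<^sub>m d)"
proof -
  \<comment> \<open>The skew-Hermitian part of M plus t / \<i> times its Hermitian part:
    skew-Hermitian for real t, and equal to M at t = \<i>.\<close>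
  define H where "H = (\<lambda>t. mat d d (\<lambda>(i, j). (M $$ (i, j) - cnj (M $$ (j, i))) / 2
    + (M $$ (i, j) + cnj (M $$ (j, i))) / (2 * \<i>) * t))"
  define D where "D = (\<lambda>t. det (1\<^sub>m d + H t))"
  \<comment> \<open>\<open>N t\<close> is \<open>D t\<close> times the Cayley transform of
    \<open>H t\<close> wherever \<open>D t\<close> is nonzero; both are polynomial in t.\<close>
  define N where "N = (\<lambda>t. (1\<^sub>m d - H t) * adj_mat (1\<^sub>m d + H t))"
  let ?q = "avg m k Q 1 (1\<^sub>m d)"
  have Hc: "H t \<in> carrier_mat d d" for t by (simp add: H_def)
  have Hi: "H \<i> = M" using M by (intro eq_matI) (auto simp: H_def field_simps)
  have pm: "1\<^sub>m d + H t \<in> carrier_mat d d" "1\<^sub>m d - H t \<in> carrier_mat d d"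
    "adj_mat (1\<^sub>m d + H t) \<in> carrier_mat d d" "N t \<in> carrier_mat d d" for t
    using Hc[of t] adj_mat(1)[of "1\<^sub>m d + H t" d] by (auto simp: N_def)
  have lin: "polyfun 1 (\<lambda>t. a + b * t)" for a b
    using polyfun_add[OF polyfun_const polyfun_cmult[OF polyfun_ident]] by simp
  have plus: "polyfun 1 (\<lambda>t. (1\<^sub>m d + H t) $$ (i, j))" and minus: "polyfun 1 (\<lambda>t. (1\<^sub>m d - H t) $$ (i, j))"
    if "i < d" "j < d" for i j
  proof -
    let ?a = "(M $$ (i, j) - cnj (M $$ (j, i))) / 2" and ?b = "(M $$ (i, j) + cnj (M $$ (j, i))) / (2 * \<i>)"
    have "(1\<^sub>m d + H t) $$ (i, j) = (of_bool (i = j) + ?a) + ?b * t"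
      "(1\<^sub>m d - H t) $$ (i, j) = (of_bool (i = j) - ?a) + (- ?b) * t" for t
      using that by (simp_all add: H_def)
    then show "polyfun 1 (\<lambda>t. (1\<^sub>m d + H t) $$ (i, j))" "polyfun 1 (\<lambda>t. (1\<^sub>m d - H t) $$ (i, j))"
      by (simp_all only: lin)
  qed
  have pD: "polyfun (d * 1) D" unfolding D_def by (rule polyfun_det[OF pm(1) plus])
  have pN: "polyfun (1 + d * 1) (\<lambda>t. N t $$ (i, j))" if "i < d" "j < d" for i j
    unfolding N_def
    by (rule polyfun_mat_mult[OF pm(2) pm(3) minus polyfun_adj_mat[OF pm(1) plus] that])
  have pdN: "polyfun (d * (1 + d * 1)) (\<lambda>t. det (N t))" by (rule polyfun_det[OF pm(4) pN])
  have pavg: "polyfun (m * (d * (1 + d * 1))) (\<lambda>t. avg m k Q (D t) (N t))"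
    by (rule polyfun_avg[OF pm(4) pN polyfun_mono[OF pD] Q]) simp_all
  have split: "N t = D t \<cdot>\<^sub>m ((1\<^sub>m d - H t) * Z)" if "Z \<in> carrier_mat d d" "(1\<^sub>m d + H t) * Z = 1\<^sub>m d" for t Z
    using adj_mat_inverse[OF pm(1) that] pm(2) that(1)
    by (simp add: N_def D_def mult_smult_distrib[of _ d d _ d])
  \<comment> \<open>The powers of \<open>D t\<close> clear the denominators. Left invariance gives
    the identity for all real t, hence it holds for all t.\<close>
  have "(\<lambda>t. avg m k Q (D t) (N t) * D t ^ (d * k)) t = (\<lambda>t. D t ^ (d * m) * (det (N t) ^ k * ?q)) t" for t
  proof (rule polyfun_eqI[OF polyfun_mult[OF pavg polyfun_power[OF pD]]
        polyfun_mult[OF polyfun_power[OF pD] polyfun_mult[OF polyfun_power[OF pdN] polyfun_const[of 0]]]])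
    have "avg m k Q (D t) (N t) * D t ^ (d * k) = D t ^ (d * m) * (det (N t) ^ k * ?q)" if "t \<in> \<real>" for t
    proof -
      have skew: "cnj (H t $$ (j, i)) = - H t $$ (i, j)" if "i < d" "j < d" for i j
        using that \<open>t \<in> \<real>\<close> Reals_cnj_iff[of t] by (simp add: H_def field_simps)
      have D0: "D t \<noteq> 0" unfolding D_def by (rule det_one_plus_skew_hermitian[OF Hc skew])
      define Z where "Z = (1 / D t) \<cdot>\<^sub>m adj_mat (1\<^sub>m d + H t)"
      have Z: "Z \<in> carrier_mat d d" using pm(3) by (simp add: Z_def)
      have inv: "(1\<^sub>m d + H t) * Z = 1\<^sub>m d"
        unfolding Z_def mult_smult_distrib[OF pm(1) pm(3)] adj_mat(2)[OF pm(1)]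
        using D0 by (simp add: D_def smult_smult_mat one_smult_mat)
      let ?U = "(1\<^sub>m d - H t) * Z"
      have U: "?U \<in> unitary_group d" by (rule cayley_unitary[OF Hc skew Z inv])
      have Uc: "?U \<in> carrier_mat d d" by (rule unitaryD(1)[OF U])
      have 1: "avg m k Q (D t) (N t) = D t ^ (d * m) * (det ?U ^ k * ?q)"
        unfolding split[OF Z inv] avg_scale[OF Uc Q] avg_unitary[OF U Q] by (rule refl)
      have 2: "det (N t) ^ k = D t ^ (d * k) * det ?U ^ k"
        unfolding split[OF Z inv] det_smult_mat[OF Uc] by (simp add: power_mult_distrib power_mult)
      show ?thesis unfolding 1 2 by (simp only: mult_ac)
    qed
    then have "\<real> \<subseteq> {t. avg m k Q (D t) (N t) * D t ^ (d * k) = D t ^ (d * m) * (det (N t) ^ k * ?q)}"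
      by blast
    then show "infinite {t. avg m k Q (D t) (N t) * D t ^ (d * k) = D t ^ (d * m) * (det (N t) ^ k * ?q)}"
      using infinite_reals finite_subset by blast
  qed
  then have *: "avg m k Q (D \<i>) (N \<i>) * D \<i> ^ (d * k) = D \<i> ^ (d * m) * (det (N \<i>) ^ k * ?q)" .
  have W': "(1\<^sub>m d + H \<i>) * W = 1\<^sub>m d" using W by (simp add: Hi)
  have "D \<i> * det W = 1" using det_mult[OF pm(1)[of \<i>] W(1)] by (simp add: D_def W')
  then have D0: "D \<i> \<noteq> 0" by auto
  let ?U = "(1\<^sub>m d - H \<i>) * W"
  have Uc: "?U \<in> carrier_mat d d" using pm(2)[of \<i>] W(1) by simp
  have "D \<i> ^ (d * m) * avg m k Q 1 ?U * D \<i> ^ (d * k) = D \<i> ^ (d * m) * (D \<i> ^ (d * k) * det ?U ^ k * ?q)"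
    using * unfolding split[OF W(1) W'] avg_scale[OF Uc Q] det_smult_mat[OF Uc] by (simp add: power_mult_distrib power_mult)
  then have "avg m k Q 1 ?U = det ?U ^ k * ?q" using D0 by simp
  then show ?thesis by (simp add: Hi)
qed

text \<open>Cayley transforms reach every Y for which det (1 + Y) is nonzero. Along the line s Y
  this fails for finitely many s only, and both sides are polynomial in s, so s = 1 is reached in
  any case.\<close>

lemma avg_det:
  assumes Y: "Y \<in> carrier_mat d d" and Q: "\<And>a. Q a \<in> carrier_mat d d"
  shows "avg m k Q 1 Y = det Y ^ k * avg m k Q 1 (1\<^sub>m d)"
proof -
  let ?q = "avg m k Q 1 (1\<^sub>m d)"
  have invertible: "avg m k Q 1 Y = det Y ^ k * ?q"
    if Y: "Y \<in> carrier_mat d d" and D: "det (1\<^sub>m d + Y) \<noteq> 0" for Y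
  proof -
    have c: "1\<^sub>m d + Y \<in> carrier_mat d d" "1\<^sub>m d - Y \<in> carrier_mat d d" using Y by auto
    define R where "R = (1 / det (1\<^sub>m d + Y)) \<cdot>\<^sub>m adj_mat (1\<^sub>m d + Y)"
    note adj = adj_mat[OF c(1)]
    have R: "R \<in> carrier_mat d d" using adj(1) by (simp add: R_def)
    have inv: "(1\<^sub>m d + Y) * R = 1\<^sub>m d" "R * (1\<^sub>m d + Y) = 1\<^sub>m d"
      unfolding R_def mult_smult_distrib[OF c(1) adj(1)] mult_smult_assoc_mat[OF adj(1) c(1)] adj(2,3)
      using D by (simp_all add: smult_smult_mat one_smult_mat)
    define M where "M = (1\<^sub>m d - Y) * R"
    have M: "M \<in> carrier_mat d d" using R c by (simp add: M_def)
    have MY: "M * (1\<^sub>m d + Y) = 1\<^sub>m d - Y"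
      using c R inv(2) by (simp add: M_def assoc_mult_mat[of _ d d _ d _ d] right_mult_one_mat[of _ d d])
    \<comment> \<open>The Cayley transform is an involution: M is the transform of Y, so 1 + M = 2
      R, whose inverse is half of 1 + Y.\<close>
    define W where "W = (1 / 2 :: complex) \<cdot>\<^sub>m (1\<^sub>m d + Y)"
    have W: "W \<in> carrier_mat d d" using c by (simp add: W_def)
    have "(1\<^sub>m d + M) * W = (1 / 2) \<cdot>\<^sub>m ((1\<^sub>m d + Y) + (1\<^sub>m d - Y))"
      unfolding W_def using M c MY
      by (simp add: mult_smult_distrib[of _ d d _ d] add_mult_distrib_mat[of _ d d _ _ d] left_mult_one_mat[of _ d d])
    also have "\<dots> = 1\<^sub>m d" using Y by (intro eq_matI) auto
    finally have W1: "(1\<^sub>m d + M) * W = 1\<^sub>m d" .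
    have "(1\<^sub>m d - M) * W = (1 / 2) \<cdot>\<^sub>m ((1\<^sub>m d + Y) - (1\<^sub>m d - Y))"
      unfolding W_def mult_smult_distrib[OF minus_carrier_mat[OF M] c(1)] minus_mult_distrib_mat[OF one_carrier_mat M c(1)] MY left_mult_one_mat[OF c(1)] by (rule refl)
    also have "\<dots> = Y" using Y by (intro eq_matI) auto
    finally have W2: "(1\<^sub>m d - M) * W = Y" .
    show ?thesis using avg_cayley[OF M W W1 Q] by (simp only: W2)
  qed
  have sY: "s \<cdot>\<^sub>m Y \<in> carrier_mat d d" "1\<^sub>m d + s \<cdot>\<^sub>m Y \<in> carrier_mat d d" for s using Y by auto
  have lin: "polyfun 1 (\<lambda>t. a + b * t)" for a b
    using polyfun_add[OF polyfun_const polyfun_cmult[OF polyfun_ident]] by simp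
  have p1: "polyfun 1 (\<lambda>s. (s \<cdot>\<^sub>m Y) $$ (i, j))" and p2: "polyfun 1 (\<lambda>s. (1\<^sub>m d + s \<cdot>\<^sub>m Y) $$ (i, j))"
    if "i < d" "j < d" for i j
  proof -
    have "(s \<cdot>\<^sub>m Y) $$ (i, j) = 0 + Y $$ (i, j) * s"
      "(1\<^sub>m d + s \<cdot>\<^sub>m Y) $$ (i, j) = of_bool (i = j) + Y $$ (i, j) * s" for s
      using that Y by simp_all
    then show "polyfun 1 (\<lambda>s. (s \<cdot>\<^sub>m Y) $$ (i, j))" "polyfun 1 (\<lambda>s. (1\<^sub>m d + s \<cdot>\<^sub>m Y) $$ (i, j))"
      by (simp_all only: lin)
  qed
  obtain P where P: "\<And>s. det (1\<^sub>m d + s \<cdot>\<^sub>m Y) = poly P s"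
    using polyfun_det[of "\<lambda>s. 1\<^sub>m d + s \<cdot>\<^sub>m Y" d 1, OF sY(2) p2] by (auto simp: polyfun_def)
  have "0 \<cdot>\<^sub>m Y = 0\<^sub>m d d" using Y by (intro eq_matI) auto
  then have "poly P 0 = 1" using P[of 0] by simp
  then have "P \<noteq> 0" by auto
  then have "infinite (- {s. poly P s = 0})"
    using poly_roots_finite[of P] infinite_UNIV_char_0[where 'a = complex] by (simp add: Compl_eq_Diff_UNIV)
  moreover have "- {s. poly P s = 0} \<subseteq> {s. avg m k Q 1 (s \<cdot>\<^sub>m Y) = det (s \<cdot>\<^sub>m Y) ^ k * ?q}"
    using invertible[OF sY(1)] P by auto
  ultimately have inf: "infinite {s. avg m k Q 1 (s \<cdot>\<^sub>m Y) = det (s \<cdot>\<^sub>m Y) ^ k * ?q}"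
    using finite_subset by blast
  have "avg m k Q 1 (1 \<cdot>\<^sub>m Y) = det (1 \<cdot>\<^sub>m Y) ^ k * ?q"
    by (rule polyfun_eqI[OF polyfun_avg[OF sY(1) p1 polyfun_const Q]
          polyfun_mult[OF polyfun_power[OF polyfun_det[OF sY(1) p1]] polyfun_const[of 0]] inf])
  moreover have "1 \<cdot>\<^sub>m Y = Y" using Y by (intro eq_matI) auto
  ultimately show ?thesis by simp
qed

end

section \<open>Duality between Haar and Gaussian averages\<close>

lemmas square_mat = mult_carrier_mat[of _ n n _ n] right_mult_one_mat[of _ n n] left_mult_one_mat[of _ n n]
  mat_adjoint_carrier[of _ n n] for n

lemma det_one_plus_conj:
  assumes S: "S \<in> carrier_mat d d" "S' \<in> carrier_mat d d" "S * S' = 1\<^sub>m d" and X: "X \<in> carrier_mat d d"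
  shows "det (1\<^sub>m d + S * X * S') = det (1\<^sub>m d + X :: complex mat)"
proof -
  have c: "S * X \<in> carrier_mat d d" "1\<^sub>m d + X \<in> carrier_mat d d" using S X by auto
  have "S * (1\<^sub>m d + X) * S' = 1\<^sub>m d + S * X * S'"
    using S X c by (simp add: mult_add_distrib_mat[of _ d d _ d] add_mult_distrib_mat[of _ d d _ _ d])
  then have "det (1\<^sub>m d + S * X * S') = det S * det (1\<^sub>m d + X) * det S'"
    using S c by (simp add: det_mult[of _ d, symmetric])
  moreover have "det S * det S' = 1"
    using det_mult[OF S(1,2)] S(3) by simp
  ultimately show ?thesis by (simp add: mult.commute mult.left_commute)
qed

lemma prod_if_less_double: "(\<Prod>a<2 * k. if a < k then x else y) = x ^ k * (y :: complex) ^ k"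
proof -
  have "{..<2 * k} \<inter> {a. a < k} = {..<k}" "{..<2 * k} \<inter> - {a. a < k} = {k..<2 * k}" by auto
  then show ?thesis by (subst prod.If_cases) simp_all
qed

text \<open>Coefficients of entry (i, j) of P G Q as a linear form in the entries of G. By
  \<open>gram_form\<close> the covariance of two such entries factors into a row part and a column
  part.\<close>

definition form :: "complex mat \<Rightarrow> complex mat \<Rightarrow> nat \<Rightarrow> nat \<Rightarrow> nat \<times> nat \<Rightarrow> complex" where
  "form P Q i j = (\<lambda>v. P $$ (i, fst v) * Q $$ (snd v, j))"

lemma lin_form:
  assumes W: "wick (grid d d) K H" and P: "P \<in> carrier_mat d d" and Q: "Q \<in> carrier_mat d d"
  shows "mat d d (\<lambda>(i, j). wick.lin (grid d d) (form P Q i j) z) = P * mat d d z * Q"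
proof (rule eq_matI)
  fix i j assume "i < dim_row (P * mat d d z * Q)" "j < dim_col (P * mat d d z * Q)"
  then have ij: "i < d" "j < d" using P Q by auto
  have "(P * mat d d z * Q) $$ (i, j) = (\<Sum>q<d. (P * mat d d z) $$ (i, q) * Q $$ (q, j))"
    using ij P Q by (simp add: scalar_prod_def atLeast0LessThan)
  also have "\<dots> = (\<Sum>q<d. \<Sum>p<d. P $$ (i, p) * z (p, q) * Q $$ (q, j))"
    using ij P Q by (intro sum.cong refl) (simp add: scalar_prod_def atLeast0LessThan sum_distrib_right)
  also have "\<dots> = (\<Sum>p<d. \<Sum>q<d. P $$ (i, p) * Q $$ (q, j) * z (p, q))"
    by (subst sum.swap) (simp add: mult_ac)
  also have "\<dots> = wick.lin (grid d d) (form P Q i j) z"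
    by (simp add: wick.lin_def[OF W] form_def sum.cartesian_product split_beta)
  finally show "mat d d (\<lambda>(i, j). wick.lin (grid d d) (form P Q i j) z) $$ (i, j) = (P * mat d d z * Q) $$ (i, j)"
    using ij by simp
qed (use P Q in auto)

lemma gram_form:
  assumes W: "wick (grid d d) K H" and P: "P \<in> carrier_mat d d" "P' \<in> carrier_mat d d"
    and Q: "Q \<in> carrier_mat d d" "Q' \<in> carrier_mat d d"
    and ij: "i < d" "j < d" "i' < d" "j' < d"
  shows "wick.gram (grid d d) (form P Q i j) (form P' Q' i' j') = (P * mat_adjoint P') $$ (i, i') * (mat_adjoint Q' * Q) $$ (j', j)"
proof -
  have 1: "(P * mat_adjoint P') $$ (i, i') = (\<Sum>p<d. P $$ (i, p) * cnj (P' $$ (i', p)))"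
    using ij P mat_adjoint_carrier[OF P(2)]
    by (simp add: scalar_prod_def atLeast0LessThan mat_adjoint_index[OF P(2)])
  have 2: "(mat_adjoint Q' * Q) $$ (j', j) = (\<Sum>q<d. cnj (Q' $$ (q, j')) * Q $$ (q, j))"
    using ij Q mat_adjoint_carrier[OF Q(2)]
    by (simp add: scalar_prod_def atLeast0LessThan mat_adjoint_index[OF Q(2)])
  show ?thesis
    unfolding 1 2 by (simp add: wick.gram_def[OF W] form_def sum_product sum.cartesian_product mult_ac split_beta)
qed

text \<open>Averaging the left-hand side of \<open>haar.avg_det\<close> over a Gaussian matrix instead of over \<open>U(d)\<close> gives
  the same answer for every \<open>V\<close>, and the Gaussian average is given by Wick's formula. A finite signed
  sum with the moments of a Gaussian is used, so that no integrability question arises.\<close>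

theorem (in haar) haar_gauss:
  assumes A: "A \<in> carrier_mat d d" "det A \<noteq> 0"
    and S: "S \<in> carrier_mat d d" "S' \<in> carrier_mat d d" "S * S' = 1\<^sub>m d" "S' * S = 1\<^sub>m d"
    and B: "B = S * (A * mat_adjoint A) * S'" "upper_triangular B"
  shows "(\<Sum>\<phi>\<in>grid k d \<rightarrow>\<^sub>E {..<k}. tsum k d \<phi>) *
      (\<integral>V. det (1\<^sub>m d + A * V) ^ k * cnj (det (1\<^sub>m d + A * V) ^ k) \<partial>\<mu>)
    = (\<Sum>\<phi>\<in>grid k d \<rightarrow>\<^sub>E {..<2 * k}. (\<Prod>e\<in>grid k d. if \<phi> e < k then B $$ (snd e, snd e) else 1) * tsum k d \<phi>)"
    (is "?N * ?I = ?Val")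
proof -
  define A' where "A' = mat_adjoint A"
  have A': "A' \<in> carrier_mat d d" "det A' = cnj (det A)"
    using A(1) by (simp_all add: A'_def mat_adjoint_carrier det_mat_adjoint)
  note adj = adj_mat[OF A'(1)]
  define C where "C = (1 / det A') \<cdot>\<^sub>m adj_mat A'"
  have C: "C \<in> carrier_mat d d" using adj(1) by (simp add: C_def)
  have inv: "A' * C = 1\<^sub>m d" "C * A' = 1\<^sub>m d"
    unfolding C_def mult_smult_distrib[OF A'(1) adj(1)] mult_smult_assoc_mat[OF adj(1) A'(1)] adj(2,3)
    using A(2) A'(2) by (simp_all add: smult_smult_mat one_smult_mat)
  \<comment> \<open>The k conjugated determinants will be traded for k further ones in which A is
    replaced by C, the inverse of its adjoint; hence 2k factors.\<close>
  define Q where "Q = (\<lambda>a. if a < k then A else C)"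
  have Q: "Q a \<in> carrier_mat d d" for a using A C by (simp add: Q_def)
  have Bc: "B \<in> carrier_mat d d" using S A A' by (simp add: B(1) A'_def square_mat)
  \<comment> \<open>The covariances to be realised: B for the factors with A, the identity for those
    with C. The extension \<open>R\<close> by 0 is upper triangular for all indices.\<close>
  define RM where "RM = (\<lambda>a. if a < k then B else 1\<^sub>m d)"
  have RM: "RM a \<in> carrier_mat d d" for a using Bc by (simp add: RM_def)
  define R where "R = (\<lambda>a i i'. if i < d \<and> i' < d then RM a $$ (i, i') else 0)"
  note assoc = assoc_mult_mat[of _ d d _ d _ d] square_mat
  obtain I and c :: "(nat \<times> nat \<Rightarrow> nat \<times> nat) \<Rightarrow> complex" and z :: "(nat \<times> nat \<Rightarrow> nat \<times> nat) \<Rightarrow> nat \<times> nat \<Rightarrow> complex"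
    where I: "finite I" and W: "wick (grid d d) (2 * k * d) (\<lambda>F a. (\<Sum>s\<in>I. c s * F (z s)) = a)"
    by (rule finite_wick[OF finite_cartesian_product[OF finite_lessThan finite_lessThan]]) (rule that)
  interpret w: wick "grid d d" "2 * k * d" "\<lambda>F a. (\<Sum>s\<in>I. c s * F (z s)) = a" by (rule W)
  define G where "G = (\<lambda>s. mat d d (z s))"
  have G: "G s \<in> carrier_mat d d" for s by (simp add: G_def)
  have one: "w.lin (form (1\<^sub>m d) (1\<^sub>m d) i j) (z s) = G s $$ (i, j)" if "i < d" "j < d" for i j s
    using arg_cong[OF lin_form[OF W one_carrier_mat one_carrier_mat, of "z s"], of "\<lambda>M. M $$ (i, j)"] that
    by (simp add: G_def)
  have N: "(\<Sum>s\<in>I. c s * (det (G s) ^ k * cnj (det (G s) ^ k))) = ?N"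
  proof -
    have "(\<Sum>s\<in>I. c s * (det (mat d d (\<lambda>(i, j). w.lin (form (1\<^sub>m d) (1\<^sub>m d) i j) (z s))) ^ k *
        cnj (det (mat d d (\<lambda>(i, j). w.lin (form (1\<^sub>m d) (1\<^sub>m d) i j) (z s))) ^ k))) = ?N"
    proof (rule w.det_power_times_conj_det_power)
      fix i j i' j' assume ij: "i < d" "j < d" "i' < d" "j' < d"
      show "w.gram (form (1\<^sub>m d) (1\<^sub>m d) i j) (form (1\<^sub>m d) (1\<^sub>m d) i' j') = of_bool (i = i' \<and> j = j')"
        unfolding gram_form[OF W one_carrier_mat one_carrier_mat one_carrier_mat one_carrier_mat ij]
        using ij by (simp add: mat_adjoint_one)
    qed simp
    then show ?thesis by (simp add: lin_form[OF W one_carrier_mat one_carrier_mat] G_def)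
  qed
  \<comment> \<open>The Gaussian mean for fixed V. In the covariances V enters only through V' * V =
    1, so the value is the same for every V.\<close>
  have Val: "(\<Sum>s\<in>I. c s * (cnj (det A) ^ k * cnj (det (G s) ^ k) *
      ((\<Prod>a<2 * k. det (1 \<cdot>\<^sub>m 1\<^sub>m d + Q a * (G s * V))) * cnj (det V ^ k)))) = ?Val" if V: "V \<in> unitary_group d" for V
  proof -
    note Vu = unitaryD[OF V]
    define V' where "V' = mat_adjoint V"
    have V': "V' \<in> carrier_mat d d" "det V' = cnj (det V)" "V' * V = 1\<^sub>m d" "V * V' = 1\<^sub>m d"
      using Vu by (simp_all add: V'_def mat_adjoint_carrier det_mat_adjoint)
    \<comment> \<open>Chosen so that P a = S * Q a. Then P a * G * (V * S') is conjugate under S to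
      Q a * G * V, while its row covariance with the second matrix is \<open>RM a\<close>.\<close>
    define P where "P = (\<lambda>a. RM a * S * C)"
    have P: "P a \<in> carrier_mat d d" for a using RM S C by (simp add: P_def square_mat)
    have PA: "mat_adjoint (A' * S') \<in> carrier_mat d d" "mat_adjoint (S * V') \<in> carrier_mat d d" "V * S' \<in> carrier_mat d d"
      using A' S V' Vu by (simp_all add: mat_adjoint_carrier square_mat)
    have adjadj: "mat_adjoint (mat_adjoint (A' * S')) = A' * S'" "mat_adjoint (mat_adjoint (S * V')) = S * V'"
      using A' S V' by (simp_all add: mat_adjoint_adjoint[of _ d d] square_mat)
    have i1: "P a * (A' * S') = RM a" for a
    proof -
      have "P a * (A' * S') = RM a * (S * ((C * A') * S'))"
        using RM[of a] S(1,2) C A'(1) by (simp add: P_def assoc)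
      then show ?thesis using RM[of a] S by (simp add: inv square_mat)
    qed
    have i2: "S * V' * (V * S') = 1\<^sub>m d"
    proof -
      have "S * V' * (V * S') = S * ((V' * V) * S')" using S(1,2) V'(1) Vu(1) by (simp add: assoc)
      then show ?thesis using S V' by (simp add: square_mat)
    qed
    have "(\<Sum>s\<in>I. c s * ((\<Prod>a<2 * k. det (1\<^sub>m d + mat d d (\<lambda>(i, j). w.lin (form (P a) (V * S') i j) (z s)))) *
        cnj (det (mat d d (\<lambda>(i, j). w.lin (form (mat_adjoint (A' * S')) (mat_adjoint (S * V')) i j) (z s))) ^ k)))
      = (\<Sum>\<phi>\<in>grid k d \<rightarrow>\<^sub>E {..<2 * k}. (\<Prod>e\<in>grid k d. R (\<phi> e) (snd e) (snd e)) * tsum k d \<phi>)"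
    proof (rule w.dets_times_conj_det_power[where R = R])
      fix a i j i' j' assume "a < 2 * k" and ij: "i < d" "j < d" "i' < d" "j' < d"
      show "w.gram (form (P a) (V * S') i j) (form (mat_adjoint (A' * S')) (mat_adjoint (S * V')) i' j')
        = R a i i' * of_bool (j = j')"
        unfolding gram_form[OF W P PA(1) PA(3) PA(2) ij] adjadj i1 i2
        using ij by (simp add: R_def)
    next
      fix a i i' :: nat assume "i' < i"
      then show "R a i i' = 0" using B(2) Bc by (auto simp: R_def RM_def upper_triangular_def)
    qed simp_all
    also have "\<dots> = ?Val"
    proof (intro sum.cong prod.cong refl arg_cong2[where f = times])
      fix \<phi> :: "nat \<times> nat \<Rightarrow> nat" and e assume "e \<in> grid k d"
      then show "R (\<phi> e) (snd e) (snd e) = (if \<phi> e < k then B $$ (snd e, snd e) else 1)"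
        by (auto simp: R_def RM_def)
    qed
    finally have *: "(\<Sum>s\<in>I. c s * ((\<Prod>a<2 * k. det (1\<^sub>m d + P a * G s * (V * S'))) *
        cnj (det (mat_adjoint (A' * S') * G s * mat_adjoint (S * V')) ^ k))) = ?Val"
      by (simp only: lin_form[OF W P PA(3)] lin_form[OF W PA(1) PA(2)] G_def)
    have d1: "det (1\<^sub>m d + P a * G s * (V * S')) = det (1 \<cdot>\<^sub>m 1\<^sub>m d + Q a * (G s * V))" for a s
    proof -
      have "RM a * S * C = S * Q a"
      proof (cases "a < k")
        case True
        have "B * S * C = S * A * (A' * (S' * S) * C)"
          using S(1,2) A(1) A'(1) C by (simp add: B(1) A'_def[symmetric] assoc)
        also have "\<dots> = S * A" using S A A' C by (simp add: inv square_mat)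
        finally show ?thesis using True by (simp add: RM_def Q_def)
      qed (use S C in \<open>simp_all add: RM_def Q_def square_mat\<close>)
      then have "P a * G s * (V * S') = S * (Q a * (G s * V)) * S'"
        using S(1,2) C Q[of a] G[of s] Vu(1) by (simp add: P_def assoc)
      then show ?thesis using Q[of a] G[of s] Vu
        by (simp add: det_one_plus_conj[OF S(1-3)] one_smult_mat square_mat)
    qed
    have d2: "cnj (det (mat_adjoint (A' * S') * G s * mat_adjoint (S * V'))) = cnj (det A) * cnj (det (G s)) * cnj (det V)" for s
    proof -
      have "det S * det S' = 1" using det_mult[OF S(1,2)] S(3) by simp
      moreover have "det (mat_adjoint (A' * S') * G s * mat_adjoint (S * V'))
          = cnj (det A' * det S') * det (G s) * cnj (det S * det V')"
        using PA G[of s] A' S V' by (simp add: det_mult[of _ d] det_mat_adjoint[of _ d] square_mat)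
      ultimately show ?thesis using A'(2) V'(2) by (simp add: mult_ac)
    qed
    have "(\<Sum>s\<in>I. c s * (cnj (det A) ^ k * cnj (det (G s) ^ k) *
      ((\<Prod>a<2 * k. det (1 \<cdot>\<^sub>m 1\<^sub>m d + Q a * (G s * V))) * cnj (det V ^ k))))
      = (\<Sum>s\<in>I. c s * ((\<Prod>a<2 * k. det (1\<^sub>m d + P a * G s * (V * S'))) *
        cnj (det (mat_adjoint (A' * S') * G s * mat_adjoint (S * V')) ^ k)))"
      by (simp only: d1 complex_cnj_power d2 power_mult_distrib mult_ac)
    then show ?thesis using * by simp
  qed
  define q where "q = avg (2 * k) k Q 1 (1\<^sub>m d)"
  \<comment> \<open>The constant is averaged over V, the finite sum is exchanged with the integral,
    and \<open>avg_det\<close> evaluates the inner average at each fixed \<open>G s\<close>.\<close>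
  have "?Val = (\<integral>V. ?Val \<partial>\<mu>)" using prob_space by simp
  also have "\<dots> = (\<integral>V. (\<Sum>s\<in>I. c s * (cnj (det A) ^ k * cnj (det (G s) ^ k) *
      ((\<Prod>a<2 * k. det (1 \<cdot>\<^sub>m 1\<^sub>m d + Q a * (G s * V))) * cnj (det V ^ k)))) \<partial>\<mu>)"
    using Val by (intro Bochner_Integration.integral_cong refl) simp
  also have "\<dots> = (\<Sum>s\<in>I. c s * (cnj (det A) ^ k * cnj (det (G s) ^ k) * avg (2 * k) k Q 1 (G s)))"
    unfolding avg_def
    by (subst Bochner_Integration.integral_sum)
      (simp_all add: bm_integrable[OF bm_avg[OF G Q]] del: complex_cnj_power)
  also have "\<dots> = (\<Sum>s\<in>I. cnj (det A) ^ k * q * (c s * (det (G s) ^ k * cnj (det (G s) ^ k))))"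
    by (simp only: avg_det[OF G Q] q_def mult_ac)
  also have "\<dots> = cnj (det A) ^ k * q * ?N"
    unfolding sum_distrib_left[symmetric] N by (rule refl)
  also have "cnj (det A) ^ k * q = ?I"
    unfolding q_def avg_def integral_mult_right_zero[symmetric]
  proof (rule Bochner_Integration.integral_cong[OF refl])
    fix V assume "V \<in> space \<mu>"
    then have V: "V \<in> unitary_group d" by simp
    note Vu = unitaryD[OF V]
    define V' where "V' = mat_adjoint V"
    have V': "V' \<in> carrier_mat d d" "det V' = cnj (det V)" "V' * V = 1\<^sub>m d"
      using Vu by (simp_all add: V'_def mat_adjoint_carrier det_mat_adjoint)
    have "mat_adjoint (1\<^sub>m d + A * V) = 1\<^sub>m d + V' * A'"
    proof -
      have AV: "A * V \<in> carrier_mat d d" "1\<^sub>m d + A * V \<in> carrier_mat d d" using A Vu by auto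
      have "mat_adjoint (1\<^sub>m d + A * V) = 1\<^sub>m d + mat_adjoint (A * V)"
        using AV mat_adjoint_carrier[OF AV(1)] mat_adjoint_carrier[OF AV(2)]
        by (intro eq_matI) (auto simp: mat_adjoint_index[OF AV(1)] mat_adjoint_index[OF AV(2)] simp del: index_mult_mat)
      then show ?thesis by (simp add: mat_adjoint_mult[OF A(1) Vu(1)] A'_def V'_def)
    qed
    also have "\<dots> = V' * A' * (1\<^sub>m d + C * V)"
    proof -
      have "V' * A' * (C * V) = V' * ((A' * C) * V)" using V'(1) A'(1) C Vu(1) by (simp add: assoc)
      also have "\<dots> = 1\<^sub>m d" using V' Vu by (simp add: inv square_mat)
      finally have VC: "V' * A' * (C * V) = 1\<^sub>m d" .
      have "V' * A' * (1\<^sub>m d + C * V) = V' * A' + V' * A' * (C * V)"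
        using V' A' C Vu by (simp add: mult_add_distrib_mat[of _ d d _ d] square_mat)
      then show ?thesis unfolding VC using V' A' by (simp add: comm_add_mat[of _ d d] square_mat)
    qed
    finally have "cnj (det (1\<^sub>m d + A * V)) = det (V' * A' * (1\<^sub>m d + C * V))"
      using A Vu by (simp add: det_mat_adjoint[of "1\<^sub>m d + A * V" d, symmetric])
    also have "\<dots> = cnj (det V) * cnj (det A) * det (1\<^sub>m d + C * V)"
      using V' A' C Vu by (simp add: det_mult[of _ d] square_mat)
    finally have cnj: "cnj (det (1\<^sub>m d + A * V)) = cnj (det V) * cnj (det A) * det (1\<^sub>m d + C * V)" .
    have *: "(\<Prod>a<2 * k. det (1 \<cdot>\<^sub>m 1\<^sub>m d + Q a * (1\<^sub>m d * V)))
      = (\<Prod>a<2 * k. if a < k then det (1\<^sub>m d + A * V) else det (1\<^sub>m d + C * V))"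
      using Vu by (intro prod.cong) (simp_all add: Q_def one_smult_mat square_mat)
    show "cnj (det A) ^ k * ((\<Prod>a<2 * k. det (1 \<cdot>\<^sub>m 1\<^sub>m d + Q a * (1\<^sub>m d * V))) * cnj (det V ^ k))
      = det (1\<^sub>m d + A * V) ^ k * cnj (det (1\<^sub>m d + A * V) ^ k)"
      unfolding * prod_if_less_double complex_cnj_power cnj power_mult_distrib by (simp only: mult_ac)
  qed
  finally show ?thesis by (simp add: mult.commute)
qed

section \<open>Eigenvalues and the inequality of arithmetic and geometric means\<close>

definition mtrace :: "nat \<Rightarrow> complex mat \<Rightarrow> complex" where
  "mtrace n A = (\<Sum>i<n. A $$ (i, i))"

lemma mtrace_mult_eq:
  assumes "A \<in> carrier_mat n m" "B \<in> carrier_mat m n"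
  shows "mtrace n (A * B) = (\<Sum>i<n. \<Sum>j<m. A $$ (i, j) * B $$ (j, i))"
  using assms by (simp add: mtrace_def scalar_prod_def atLeast0LessThan)

lemma mtrace_comm:
  assumes "A \<in> carrier_mat n m" "B \<in> carrier_mat m n"
  shows "mtrace n (A * B) = mtrace m (B * A)"
  unfolding mtrace_mult_eq[OF assms] mtrace_mult_eq[OF assms(2,1)] by (subst sum.swap) (simp add: mult.commute)

lemma schur_form:
  fixes A :: "complex mat"
  assumes A: "A \<in> carrier_mat n n"
  obtains P Q B where "P \<in> carrier_mat n n" "Q \<in> carrier_mat n n" "B \<in> carrier_mat n n"
    "P * Q = 1\<^sub>m n" "Q * P = 1\<^sub>m n" "A = P * B * Q" "upper_triangular B"
    "\<And>i. i < n \<Longrightarrow> eigenvalue A (B $$ (i, i))"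
proof -
  obtain es where es: "char_poly A = (\<Prod>e\<leftarrow>es. [:- e, 1:])"
    using char_poly_factorized[OF A] by auto
  obtain B P Q where sd: "schur_decomposition A es = (B, P, Q)" by (rule prod_cases3)
  from schur_decomposition[OF A es sd]
  have sim: "similar_mat_wit A B P Q" and ut: "upper_triangular B" and diag: "diag_mat B = es" by auto
  note w = similar_mat_witD2[OF A sim]
  have ev: "eigenvalue A (B $$ (i, i))" if "i < n" for i
  proof -
    have "B $$ (i, i) \<in> set es" unfolding diag[symmetric] diag_mat_def using that w(5) by simp
    then have "poly (char_poly A) (B $$ (i, i)) = 0"
      unfolding es poly_prod_list by (simp add: prod_list_zero_iff image_iff)
    then show ?thesis using eigenvalue_root_char_poly[OF A] by simp
  qed
  show ?thesis by (rule that[OF w(6,7,5,1,2,3) ut ev])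
qed

lemma mtrace_schur:
  assumes "P \<in> carrier_mat n n" "Q \<in> carrier_mat n n" "B \<in> carrier_mat n n" "Q * P = 1\<^sub>m n"
  shows "mtrace n (P * B * Q) = mtrace n B"
proof -
  have "mtrace n (P * B * Q) = mtrace n (Q * (P * B))"
    using assms by (intro mtrace_comm[of _ n n]) (simp_all add: square_mat)
  also have "Q * (P * B) = B"
    using assms by (simp add: assoc_mult_mat[of _ n n _ n _ n, symmetric] square_mat)
  finally show ?thesis .
qed

lemma det_one_plus_schur:
  assumes P: "P \<in> carrier_mat n n" "Q \<in> carrier_mat n n" "B \<in> carrier_mat n n" "P * Q = 1\<^sub>m n"
    and B: "upper_triangular B"
  shows "det (1\<^sub>m n + y \<cdot>\<^sub>m (P * B * Q)) = (\<Prod>i<n. 1 + y * B $$ (i, i) :: complex)"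
proof -
  have "y \<cdot>\<^sub>m (P * B * Q) = P * (y \<cdot>\<^sub>m B) * Q"
    using P by (simp add: mult_smult_assoc_mat[of _ n n _ n] mult_smult_distrib[of _ n n _ n] square_mat)
  then have "det (1\<^sub>m n + y \<cdot>\<^sub>m (P * B * Q)) = det (1\<^sub>m n + y \<cdot>\<^sub>m B)"
    using P by (simp add: det_one_plus_conj square_mat)
  also have "\<dots> = prod_list (diag_mat (1\<^sub>m n + y \<cdot>\<^sub>m B))"
  proof (rule det_upper_triangular[where n = n])
    show "upper_triangular (1\<^sub>m n + y \<cdot>\<^sub>m B)"
      using B P(3) by (auto simp: upper_triangular_def)
  qed (use P in simp)
  also have "\<dots> = (\<Prod>i<n. 1 + y * B $$ (i, i))"
    unfolding prod_list_diag_prod using P by (simp add: atLeast0LessThan)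
  finally show ?thesis .
qed

text \<open>For an eigenvector v the eigenvalue is |Z v|^2 / |v|^2.\<close>

lemma eigenvalue_adjoint_mult:
  assumes Z: "Z \<in> carrier_mat n n" and ev: "eigenvalue (mat_adjoint Z * Z) \<mu>"
  obtains m where "0 \<le> m" "\<mu> = complex_of_real m"
proof -
  note Zc = mat_adjoint_carrier[OF Z]
  obtain v where v: "v \<in> carrier_vec n" "v \<noteq> 0\<^sub>v n" "(mat_adjoint Z * Z) *\<^sub>v v = \<mu> \<cdot>\<^sub>v v"
    using ev Zc by (auto simp: eigenvalue_def eigenvector_def)
  define w where "w = Z *\<^sub>v v"
  have w: "w \<in> carrier_vec n" using Z v by (simp add: w_def)
  have wj: "w $ j = (\<Sum>i<n. Z $$ (j, i) * v $ i)" if "j < n" for j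
    using that Z v by (simp add: w_def scalar_prod_def atLeast0LessThan)
  have row: "\<mu> * v $ i = (\<Sum>j<n. cnj (Z $$ (j, i)) * w $ j)" if "i < n" for i
  proof -
    have "mat_adjoint Z *\<^sub>v w = \<mu> \<cdot>\<^sub>v v"
      using v(3) assoc_mult_mat_vec[OF Zc Z v(1)] by (simp add: w_def)
    then have "\<mu> * v $ i = (mat_adjoint Z *\<^sub>v w) $ i" using that v(1) by simp
    then show ?thesis
      using that Zc w by (simp add: scalar_prod_def atLeast0LessThan mat_adjoint_index[OF Z])
  qed
  define s where "s = (\<Sum>i<n. (norm (v $ i))\<^sup>2)"
  have "\<mu> * complex_of_real s = (\<Sum>i<n. cnj (v $ i) * (\<mu> * v $ i))"
    unfolding s_def of_real_sum complex_norm_square sum_distrib_left by (simp add: mult_ac)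
  also have "\<dots> = (\<Sum>i<n. \<Sum>j<n. cnj (Z $$ (j, i) * v $ i) * w $ j)"
    by (intro sum.cong refl) (simp add: row sum_distrib_left mult_ac)
  also have "\<dots> = (\<Sum>j<n. cnj (w $ j) * w $ j)"
    by (subst sum.swap) (simp add: wj cnj_sum sum_distrib_right)
  also have "\<dots> = complex_of_real (\<Sum>j<n. (norm (w $ j))\<^sup>2)"
    unfolding of_real_sum complex_norm_square by (simp add: mult.commute)
  finally have eq: "\<mu> * complex_of_real s = complex_of_real (\<Sum>j<n. (norm (w $ j))\<^sup>2)" .
  have "\<exists>i<n. v $ i \<noteq> 0"
  proof (rule ccontr)
    assume "\<not> (\<exists>i<n. v $ i \<noteq> 0)"
    then have "v = 0\<^sub>v n" using v(1) by (intro eq_vecI) auto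
    then show False using v(2) by simp
  qed
  then obtain i where i: "i < n" "v $ i \<noteq> 0" by auto
  have "0 < s"
    unfolding s_def by (rule sum_pos2[of _ i]) (use i in auto)
  then have "\<mu> = complex_of_real ((\<Sum>j<n. (norm (w $ j))\<^sup>2) / s)"
    using eq by (simp add: field_simps)
  moreover have "0 \<le> (\<Sum>j<n. (norm (w $ j))\<^sup>2) / s" using \<open>0 < s\<close> by (simp add: sum_nonneg)
  ultimately show ?thesis by (rule that[rotated])
qed

definition gram_det :: "nat \<Rightarrow> complex mat \<Rightarrow> complex mat \<Rightarrow> complex \<Rightarrow> complex" where
  "gram_det k T W y = det (y \<cdot>\<^sub>m (mat_adjoint T * T) + mat_adjoint W * W)"

text \<open>Put Z = T R with R the inverse of W. The matrix is then the congruence by W of 1 + y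
  times (adjoint of Z) Z; c is |det W|^2, and the m a are the eigenvalues of that positive
  semidefinite product. Being a product of affine factors, the determinant is log-concave in y \<ge>
  0.\<close>

lemma gram_det_factor:
  assumes T: "T \<in> carrier_mat k k" and W: "W \<in> carrier_mat k k" and D: "det W \<noteq> 0"
  obtains c m where "0 \<le> c" "\<And>a. a < k \<Longrightarrow> 0 \<le> m a"
    "\<And>y. gram_det k T W (complex_of_real y) = complex_of_real (c * (\<Prod>a<k. 1 + y * m a))"
proof -
  note adj = adj_mat[OF W]
  define R where "R = (1 / det W) \<cdot>\<^sub>m adj_mat W"
  have R: "R \<in> carrier_mat k k" using adj(1) by (simp add: R_def)
  have inv: "R * W = 1\<^sub>m k"
    unfolding R_def mult_smult_assoc_mat[OF adj(1) W] adj(3)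
    using D by (simp add: smult_smult_mat one_smult_mat)
  define Z where "Z = T * R"
  have Z: "Z \<in> carrier_mat k k" using T R by (simp add: Z_def)
  have ZW: "Z * W = T"
    using T R W inv by (simp add: Z_def assoc_mult_mat[of _ k k _ k _ k] square_mat)
  let ?Z = "mat_adjoint Z" and ?W = "mat_adjoint W"
  note c = mat_adjoint_carrier[OF Z] mat_adjoint_carrier[OF W]
  have ZZ: "?Z * Z \<in> carrier_mat k k" using c(1) Z by (simp add: square_mat)
  obtain P Q B where S: "P \<in> carrier_mat k k" "Q \<in> carrier_mat k k" "B \<in> carrier_mat k k"
    "P * Q = 1\<^sub>m k" "Q * P = 1\<^sub>m k" "?Z * Z = P * B * Q" "upper_triangular B"
    and ev: "\<And>i. i < k \<Longrightarrow> eigenvalue (?Z * Z) (B $$ (i, i))"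
    by (rule schur_form[OF ZZ]) (rule that)
  define m where "m = (\<lambda>i. Re (B $$ (i, i)))"
  have m: "0 \<le> m i" "B $$ (i, i) = complex_of_real (m i)" if i: "i < k" for i
  proof -
    obtain e where "0 \<le> e" "B $$ (i, i) = complex_of_real e"
      by (rule eigenvalue_adjoint_mult[OF Z ev[OF i]]) (rule that)
    then show "0 \<le> m i" "B $$ (i, i) = complex_of_real (m i)" by (simp_all add: m_def)
  qed
  have "gram_det k T W (complex_of_real y) = complex_of_real ((norm (det W))\<^sup>2 * (\<Prod>a<k. 1 + y * m a))" for y
  proof -
    let ?y = "complex_of_real y"
    have 1: "1\<^sub>m k + ?y \<cdot>\<^sub>m (?Z * Z) \<in> carrier_mat k k" using ZZ by simp
    have "mat_adjoint T * T = ?W * ?Z * (Z * W)"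
      unfolding ZW[symmetric] mat_adjoint_mult[OF Z W] by (rule refl)
    also have "\<dots> = ?W * (?Z * Z) * W"
      using c Z W by (simp add: assoc_mult_mat[of _ k k _ k _ k] square_mat)
    finally have TT: "mat_adjoint T * T = ?W * (?Z * Z) * W" .
    have "?W * (1\<^sub>m k + ?y \<cdot>\<^sub>m (?Z * Z)) * W = ?W * W + ?y \<cdot>\<^sub>m (?W * (?Z * Z) * W)"
      using c W ZZ
      by (simp add: mult_add_distrib_mat[of _ k k _ k] add_mult_distrib_mat[of _ k k _ _ k]
          mult_smult_assoc_mat[of _ k k _ k] mult_smult_distrib[of _ k k _ k] square_mat)
    also have "\<dots> = ?y \<cdot>\<^sub>m (?W * (?Z * Z) * W) + ?W * W"
      by (rule comm_add_mat[of _ k k]) (use c W ZZ in \<open>simp_all add: square_mat\<close>)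
    finally have "gram_det k T W ?y = det (?W * (1\<^sub>m k + ?y \<cdot>\<^sub>m (?Z * Z)) * W)"
      by (simp add: gram_det_def TT)
    also have "\<dots> = det W * cnj (det W) * det (1\<^sub>m k + ?y \<cdot>\<^sub>m (?Z * Z))"
      using c W 1 by (simp add: det_mult[of _ k] det_mat_adjoint[OF W] square_mat)
    also have "det (1\<^sub>m k + ?y \<cdot>\<^sub>m (?Z * Z)) = (\<Prod>i<k. 1 + ?y * B $$ (i, i))"
      unfolding S(6) by (rule det_one_plus_schur[OF S(1-4,7)])
    also have "\<dots> = complex_of_real (\<Prod>a<k. 1 + y * m a)"
      unfolding of_real_prod by (intro prod.cong refl) (simp add: m)
    finally show ?thesis by (simp only: complex_norm_square of_real_mult)
  qed
  note f = this
  show ?thesis by (rule that[OF zero_le_power2]) (erule m(1), rule f)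
qed

section \<open>Replacing the eigenvalues by their mean\<close>

lemma powr_inverse_power:
  assumes "0 \<le> x" "0 < d"
  shows "(x powr (1 / real d)) ^ d = x"
proof (cases "x = 0")
  case False
  then have "(x powr (1 / real d)) ^ d = (x powr (1 / real d)) powr real d"
    by (intro powr_realpow[symmetric]) simp
  then show ?thesis using assms False by (simp add: powr_powr)
qed (use assms in simp)

lemma prod_le_power_mean:
  fixes f :: "nat \<Rightarrow> real"
  assumes "\<And>i. i < d \<Longrightarrow> 0 \<le> f i" "0 < d"
  shows "(\<Prod>i<d. f i) \<le> ((\<Sum>i<d. f i) / d) ^ d"
proof -
  have "(\<Prod>i<d. f i) powr (1 / d) \<le> (\<Sum>i<d. f i / d)"
    using arith_geom_mean[of "{..<d}" f] assms by (simp add: lessThan_empty_iff)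
  then have "((\<Prod>i<d. f i) powr (1 / d)) ^ d \<le> (\<Sum>i<d. f i / d) ^ d"
    by (intro power_mono) simp_all
  moreover have "((\<Prod>i<d. f i) powr (1 / d)) ^ d = (\<Prod>i<d. f i)"
    by (rule powr_inverse_power) (use assms in \<open>auto intro!: prod_nonneg\<close>)
  ultimately show ?thesis by (simp add: sum_divide_distrib)
qed

text \<open>For fixed a the factor 1 + y * m a is affine in y, so its mean over the y i is its value
  at their mean. The inequality of arithmetic and geometric means is applied to each a
  separately.\<close>

lemma gram_det_prod_le_invertible:
  assumes T: "T \<in> carrier_mat k k" and W: "W \<in> carrier_mat k k" "det W \<noteq> 0"
    and y: "\<And>i. i < d \<Longrightarrow> 0 \<le> y i" and d: "0 < d"
  shows "Re (\<Prod>i<d. gram_det k T W (complex_of_real (y i)))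
    \<le> Re (gram_det k T W (complex_of_real ((\<Sum>i<d. y i) / d)) ^ d)"
proof -
  obtain c m where c: "0 \<le> c" and m: "\<And>a. a < k \<Longrightarrow> 0 \<le> m a" and
    f: "\<And>y. gram_det k T W (complex_of_real y) = complex_of_real (c * (\<Prod>a<k. 1 + y * m a))"
    using gram_det_factor[OF T W] by blast
  let ?r = "(\<Sum>i<d. y i) / d"
  have "(\<Prod>i<d. c * (\<Prod>a<k. 1 + y i * m a)) = c ^ d * (\<Prod>i<d. \<Prod>a<k. 1 + y i * m a)"
    by (simp add: prod.distrib)
  also have "(\<Prod>i<d. \<Prod>a<k. 1 + y i * m a) = (\<Prod>a<k. \<Prod>i<d. 1 + y i * m a)" by (rule prod.swap)
  also have "c ^ d * \<dots> \<le> c ^ d * (\<Prod>a<k. (1 + ?r * m a) ^ d)"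
  proof (intro mult_left_mono prod_mono conjI)
    fix a assume "a \<in> {..<k}"
    then have a: "0 \<le> 1 + y i * m a" if "i < d" for i using m y that by simp
    show "0 \<le> (\<Prod>i<d. 1 + y i * m a)" using a by (intro prod_nonneg) simp
    have "(\<Prod>i<d. 1 + y i * m a) \<le> ((\<Sum>i<d. 1 + y i * m a) / d) ^ d"
      by (rule prod_le_power_mean[OF a d])
    also have "(\<Sum>i<d. 1 + y i * m a) / d = 1 + ?r * m a"
    proof -
      have "(\<Sum>i<d. 1 + y i * m a) = d + (\<Sum>i<d. y i) * m a"
        by (simp add: sum.distrib sum_distrib_right)
      then show ?thesis using d by (simp add: field_simps)
    qed
    finally show "(\<Prod>i<d. 1 + y i * m a) \<le> (1 + ?r * m a) ^ d" .
  qed (use c in simp)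
  also have "\<dots> = (c * (\<Prod>a<k. 1 + ?r * m a)) ^ d"
    by (simp add: power_mult_distrib prod_power_distrib)
  finally have "(\<Prod>i<d. c * (\<Prod>a<k. 1 + y i * m a)) \<le> (c * (\<Prod>a<k. 1 + ?r * m a)) ^ d" .
  then show ?thesis
    unfolding f by (simp only: of_real_prod[symmetric] of_real_power[symmetric] Re_complex_of_real)
qed

lemma tendsto_det:
  assumes "\<And>t. M t \<in> carrier_mat n n" "A \<in> carrier_mat n n"
    and "\<And>i j. i < n \<Longrightarrow> j < n \<Longrightarrow> ((\<lambda>t. M t $$ (i, j)) \<longlongrightarrow> A $$ (i, j)) F"
  shows "((\<lambda>t. det (M t)) \<longlongrightarrow> det (A :: complex mat)) F"
proof -
  have "((\<lambda>t. \<Sum>p | p permutes {0..<n}. signof p * (\<Prod>i = 0..<n. M t $$ (i, p i)))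
    \<longlongrightarrow> (\<Sum>p | p permutes {0..<n}. signof p * (\<Prod>i = 0..<n. A $$ (i, p i)))) F"
  proof (intro tendsto_sum tendsto_mult tendsto_const tendsto_prod)
    fix p i assume "p \<in> {p. p permutes {0..<n}}" "i \<in> {0..<n}"
    then have "i < n" "p i < n" using permutes_in_image[of p "{0..<n}" i] by auto
    then show "((\<lambda>t. M t $$ (i, p i)) \<longlongrightarrow> A $$ (i, p i)) F" by (rule assms(3))
  qed
  then show ?thesis by (simp only: det_def'[OF assms(1)] det_def'[OF assms(2)])
qed

text \<open>Every such t is a negated eigenvalue of W.\<close>

lemma finite_singular_shifts:
  assumes W: "W \<in> carrier_mat n n"
  shows "finite {t. det (W + t \<cdot>\<^sub>m 1\<^sub>m n) = (0 :: complex)}"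
proof (rule finite_subset)
  show "{t. det (W + t \<cdot>\<^sub>m 1\<^sub>m n) = 0} \<subseteq> uminus ` {e. poly (char_poly W) e = 0}"
  proof
    fix t assume "t \<in> {t. det (W + t \<cdot>\<^sub>m 1\<^sub>m n) = 0}"
    then have "det (char_matrix W (- t)) = 0" using W by (simp add: char_matrix_def)
    then have "eigenvalue W (- t)" using eigenvalue_det[OF W] by simp
    then have "poly (char_poly W) (- t) = 0" using eigenvalue_root_char_poly[OF W] by simp
    then have "- t \<in> {e. poly (char_poly W) e = 0}" by simp
    then show "t \<in> uminus ` {e. poly (char_poly W) e = 0}" by (rule rev_image_eqI) simp
  qed
  have "char_poly W \<noteq> 0" using degree_monic_char_poly[OF W] by auto
  then show "finite (uminus ` {e. poly (char_poly W) e = 0})"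
    by (intro finite_imageI poly_roots_finite)
qed

lemma eventually_shift_invertible:
  assumes W: "W \<in> carrier_mat n n"
  shows "\<forall>\<^sub>F t in at (0 :: real). det (W + complex_of_real t \<cdot>\<^sub>m 1\<^sub>m n) \<noteq> 0"
proof -
  have "finite (complex_of_real -` {t. det (W + t \<cdot>\<^sub>m 1\<^sub>m n) = 0})"
    by (rule finite_vimageI[OF finite_singular_shifts[OF W]]) (simp add: inj_def)
  then have "closed (complex_of_real -` {t. det (W + t \<cdot>\<^sub>m 1\<^sub>m n) = 0} - {0})"
    by (intro finite_imp_closed) simp
  then have "open (- (complex_of_real -` {t. det (W + t \<cdot>\<^sub>m 1\<^sub>m n) = 0} - {0}))" by (rule open_Compl)
  then show ?thesis
    unfolding eventually_at_topological by (intro exI conjI) (assumption, simp, auto)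
qed

text \<open>Both sides are continuous in W, and W + t is invertible for all small nonzero t.\<close>

lemma gram_det_prod_le:
  assumes T: "T \<in> carrier_mat k k" and W: "W \<in> carrier_mat k k"
    and y: "\<And>i. i < d \<Longrightarrow> 0 \<le> y i" and d: "0 < d"
  shows "Re (\<Prod>i<d. gram_det k T W (complex_of_real (y i)))
    \<le> Re (gram_det k T W (complex_of_real ((\<Sum>i<d. y i) / d)) ^ d)"
proof -
  define V where "V = (\<lambda>t. W + complex_of_real t \<cdot>\<^sub>m 1\<^sub>m k)"
  have V: "V t \<in> carrier_mat k k" for t using W by (simp add: V_def)
  have lim: "((\<lambda>t. gram_det k T (V t) y) \<longlongrightarrow> gram_det k T W y) (at 0)" for y
    unfolding gram_det_def
  proof (rule tendsto_det)
    note c = mat_adjoint_carrier[OF T] mat_adjoint_carrier[OF W] mat_adjoint_carrier[OF V]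
    show "y \<cdot>\<^sub>m (mat_adjoint T * T) + mat_adjoint (V t) * V t \<in> carrier_mat k k" for t
      using T c(1) V[of t] c(3)[of t] by (simp add: square_mat)
    show "y \<cdot>\<^sub>m (mat_adjoint T * T) + mat_adjoint W * W \<in> carrier_mat k k"
      using T W c by (simp add: square_mat)
    fix i j assume ij: "i < k" "j < k"
    have entry: "(y \<cdot>\<^sub>m (mat_adjoint T * T) + mat_adjoint X * X) $$ (i, j)
      = y * (mat_adjoint T * T) $$ (i, j) + (\<Sum>l<k. cnj (X $$ (l, i)) * X $$ (l, j))"
      if X: "X \<in> carrier_mat k k" for X
      using ij T c(1) X mat_adjoint_carrier[OF X]
      by (simp add: scalar_prod_def atLeast0LessThan mat_adjoint_index[OF X])
    have VW: "((\<lambda>t. V t $$ (l, j)) \<longlongrightarrow> W $$ (l, j)) (at 0)" if "l < k" "j < k" for l j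
    proof -
      have "((\<lambda>t. W $$ (l, j) + complex_of_real t * of_bool (l = j)) \<longlongrightarrow> W $$ (l, j) + complex_of_real 0 * of_bool (l = j)) (at 0)"
        by (intro tendsto_intros)
      moreover have "(\<lambda>t. V t $$ (l, j)) = (\<lambda>t. W $$ (l, j) + complex_of_real t * of_bool (l = j))"
        using that W by (auto simp: V_def)
      ultimately show ?thesis by simp
    qed
    show "((\<lambda>t. (y \<cdot>\<^sub>m (mat_adjoint T * T) + mat_adjoint (V t) * V t) $$ (i, j))
      \<longlongrightarrow> (y \<cdot>\<^sub>m (mat_adjoint T * T) + mat_adjoint W * W) $$ (i, j)) (at 0)"
      unfolding entry[OF V] entry[OF W] by (intro tendsto_intros VW) (use ij in auto)
  qed
  let ?r = "complex_of_real ((\<Sum>i<d. y i) / d)"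
  show ?thesis
  proof (rule tendsto_le)
    show "((\<lambda>t. Re (\<Prod>i<d. gram_det k T (V t) (complex_of_real (y i))))
      \<longlongrightarrow> Re (\<Prod>i<d. gram_det k T W (complex_of_real (y i)))) (at 0)"
      by (intro tendsto_intros lim)
    show "((\<lambda>t. Re (gram_det k T (V t) ?r ^ d)) \<longlongrightarrow> Re (gram_det k T W ?r ^ d)) (at 0)"
      by (intro tendsto_intros lim)
    show "\<forall>\<^sub>F t in at 0. Re (\<Prod>i<d. gram_det k T (V t) (complex_of_real (y i))) \<le> Re (gram_det k T (V t) ?r ^ d)"
      using eventually_shift_invertible[OF W]
    proof (rule eventually_mono)
      fix t :: real assume "det (W + complex_of_real t \<cdot>\<^sub>m 1\<^sub>m k) \<noteq> 0"
      then have "det (V t) \<noteq> 0" by (simp add: V_def)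
      from gram_det_prod_le_invertible[OF T V this y d]
      show "Re (\<Prod>i<d. gram_det k T (V t) (complex_of_real (y i))) \<le> Re (gram_det k T (V t) ?r ^ d)" .
    qed
  qed simp
qed

lemma sum_lessThan_add: "(\<Sum>c<k + m. f c) = (\<Sum>c<k. f c) + (\<Sum>c<m. f (k + c) :: complex)" for m :: nat
  by (induction m) (simp_all add: add.assoc)

text \<open>The two sides are the Gaussian means of the two sides of
  \<open>gram_det_prod_le\<close>, with T and W the upper and lower half of a 2k by k matrix.
  Monotonicity of the integral requires a positive measure, hence \<open>gaussian\<close> and not
  the signed measure of \<open>finite_wick\<close>.\<close>

lemma gaussian_gram_le:
  assumes y: "\<And>i. i < d \<Longrightarrow> 0 \<le> y i" and d: "0 < d"
  shows "Re (\<Sum>\<phi>\<in>grid k d \<rightarrow>\<^sub>E {..<2 * k}. (\<Prod>e\<in>grid k d. if \<phi> e < k then complex_of_real (y (snd e)) else 1) * tsum k d \<phi>)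
    \<le> Re (\<Sum>\<phi>\<in>grid k d \<rightarrow>\<^sub>E {..<2 * k}.
        (\<Prod>e\<in>grid k d. if \<phi> e < k then complex_of_real ((\<Sum>i<d. y i) / d) else 1) * tsum k d \<phi>)"
proof -
  let ?M = "gaussian (grid (2 * k) k) (k * d)"
  have wick: "wick (grid (2 * k) k) (k * d) (has_bochner_integral ?M)"
    by (rule gaussian_wick) simp
  define T where "T = (\<lambda>z. mat k k (z :: nat \<times> nat \<Rightarrow> complex))"
  define W where "W = (\<lambda>z. mat k k (\<lambda>(a, b). z (k + a, b) :: complex))"
  have TW: "T z \<in> carrier_mat k k" "W z \<in> carrier_mat k k" for z by (simp_all add: T_def W_def)
  have gd: "det (mat k k (\<lambda>(b, b'). \<Sum>c<2 * k. (if c < k then u else 1) * cnj (z (c, b)) * z (c, b')))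
    = gram_det k (T z) (W z) u" for u z
    unfolding gram_det_def
  proof (rule arg_cong[where f = det], rule eq_matI)
    note c = mat_adjoint_carrier[OF TW(1)[of z]] mat_adjoint_carrier[OF TW(2)[of z]]
    fix b b' assume "b < dim_row (u \<cdot>\<^sub>m (mat_adjoint (T z) * T z) + mat_adjoint (W z) * W z)"
      "b' < dim_col (u \<cdot>\<^sub>m (mat_adjoint (T z) * T z) + mat_adjoint (W z) * W z)"
    then have b: "b < k" "b' < k" using c TW[of z] by auto
    have "(u \<cdot>\<^sub>m (mat_adjoint (T z) * T z) + mat_adjoint (W z) * W z) $$ (b, b')
      = u * (\<Sum>c<k. cnj (z (c, b)) * z (c, b')) + (\<Sum>c<k. cnj (z (k + c, b)) * z (k + c, b'))"
      using b c TW[of z]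
      by (simp add: scalar_prod_def atLeast0LessThan mat_adjoint_index[OF TW(1)] mat_adjoint_index[OF TW(2)])
        (simp add: T_def W_def)
    then show "mat k k (\<lambda>(b, b'). \<Sum>c<2 * k. (if c < k then u else 1) * cnj (z (c, b)) * z (c, b')) $$ (b, b')
      = (u \<cdot>\<^sub>m (mat_adjoint (T z) * T z) + mat_adjoint (W z) * W z) $$ (b, b')"
      using b by (simp add: mult_2 sum_lessThan_add sum_distrib_left mult.assoc)
  qed (use TW[of z] mat_adjoint_carrier[OF TW(1)[of z]] mat_adjoint_carrier[OF TW(2)[of z]] in auto)
  let ?f = "\<lambda>(u :: nat \<Rightarrow> complex) z. \<Prod>i<d. gram_det k (T z) (W z) (u i)"
  let ?v = "\<lambda>u. \<Sum>\<phi>\<in>grid k d \<rightarrow>\<^sub>E {..<2 * k}. (\<Prod>e\<in>grid k d. if \<phi> e < k then u (snd e) else 1) * tsum k d \<phi>"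
  have E: "has_bochner_integral ?M (?f u) (?v u)" for u
    using wick_gram_dets[OF wick order_refl, of "\<lambda>c i. if c < k then u i else 1"] unfolding gd .
  have Re: "Re (?v u) = (\<integral>z. Re (?f u z) \<partial>?M)" and int: "integrable ?M (\<lambda>z. Re (?f u z))" for u
    using E[of u] by (auto simp: has_bochner_integral_iff)
  have "(\<integral>z. Re (?f (\<lambda>i. complex_of_real (y i)) z) \<partial>?M)
    \<le> (\<integral>z. Re (?f (\<lambda>_. complex_of_real ((\<Sum>i<d. y i) / d)) z) \<partial>?M)"
  proof (rule integral_mono[OF int int])
    fix z
    show "Re (?f (\<lambda>i. complex_of_real (y i)) z) \<le> Re (?f (\<lambda>_. complex_of_real ((\<Sum>i<d. y i) / d)) z)"
      using gram_det_prod_le[where T = "T z" and W = "W z", OF TW y d] by simp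
  qed
  then show ?thesis
    using Re[of "\<lambda>i. complex_of_real (y i)"] Re[of "\<lambda>_. complex_of_real ((\<Sum>i<d. y i) / d)"]
    by (simp only:)
qed

section \<open>Positivity of the normalising constant\<close>

text \<open>With a single row of cells the tests force \<beta> = \<sigma> and the signs cancel, so
  the only \<phi> gives k!. This is the mean of |det Y|^2 for a k by k Gaussian matrix Y and will
  show that det Y is not almost surely 0.\<close>

lemma sum_tsum_one_ne_zero: "(\<Sum>\<phi>\<in>grid 1 k \<rightarrow>\<^sub>E {..<1}. tsum 1 k \<phi>) \<noteq> 0"
proof -
  let ?J = "grid 1 k"
  have "tsum 1 k \<phi> = fact k" if \<phi>: "\<phi> \<in> ?J \<rightarrow>\<^sub>E {..<1}" for \<phi>
  proof -
    have \<phi>0: "\<phi> e = 0" if "e \<in> ?J" for e using PiE_mem[OF \<phi> that] by simp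
    have 1: "\<forall>e\<in>?J. \<phi> (\<beta> e) = \<phi> e" if "\<beta> permutes ?J" for \<beta>
      using permutes_in_image[OF that] \<phi>0 by simp
    have z: "fst e = 0" if "e \<in> ?J" for e :: "nat \<times> nat" using that by auto
    have 2: "(\<forall>e\<in>?J. fst (\<sigma> e) = fst e \<and> snd (\<sigma> e) = snd (\<beta> e)) \<longleftrightarrow> \<beta> = \<sigma>"
      if \<beta>: "\<beta> permutes ?J" and \<sigma>: "\<sigma> permutes ?J" for \<beta> \<sigma>
    proof -
      have f: "fst (\<beta> e) = 0" "fst (\<sigma> e) = 0" if "e \<in> ?J" for e
        by (rule z[OF iffD2[OF permutes_in_image[OF \<beta>] that]]) (rule z[OF iffD2[OF permutes_in_image[OF \<sigma>] that]])
      show ?thesis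
      proof
        assume *: "\<forall>e\<in>?J. fst (\<sigma> e) = fst e \<and> snd (\<sigma> e) = snd (\<beta> e)"
        show "\<beta> = \<sigma>"
        proof
          fix e show "\<beta> e = \<sigma> e"
          proof (cases "e \<in> ?J")
            case True
            have "snd (\<sigma> e) = snd (\<beta> e)" using bspec[OF * True] by (rule conjunct2)
            with f[OF True] show ?thesis by (simp only: prod_eq_iff)
          next
            case False
            show ?thesis unfolding permutes_not_in[OF \<beta> False] permutes_not_in[OF \<sigma> False] by (rule refl)
          qed
        qed
      next
        assume eq: "\<beta> = \<sigma>"
        show "\<forall>e\<in>?J. fst (\<sigma> e) = fst e \<and> snd (\<sigma> e) = snd (\<beta> e)"
          unfolding eq by (rule ballI) (simp only: f(2) z simp_thms)
      qed
    qed
    have fin: "finite {p. p permutes ?J}" by (simp add: finite_permutations)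
    have "tsum 1 k \<phi> = (\<Sum>\<beta> | \<beta> permutes ?J. \<Sum>\<sigma> | \<sigma> permutes ?J. if \<beta> = \<sigma> then 1 else 0)"
      unfolding tsum_def
    proof (intro sum.cong refl)
      fix \<beta> \<sigma> assume "\<beta> \<in> {p. p permutes ?J}" "\<sigma> \<in> {p. p permutes ?J}"
      then have p: "\<beta> permutes ?J" "\<sigma> permutes ?J" by simp_all
      have sgn: "of_int (sign \<sigma>) * of_int (sign \<sigma>) = (1 :: complex)"
        by (simp add: sign_def)
      have h: "of_bool (\<forall>e\<in>?J. \<phi> (\<beta> e) = \<phi> e) = (1 :: complex)"
        unfolding of_bool_def using 1[OF p(1)] by (rule if_P)
      show "of_int (sign \<beta>) * of_int (sign \<sigma>) * of_bool (\<forall>e\<in>?J. \<phi> (\<beta> e) = \<phi> e) *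
        of_bool (\<forall>e\<in>?J. fst (\<sigma> e) = fst e \<and> snd (\<sigma> e) = snd (\<beta> e)) = (if \<beta> = \<sigma> then 1 else 0 :: complex)"
        unfolding h 2[OF p] by (cases "\<beta> = \<sigma>") (simp_all add: sgn)
    qed
    also have "\<dots> = (\<Sum>\<beta> | \<beta> permutes ?J. 1)"
    proof (rule sum.cong[OF refl])
      fix \<beta> assume "\<beta> \<in> {p. p permutes ?J}"
      then show "(\<Sum>\<sigma> | \<sigma> permutes ?J. if \<beta> = \<sigma> then 1 else 0) = (1 :: complex)"
        by (simp only: sum.delta'[OF fin] if_True)
    qed
    also have "\<dots> = of_nat (card {p. p permutes ?J})" by simp
    also have "\<dots> = fact k"
      by (simp add: card_permutations[OF refl])
    finally show ?thesis .
  qed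
  then have "(\<Sum>\<phi>\<in>?J \<rightarrow>\<^sub>E {..<1}. tsum 1 k \<phi>) = (\<Sum>\<phi>\<in>?J \<rightarrow>\<^sub>E {..<1 :: nat}. fact k)"
    by (rule sum.cong[OF refl])
  also have "\<dots> = fact k" by (simp add: card_PiE)
  finally show ?thesis by simp
qed

text \<open>The sum is the mean of |det Y| ^ (2d) for a k by k Gaussian matrix Y, hence nonnegative.
  If it vanished, det Y would be 0 almost everywhere, contrary to
  \<open>sum_tsum_one_ne_zero\<close>.\<close>

lemma tsum_total_pos:
  shows "0 < Re (\<Sum>\<phi>\<in>grid k d \<rightarrow>\<^sub>E {..<k}. tsum k d \<phi>)" "Im (\<Sum>\<phi>\<in>grid k d \<rightarrow>\<^sub>E {..<k}. tsum k d \<phi>) = 0"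
proof -
  \<comment> \<open>The order k * d + k covers both |det Y| ^ (2d) and |det Y|^2.\<close>
  let ?M = "gaussian (grid k k) (k * d + k)"
  let ?N = "\<Sum>\<phi>\<in>grid k d \<rightarrow>\<^sub>E {..<k}. tsum k d \<phi>"
  have W: "wick (grid k k) (k * d + k) (has_bochner_integral ?M)"
    by (rule gaussian_wick) simp
  interpret w: wick "grid k k" "k * d + k" "has_bochner_integral ?M" by (rule W)
  define Y where "Y = (\<lambda>z. mat k k (z :: nat \<times> nat \<Rightarrow> complex))"
  have Y: "Y z \<in> carrier_mat k k" for z by (simp add: Y_def)
  have Yi: "Y z $$ (i, j) = z (i, j)" if "i < k" "j < k" for z i j using that by (simp add: Y_def)
  have sq: "det (mat k k (\<lambda>(b, b'). \<Sum>c<k. 1 * cnj (z (c, b)) * z (c, b'))) = complex_of_real ((norm (det (Y z)))\<^sup>2)" for z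
  proof -
    have "mat k k (\<lambda>(b, b'). \<Sum>c<k. 1 * cnj (z (c, b)) * z (c, b')) = mat_adjoint (Y z) * Y z"
      using mat_adjoint_carrier[OF Y[of z]] Y[of z]
      by (intro eq_matI) (auto simp: scalar_prod_def atLeast0LessThan mat_adjoint_index[OF Y] Yi)
    then have "det (mat k k (\<lambda>(b, b'). \<Sum>c<k. 1 * cnj (z (c, b)) * z (c, b'))) = cnj (det (Y z)) * det (Y z)"
      using det_mult[OF mat_adjoint_carrier[OF Y] Y] det_mat_adjoint[OF Y] by simp
    then show ?thesis by (simp only: complex_norm_square mult.commute)
  qed
  have E: "has_bochner_integral ?M (\<lambda>z. complex_of_real (((norm (det (Y z)))\<^sup>2) ^ d)) ?N"
    using wick_gram_dets[OF W, of d "\<lambda>_ _. 1"] unfolding sq by simp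
  have N: "?N = complex_of_real (\<integral>z. ((norm (det (Y z)))\<^sup>2) ^ d \<partial>?M)"
    using has_bochner_integral_integral_eq[OF E] by (simp only: integral_complex_of_real)
  then show "Im ?N = 0" by (simp only: Im_complex_of_real)
  have int: "integrable ?M (\<lambda>z. ((norm (det (Y z)))\<^sup>2) ^ d)"
    using E by (simp only: has_bochner_integral_iff complex_of_real_integrable_eq)
  have "(\<integral>z. ((norm (det (Y z)))\<^sup>2) ^ d \<partial>?M) \<noteq> 0"
  proof
    assume "(\<integral>z. ((norm (det (Y z)))\<^sup>2) ^ d \<partial>?M) = 0"
    then have "AE z in ?M. ((norm (det (Y z)))\<^sup>2) ^ d = 0"
      using integral_nonneg_eq_0_iff_AE[OF int] by simp
    then have AE: "AE z in ?M. det (Y z) = 0" by (rule AE_mp) (auto intro!: AE_I2)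
    let ?l = "\<lambda>i j :: nat. \<lambda>v :: nat \<times> nat. of_bool (v = (i, j)) :: complex"
    have lin: "w.lin (?l i j) z = z (i, j)" if "i < k" "j < k" for i j z
    proof -
      have "w.lin (?l i j) z = (\<Sum>v\<in>grid k k. if v = (i, j) then z v else 0)"
        unfolding w.lin_def by (intro sum.cong refl) auto
      also have "\<dots> = z (i, j)" using that by (subst sum.delta) auto
      finally show ?thesis .
    qed
    have matY: "mat k k (\<lambda>(i, j). w.lin (?l i j) z) = Y z" for z
      by (intro eq_matI) (auto simp: lin Y_def)
    have "has_bochner_integral ?M (\<lambda>z. det (mat k k (\<lambda>(i, j). w.lin (?l i j) z)) ^ 1 *
        cnj (det (mat k k (\<lambda>(i, j). w.lin (?l i j) z)) ^ 1)) (\<Sum>\<phi>\<in>grid 1 k \<rightarrow>\<^sub>E {..<1}. tsum 1 k \<phi>)"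
    proof (rule w.det_power_times_conj_det_power)
      fix i j i' j' assume ij: "i < k" "j < k" "i' < k" "j' < k"
      have "w.gram (?l i j) (?l i' j') = w.lin (?l i j) (\<lambda>v. cnj (?l i' j' v))"
        by (simp only: w.gram_def w.lin_def)
      then show "w.gram (?l i j) (?l i' j') = of_bool (i = i' \<and> j = j')"
        using ij by (simp add: lin)
    qed simp
    then have "has_bochner_integral ?M (\<lambda>z. det (Y z) * cnj (det (Y z))) (\<Sum>\<phi>\<in>grid 1 k \<rightarrow>\<^sub>E {..<1}. tsum 1 k \<phi>)"
      by (simp only: matY power_one_right)
    then have "(\<Sum>\<phi>\<in>grid 1 k \<rightarrow>\<^sub>E {..<1}. tsum 1 k \<phi>) = (\<integral>z. det (Y z) * cnj (det (Y z)) \<partial>?M)"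
      and meas: "(\<lambda>z. det (Y z) * cnj (det (Y z))) \<in> borel_measurable ?M"
      by (auto simp: has_bochner_integral_iff)
    moreover have "(\<integral>z. det (Y z) * cnj (det (Y z)) \<partial>?M) = (\<integral>z. 0 \<partial>?M)"
      using AE meas by (intro integral_cong_AE) auto
    ultimately show False using sum_tsum_one_ne_zero[of k] by simp
  qed
  moreover have "0 \<le> (\<integral>z. ((norm (det (Y z)))\<^sup>2) ^ d \<partial>?M)" by (rule Bochner_Integration.integral_nonneg) simp
  ultimately have "0 < (\<integral>z. ((norm (det (Y z)))\<^sup>2) ^ d \<partial>?M)" by linarith
  then show "0 < Re ?N" by (simp only: N Re_complex_of_real)
qed

section \<open>The reproducing kernel of minors\<close>

text \<open>Products of d maximal minors of a matrix z with k columns. They are multiplied by det w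
  ^ d under z -> z w (\<open>minor_mult\<close>), and their span is the space whose dimension is to
  be bounded.\<close>

definition minor :: "nat \<Rightarrow> nat \<Rightarrow> (nat \<times> nat \<Rightarrow> nat) \<Rightarrow> (nat \<times> nat \<Rightarrow> complex) \<Rightarrow> complex" where
  "minor k d \<phi> z = (\<Prod>i<d. det (mat k k (\<lambda>(a, b). z (\<phi> (a, i), b))))"

lemma minor_expand:
  "minor k d \<phi> z = (\<Sum>\<tau> | \<tau> permutes grid k d. of_int (sign \<tau>) * of_bool (\<forall>e\<in>grid k d. snd e = snd (\<tau> e)) *
      (\<Prod>e\<in>grid k d. z (\<phi> e, fst (\<tau> e))))"
proof -
  have "minor k d \<phi> z = sdet (grid k d) (\<lambda>e e'. if snd e = snd e' then z (\<phi> (fst e, snd e), fst e') else 0)"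
    unfolding minor_def det_eq_sdet by (subst sdet_snd_blocks) simp
  also have "\<dots> = (\<Sum>\<tau> | \<tau> permutes grid k d. of_int (sign \<tau>) * of_bool (\<forall>e\<in>grid k d. snd e = snd (\<tau> e)) *
      (\<Prod>e\<in>grid k d. z (\<phi> e, fst (\<tau> e))))"
    unfolding sdet_def by (simp add: prod_if_zero mult.assoc)
  finally show ?thesis .
qed

text \<open>Expanded for the transpose, so that the permuted index is the row index; this matches
  the coordinate forms \<open>w2\<close> in \<open>kern_reproducing\<close>.\<close>

lemma det_expand_transpose:
  "det (mat k k Y) ^ d = (\<Sum>\<tau> | \<tau> permutes grid k d. of_int (sign \<tau>) * of_bool (\<forall>e\<in>grid k d. snd e = snd (\<tau> e)) *
      (\<Prod>e\<in>grid k d. Y (fst (\<tau> e), fst e)))" for Y :: "nat \<times> nat \<Rightarrow> complex"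
proof -
  have "transpose_mat (mat k k Y) = mat k k (\<lambda>(a, b). Y (b, a))" by (intro eq_matI) auto
  then have "det (mat k k Y) = det (mat k k (\<lambda>(a, b). Y (b, a)))"
    using det_transpose[of "mat k k Y" k] by simp
  then have "det (mat k k Y) ^ d = (\<Prod>i<d. sdet {..<k} (\<lambda>a b. Y (b, a)))"
    by (simp add: det_eq_sdet)
  also have "\<dots> = sdet (grid k d) (\<lambda>e e'. if snd e = snd e' then Y (fst e', fst e) else 0)"
    by (rule sdet_snd_blocks[symmetric])
  also have "\<dots> = (\<Sum>\<tau> | \<tau> permutes grid k d. of_int (sign \<tau>) * of_bool (\<forall>e\<in>grid k d. snd e = snd (\<tau> e)) *
      (\<Prod>e\<in>grid k d. Y (fst (\<tau> e), fst e)))"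
    unfolding sdet_def by (simp add: prod_if_zero mult.assoc)
  finally show ?thesis .
qed

lemma minor_mult:
  assumes "\<phi> \<in> grid k d \<rightarrow>\<^sub>E {..<m}" "\<And>c b. c < m \<Longrightarrow> b < k \<Longrightarrow> z (c, b) = (\<Sum>j<k. u (c, j) * w (j, b))"
  shows "minor k d \<phi> z = minor k d \<phi> u * det (mat k k w) ^ d"
proof -
  have "det (mat k k (\<lambda>(a, b). z (\<phi> (a, i), b))) = det (mat k k (\<lambda>(a, b). u (\<phi> (a, i), b))) * det (mat k k w)"
    if "i < d" for i
  proof -
    have "\<phi> (a, i) < m" if "a < k" for a
      using PiE_mem[OF assms(1), of "(a, i)"] that \<open>i < d\<close> by simp
    then have "mat k k (\<lambda>(a, b). z (\<phi> (a, i), b)) = mat k k (\<lambda>(a, b). u (\<phi> (a, i), b)) * mat k k w"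
      by (intro eq_matI) (auto simp: scalar_prod_def atLeast0LessThan assms(2))
    then show ?thesis by (simp add: det_mult[of _ k])
  qed
  then show ?thesis by (simp add: minor_def prod.distrib)
qed

lemma (in wick) wick_sums:
  assumes "finite J" "card J \<le> K" "finite P"
  shows "H (\<lambda>z. (\<Sum>\<tau>\<in>P. co \<tau> * (\<Prod>e\<in>J. lin (u \<tau> e) z)) * (\<Sum>\<tau>\<in>P. co \<tau> * (\<Prod>e\<in>J. cnj (lin (w \<tau> e) z))))
    (\<Sum>\<tau>\<in>P. \<Sum>\<tau>'\<in>P. co \<tau> * co \<tau>' * (\<Sum>p\<in>bijs J J. \<Prod>e\<in>J. gram (u \<tau> (p e)) (w \<tau>' e)))"
proof -
  have "H (\<lambda>z. \<Sum>\<tau>\<in>P. \<Sum>\<tau>'\<in>P. co \<tau> * co \<tau>' * ((\<Prod>e\<in>J. lin (u \<tau> e) z) * (\<Prod>e\<in>J. cnj (lin (w \<tau>' e) z))))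
    (\<Sum>\<tau>\<in>P. \<Sum>\<tau>'\<in>P. co \<tau> * co \<tau>' * (\<Sum>p\<in>bijs J J. \<Prod>e\<in>J. gram (u \<tau> (p e)) (w \<tau>' e)))"
    using assms by (intro H_sum H_mult wick_formula) auto
  then show ?thesis by (simp add: sum_product mult_ac)
qed

text \<open>Up to normalisation \<open>kern\<close> is the reproducing kernel of the span of the functions
  \<open>minor k d \<phi>\<close>. By Wick's formula the left-hand side depends on Gram matrices only, so the
  \<open>m \<times> k\<close> Gaussian matrix may be replaced by \<open>x\<close> times a \<open>k \<times> k\<close> Gaussian matrix.\<close>

lemma kern_reproducing:
  assumes \<phi>: "\<phi> \<in> grid k d \<rightarrow>\<^sub>E {..<m}"
  shows "(\<Sum>\<psi>\<in>grid k d \<rightarrow>\<^sub>E {..<m}. kern k d \<phi> \<psi> * minor k d \<psi> x)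
    = (\<Sum>\<psi>\<in>grid k d \<rightarrow>\<^sub>E {..<k}. tsum k d \<psi>) * minor k d \<phi> x"
proof -
  let ?J = "grid k d"
  let ?P = "{p. p permutes ?J}" and ?F = "?J \<rightarrow>\<^sub>E {..<m}"
  define co where "co = (\<lambda>\<tau>. of_int (sign \<tau>) * of_bool (\<forall>e\<in>?J. snd e = snd (\<tau> e)) :: complex)"
  have finP: "finite ?P" by (simp add: finite_permutations)
  have finF: "finite ?F" by (auto intro: finite_PiE)
  have finJ: "finite ?J" "card ?J \<le> k * d" by simp_all
  have \<tau>: "fst (\<tau> e) < k" if "\<tau> \<in> ?P" "e \<in> ?J" for \<tau> e
  proof -
    have "\<tau> e \<in> ?J" using that by (simp only: mem_Collect_eq permutes_in_image)
    then show ?thesis by (simp only: mem_Times_iff lessThan_iff)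
  qed
  obtain I1 and c1 :: "(nat \<times> nat \<Rightarrow> nat \<times> nat) \<Rightarrow> complex" and z1 :: "(nat \<times> nat \<Rightarrow> nat \<times> nat) \<Rightarrow> nat \<times> nat \<Rightarrow> complex"
    where I1: "finite I1" and W1: "wick (grid m k) (k * d) (\<lambda>F a. (\<Sum>s\<in>I1. c1 s * F (z1 s)) = a)"
    by (rule finite_wick[OF finite_cartesian_product[OF finite_lessThan finite_lessThan]]) (rule that)
  obtain I2 and c2 :: "(nat \<times> nat \<Rightarrow> nat \<times> nat) \<Rightarrow> complex" and z2 :: "(nat \<times> nat \<Rightarrow> nat \<times> nat) \<Rightarrow> nat \<times> nat \<Rightarrow> complex"
    where I2: "finite I2" and W2: "wick (grid k k) (k * d) (\<lambda>F a. (\<Sum>s\<in>I2. c2 s * F (z2 s)) = a)"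
    by (rule finite_wick[OF finite_cartesian_product[OF finite_lessThan finite_lessThan]]) (rule that)
  interpret w1: wick "grid m k" "k * d" "\<lambda>F a. (\<Sum>s\<in>I1. c1 s * F (z1 s)) = a" by (rule W1)
  interpret w2: wick "grid k k" "k * d" "\<lambda>F a. (\<Sum>s\<in>I2. c2 s * F (z2 s)) = a" by (rule W2)
  \<comment> \<open>On the m by k Gaussian matrix z, \<open>u1\<close> is a coordinate and
    \<open>w1\<close> an entry of (adjoint of x) z; on the k by k one, \<open>u2\<close> is an entry
    of x z and \<open>w2\<close> a coordinate. Moving x from one factor to the other leaves the
    covariances unchanged.\<close>
  define u1 where "u1 = (\<lambda>\<tau> e (v :: nat \<times> nat). of_bool (v = (\<phi> e, fst (\<tau> e :: nat \<times> nat))) :: complex)"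
  define w1 where "w1 = (\<lambda>\<tau> (e :: nat \<times> nat) (v :: nat \<times> nat). of_bool (snd v = fst e) * cnj (x (fst v, fst (\<tau> e :: nat \<times> nat))))"
  define u2 where "u2 = (\<lambda>\<tau> e (v :: nat \<times> nat). of_bool (snd v = fst (\<tau> e :: nat \<times> nat)) * x (\<phi> e, fst v))"
  define w2 where "w2 = (\<lambda>\<tau> (e :: nat \<times> nat) (v :: nat \<times> nat). of_bool (v = (fst (\<tau> e :: nat \<times> nat), fst e)) :: complex)"
  have delta: "(\<Sum>v\<in>A. of_bool (v = y) * f v) = (f y :: complex)" "(\<Sum>v\<in>A. f v * of_bool (v = y)) = f y"
    if "finite A" "y \<in> A" for A y and f :: "nat \<times> nat \<Rightarrow> complex"
  proof -
    have "(\<Sum>v\<in>A. of_bool (v = y) * f v) = (\<Sum>v\<in>A. if v = y then f v else 0)" by (intro sum.cong) auto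
    then show 1: "(\<Sum>v\<in>A. of_bool (v = y) * f v) = f y" using that by (simp add: sum.delta)
    show "(\<Sum>v\<in>A. f v * of_bool (v = y)) = f y" using 1 by (simp only: mult.commute)
  qed
  have in1: "(\<phi> e, fst (\<tau>' e)) \<in> grid m k" if "e \<in> ?J" "\<tau>' \<in> ?P" for e \<tau>'
    using PiE_mem[OF \<phi> that(1)] \<tau>[OF that(2,1)] by simp
  have in2: "(fst (\<tau>' e), fst e) \<in> grid k k" if "e \<in> ?J" "\<tau>' \<in> ?P" for e \<tau>'
    using that(1) \<tau>[OF that(2,1)] by (simp add: mem_Times_iff)
  have fin: "finite (grid m k)" "finite (grid k k)" by simp_all
  have gram: "w1.gram (u1 \<tau> e) (w1 \<tau>' t) = w2.gram (u2 \<tau> e) (w2 \<tau>' t)"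
    if "\<tau> \<in> ?P" "\<tau>' \<in> ?P" "e \<in> ?J" "t \<in> ?J" for \<tau> \<tau>' e t
  proof -
    have "w1.gram (u1 \<tau> e) (w1 \<tau>' t) = cnj (w1 \<tau>' t (\<phi> e, fst (\<tau> e)))"
      unfolding w1.gram_def u1_def by (rule delta(1)[OF fin(1) in1[OF that(3,1)]])
    moreover have "w2.gram (u2 \<tau> e) (w2 \<tau>' t) = u2 \<tau> e (fst (\<tau>' t), fst t)"
    proof -
      have "w2.gram (u2 \<tau> e) (w2 \<tau>' t) = (\<Sum>v\<in>grid k k. u2 \<tau> e v * of_bool (v = (fst (\<tau>' t), fst t)))"
        unfolding w2.gram_def w2_def by (intro sum.cong refl) (simp add: of_bool_def)
      then show ?thesis using delta(2)[OF fin(2) in2[OF that(4,2)]] by simp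
    qed
    ultimately show ?thesis by (simp add: w1_def u2_def)
  qed
  let ?V = "\<Sum>\<tau>\<in>?P. \<Sum>\<tau>'\<in>?P. co \<tau> * co \<tau>' * (\<Sum>p\<in>bijs ?J ?J. \<Prod>e\<in>?J. w1.gram (u1 \<tau> (p e)) (w1 \<tau>' e))"
  have V2: "?V = (\<Sum>\<tau>\<in>?P. \<Sum>\<tau>'\<in>?P. co \<tau> * co \<tau>' * (\<Sum>p\<in>bijs ?J ?J. \<Prod>e\<in>?J. w2.gram (u2 \<tau> (p e)) (w2 \<tau>' e)))"
  proof (rule sum.cong[OF refl], rule sum.cong[OF refl])
    fix \<tau> \<tau>' assume t: "\<tau> \<in> ?P" "\<tau>' \<in> ?P"
    have "(\<Sum>p\<in>bijs ?J ?J. \<Prod>e\<in>?J. w1.gram (u1 \<tau> (p e)) (w1 \<tau>' e)) = (\<Sum>p\<in>bijs ?J ?J. \<Prod>e\<in>?J. w2.gram (u2 \<tau> (p e)) (w2 \<tau>' e))"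
    proof (rule sum.cong[OF refl], rule prod.cong[OF refl])
      fix p e assume "p \<in> bijs ?J ?J" and e: "e \<in> ?J"
      then have "p \<in> ?J \<rightarrow>\<^sub>E ?J" by (simp add: bijs_def)
      from gram[OF t PiE_mem[OF this e] e]
      show "w1.gram (u1 \<tau> (p e)) (w1 \<tau>' e) = w2.gram (u2 \<tau> (p e)) (w2 \<tau>' e)" .
    qed
    then show "co \<tau> * co \<tau>' * (\<Sum>p\<in>bijs ?J ?J. \<Prod>e\<in>?J. w1.gram (u1 \<tau> (p e)) (w1 \<tau>' e))
      = co \<tau> * co \<tau>' * (\<Sum>p\<in>bijs ?J ?J. \<Prod>e\<in>?J. w2.gram (u2 \<tau> (p e)) (w2 \<tau>' e))" by (simp only:)
  qed
  have L: "(\<Sum>\<psi>\<in>?F. kern k d \<phi> \<psi> * minor k d \<psi> x) = ?V"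
  proof -
    have ker: "kern k d \<phi> \<psi> = (\<Sum>s\<in>I1. c1 s * (minor k d \<phi> (z1 s) * (\<Prod>e\<in>?J. cnj (z1 s (\<psi> e, fst e)))))"
      if "\<psi> \<in> ?F" for \<psi>
      using kern_wick[OF W1 order_refl \<phi> that] by (simp only: minor_expand)
    \<comment> \<open>The sum over all maps \<psi> is a product over the cells of sums over one row
      index, and these are the conjugated forms \<open>w1\<close>.\<close>
    have sub: "(\<Sum>\<psi>\<in>?F. (\<Prod>e\<in>?J. cnj (z (\<psi> e, fst e))) * minor k d \<psi> x)
      = (\<Sum>\<tau>\<in>?P. co \<tau> * (\<Prod>e\<in>?J. cnj (w1.lin (w1 \<tau> e) z)))" for z
    proof -
      have lin: "cnj (w1.lin (w1 \<tau> e) z) = (\<Sum>c<m. cnj (z (c, fst e)) * x (c, fst (\<tau> e)))"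
        if "e \<in> ?J" for \<tau> e
      proof -
        have "w1.lin (w1 \<tau> e) z = (\<Sum>c<m. \<Sum>b<k. of_bool (b = fst e) * (cnj (x (c, fst (\<tau> e))) * z (c, b)))"
          unfolding w1.lin_def sum.cartesian_product
          by (rule sum.cong[OF refl]) (simp add: w1_def split_beta mult.assoc)
        also have "\<dots> = (\<Sum>c<m. cnj (x (c, fst (\<tau> e))) * z (c, fst e))"
        proof (rule sum.cong[OF refl])
          fix c
          have "(\<Sum>b<k. of_bool (b = fst e) * (cnj (x (c, fst (\<tau> e))) * z (c, b)))
            = (\<Sum>b<k. if b = fst e then cnj (x (c, fst (\<tau> e))) * z (c, b) else 0)"
            by (intro sum.cong) auto
          then show "(\<Sum>b<k. of_bool (b = fst e) * (cnj (x (c, fst (\<tau> e))) * z (c, b))) = cnj (x (c, fst (\<tau> e))) * z (c, fst e)"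
            using that by (simp add: mem_Times_iff)
        qed
        finally show ?thesis by (simp add: mult.commute)
      qed
      have "(\<Sum>\<psi>\<in>?F. (\<Prod>e\<in>?J. cnj (z (\<psi> e, fst e))) * minor k d \<psi> x)
        = (\<Sum>\<psi>\<in>?F. \<Sum>\<tau>\<in>?P. co \<tau> * (\<Prod>e\<in>?J. cnj (z (\<psi> e, fst e)) * x (\<psi> e, fst (\<tau> e))))"
        unfolding minor_expand co_def by (simp add: sum_distrib_left prod.distrib mult_ac)
      also have "\<dots> = (\<Sum>\<tau>\<in>?P. co \<tau> * (\<Sum>\<psi>\<in>?F. \<Prod>e\<in>?J. cnj (z (\<psi> e, fst e)) * x (\<psi> e, fst (\<tau> e))))"
        by (subst sum.swap) (simp add: sum_distrib_left)
      also have "\<dots> = (\<Sum>\<tau>\<in>?P. co \<tau> * (\<Prod>e\<in>?J. \<Sum>c<m. cnj (z (c, fst e)) * x (c, fst (\<tau> e))))"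
        by (subst prod_sum_PiE) simp_all
      also have "\<dots> = (\<Sum>\<tau>\<in>?P. co \<tau> * (\<Prod>e\<in>?J. cnj (w1.lin (w1 \<tau> e) z)))"
      proof (rule sum.cong[OF refl])
        fix \<tau>
        have "(\<Prod>e\<in>?J. \<Sum>c<m. cnj (z (c, fst e)) * x (c, fst (\<tau> e))) = (\<Prod>e\<in>?J. cnj (w1.lin (w1 \<tau> e) z))"
          by (rule prod.cong[OF refl]) (rule lin[symmetric])
        then show "co \<tau> * (\<Prod>e\<in>?J. \<Sum>c<m. cnj (z (c, fst e)) * x (c, fst (\<tau> e))) = co \<tau> * (\<Prod>e\<in>?J. cnj (w1.lin (w1 \<tau> e) z))"
          by (simp only:)
      qed
      finally show ?thesis .
    qed
    have lin1: "minor k d \<phi> z = (\<Sum>\<tau>\<in>?P. co \<tau> * (\<Prod>e\<in>?J. w1.lin (u1 \<tau> e) z))" for z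
      unfolding minor_expand co_def
    proof (rule sum.cong[OF refl])
      fix \<tau> assume t: "\<tau> \<in> ?P"
      have "(\<Prod>e\<in>?J. z (\<phi> e, fst (\<tau> e))) = (\<Prod>e\<in>?J. w1.lin (u1 \<tau> e) z)"
        unfolding w1.lin_def u1_def by (rule prod.cong[OF refl]) (rule delta(1)[OF fin(1) in1[OF _ t], symmetric])
      then show "of_int (sign \<tau>) * of_bool (\<forall>e\<in>?J. snd e = snd (\<tau> e)) * (\<Prod>e\<in>?J. z (\<phi> e, fst (\<tau> e)))
        = of_int (sign \<tau>) * of_bool (\<forall>e\<in>?J. snd e = snd (\<tau> e)) * (\<Prod>e\<in>?J. w1.lin (u1 \<tau> e) z)" by (simp only:)
    qed
    have "(\<Sum>\<psi>\<in>?F. kern k d \<phi> \<psi> * minor k d \<psi> x)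
      = (\<Sum>\<psi>\<in>?F. \<Sum>s\<in>I1. c1 s * (minor k d \<phi> (z1 s) * ((\<Prod>e\<in>?J. cnj (z1 s (\<psi> e, fst e))) * minor k d \<psi> x)))"
      by (intro sum.cong refl) (simp add: ker sum_distrib_right mult.assoc)
    also have "\<dots> = (\<Sum>s\<in>I1. c1 s * (minor k d \<phi> (z1 s) *
        (\<Sum>\<psi>\<in>?F. (\<Prod>e\<in>?J. cnj (z1 s (\<psi> e, fst e))) * minor k d \<psi> x)))"
      by (subst sum.swap) (simp add: sum_distrib_left)
    also have "\<dots> = ?V"
      unfolding sub lin1 by (rule w1.wick_sums[OF finJ finP])
    finally show ?thesis .
  qed
  \<comment> \<open>The same value from the k by k matrix z: the minor of x z is paired with det z ^
    d, and \<open>minor_mult\<close> separates the minor of x.\<close>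
  have R: "(\<Sum>s\<in>I2. c2 s * (minor k d \<phi> x * det (mat k k (z2 s)) ^ d * cnj (det (mat k k (z2 s)) ^ d))) = ?V"
  proof -
    have lin2: "minor k d \<phi> x * det (mat k k z) ^ d = (\<Sum>\<tau>\<in>?P. co \<tau> * (\<Prod>e\<in>?J. w2.lin (u2 \<tau> e) z))" for z
    proof -
      let ?xz = "\<lambda>v. \<Sum>j<k. x (fst v, j) * z (j, snd v)"
      have "minor k d \<phi> x * det (mat k k z) ^ d = minor k d \<phi> ?xz"
        by (rule minor_mult[OF \<phi>, symmetric]) simp
      also have "\<dots> = (\<Sum>\<tau>\<in>?P. co \<tau> * (\<Prod>e\<in>?J. w2.lin (u2 \<tau> e) z))"
        unfolding minor_expand co_def
      proof (rule sum.cong[OF refl])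
        fix \<tau> assume \<tau>P: "\<tau> \<in> ?P"
        have "?xz (\<phi> e, fst (\<tau> e)) = w2.lin (u2 \<tau> e) z" if "e \<in> ?J" for e
        proof -
          note t = \<tau>P that
        have "w2.lin (u2 \<tau> e) z = (\<Sum>j<k. \<Sum>b<k. of_bool (b = fst (\<tau> e)) * (x (\<phi> e, j) * z (j, b)))"
          unfolding w2.lin_def sum.cartesian_product
          by (rule sum.cong[OF refl]) (simp add: u2_def split_beta mult.assoc)
        also have "\<dots> = (\<Sum>j<k. x (\<phi> e, j) * z (j, fst (\<tau> e)))"
        proof (rule sum.cong[OF refl])
          fix j
          have "(\<Sum>b<k. of_bool (b = fst (\<tau> e)) * (x (\<phi> e, j) * z (j, b)))
            = (\<Sum>b<k. if b = fst (\<tau> e) then x (\<phi> e, j) * z (j, b) else 0)"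
            by (intro sum.cong) auto
          then show "(\<Sum>b<k. of_bool (b = fst (\<tau> e)) * (x (\<phi> e, j) * z (j, b))) = x (\<phi> e, j) * z (j, fst (\<tau> e))"
            using \<tau>[OF t] by simp
        qed
          finally show ?thesis by simp
        qed
        then have "(\<Prod>e\<in>?J. ?xz (\<phi> e, fst (\<tau> e))) = (\<Prod>e\<in>?J. w2.lin (u2 \<tau> e) z)"
          by (rule prod.cong[OF refl])
        then show "of_int (sign \<tau>) * of_bool (\<forall>e\<in>?J. snd e = snd (\<tau> e)) * (\<Prod>e\<in>?J. ?xz (\<phi> e, fst (\<tau> e)))
          = of_int (sign \<tau>) * of_bool (\<forall>e\<in>?J. snd e = snd (\<tau> e)) * (\<Prod>e\<in>?J. w2.lin (u2 \<tau> e) z)" by (simp only:)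
      qed
      finally show ?thesis .
    qed
    have cnj2: "cnj (det (mat k k z) ^ d) = (\<Sum>\<tau>\<in>?P. co \<tau> * (\<Prod>e\<in>?J. cnj (w2.lin (w2 \<tau> e) z)))" for z
    proof -
      have "cnj (of_int (sign \<tau>)) * cnj (of_bool (\<forall>e\<in>?J. snd e = snd (\<tau> e))) = co \<tau>" for \<tau>
        by (simp add: co_def of_bool_def)
      moreover have "(\<Prod>e\<in>?J. cnj (z (fst (\<tau> e), fst e))) = (\<Prod>e\<in>?J. cnj (w2.lin (w2 \<tau> e) z))" if t: "\<tau> \<in> ?P" for \<tau>
        unfolding w2.lin_def w2_def
        by (rule prod.cong[OF refl]) (rule arg_cong[where f = cnj], rule delta(1)[OF fin(2) in2[OF _ t], symmetric])
      ultimately show ?thesis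
        unfolding det_expand_transpose cnj_sum complex_cnj_mult cnj_prod
        by (intro sum.cong[OF refl]) (simp only:)
    qed
    show ?thesis unfolding lin2 cnj2 V2 by (rule w2.wick_sums[OF finJ finP])
  qed
  have N: "(\<Sum>s\<in>I2. c2 s * (det (mat k k (z2 s)) ^ d * cnj (det (mat k k (z2 s)) ^ d))) = (\<Sum>\<psi>\<in>?J \<rightarrow>\<^sub>E {..<k}. tsum k d \<psi>)"
  proof -
    have sq: "det (mat k k (\<lambda>(b, b'). \<Sum>c<k. 1 * cnj (z (c, b)) * z (c, b'))) = det (mat k k z) * cnj (det (mat k k z))" for z
    proof -
      have Y: "mat k k z \<in> carrier_mat k k" by simp
      have "mat k k (\<lambda>(b, b'). \<Sum>c<k. 1 * cnj (z (c, b)) * z (c, b')) = mat_adjoint (mat k k z) * mat k k z"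
        using mat_adjoint_carrier[OF Y]
        by (intro eq_matI) (auto simp: scalar_prod_def atLeast0LessThan mat_adjoint_index[OF Y])
      then show ?thesis
        using det_mult[OF mat_adjoint_carrier[OF Y] Y] det_mat_adjoint[OF Y] by (simp add: mult.commute)
    qed
    show ?thesis
      using wick_gram_dets[OF W2 order_refl, of "\<lambda>_ _. 1"] unfolding sq by (simp add: power_mult_distrib)
  qed
  have "?V = (\<Sum>s\<in>I2. c2 s * (minor k d \<phi> x * det (mat k k (z2 s)) ^ d * cnj (det (mat k k (z2 s)) ^ d)))"
    by (rule R[symmetric])
  also have "\<dots> = minor k d \<phi> x * (\<Sum>s\<in>I2. c2 s * (det (mat k k (z2 s)) ^ d * cnj (det (mat k k (z2 s)) ^ d)))"
    unfolding sum_distrib_left by (rule sum.cong[OF refl]) (simp only: mult_ac)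
  finally show ?thesis unfolding L N by (simp only: mult.commute)
qed

section \<open>Traces of idempotent kernels\<close>

lemma mult_mat_index:
  assumes "X \<in> carrier_mat n m" "Y \<in> carrier_mat m l" "i < n" "j < l"
  shows "(X * Y) $$ (i, j) = (\<Sum>p<m. X $$ (i, p) * (Y $$ (p, j) :: complex))"
  using assms by (simp add: scalar_prod_def atLeast0LessThan)

text \<open>The nonzero spectrum of an idempotent \<open>A * B\<close> is that of \<open>B * A\<close>, of size \<open>D\<close>.\<close>

lemma mtrace_idempotent_factor:
  assumes A: "A \<in> carrier_mat m D" and B: "B \<in> carrier_mat D m" and idem: "(A * B) * (A * B) = A * B"
  obtains q :: nat where "q \<le> D" "mtrace m (A * B) = of_nat q"
proof -
  define Q where "Q = B * A"
  have Q: "Q \<in> carrier_mat D D" using A B by (simp add: Q_def)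
  have AB: "A * B \<in> carrier_mat m m" using A B by simp
  have BAB: "B * (A * B) \<in> carrier_mat D m" using B AB by simp
  have QQ: "Q * Q = B * (A * B) * A"
    using A B AB BAB by (simp add: Q_def assoc_mult_mat[of _ D m _ D _ D] assoc_mult_mat[of _ D m _ m _ D] assoc_mult_mat[of _ m D _ m _ D])
  have "Q * Q * Q = B * (A * B) * A * (B * A)" by (simp only: QQ) (simp only: Q_def)
  also have "\<dots> = B * (A * B) * (A * (B * A))"
    by (rule assoc_mult_mat[OF BAB A mult_carrier_mat[OF B A]])
  also have "A * (B * A) = A * B * A" by (rule assoc_mult_mat[OF A B A, symmetric])
  also have "B * (A * B) * (A * B * A) = B * (A * B) * (A * B) * A"
    by (rule assoc_mult_mat[OF BAB AB A, symmetric])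
  also have "B * (A * B) * (A * B) = B * ((A * B) * (A * B))" by (rule assoc_mult_mat[OF B AB AB])
  also have "\<dots> * A = Q * Q" by (simp only: idem QQ)
  \<comment> \<open>B * A itself need not be idempotent, but its cube equals its square, which
    confines its eigenvalues to 0 and 1.\<close>
  finally have QQQ: "Q * Q * Q = Q * Q" .
  obtain P R U where S: "P \<in> carrier_mat D D" "R \<in> carrier_mat D D" "U \<in> carrier_mat D D"
    "P * R = 1\<^sub>m D" "R * P = 1\<^sub>m D" "Q = P * U * R" "upper_triangular U"
    and ev: "\<And>i. i < D \<Longrightarrow> eigenvalue Q (U $$ (i, i))"
    by (rule schur_form[OF Q]) (rule that)
  have 01: "U $$ (i, i) = of_bool (U $$ (i, i) = 1)" if i: "i < D" for i
  proof -
    let ?l = "U $$ (i, i)"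
    obtain v where v: "v \<in> carrier_vec D" "v \<noteq> 0\<^sub>v D" "Q *\<^sub>v v = ?l \<cdot>\<^sub>v v"
      using ev[OF i] Q by (auto simp: eigenvalue_def eigenvector_def)
    have step: "Q *\<^sub>v (c \<cdot>\<^sub>v v) = (c * ?l) \<cdot>\<^sub>v v" for c
      using mult_mat_vec[OF Q v(1), of c] v(3) by (simp add: smult_smult_assoc)
    have v2: "(Q * Q) *\<^sub>v v = (?l * ?l) \<cdot>\<^sub>v v"
      using assoc_mult_mat_vec[OF Q Q v(1)] step v(3) by simp
    have "(Q * Q * Q) *\<^sub>v v = (Q * Q) *\<^sub>v (?l \<cdot>\<^sub>v v)"
      using assoc_mult_mat_vec[OF mult_carrier_mat[OF Q Q] Q v(1)] v(3) by simp
    also have "\<dots> = Q *\<^sub>v (Q *\<^sub>v (?l \<cdot>\<^sub>v v))" by (rule assoc_mult_mat_vec[OF Q Q]) (use v in simp)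
    also have "\<dots> = (?l * ?l * ?l) \<cdot>\<^sub>v v" by (simp only: step)
    finally have "(?l * ?l * ?l) \<cdot>\<^sub>v v = (?l * ?l) \<cdot>\<^sub>v v" by (simp only: QQQ v2)
    note l3 = this
    have "\<exists>j<D. v $ j \<noteq> 0"
    proof (rule ccontr)
      assume "\<not> (\<exists>j<D. v $ j \<noteq> 0)"
      then have "v = 0\<^sub>v D" using v(1) by (intro eq_vecI) auto
      then show False using v(2) by simp
    qed
    then obtain j where j: "j < D" "v $ j \<noteq> 0" by auto
    have "(?l * ?l * ?l) * v $ j = (?l * ?l) * v $ j"
      using arg_cong[OF l3, of "\<lambda>w. w $ j"] v(1) j(1) by simp
    then have "?l = 0 \<or> ?l = 1" using j by simp
    then show ?thesis by auto
  qed
  have "mtrace m (A * B) = mtrace D Q" unfolding Q_def by (rule mtrace_comm[OF A B])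
  also have "\<dots> = mtrace D U" unfolding S(6) by (rule mtrace_schur[OF S(1,2,3,5)])
  also have "\<dots> = (\<Sum>i<D. of_bool (U $$ (i, i) = 1))"
    unfolding mtrace_def by (intro sum.cong refl) (rule 01, simp)
  also have "\<dots> = of_nat (card ({..<D} \<inter> {i. U $$ (i, i) = 1}))"
    by simp
  finally have "mtrace m (A * B) = of_nat (card ({..<D} \<inter> {i. U $$ (i, i) = 1}))" .
  moreover have "card ({..<D} \<inter> {i. U $$ (i, i) = 1}) \<le> card {..<D}" by (rule card_mono) auto
  ultimately show ?thesis by (intro that) simp_all
qed

text \<open>P / N is an idempotent matrix that factors through the index set S. In the application P
  is a block of \<open>kern\<close>, N the normalising constant, and S a set of monomials.\<close>

lemma trace_idempotent_kernel:
  fixes P :: "'i \<Rightarrow> 'i \<Rightarrow> complex"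
  assumes fin: "finite I" "finite S" and N: "N \<noteq> 0"
    and factor: "\<And>i j. i \<in> I \<Longrightarrow> j \<in> I \<Longrightarrow> P i j = (\<Sum>s\<in>S. a s i * b s j)"
    and idem: "\<And>i j. i \<in> I \<Longrightarrow> j \<in> I \<Longrightarrow> (\<Sum>l\<in>I. P i l * P l j) = N * P i j"
  obtains q :: nat where "q \<le> card S" "(\<Sum>i\<in>I. P i i) = N * of_nat q"
proof -
  let ?m = "card I" and ?D = "card S"
  obtain f where f: "bij_betw f {..<?m} I" using ex_bij_betw_nat_finite[OF fin(1)] by (auto simp: atLeast0LessThan)
  obtain g where g: "bij_betw g {..<?D} S" using ex_bij_betw_nat_finite[OF fin(2)] by (auto simp: atLeast0LessThan)
  have fI: "f i \<in> I" if "i < ?m" for i using bij_betwE[OF f] that by simp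
  define A where "A = mat ?m ?D (\<lambda>(i, s). a (g s) (f i) / N)"
  define B where "B = mat ?D ?m (\<lambda>(s, j). b (g s) (f j))"
  have AB: "A \<in> carrier_mat ?m ?D" "B \<in> carrier_mat ?D ?m" by (simp_all add: A_def B_def)
  have entry: "(A * B) $$ (i, j) = P (f i) (f j) / N" if "i < ?m" "j < ?m" for i j
  proof -
    have "(A * B) $$ (i, j) = (\<Sum>s<?D. a (g s) (f i) / N * b (g s) (f j))"
      using that by (simp add: A_def B_def scalar_prod_def atLeast0LessThan)
    also have "\<dots> = (\<Sum>s\<in>S. a s (f i) / N * b s (f j))" by (rule sum.reindex_bij_betw[OF g])
    finally show ?thesis using that by (simp add: factor fI sum_divide_distrib)
  qed
  have c: "A * B \<in> carrier_mat ?m ?m" using AB by simp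
  have "(A * B) * (A * B) = A * B"
  proof (rule eq_matI)
    fix i j assume "i < dim_row (A * B)" "j < dim_col (A * B)"
    then have ij: "i < ?m" "j < ?m" using c by auto
    have "((A * B) * (A * B)) $$ (i, j) = (\<Sum>l<?m. (A * B) $$ (i, l) * (A * B) $$ (l, j))"
      by (rule mult_mat_index[OF c c ij])
    also have "\<dots> = (\<Sum>l<?m. P (f i) (f l) * P (f l) (f j) / N\<^sup>2)"
      using ij by (intro sum.cong refl) (simp add: entry power2_eq_square del: index_mult_mat)
    also have "\<dots> = (\<Sum>l<?m. (\<lambda>l. P (f i) l * P l (f j)) (f l)) / N\<^sup>2" by (simp add: sum_divide_distrib)
    also have "(\<Sum>l<?m. (\<lambda>l. P (f i) l * P l (f j)) (f l)) = N * P (f i) (f j)"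
      using idem[OF fI fI] ij by (subst sum.reindex_bij_betw[OF f]) simp
    also have "\<dots> / N\<^sup>2 = (A * B) $$ (i, j)" using N by (simp add: entry ij power2_eq_square del: index_mult_mat)
    finally show "((A * B) * (A * B)) $$ (i, j) = (A * B) $$ (i, j)" .
  qed (use c in auto)
  then obtain q where q: "q \<le> ?D" "mtrace ?m (A * B) = of_nat q"
    by (rule mtrace_idempotent_factor[OF AB])
  have "mtrace ?m (A * B) = (\<Sum>i<?m. (\<lambda>i. P i i / N) (f i))"
    unfolding mtrace_def by (intro sum.cong refl) (simp add: entry del: index_mult_mat)
  also have "\<dots> = (\<Sum>i\<in>I. P i i) / N" by (subst sum.reindex_bij_betw[OF f]) (simp add: sum_divide_distrib)
  finally have "(\<Sum>i\<in>I. P i i) = N * of_nat q" using q(2) N by (simp add: field_simps)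
  then show ?thesis by (rule that[OF q(1)])
qed

section \<open>Polynomial coordinates for the span of the minors\<close>

abbreviation exponents :: "nat \<Rightarrow> nat \<Rightarrow> (nat \<times> nat \<Rightarrow> nat) set" where
  "exponents k n \<equiv> grid k k \<rightarrow>\<^sub>E {..n}"

text \<open>Values below k are rows of the upper half of a 2k by k matrix; n is the power of \<rho>
  to which these maps contribute.\<close>

abbreviation top_maps :: "nat \<Rightarrow> nat \<Rightarrow> nat \<Rightarrow> (nat \<times> nat \<Rightarrow> nat) set" where
  "top_maps k d n \<equiv> {\<phi> \<in> grid k d \<rightarrow>\<^sub>E {..<2 * k}. card {e \<in> grid k d. \<phi> e < k} = n}"

text \<open>The 2k by k matrix with upper half Y and the identity as lower half.\<close>

definition pad :: "nat \<Rightarrow> (nat \<times> nat \<Rightarrow> complex) \<Rightarrow> nat \<times> nat \<Rightarrow> complex" where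
  "pad k Y = (\<lambda>v. if fst v < k then Y v else of_bool (fst v - k = snd v))"

text \<open>A map in \<open>top_maps k d n\<close> selects exactly n factors from the upper half, so
  the minor has degree n in the k * k entries of Y. Letting every exponent range over 0, ..., n
  gives the count (n + 1) ^ (k * k).\<close>

lemma minor_pad:
  obtains a where "\<And>\<phi> Y. \<phi> \<in> top_maps k d n \<Longrightarrow>
    minor k d \<phi> (pad k Y) = (\<Sum>\<alpha>\<in>exponents k n. a \<alpha> \<phi> * (\<Prod>v\<in>grid k k. Y v ^ \<alpha> v))"
proof -
  let ?J = "grid k d"
  let ?P = "{p. p permutes ?J}"
  \<comment> \<open>The exponent of the entry v of Y in the term of \<tau>; cells sent to the lower
    half contribute the 0/1 factors collected in \<open>co\<close>.\<close>
  define ex where "ex = (\<lambda>\<phi> \<tau>. \<lambda>v\<in>grid k k. card {e \<in> {e \<in> ?J. \<phi> e < k}. (\<phi> e, fst (\<tau> e :: nat \<times> nat)) = v})"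
  define co where "co = (\<lambda>\<phi> \<tau>. of_int (sign \<tau>) * of_bool (\<forall>e\<in>?J. snd e = snd (\<tau> e)) *
    (\<Prod>e\<in>{e \<in> ?J. \<not> \<phi> e < k}. of_bool (\<phi> e - k = fst (\<tau> e))) :: complex)"
  have "minor k d \<phi> (pad k Y) = (\<Sum>\<alpha>\<in>exponents k n. (\<Sum>\<tau>\<in>{\<tau> \<in> ?P. ex \<phi> \<tau> = \<alpha>}. co \<phi> \<tau>) * (\<Prod>v\<in>grid k k. Y v ^ \<alpha> v))"
    if \<phi>: "\<phi> \<in> top_maps k d n" for \<phi> Y
  proof -
    have finP: "finite ?P" by (simp add: finite_permutations)
    have mon: "(\<Prod>e\<in>?J. pad k Y (\<phi> e, fst (\<tau> e))) = (\<Prod>v\<in>grid k k. Y v ^ ex \<phi> \<tau> v) *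
      (\<Prod>e\<in>{e \<in> ?J. \<not> \<phi> e < k}. of_bool (\<phi> e - k = fst (\<tau> e)))" if \<tau>: "\<tau> \<in> ?P" for \<tau>
    proof -
      have "(\<Prod>e\<in>?J. pad k Y (\<phi> e, fst (\<tau> e)))
        = (\<Prod>e\<in>{e \<in> ?J. \<phi> e < k}. pad k Y (\<phi> e, fst (\<tau> e))) * (\<Prod>e\<in>{e \<in> ?J. \<not> \<phi> e < k}. pad k Y (\<phi> e, fst (\<tau> e)))"
        by (subst prod.union_disjoint[symmetric]) (auto intro!: prod.cong)
      also have "(\<Prod>e\<in>{e \<in> ?J. \<not> \<phi> e < k}. pad k Y (\<phi> e, fst (\<tau> e)))
        = (\<Prod>e\<in>{e \<in> ?J. \<not> \<phi> e < k}. of_bool (\<phi> e - k = fst (\<tau> e)))"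
        by (intro prod.cong refl) (simp add: pad_def)
      also have "(\<Prod>e\<in>{e \<in> ?J. \<phi> e < k}. pad k Y (\<phi> e, fst (\<tau> e))) = (\<Prod>e\<in>{e \<in> ?J. \<phi> e < k}. Y (\<phi> e, fst (\<tau> e)))"
        by (intro prod.cong refl) (simp add: pad_def)
      also have "\<dots> = (\<Prod>v\<in>grid k k. \<Prod>e\<in>{e \<in> {e \<in> ?J. \<phi> e < k}. (\<phi> e, fst (\<tau> e)) = v}. Y (\<phi> e, fst (\<tau> e)))"
      proof (rule prod.group[symmetric])
        show "(\<lambda>e. (\<phi> e, fst (\<tau> e))) ` {e \<in> ?J. \<phi> e < k} \<subseteq> grid k k"
        proof
          fix v assume "v \<in> (\<lambda>e. (\<phi> e, fst (\<tau> e))) ` {e \<in> ?J. \<phi> e < k}"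
          then obtain e where e: "e \<in> ?J" "\<phi> e < k" "v = (\<phi> e, fst (\<tau> e))" by blast
          have "\<tau> e \<in> ?J" using \<tau> e(1) permutes_in_image[of \<tau> ?J e] by blast
          then show "v \<in> grid k k" using e by (simp add: mem_Times_iff)
        qed
      qed simp_all
      also have "\<dots> = (\<Prod>v\<in>grid k k. Y v ^ ex \<phi> \<tau> v)"
        by (intro prod.cong refl) (simp add: ex_def)
      finally show ?thesis .
    qed
    have ex: "ex \<phi> \<tau> \<in> exponents k n" for \<tau>
    proof -
      have "card {e \<in> {e \<in> ?J. \<phi> e < k}. (\<phi> e, fst (\<tau> e)) = v} \<le> card {e \<in> ?J. \<phi> e < k}" for v
        by (rule card_mono) auto
      then show ?thesis using \<phi> by (auto simp: ex_def)
    qed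
    have "minor k d \<phi> (pad k Y) = (\<Sum>\<tau>\<in>?P. co \<phi> \<tau> * (\<Prod>v\<in>grid k k. Y v ^ ex \<phi> \<tau> v))"
      unfolding minor_expand co_def by (intro sum.cong refl) (simp add: mon mult_ac)
    also have "\<dots> = (\<Sum>\<alpha>\<in>exponents k n. \<Sum>\<tau>\<in>{\<tau> \<in> ?P. ex \<phi> \<tau> = \<alpha>}. co \<phi> \<tau> * (\<Prod>v\<in>grid k k. Y v ^ ex \<phi> \<tau> v))"
      by (rule sum.group[symmetric]) (use finP ex in \<open>auto intro: finite_PiE\<close>)
    also have "\<dots> = (\<Sum>\<alpha>\<in>exponents k n. (\<Sum>\<tau>\<in>{\<tau> \<in> ?P. ex \<phi> \<tau> = \<alpha>}. co \<phi> \<tau>) * (\<Prod>v\<in>grid k k. Y v ^ \<alpha> v))"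
      unfolding sum_distrib_right by (intro sum.cong refl) simp
    finally show ?thesis .
  qed
  then show ?thesis by (rule that[of "\<lambda>\<alpha> \<phi>. \<Sum>\<tau>\<in>{\<tau> \<in> ?P. ex \<phi> \<tau> = \<alpha>}. co \<phi> \<tau>"])
qed

text \<open>Since \<open>minor k d \<phi> (x * W) = minor k d \<phi> x * det W ^ d\<close>, a point with invertible lower half may be
  normalised to \<open>pad k Y\<close>; singular lower halves are reached by interpolation along \<open>W + t\<close>.\<close>

lemma minor_coordinates:
  obtains a where "\<And>z. \<exists>c. \<forall>\<phi>\<in>top_maps k d n. minor k d \<phi> z = (\<Sum>\<alpha>\<in>exponents k n. a \<alpha> \<phi> * c \<alpha>)"
proof -
  obtain a where a: "\<And>\<phi> Y. \<phi> \<in> top_maps k d n \<Longrightarrow>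
    minor k d \<phi> (pad k Y) = (\<Sum>\<alpha>\<in>exponents k n. a \<alpha> \<phi> * (\<Prod>v\<in>grid k k. Y v ^ \<alpha> v))"
    by (rule minor_pad[of k d n]) (rule that)
  have "\<exists>c. \<forall>\<phi>\<in>top_maps k d n. minor k d \<phi> z = (\<Sum>\<alpha>\<in>exponents k n. a \<alpha> \<phi> * c \<alpha>)" for z
  proof -
    define T where "T = mat k k z"
    define W where "W = mat k k (\<lambda>(j, b). z (k + j, b))"
    have TW: "T \<in> carrier_mat k k" "W \<in> carrier_mat k k" by (simp_all add: T_def W_def)
    define V where "V = (\<lambda>t. W + t \<cdot>\<^sub>m 1\<^sub>m k)"
    have V: "V t \<in> carrier_mat k k" for t using TW by (simp add: V_def)
    \<comment> \<open>z with t added on the diagonal of its lower half, which becomes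
      \<open>V t\<close>.\<close>
    define x where "x = (\<lambda>t v. z v + (if fst v < k then 0 else t * of_bool (fst v - k = snd v)))"
    have "infinite (- {t. det (V t) = 0})"
      using finite_singular_shifts[OF TW(2)] infinite_UNIV_char_0[where 'a = complex]
      by (simp add: Compl_eq_Diff_UNIV V_def)
    \<comment> \<open>One node more than d * k, which bounds the degree in t of a product of d
      minors of size k.\<close>
    then obtain A where A: "finite A" "card A = Suc (d * (k * 1))" "A \<subseteq> - {t. det (V t) = 0}"
      using infinite_arbitrarily_large by blast
    obtain l :: "complex \<Rightarrow> complex poly" where l: "\<And>p. degree p \<le> d * (k * 1) \<Longrightarrow>
        p = (\<Sum>t\<in>A. Polynomial.smult (poly p t) (l t))"
        and "\<And>t. degree (l t) \<le> d * (k * 1)"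
      by (rule lagrange_interpolation[OF A(1,2)]) (rule that)
    define Y where "Y = (\<lambda>t v. (T * ((1 / det (V t)) \<cdot>\<^sub>m adj_mat (V t))) $$ v)"
    have norm: "minor k d \<phi> (x t) = minor k d \<phi> (pad k (Y t)) * det (V t) ^ d"
      if "t \<in> A" and \<phi>: "\<phi> \<in> top_maps k d n" for \<phi> t
    proof -
      have D: "det (V t) \<noteq> 0" using that(1) A(3) by auto
      let ?R = "(1 / det (V t)) \<cdot>\<^sub>m adj_mat (V t)"
      note adj = adj_mat[OF V[of t]]
      have R: "?R \<in> carrier_mat k k" using adj(1) by simp
      have inv: "?R * V t = 1\<^sub>m k"
        unfolding mult_smult_assoc_mat[OF adj(1) V] adj(3) using D by (simp add: smult_smult_mat one_smult_mat)
      have TRV: "T * ?R * V t = T"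
        using assoc_mult_mat[OF TW(1) R V[of t]] inv TW by (simp add: square_mat)
      have "minor k d \<phi> (x t) = minor k d \<phi> (pad k (Y t)) * det (mat k k (\<lambda>v. V t $$ v)) ^ d"
      proof (rule minor_mult)
        show "\<phi> \<in> grid k d \<rightarrow>\<^sub>E {..<2 * k}" using \<phi> by simp
        fix c b assume c: "c < 2 * k" and b: "b < k"
        show "x t (c, b) = (\<Sum>j<k. pad k (Y t) (c, j) * V t $$ (j, b))"
        proof (cases "c < k")
          case True
          have "(\<Sum>j<k. pad k (Y t) (c, j) * V t $$ (j, b)) = (\<Sum>j<k. (T * ?R) $$ (c, j) * V t $$ (j, b))"
            using True by (simp add: pad_def Y_def)
          also have "\<dots> = (T * ?R * V t) $$ (c, b)"
            by (rule mult_mat_index[OF mult_carrier_mat[OF TW(1) R] V True b, symmetric])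
          also have "\<dots> = z (c, b)" unfolding TRV using True b by (simp add: T_def)
          finally show ?thesis using True by (simp add: x_def)
        next
          case False
          have "(\<Sum>j<k. pad k (Y t) (c, j) * V t $$ (j, b)) = (\<Sum>j<k. if j = c - k then V t $$ (j, b) else 0)"
            using False by (intro sum.cong refl) (auto simp: pad_def)
          also have "\<dots> = V t $$ (c - k, b)" using False c by simp
          also have "\<dots> = x t (c, b)" using False b c by (simp add: V_def x_def W_def)
          finally show ?thesis by simp
        qed
      qed
      also have "mat k k (\<lambda>v. V t $$ v) = V t" using V[of t] by (intro eq_matI) auto
      finally show ?thesis .
    qed
    have lin: "polyfun 1 (\<lambda>t. u + v * t)" for u v
      using polyfun_add[OF polyfun_const polyfun_cmult[OF polyfun_ident]] by simp
    \<comment> \<open>The coordinates are interpolated from the nodes to t = 0. Nodes, basis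
      polynomials and \<open>Y t\<close> depend on z only, so the same coordinates serve every
      \<phi>.\<close>
    have main: "minor k d \<phi> z = (\<Sum>\<alpha>\<in>exponents k n. a \<alpha> \<phi> *
      (\<Sum>t\<in>A. det (V t) ^ d * poly (l t) 0 * (\<Prod>v\<in>grid k k. Y t v ^ \<alpha> v)))" if \<phi>: "\<phi> \<in> top_maps k d n" for \<phi>
    proof -
      have pd: "polyfun (k * 1) (\<lambda>t. det (mat k k (\<lambda>(a, b). x t (\<phi> (a, i), b))))" for i
      proof (rule polyfun_det)
        fix p q assume pq: "p < k" "q < k"
        let ?v = "(\<phi> (p, i), q)"
        have "mat k k (\<lambda>(a, b). x t (\<phi> (a, i), b)) $$ (p, q)
          = z ?v + (if fst ?v < k then 0 else of_bool (fst ?v - k = snd ?v)) * t" for t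
          using pq by (simp add: x_def)
        then show "polyfun 1 (\<lambda>t. mat k k (\<lambda>(a, b). x t (\<phi> (a, i), b)) $$ (p, q))" by (simp only: lin)
      qed simp
      have "polyfun (d * (k * 1)) (\<lambda>t. minor k d \<phi> (x t))"
        unfolding minor_def using polyfun_prod[of "{..<d}" "k * 1", OF _ pd] by simp
      then obtain p where p: "degree p \<le> d * (k * 1)" and p0: "\<forall>t. minor k d \<phi> (x t) = poly p t"
        unfolding polyfun_def by (elim exE conjE) (rule that)
      have "x 0 = z" by (rule ext) (simp add: x_def)
      then have "minor k d \<phi> z = poly p 0" using spec[OF p0, of 0] by simp
      also have "\<dots> = (\<Sum>t\<in>A. poly p t * poly (l t) 0)"
        using arg_cong[OF l[OF p], of "\<lambda>p. poly p 0"] by (simp only: poly_sum poly_smult)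
      also have "\<dots> = (\<Sum>t\<in>A. \<Sum>\<alpha>\<in>exponents k n. a \<alpha> \<phi> * (det (V t) ^ d * poly (l t) 0 * (\<Prod>v\<in>grid k k. Y t v ^ \<alpha> v)))"
      proof (rule sum.cong[OF refl])
        fix t assume t: "t \<in> A"
        have e: "poly p t = (\<Sum>\<alpha>\<in>exponents k n. a \<alpha> \<phi> * (\<Prod>v\<in>grid k k. Y t v ^ \<alpha> v)) * det (V t) ^ d"
          using norm[OF t \<phi>] a[OF \<phi>] spec[OF p0, of t] by simp
        show "poly p t * poly (l t) 0 = (\<Sum>\<alpha>\<in>exponents k n. a \<alpha> \<phi> * (det (V t) ^ d * poly (l t) 0 * (\<Prod>v\<in>grid k k. Y t v ^ \<alpha> v)))"
          unfolding e sum_distrib_right by (rule sum.cong[OF refl]) (simp only: mult_ac)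
      qed
      also have "\<dots> = (\<Sum>\<alpha>\<in>exponents k n. a \<alpha> \<phi> *
        (\<Sum>t\<in>A. det (V t) ^ d * poly (l t) 0 * (\<Prod>v\<in>grid k k. Y t v ^ \<alpha> v)))"
        by (subst sum.swap) (simp add: sum_distrib_left)
      finally show ?thesis .
    qed
    show ?thesis
    proof (rule exI, rule ballI)
      fix \<phi> assume "\<phi> \<in> top_maps k d n"
      from main[OF this] show "minor k d \<phi> z = (\<Sum>\<alpha>\<in>exponents k n. a \<alpha> \<phi> *
        (\<lambda>\<alpha>. \<Sum>t\<in>A. det (V t) ^ d * poly (l t) 0 * (\<Prod>v\<in>grid k k. Y t v ^ \<alpha> v)) \<alpha>)" .
    qed
  qed
  then show ?thesis by (rule that)
qed

text \<open>A nonzero term requires a permutation \<beta> with \<phi> o \<beta> = \<psi> on the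
  grid. Hence \<open>kern\<close> is block diagonal with respect to the sets
  \<open>top_maps\<close>.\<close>

lemma kern_top:
  assumes "kern k d \<phi> \<psi> \<noteq> 0"
  shows "card {e \<in> grid k d. \<psi> e < k} = card {e \<in> grid k d. \<phi> e < k}"
proof -
  let ?J = "grid k d"
  let ?s = "\<lambda>\<tau>. \<Sum>\<beta> | \<beta> permutes ?J. of_bool (\<forall>e\<in>?J. \<phi> (\<beta> e) = \<psi> e \<and> fst (\<tau> (\<beta> e)) = fst e) :: complex"
  obtain \<tau> where "of_int (sign \<tau>) * of_bool (\<forall>e\<in>?J. snd e = snd (\<tau> e)) * ?s \<tau> \<noteq> 0"
    using assms unfolding kern_def by (rule sum.not_neutral_contains_not_neutral)
  then have "?s \<tau> \<noteq> 0" by (rule contrapos_nn) (simp only: mult_zero_right)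
  then obtain \<beta> where "\<beta> \<in> {\<beta>. \<beta> permutes ?J}" "of_bool (\<forall>e\<in>?J. \<phi> (\<beta> e) = \<psi> e \<and> fst (\<tau> (\<beta> e)) = fst e) \<noteq> (0 :: complex)"
    by (rule sum.not_neutral_contains_not_neutral)
  then have \<beta>: "\<beta> permutes ?J" and b: "of_bool (\<forall>e\<in>?J. \<phi> (\<beta> e) = \<psi> e \<and> fst (\<tau> (\<beta> e)) = fst e) \<noteq> (0 :: complex)"
    by (simp_all only: mem_Collect_eq simp_thms not_False_eq_True)
  have all: "\<forall>e\<in>?J. \<phi> (\<beta> e) = \<psi> e \<and> fst (\<tau> (\<beta> e)) = fst e"
    using b unfolding of_bool_def by (rule contrapos_np) (rule if_not_P)
  have \<phi>\<beta>: "\<phi> (\<beta> e) = \<psi> e" if "e \<in> ?J" for e using bspec[OF all that] by (rule conjunct1)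
  have "bij_betw \<beta> {e \<in> ?J. \<psi> e < k} {e \<in> ?J. \<phi> e < k}"
  proof (rule bij_betw_subset[OF permutes_bij[OF \<beta>]])
    show "\<beta> ` {e \<in> ?J. \<psi> e < k} = {e \<in> ?J. \<phi> e < k}"
    proof (rule equalityI; rule subsetI)
      fix e assume "e \<in> {e \<in> ?J. \<phi> e < k}"
      then have e: "e \<in> \<beta> ` ?J" "\<phi> e < k" by (simp_all only: permutes_image[OF \<beta>] mem_Collect_eq)
      from e(1) obtain e' where e': "e = \<beta> e'" "e' \<in> ?J" by (rule imageE)
      have "\<psi> e' < k" using e(2) \<phi>\<beta>[OF e'(2)] by (simp only: e'(1))
      with e' show "e \<in> \<beta> ` {e \<in> ?J. \<psi> e < k}" by (simp only: image_eqI mem_Collect_eq)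
    next
      fix e assume "e \<in> \<beta> ` {e \<in> ?J. \<psi> e < k}"
      then obtain e' where e': "e = \<beta> e'" "e' \<in> {e \<in> ?J. \<psi> e < k}" by (rule imageE)
      then have "e' \<in> ?J" "\<psi> e' < k" by (simp_all only: mem_Collect_eq)
      then show "e \<in> {e \<in> ?J. \<phi> e < k}"
        using \<phi>\<beta> iffD2[OF permutes_in_image[OF \<beta>]] by (simp only: e'(1) mem_Collect_eq)
    qed
  qed simp
  then show ?thesis by (rule bij_betw_same_card)
qed

text \<open>Divided by the normalising constant, \<open>kern\<close> is idempotent by the
  reproducing property, and by \<open>kern_top\<close> so is each block. The block of n factors
  through \<open>exponents k n\<close>, and its trace is the sum of the \<open>tsum\<close> by
  \<open>kern_self\<close>; thus q is the trace of an idempotent and bounded by the number of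
  exponents.\<close>

lemma tsum_top_total:
  obtains q :: nat where "q \<le> (n + 1) ^ (k * k)"
    "(\<Sum>\<phi>\<in>top_maps k d n. tsum k d \<phi>) = (\<Sum>\<phi>\<in>grid k d \<rightarrow>\<^sub>E {..<k}. tsum k d \<phi>) * of_nat q"
proof -
  let ?J = "grid k d"
  let ?F = "?J \<rightarrow>\<^sub>E {..<2 * k}" and ?Fn = "top_maps k d n"
  let ?N = "\<Sum>\<phi>\<in>?J \<rightarrow>\<^sub>E {..<k}. tsum k d \<phi>"
  have finF: "finite ?F" by (auto intro: finite_PiE)
  then have finFn: "finite ?Fn" by simp
  have finE: "finite (exponents k n)" by (auto intro: finite_PiE)
  obtain I and c :: "(nat \<times> nat \<Rightarrow> nat \<times> nat) \<Rightarrow> complex" and z :: "(nat \<times> nat \<Rightarrow> nat \<times> nat) \<Rightarrow> nat \<times> nat \<Rightarrow> complex"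
    where I: "finite I" and W: "wick (grid (2 * k) k) (k * d) (\<lambda>F a. (\<Sum>s\<in>I. c s * F (z s)) = a)"
    by (rule finite_wick[OF finite_cartesian_product[OF finite_lessThan finite_lessThan]]) (rule that)
  have ker: "kern k d \<phi> \<psi> = (\<Sum>s\<in>I. c s * (minor k d \<phi> (z s) * (\<Prod>e\<in>?J. cnj (z s (\<psi> e, fst e)))))"
    if "\<phi> \<in> ?F" "\<psi> \<in> ?F" for \<phi> \<psi>
    using kern_wick[OF W order_refl that] by (simp only: minor_expand)
  obtain a where "\<And>z. \<exists>c. \<forall>\<phi>\<in>?Fn. minor k d \<phi> z = (\<Sum>\<alpha>\<in>exponents k n. a \<alpha> \<phi> * c \<alpha>)"
    by (rule minor_coordinates[of k d n]) (rule that)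
  then have "\<forall>z. \<exists>c. \<forall>\<phi>\<in>?Fn. minor k d \<phi> z = (\<Sum>\<alpha>\<in>exponents k n. a \<alpha> \<phi> * c \<alpha>)" by (rule allI)
  from choice[OF this] obtain C
    where C0: "\<forall>z. \<forall>\<phi>\<in>?Fn. minor k d \<phi> z = (\<Sum>\<alpha>\<in>exponents k n. a \<alpha> \<phi> * C z \<alpha>)" by (rule exE)
  have C: "minor k d \<phi> z = (\<Sum>\<alpha>\<in>exponents k n. a \<alpha> \<phi> * C z \<alpha>)" if "\<phi> \<in> ?Fn" for \<phi> z
    by (rule bspec[OF spec[OF C0] that])
  have idem: "(\<Sum>\<psi>\<in>?F. kern k d \<phi> \<psi> * kern k d \<psi> \<omega>) = ?N * kern k d \<phi> \<omega>" if "\<phi> \<in> ?F" "\<omega> \<in> ?F" for \<phi> \<omega>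
  proof -
    let ?m = "\<lambda>s. \<Prod>e\<in>?J. cnj (z s (\<omega> e, fst e))"
    have "(\<Sum>\<psi>\<in>?F. kern k d \<phi> \<psi> * kern k d \<psi> \<omega>)
      = (\<Sum>\<psi>\<in>?F. \<Sum>s\<in>I. c s * ?m s * (kern k d \<phi> \<psi> * minor k d \<psi> (z s)))"
      by (intro sum.cong refl) (simp add: ker[OF _ that(2)] sum_distrib_left mult_ac)
    also have "\<dots> = (\<Sum>s\<in>I. c s * ?m s * (\<Sum>\<psi>\<in>?F. kern k d \<phi> \<psi> * minor k d \<psi> (z s)))"
      by (subst sum.swap) (simp add: sum_distrib_left)
    also have "\<dots> = ?N * kern k d \<phi> \<omega>"
      unfolding kern_reproducing[OF that(1)] ker[OF that]
      by (subst sum_distrib_left) (rule sum.cong[OF refl], simp only: mult_ac)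
    finally show ?thesis .
  qed
  have idem_top: "(\<Sum>\<psi>\<in>?Fn. kern k d \<phi> \<psi> * kern k d \<psi> \<omega>) = ?N * kern k d \<phi> \<omega>" if "\<phi> \<in> ?Fn" "\<omega> \<in> ?Fn" for \<phi> \<omega>
  proof -
    have "(\<Sum>\<psi>\<in>?Fn. kern k d \<phi> \<psi> * kern k d \<psi> \<omega>) = (\<Sum>\<psi>\<in>?F. kern k d \<phi> \<psi> * kern k d \<psi> \<omega>)"
    proof (rule sum.mono_neutral_left[OF finF])
      show "\<forall>\<psi>\<in>?F - ?Fn. kern k d \<phi> \<psi> * kern k d \<psi> \<omega> = 0"
      proof
        fix \<psi> assume "\<psi> \<in> ?F - ?Fn"
        then have "kern k d \<phi> \<psi> = 0" using kern_top[of k d \<phi> \<psi>] that(1) by auto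
        then show "kern k d \<phi> \<psi> * kern k d \<psi> \<omega> = 0" by simp
      qed
    qed auto
    then show ?thesis using idem[of \<phi> \<omega>] that by simp
  qed
  have factor: "kern k d \<phi> \<psi> = (\<Sum>\<alpha>\<in>exponents k n. a \<alpha> \<phi> * (\<Sum>s\<in>I. c s * C (z s) \<alpha> * (\<Prod>e\<in>?J. cnj (z s (\<psi> e, fst e)))))"
    if "\<phi> \<in> ?Fn" "\<psi> \<in> ?Fn" for \<phi> \<psi>
  proof -
    have F: "\<phi> \<in> ?F" "\<psi> \<in> ?F" using that by simp_all
    show ?thesis
      unfolding ker[OF F] C[OF that(1)] sum_distrib_left sum_distrib_right
      by (subst sum.swap) (simp only: mult_ac)
  qed
  have N0: "?N \<noteq> 0"
  proof
    assume "?N = 0"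
    then show False using tsum_total_pos(1)[of k d] by simp
  qed
  obtain q where "q \<le> card (exponents k n)" "(\<Sum>\<phi>\<in>?Fn. kern k d \<phi> \<phi>) = ?N * of_nat q"
    by (rule trace_idempotent_kernel[OF finFn finE N0 factor idem_top]) (assumption | rule that)+
  moreover have "card (exponents k n) = (n + 1) ^ (k * k)" by (simp add: card_PiE)
  ultimately show ?thesis by (intro that[of q]) (simp_all only: kern_self)
qed

section \<open>Moments for a fixed matrix\<close>

lemma prod_const_on:
  assumes "finite J"
  shows "(\<Prod>e\<in>J. if P e then c else 1) = (c :: complex) ^ card {e \<in> J. P e}"
proof -
  have "(\<Prod>e\<in>J. if P e then c else 1) = (\<Prod>e\<in>{e \<in> J. P e}. c)"
    by (rule prod.mono_neutral_cong_right) (use assms in auto)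
  then show ?thesis by simp
qed

text \<open>Group the maps by the number n of cells sent to the upper half; each map of the group
  carries the weight c ^ n.\<close>

lemma tsum_weighted_total:
  obtains q :: "nat \<Rightarrow> nat" where "\<And>n. q n \<le> (n + 1) ^ (k * k)"
    "\<And>c. (\<Sum>\<phi>\<in>grid k d \<rightarrow>\<^sub>E {..<2 * k}. (\<Prod>e\<in>grid k d. if \<phi> e < k then c else 1) * tsum k d \<phi>)
      = (\<Sum>\<phi>\<in>grid k d \<rightarrow>\<^sub>E {..<k}. tsum k d \<phi>) * (\<Sum>n\<le>k * d. c ^ n * of_nat (q n))"
proof -
  let ?J = "grid k d"
  let ?F = "?J \<rightarrow>\<^sub>E {..<2 * k}" and ?N = "\<Sum>\<phi>\<in>grid k d \<rightarrow>\<^sub>E {..<k}. tsum k d \<phi>"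
  have "\<forall>n. \<exists>q. q \<le> (n + 1) ^ (k * k) \<and> (\<Sum>\<phi>\<in>top_maps k d n. tsum k d \<phi>) = ?N * of_nat q"
  proof
    fix n
    obtain q :: nat where "q \<le> (n + 1) ^ (k * k)" "(\<Sum>\<phi>\<in>top_maps k d n. tsum k d \<phi>) = ?N * of_nat q"
      by (rule tsum_top_total) (rule that)
    then show "\<exists>q. q \<le> (n + 1) ^ (k * k) \<and> (\<Sum>\<phi>\<in>top_maps k d n. tsum k d \<phi>) = ?N * of_nat q"
      by (intro exI conjI)
  qed
  from choice[OF this] obtain q where
    q: "\<forall>n. q n \<le> (n + 1) ^ (k * k) \<and> (\<Sum>\<phi>\<in>top_maps k d n. tsum k d \<phi>) = ?N * of_nat (q n)"
    by (rule exE)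
  have finF: "finite ?F" by (auto intro: finite_PiE)
  have finJ: "finite ?J" by simp
  have "(\<Sum>\<phi>\<in>?F. (\<Prod>e\<in>?J. if \<phi> e < k then c else 1) * tsum k d \<phi>) = ?N * (\<Sum>n\<le>k * d. c ^ n * of_nat (q n))" for c
  proof -
    have card: "card {e \<in> ?J. \<phi> e < k} \<in> {..k * d}" for \<phi> :: "nat \<times> nat \<Rightarrow> nat"
      using card_mono[OF finJ, of "{e \<in> ?J. \<phi> e < k}"] by simp
    have "(\<Sum>\<phi>\<in>?F. (\<Prod>e\<in>?J. if \<phi> e < k then c else 1) * tsum k d \<phi>)
      = (\<Sum>\<phi>\<in>?F. c ^ card {e \<in> ?J. \<phi> e < k} * tsum k d \<phi>)"
      by (simp only: prod_const_on[OF finJ])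
    also have "\<dots> = (\<Sum>n\<le>k * d. \<Sum>\<phi>\<in>{\<phi> \<in> ?F. card {e \<in> ?J. \<phi> e < k} = n}. c ^ card {e \<in> ?J. \<phi> e < k} * tsum k d \<phi>)"
      by (rule sum.group[symmetric]) (use finF card in auto)
    also have "\<dots> = (\<Sum>n\<le>k * d. c ^ n * (\<Sum>\<phi>\<in>top_maps k d n. tsum k d \<phi>))"
      unfolding sum_distrib_left by (intro sum.cong refl) simp
    also have "\<dots> = (\<Sum>n\<le>k * d. ?N * (c ^ n * of_nat (q n)))"
    proof (rule sum.cong[OF refl])
      fix n
      show "c ^ n * (\<Sum>\<phi>\<in>top_maps k d n. tsum k d \<phi>) = ?N * (c ^ n * of_nat (q n))"
        unfolding spec[OF q, THEN conjunct2] by (simp only: mult_ac)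
    qed
    finally show ?thesis by (simp only: sum_distrib_left)
  qed
  then show ?thesis by (rule that[rotated]) (rule spec[OF q, THEN conjunct1])
qed

text \<open>The mean eigenvalue \<rho> of A times its adjoint, written as a normalised squared
  Frobenius norm.\<close>

definition fro :: "nat \<Rightarrow> complex mat \<Rightarrow> real" where
  "fro d A = (\<Sum>i<d. \<Sum>j<d. (cmod (A $$ (i, j)))\<^sup>2) / d"

lemma mtrace_mult_adjoint:
  assumes A: "A \<in> carrier_mat d d"
  shows "mtrace d (A * mat_adjoint A) = complex_of_real (\<Sum>i<d. \<Sum>j<d. (cmod (A $$ (i, j)))\<^sup>2)"
  unfolding mtrace_mult_eq[OF A mat_adjoint_carrier[OF A]] of_real_sum
  by (intro sum.cong refl) (simp add: mat_adjoint_index[OF A] complex_norm_square del: of_real_power)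

context haar
begin

lemma bm_det_one_plus:
  assumes A: "A \<in> carrier_mat d d"
  shows "bm (\<lambda>V. det (1\<^sub>m d + V * A))"
proof (rule bm_det[where n = d])
  show "1\<^sub>m d + V * A \<in> carrier_mat d d" if "V \<in> unitary_group d" for V
    using unitaryD(1)[OF that] A by (simp add: square_mat)
  fix i j assume ij: "i < d" "j < d"
  show "bm (\<lambda>V. (1\<^sub>m d + V * A) $$ (i, j))"
  proof (rule bm_cong)
    show "bm (\<lambda>V. of_bool (i = j) + (\<Sum>l<d. V $$ (i, l) * A $$ (l, j)))"
      by (intro bm_add bm_const bm_sum finite_lessThan bm_mult bm_entry) (use ij in simp_all)
    fix V assume "V \<in> unitary_group d"
    then show "of_bool (i = j) + (\<Sum>l<d. V $$ (i, l) * A $$ (l, j)) = (1\<^sub>m d + V * A) $$ (i, j)"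
      using unitaryD(1)[of V d] A ij by (auto simp: scalar_prod_def atLeast0LessThan)
  qed
qed

lemma of_real_norm_power: "complex_of_real (cmod z ^ (2 * k)) = z ^ k * cnj (z ^ k)"
  unfolding complex_norm_square[symmetric] by (simp add: norm_power power_mult[symmetric] mult.commute)

text \<open>\<open>haar_gauss\<close> is applied to a Schur form of A times its adjoint,
  \<open>gaussian_gram_le\<close> replaces the eigenvalues by their mean \<open>fro d A\<close>, and
  the positive constant of \<open>tsum_total_pos\<close> is divided out.\<close>

lemma moment_invertible:
  assumes A: "A \<in> carrier_mat d d" "det A \<noteq> 0" and d: "0 < d"
  shows "(\<integral>\<^sup>+V. ennreal (cmod (det (1\<^sub>m d + V * A)) ^ (2 * k)) \<partial>\<mu>)
    \<le> ennreal (\<Sum>n\<le>k * d. fro d A ^ n * real ((n + 1) ^ (k * k)))"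
proof -
  let ?D = "\<lambda>V. cmod (det (1\<^sub>m d + V * A)) ^ (2 * k)"
  let ?J = "grid k d"
  let ?N = "\<Sum>\<phi>\<in>grid k d \<rightarrow>\<^sub>E {..<k}. tsum k d \<phi>"
  note Ac = mat_adjoint_carrier[OF A(1)]
  have AA: "A * mat_adjoint A \<in> carrier_mat d d" using A Ac by (simp add: square_mat)
  obtain P Q B where S: "P \<in> carrier_mat d d" "Q \<in> carrier_mat d d" "B \<in> carrier_mat d d"
    "P * Q = 1\<^sub>m d" "Q * P = 1\<^sub>m d" "A * mat_adjoint A = P * B * Q" "upper_triangular B"
    and ev: "\<And>i. i < d \<Longrightarrow> eigenvalue (A * mat_adjoint A) (B $$ (i, i))"
    by (rule schur_form[OF AA]) (rule that)
  have B: "B = Q * (A * mat_adjoint A) * P"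
  proof -
    have "Q * (P * B * Q) * P = (Q * P) * B * (Q * P)"
      using S(1-3) by (simp add: assoc_mult_mat[of _ d d _ d _ d] square_mat)
    then show ?thesis unfolding S(6) using S by (simp add: square_mat)
  qed
  define y where "y = (\<lambda>i. Re (B $$ (i, i)))"
  have y: "0 \<le> y i" "B $$ (i, i) = complex_of_real (y i)" if i: "i < d" for i
  proof -
    obtain e where "0 \<le> e" "B $$ (i, i) = complex_of_real e"
      using ev[OF i] eigenvalue_adjoint_mult[OF Ac, of "B $$ (i, i)"] unfolding mat_adjoint_adjoint[OF A(1)] by blast
    then show "0 \<le> y i" "B $$ (i, i) = complex_of_real (y i)" by (simp_all add: y_def)
  qed
  have mean: "(\<Sum>i<d. y i) / d = fro d A"
  proof -
    have "complex_of_real (\<Sum>i<d. y i) = mtrace d B"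
      unfolding mtrace_def of_real_sum by (rule sum.cong[OF refl]) (simp add: y(2))
    also have "\<dots> = mtrace d (A * mat_adjoint A)" unfolding S(6) by (rule mtrace_schur[OF S(1-3,5), symmetric])
    also have "\<dots> = complex_of_real (\<Sum>i<d. \<Sum>j<d. (cmod (A $$ (i, j)))\<^sup>2)" by (rule mtrace_mult_adjoint[OF A(1)])
    finally have "(\<Sum>i<d. y i) = (\<Sum>i<d. \<Sum>j<d. (cmod (A $$ (i, j)))\<^sup>2)" by (simp only: of_real_eq_iff)
    then show ?thesis by (simp only: fro_def)
  qed
  have bm: "bm (\<lambda>V. det (1\<^sub>m d + V * A) ^ k * cnj (det (1\<^sub>m d + V * A) ^ k))"
    by (intro bm_mult bm_cnj bm_power bm_det_one_plus A)
  have intD: "integrable \<mu> ?D"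
    using bm_integrable[OF bm] unfolding of_real_norm_power[symmetric] by (simp only: complex_of_real_integrable_eq)
  have I: "(\<integral>V. det (1\<^sub>m d + A * V) ^ k * cnj (det (1\<^sub>m d + A * V) ^ k) \<partial>\<mu>) = complex_of_real (\<integral>V. ?D V \<partial>\<mu>)"
    unfolding integral_complex_of_real[symmetric]
  proof (rule Bochner_Integration.integral_cong[OF refl])
    fix V assume "V \<in> space \<mu>"
    then have V: "V \<in> unitary_group d" by simp
    note Vu = unitaryD[OF V]
    note V' = mat_adjoint_carrier[OF Vu(1)]
    \<comment> \<open>A V and V A are conjugate under V; this passes from the order of the duality
      to the one in which left translations act.\<close>
    have "mat_adjoint V * (V * A) * V = A * V"
      using unitary_cancel(1)[OF V A(1)] by simp
    then have "det (1\<^sub>m d + A * V) = det (1\<^sub>m d + V * A)"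
      using det_one_plus_conj[OF V' Vu(1) Vu(3), of "V * A"] Vu(1) A(1) by (simp add: square_mat)
    then show "det (1\<^sub>m d + A * V) ^ k * cnj (det (1\<^sub>m d + A * V) ^ k) = complex_of_real (?D V)"
      by (simp only: of_real_norm_power)
  qed
  let ?v = "\<lambda>u. \<Sum>\<phi>\<in>?J \<rightarrow>\<^sub>E {..<2 * k}. (\<Prod>e\<in>?J. if \<phi> e < k then u (snd e) else 1) * tsum k d \<phi>"
  have "?N * complex_of_real (\<integral>V. ?D V \<partial>\<mu>)
    = (\<Sum>\<phi>\<in>?J \<rightarrow>\<^sub>E {..<2 * k}. (\<Prod>e\<in>?J. if \<phi> e < k then B $$ (snd e, snd e) else 1) * tsum k d \<phi>)"
    unfolding I[symmetric] by (rule haar_gauss[OF A S(2,1,5,4) B S(7)])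
  also have "\<dots> = (\<Sum>\<phi>\<in>?J \<rightarrow>\<^sub>E {..<2 * k}. (\<Prod>e\<in>?J. if \<phi> e < k then complex_of_real (y (snd e)) else 1) * tsum k d \<phi>)"
  proof (rule sum.cong[OF refl])
    fix \<phi> :: "nat \<times> nat \<Rightarrow> nat"
    have "(\<Prod>e\<in>?J. if \<phi> e < k then B $$ (snd e, snd e) else 1) = (\<Prod>e\<in>?J. if \<phi> e < k then complex_of_real (y (snd e)) else 1)"
      by (rule prod.cong[OF refl]) (simp add: mem_Times_iff y(2) split: if_split)
    then show "(\<Prod>e\<in>?J. if \<phi> e < k then B $$ (snd e, snd e) else 1) * tsum k d \<phi>
      = (\<Prod>e\<in>?J. if \<phi> e < k then complex_of_real (y (snd e)) else 1) * tsum k d \<phi>" by (simp only:)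
  qed
  finally have eq: "?N * complex_of_real (\<integral>V. ?D V \<partial>\<mu>)
    = (\<Sum>\<phi>\<in>?J \<rightarrow>\<^sub>E {..<2 * k}. (\<Prod>e\<in>?J. if \<phi> e < k then complex_of_real (y (snd e)) else 1) * tsum k d \<phi>)" .
  have "Re (?N * complex_of_real (\<integral>V. ?D V \<partial>\<mu>))
    \<le> Re (\<Sum>\<phi>\<in>?J \<rightarrow>\<^sub>E {..<2 * k}. (\<Prod>e\<in>?J. if \<phi> e < k then complex_of_real (fro d A) else 1) * tsum k d \<phi>)"
    using gaussian_gram_le[where y = y and k = k, OF y(1) d] unfolding mean eq .
  moreover obtain q where q: "\<And>n. q n \<le> (n + 1) ^ (k * k)" and
    tot: "\<And>c. (\<Sum>\<phi>\<in>?J \<rightarrow>\<^sub>E {..<2 * k}. (\<Prod>e\<in>?J. if \<phi> e < k then c else 1) * tsum k d \<phi>) = ?N * (\<Sum>n\<le>k * d. c ^ n * of_nat (q n))"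
    by (rule tsum_weighted_total[of k d]) (rule that)
  ultimately have le: "Re (?N * complex_of_real (\<integral>V. ?D V \<partial>\<mu>)) \<le> Re (?N * (\<Sum>n\<le>k * d. complex_of_real (fro d A) ^ n * of_nat (q n)))"
    by (simp only:)
  have "(\<Sum>n\<le>k * d. complex_of_real (fro d A) ^ n * of_nat (q n)) = complex_of_real (\<Sum>n\<le>k * d. fro d A ^ n * real (q n))"
    by simp
  with le have "Re ?N * (\<integral>V. ?D V \<partial>\<mu>) \<le> Re ?N * (\<Sum>n\<le>k * d. fro d A ^ n * real (q n))"
    by (simp only: times_complex.simps Re_complex_of_real Im_complex_of_real mult_zero_right diff_zero)
  then have "(\<integral>V. ?D V \<partial>\<mu>) \<le> (\<Sum>n\<le>k * d. fro d A ^ n * real (q n))"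
    using tsum_total_pos(1)[of k d] by (simp only: mult_le_cancel_left_pos)
  also have "\<dots> \<le> (\<Sum>n\<le>k * d. fro d A ^ n * real ((n + 1) ^ (k * k)))"
  proof (intro sum_mono mult_left_mono)
    fix n show "real (q n) \<le> real ((n + 1) ^ (k * k))" using q[of n] by (rule of_nat_mono)
    show "0 \<le> fro d A ^ n" by (simp add: fro_def sum_nonneg)
  qed
  finally have "ennreal (\<integral>V. ?D V \<partial>\<mu>) \<le> ennreal (\<Sum>n\<le>k * d. fro d A ^ n * real ((n + 1) ^ (k * k)))"
    by (rule ennreal_leI)
  moreover have "(\<integral>\<^sup>+V. ennreal (?D V) \<partial>\<mu>) = ennreal (\<integral>V. ?D V \<partial>\<mu>)"
    by (rule nn_integral_eq_integral[OF intD]) simp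
  ultimately show ?thesis by simp
qed

text \<open>A + 1 / (m + 1) is invertible for all large m. Fatou's lemma transfers the bound to A,
  as its right-hand side is continuous in A.\<close>

lemma moment_le:
  assumes A: "A \<in> carrier_mat d d" and d: "0 < d"
  shows "(\<integral>\<^sup>+V. ennreal (cmod (det (1\<^sub>m d + V * A)) ^ (2 * k)) \<partial>\<mu>)
    \<le> ennreal (\<Sum>n\<le>k * d. fro d A ^ n * real ((n + 1) ^ (k * k)))"
proof -
  define X where "X = (\<lambda>m. A + complex_of_real (inverse (real (Suc m))) \<cdot>\<^sub>m 1\<^sub>m d)"
  have X: "X m \<in> carrier_mat d d" for m using A by (simp add: X_def)
  have lim0: "(\<lambda>m. inverse (real (Suc m))) \<longlonglongrightarrow> 0" by (rule LIMSEQ_inverse_real_of_nat)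
  then have "filterlim (\<lambda>m. inverse (real (Suc m))) (at 0) sequentially"
    by (rule filterlim_atI) (auto intro: always_eventually)
  from eventually_compose_filterlim[OF eventually_shift_invertible[OF A] this]
  have inv: "\<forall>\<^sub>F m in sequentially. det (X m) \<noteq> 0" by (simp only: X_def)
  have XA: "(\<lambda>m. X m $$ (i, j)) \<longlonglongrightarrow> A $$ (i, j)" if "i < d" "j < d" for i j
  proof -
    have "(\<lambda>m. A $$ (i, j) + complex_of_real (inverse (real (Suc m))) * of_bool (i = j)) \<longlonglongrightarrow> A $$ (i, j) + complex_of_real 0 * of_bool (i = j)"
      by (intro tendsto_intros lim0)
    moreover have "(\<lambda>m. X m $$ (i, j)) = (\<lambda>m. A $$ (i, j) + complex_of_real (inverse (real (Suc m))) * of_bool (i = j))"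
      using that A by (auto simp: X_def)
    ultimately show ?thesis by simp
  qed
  let ?f = "\<lambda>A V. ennreal (cmod (det (1\<^sub>m d + V * A)) ^ (2 * k))"
  let ?b = "\<lambda>A. ennreal (\<Sum>n\<le>k * d. fro d A ^ n * real ((n + 1) ^ (k * k)))"
  have blim: "(\<lambda>m. ?b (X m)) \<longlonglongrightarrow> ?b A"
    unfolding fro_def by (intro tendsto_intros XA) (use d in auto)
  have flim: "(\<lambda>m. ?f (X m) V) \<longlonglongrightarrow> ?f A V" if V: "V \<in> unitary_group d" for V
  proof -
    note Vc = unitaryD(1)[OF V]
    have entry: "(1\<^sub>m d + V * Y) $$ (i, j) = of_bool (i = j) + (\<Sum>l<d. V $$ (i, l) * Y $$ (l, j))"
      if "i < d" "j < d" "Y \<in> carrier_mat d d" for i j Y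
      using Vc that by (auto simp: scalar_prod_def atLeast0LessThan)
    have "(\<lambda>m. det (1\<^sub>m d + V * X m)) \<longlonglongrightarrow> det (1\<^sub>m d + V * A)"
    proof (rule tendsto_det)
      show "1\<^sub>m d + V * X m \<in> carrier_mat d d" for m using Vc X by (simp add: square_mat)
      show "1\<^sub>m d + V * A \<in> carrier_mat d d" using Vc A by (simp add: square_mat)
      fix i j assume ij: "i < d" "j < d"
      show "(\<lambda>m. (1\<^sub>m d + V * X m) $$ (i, j)) \<longlonglongrightarrow> (1\<^sub>m d + V * A) $$ (i, j)"
        unfolding entry[OF ij A] entry[OF ij X] by (intro tendsto_intros XA) (use ij in auto)
    qed
    then show ?thesis by (intro tendsto_intros)
  qed
  have meas: "?f Y \<in> borel_measurable \<mu>" if "Y \<in> carrier_mat d d" for Y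
  proof -
    have "(\<lambda>V. det (1\<^sub>m d + V * Y)) \<in> borel_measurable \<mu>" using bm_det_one_plus[OF that] by (simp add: bm_def)
    then show ?thesis by measurable
  qed
  have "(\<integral>\<^sup>+V. ?f A V \<partial>\<mu>) = (\<integral>\<^sup>+V. liminf (\<lambda>m. ?f (X m) V) \<partial>\<mu>)"
  proof (rule nn_integral_cong)
    fix V assume "V \<in> space \<mu>"
    then have "V \<in> unitary_group d" by simp
    from lim_imp_Liminf[OF sequentially_bot flim[OF this]]
    show "?f A V = liminf (\<lambda>m. ?f (X m) V)" by (rule sym)
  qed
  also have "\<dots> \<le> liminf (\<lambda>m. \<integral>\<^sup>+V. ?f (X m) V \<partial>\<mu>)"
    by (rule nn_integral_liminf) (rule meas[OF X])
  also have "\<dots> \<le> liminf (\<lambda>m. ?b (X m))"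
    by (rule Liminf_mono) (rule eventually_mono[OF inv], rule moment_invertible[OF X _ d])
  also have "\<dots> = ?b A" by (rule lim_imp_Liminf[OF sequentially_bot blim])
  finally show ?thesis .
qed

end

section \<open>The dimension-free series\<close>

text \<open>The ratio of successive terms, t * (1 + 1 / (n + 1)) ^ p, tends to t and is eventually
  below (1 + t) / 2.\<close>

lemma summable_power_poly:
  fixes t :: real
  assumes "0 < t" "t < 1"
  shows "summable (\<lambda>n. t ^ n * real ((n + 1) ^ p))"
proof -
  have "(\<lambda>n. t * (1 + inverse (real (Suc n))) ^ p) \<longlonglongrightarrow> t * (1 + 0) ^ p"
    by (intro tendsto_intros LIMSEQ_inverse_real_of_nat)
  then have "\<forall>\<^sub>F n in sequentially. t * (1 + inverse (real (Suc n))) ^ p < (1 + t) / 2"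
    by (rule order_tendstoD) (use assms in simp)
  then obtain N where N: "\<And>n. n \<ge> N \<Longrightarrow> t * (1 + inverse (real (Suc n))) ^ p < (1 + t) / 2"
    by (auto simp: eventually_sequentially)
  show ?thesis
  proof (rule summable_ratio_test[where c = "(1 + t) / 2" and N = N])
    fix n assume "n \<ge> N"
    have "real (Suc n + 1) = (1 + inverse (real (Suc n))) * real (n + 1)" by (simp add: field_simps)
    then have "t ^ Suc n * real ((Suc n + 1) ^ p) = t * (1 + inverse (real (Suc n))) ^ p * (t ^ n * real ((n + 1) ^ p))"
      by (simp only: of_nat_power power_mult_distrib power_Suc mult_ac)
    also have "\<dots> \<le> (1 + t) / 2 * (t ^ n * real ((n + 1) ^ p))"
      by (rule mult_right_mono[OF less_imp_le[OF N[OF \<open>n \<ge> N\<close>]]]) (use assms in simp)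
    finally show "norm (t ^ Suc n * real ((Suc n + 1) ^ p)) \<le> (1 + t) / 2 * norm (t ^ n * real ((n + 1) ^ p))"
      using assms by simp
  qed (use assms in simp)
qed

text \<open>Bounds the moment for a fixed matrix with \<open>fro d A\<close> at most t: the cut-off
  k * d of the finite sum is removed, and with it the dependence on d.\<close>

definition psum :: "nat \<Rightarrow> real \<Rightarrow> real" where
  "psum k t = (\<Sum>n. t ^ n * real ((n + 1) ^ (k * k)))"

lemma psum_bounds:
  assumes "0 < t" "t < 1"
  shows "(\<Sum>n\<le>m. t ^ n * real ((n + 1) ^ (k * k))) \<le> psum k t" "0 \<le> psum k t"
proof -
  show 1: "(\<Sum>n\<le>m. t ^ n * real ((n + 1) ^ (k * k))) \<le> psum k t" for m
    unfolding psum_def by (rule sum_le_suminf[OF summable_power_poly[OF assms]]) (use assms in auto)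
  have "0 \<le> (\<Sum>n\<le>0. t ^ n * real ((n + 1) ^ (k * k)))" using assms by simp
  then show "0 \<le> psum k t" using 1[of 0] by linarith
qed

text \<open>With M = max 1 (r / t) one has r ^ n \<le> t ^ n * M ^ m for n \<le> m, and M ^ m is at
  most 1 or exp (m (r / t - 1)). The exponential form is chosen because r will be the random
  \<open>fro\<close>, which is a constant plus a sum of traces.\<close>

lemma weighted_sum_le:
  assumes t: "0 < t" "t < 1" and "0 \<le> (r :: real)"
  shows "(\<Sum>n\<le>m. r ^ n * real ((n + 1) ^ (k * k))) \<le> (1 + exp (m * (r / t - 1))) * psum k t"
proof -
  define M where "M = max 1 (r / t)"
  have M: "1 \<le> M" "r \<le> t * M" using t assms(3) by (auto simp: M_def max_def field_simps)
  have "(\<Sum>n\<le>m. r ^ n * real ((n + 1) ^ (k * k))) \<le> (\<Sum>n\<le>m. M ^ m * (t ^ n * real ((n + 1) ^ (k * k))))"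
  proof (rule sum_mono)
    fix n assume "n \<in> {..m}"
    have "r ^ n \<le> (t * M) ^ n" by (rule power_mono[OF M(2) assms(3)])
    also have "\<dots> \<le> t ^ n * M ^ m"
      unfolding power_mult_distrib using t M \<open>n \<in> {..m}\<close> by (intro mult_left_mono power_increasing) auto
    finally have "r ^ n * real ((n + 1) ^ (k * k)) \<le> t ^ n * M ^ m * real ((n + 1) ^ (k * k))"
      by (rule mult_right_mono) simp
    then show "r ^ n * real ((n + 1) ^ (k * k)) \<le> M ^ m * (t ^ n * real ((n + 1) ^ (k * k)))"
      by (simp only: mult_ac)
  qed
  also have "\<dots> \<le> M ^ m * psum k t"
    unfolding sum_distrib_left[symmetric] using psum_bounds(1)[OF t] M by (intro mult_left_mono) auto
  also have "\<dots> \<le> (1 + exp (m * (r / t - 1))) * psum k t"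
  proof (rule mult_right_mono[OF _ psum_bounds(2)[OF t]])
    show "M ^ m \<le> 1 + exp (m * (r / t - 1))"
    proof (cases "r / t \<le> 1")
      case True
      then have "M = 1" by (simp add: M_def)
      then show ?thesis by simp
    next
      case False
      then have "M = r / t" by (simp add: M_def)
      also have "\<dots> \<le> exp (r / t - 1)" using exp_ge_add_one_self[of "r / t - 1"] by simp
      finally have "M ^ m \<le> exp (r / t - 1) ^ m" using M by (intro power_mono) auto
      also have "\<dots> = exp (m * (r / t - 1))" by (rule exp_of_nat_mult[symmetric])
      finally show ?thesis by simp
    qed
  qed
  finally show ?thesis .
qed

section \<open>Averaging over the unitary matrices\<close>

text \<open>|1 + u|^2 = 1 + p with p = 2 Re u + c^2 and c = |u|. For c \<le> 1/8 one has |p| \<le>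
  17/8 c < 1/2, so ln (1 + p) \<ge> p - 2 p^2, and 2 p^2 \<le> 289/32 c^2 \<le> 10 c^2; halving
  gives the constant 5.\<close>

lemma exp_le_norm_one_plus:
  assumes u: "cmod u \<le> 1 / 8"
  shows "exp (Re u - 5 * (cmod u)\<^sup>2) \<le> cmod (1 + u)"
proof -
  define c where "c = cmod u"
  define p where "p = 2 * Re u + c\<^sup>2"
  have c: "0 \<le> c" "c \<le> 1 / 8" using u by (simp_all add: c_def)
  have sq: "(cmod (1 + u))\<^sup>2 = 1 + p"
    unfolding p_def c_def cmod_power2 by (simp add: power2_eq_square algebra_simps)
  have cc: "c\<^sup>2 \<le> c / 8" using mult_left_mono[OF c(2) c(1)] by (simp add: power2_eq_square)
  have "\<bar>p\<bar> \<le> 2 * \<bar>Re u\<bar> + c\<^sup>2" unfolding p_def by (simp add: abs_if)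
  also have "\<dots> \<le> 2 * c + c / 8" using abs_Re_le_cmod[of u] cc by (simp add: c_def)
  finally have p: "\<bar>p\<bar> \<le> 17 / 8 * c" by simp
  then have "p\<^sup>2 \<le> (17 / 8 * c)\<^sup>2" by (intro power2_le_iff_abs_le[THEN iffD2]) (use c in auto)
  also have "(17 / 8 * c)\<^sup>2 = 289 / 64 * c\<^sup>2" by (simp add: power_mult_distrib power_divide)
  finally have pp: "2 * p\<^sup>2 \<le> 10 * c\<^sup>2" using zero_le_power2[of c] by linarith
  have half: "\<bar>p\<bar> \<le> 1 / 2" using p c by linarith
  have "p - 2 * p\<^sup>2 \<le> ln (1 + p)" using abs_ln_one_plus_x_minus_x_bound[OF half] by (simp add: abs_le_iff)
  then have "p - 10 * c\<^sup>2 \<le> ln (1 + p)" using pp by linarith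
  moreover have "2 * (Re u - 5 * c\<^sup>2) \<le> p - 10 * c\<^sup>2" by (simp add: p_def)
  ultimately have "2 * (Re u - 5 * c\<^sup>2) \<le> ln (1 + p)" by linarith
  then have "exp (2 * (Re u - 5 * c\<^sup>2)) \<le> exp (ln (1 + p))" by simp
  also have "\<dots> = 1 + p" using half by (intro exp_ln) linarith
  finally have "(exp (Re u - 5 * c\<^sup>2))\<^sup>2 \<le> (cmod (1 + u))\<^sup>2"
    unfolding sq by (simp only: exp_double)
  then show ?thesis unfolding c_def by (rule power2_le_imp_le) simp
qed

text \<open>Compare |V v| = |v| with |V v| = |e| |v| for an eigenvector v.\<close>

lemma unitary_eigenvalue_norm:
  assumes V: "V \<in> unitary_group n" and ev: "eigenvalue V e"
  shows "cmod e = 1"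
proof -
  note Vu = unitaryD[OF V]
  obtain v where v: "v \<in> carrier_vec n" "v \<noteq> 0\<^sub>v n" "V *\<^sub>v v = e \<cdot>\<^sub>v v"
    using ev Vu(1) by (auto simp: eigenvalue_def eigenvector_def)
  have Vv: "(\<Sum>i<n. V $$ (j, i) * v $ i) = e * v $ j" if "j < n" for j
    using arg_cong[OF v(3), of "\<lambda>w. w $ j"] that Vu(1) v(1) by (simp add: scalar_prod_def atLeast0LessThan)
  have orth: "(\<Sum>j<n. cnj (V $$ (j, i)) * V $$ (j, i')) = of_bool (i = i')" if "i < n" "i' < n" for i i'
    using arg_cong[OF Vu(3), of "\<lambda>W. W $$ (i, i')"] that Vu(1) mat_adjoint_carrier[OF Vu(1)]
    by (simp add: scalar_prod_def atLeast0LessThan mat_adjoint_index[OF Vu(1)])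
  define s where "s = (\<Sum>i<n. (cmod (v $ i))\<^sup>2)"
  have s: "complex_of_real s = (\<Sum>i<n. cnj (v $ i) * v $ i)"
    unfolding s_def of_real_sum by (intro sum.cong refl) (simp only: complex_norm_square mult.commute)
  have "complex_of_real ((cmod e)\<^sup>2 * s) = (\<Sum>j<n. cnj (e * v $ j) * (e * v $ j))"
    unfolding of_real_mult s sum_distrib_left complex_norm_square by (intro sum.cong refl) (simp add: mult_ac)
  also have "\<dots> = (\<Sum>j<n. cnj (\<Sum>i<n. V $$ (j, i) * v $ i) * (\<Sum>i<n. V $$ (j, i) * v $ i))"
    by (intro sum.cong refl) (simp add: Vv)
  also have "\<dots> = (\<Sum>j<n. \<Sum>i<n. \<Sum>i'<n. (cnj (V $$ (j, i)) * V $$ (j, i')) * (cnj (v $ i) * v $ i'))"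
    unfolding cnj_sum sum_product by (intro sum.cong refl) (simp add: mult_ac)
  also have "\<dots> = (\<Sum>i<n. \<Sum>i'<n. \<Sum>j<n. (cnj (V $$ (j, i)) * V $$ (j, i')) * (cnj (v $ i) * v $ i'))"
    by (subst sum.swap) (intro sum.cong refl sum.swap)
  also have "\<dots> = (\<Sum>i<n. \<Sum>i'<n. of_bool (i = i') * (cnj (v $ i) * v $ i'))"
    unfolding sum_distrib_right[symmetric] by (intro sum.cong refl) (simp add: orth)
  also have "\<dots> = (\<Sum>i<n. cnj (v $ i) * v $ i)"
  proof (rule sum.cong[OF refl])
    fix i assume "i \<in> {..<n}"
    moreover have "(\<Sum>i'<n. of_bool (i = i') * (cnj (v $ i) * v $ i')) = (\<Sum>i'<n. if i = i' then cnj (v $ i) * v $ i' else 0)"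
      by (intro sum.cong) auto
    ultimately show "(\<Sum>i'<n. of_bool (i = i') * (cnj (v $ i) * v $ i')) = cnj (v $ i) * v $ i" by simp
  qed
  finally have eq: "(cmod e)\<^sup>2 * s = s" unfolding s[symmetric] by (simp only: of_real_eq_iff)
  have "\<exists>i<n. v $ i \<noteq> 0"
  proof (rule ccontr)
    assume "\<not> (\<exists>i<n. v $ i \<noteq> 0)"
    then have "v = 0\<^sub>v n" using v(1) by (intro eq_vecI) auto
    then show False using v(2) by simp
  qed
  then obtain i where i: "i < n" "v $ i \<noteq> 0" by auto
  have "0 < s" unfolding s_def by (rule sum_pos2[of _ i]) (use i in auto)
  then have "(cmod e)\<^sup>2 = 1\<^sup>2" using eq by simp
  then show ?thesis by (simp only: power2_eq_iff_nonneg[OF norm_ge_zero zero_le_one])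
qed

text \<open>The product of \<open>exp_le_norm_one_plus\<close> over the eigenvalues of V: they have
  modulus 1, so u = w times an eigenvalue has modulus |w|. It turns exponential moments of the trace
  into moments of a determinant.\<close>

lemma exp_trace_le_det:
  assumes V: "V \<in> unitary_group d" and w: "cmod w \<le> 1 / 8"
  shows "exp (Re (w * mtrace d V) - 5 * (cmod w)\<^sup>2 * d) \<le> cmod (det (1\<^sub>m d + V * (w \<cdot>\<^sub>m 1\<^sub>m d)))"
proof -
  note Vc = unitaryD(1)[OF V]
  obtain P Q B where S: "P \<in> carrier_mat d d" "Q \<in> carrier_mat d d" "B \<in> carrier_mat d d"
    "P * Q = 1\<^sub>m d" "Q * P = 1\<^sub>m d" "V = P * B * Q" "upper_triangular B"
    and ev: "\<And>i. i < d \<Longrightarrow> eigenvalue V (B $$ (i, i))"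
    by (rule schur_form[OF Vc]) (rule that)
  have B1: "cmod (w * B $$ (i, i)) = cmod w" if "i < d" for i
    using unitary_eigenvalue_norm[OF V ev[OF that]] by (simp add: norm_mult)
  have tr: "mtrace d V = (\<Sum>i<d. B $$ (i, i))"
    unfolding S(6) mtrace_schur[OF S(1-3,5)] by (rule mtrace_def)
  have "V * (w \<cdot>\<^sub>m 1\<^sub>m d) = w \<cdot>\<^sub>m V"
    unfolding mult_smult_distrib[OF Vc one_carrier_mat] right_mult_one_mat[OF Vc] by (rule refl)
  then have "det (1\<^sub>m d + V * (w \<cdot>\<^sub>m 1\<^sub>m d)) = (\<Prod>i<d. 1 + w * B $$ (i, i))"
    using det_one_plus_schur[OF S(1-4,7), of w] by (simp only: S(6))
  then have "cmod (det (1\<^sub>m d + V * (w \<cdot>\<^sub>m 1\<^sub>m d))) = (\<Prod>i<d. cmod (1 + w * B $$ (i, i)))"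
    by (simp only: prod_norm)
  moreover have "(\<Prod>i<d. exp (Re (w * B $$ (i, i)) - 5 * (cmod w)\<^sup>2)) \<le> (\<Prod>i<d. cmod (1 + w * B $$ (i, i)))"
  proof (rule prod_mono)
    fix i assume "i \<in> {..<d}"
    then have i: "i < d" by simp
    show "0 \<le> exp (Re (w * B $$ (i, i)) - 5 * (cmod w)\<^sup>2) \<and> exp (Re (w * B $$ (i, i)) - 5 * (cmod w)\<^sup>2) \<le> cmod (1 + w * B $$ (i, i))"
      using exp_le_norm_one_plus[of "w * B $$ (i, i)"] w unfolding B1[OF i] by simp
  qed
  moreover have "(\<Prod>i<d. exp (Re (w * B $$ (i, i)) - 5 * (cmod w)\<^sup>2)) = exp (Re (w * mtrace d V) - 5 * (cmod w)\<^sup>2 * d)"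
    unfolding tr exp_sum[symmetric, OF finite_lessThan] sum_distrib_left Re_sum by (simp add: sum_subtractf mult_ac)
  ultimately show ?thesis by simp
qed

text \<open>The sum is at most card P times its largest term, whose exponential occurs on the right.
  Each summand on the right involves a single Z p, so that its mean can be found from one pair of
  unitaries; the 1 covers the case of empty P.\<close>

lemma exp_sum_le:
  fixes Z :: "'a \<Rightarrow> real"
  assumes "finite P"
  shows "exp (\<Sum>p\<in>P. Z p) \<le> 1 + (\<Sum>p\<in>P. exp (card P * Z p))"
proof (cases "P = {}")
  case False
  then have "Max (Z ` P) \<in> Z ` P" using assms by simp
  then obtain q where q: "q \<in> P" "Max (Z ` P) = Z q" by auto
  have "(\<Sum>p\<in>P. Z p) \<le> card P * Z q"
    using sum_bounded_above[of P Z "Z q"] Max_ge[of "Z ` P"] assms q(2) by auto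
  then have "exp (\<Sum>p\<in>P. Z p) \<le> exp (card P * Z q)" by simp
  also have "\<dots> \<le> (\<Sum>p\<in>P. exp (card P * Z p))"
    using assms q(1) by (intro member_le_sum[where f = "\<lambda>p. exp (card P * Z p)"]) auto
  finally show ?thesis by simp
qed simp

lemma ennreal_mult_one_plus_sum:
  assumes "0 \<le> c" "\<And>p. p \<in> P \<Longrightarrow> 0 \<le> f p"
  shows "ennreal (c * (1 + (\<Sum>p\<in>P. f p))) = ennreal c * (1 + (\<Sum>p\<in>P. ennreal (f p)))"
proof -
  have s: "0 \<le> (\<Sum>p\<in>P. f p)" by (rule sum_nonneg) (rule assms(2))
  have "(\<Sum>p\<in>P. ennreal (f p)) = ennreal (\<Sum>p\<in>P. f p)" by (rule sum_ennreal) (rule assms(2))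
  moreover have "1 + ennreal (\<Sum>p\<in>P. f p) = ennreal (1 + (\<Sum>p\<in>P. f p))"
    using ennreal_plus[of 1 "\<Sum>p\<in>P. f p"] s by simp
  ultimately show ?thesis using ennreal_mult[OF assms(1), of "1 + (\<Sum>p\<in>P. f p)"] s by simp
qed

lemma norm_sum_square:
  fixes z :: "'a \<Rightarrow> complex"
  shows "(cmod (\<Sum>j\<in>J. z j))\<^sup>2 = (\<Sum>i\<in>J. \<Sum>j\<in>J. Re (cnj (z i) * z j))"
proof -
  have "complex_of_real ((cmod (\<Sum>j\<in>J. z j))\<^sup>2) = (\<Sum>i\<in>J. cnj (z i)) * (\<Sum>j\<in>J. z j)"
    unfolding complex_norm_square cnj_sum by (rule mult.commute)
  also have "\<dots> = (\<Sum>i\<in>J. \<Sum>j\<in>J. cnj (z i) * z j)" by (rule sum_product)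
  finally have "Re (complex_of_real ((cmod (\<Sum>j\<in>J. z j))\<^sup>2)) = Re (\<Sum>i\<in>J. \<Sum>j\<in>J. cnj (z i) * z j)" by (rule arg_cong)
  then show ?thesis by (simp only: Re_complex_of_real Re_sum)
qed

lemma one_plus_index:
  assumes "X \<in> carrier_mat n n" "i < n" "j < n"
  shows "(1\<^sub>m n + X) $$ (i, j) = of_bool (i = j) + (X $$ (i, j) :: complex)"
  using assms by simp

lemma det_measurable:
  assumes F: "\<And>x. x \<in> space M \<Longrightarrow> F x \<in> carrier_mat d d"
    and "\<And>i j. i < d \<Longrightarrow> j < d \<Longrightarrow> (\<lambda>x. F x $$ (i, j)) \<in> borel_measurable M"
  shows "(\<lambda>x. det (F x) :: complex) \<in> borel_measurable M"
proof -
  have "(\<lambda>x. \<Sum>p | p permutes {0..<d}. signof p * (\<Prod>i = 0..<d. F x $$ (i, p i))) \<in> borel_measurable M"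
  proof (intro borel_measurable_sum borel_measurable_times borel_measurable_const borel_measurable_prod)
    fix p i assume "p \<in> {p. p permutes {0..<d}}" "i \<in> {0..<d}"
    then have "i < d" "p i < d" using permutes_in_image[of p "{0..<d}" i] by auto
    then show "(\<lambda>x. F x $$ (i, p i)) \<in> borel_measurable M" by (rule assms(2))
  qed
  then show ?thesis
    by (rule measurable_cong[THEN iffD2, rotated]) (rule det_def'[OF F])
qed

context haar
begin

lemma mtrace_measurable: "mtrace d \<in> borel_measurable \<mu>"
  unfolding mtrace_def[abs_def] by (intro borel_measurable_sum entry_measurable) auto

lemma exp_trace_moment:
  assumes w: "cmod w \<le> 1 / 8" and d: "0 < d"
  shows "(\<integral>\<^sup>+V. ennreal (exp (real (2 * k) * Re (w * mtrace d V))) \<partial>\<mu>)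
    \<le> ennreal (exp (10 * k * (cmod w)\<^sup>2 * d) * psum k (1 / 4))"
proof -
  let ?A = "w \<cdot>\<^sub>m 1\<^sub>m d" and ?E = "exp (10 * k * (cmod w)\<^sup>2 * d)"
  have A: "?A \<in> carrier_mat d d" by simp
  have meas: "(\<lambda>V. ennreal (cmod (det (1\<^sub>m d + V * ?A)) ^ (2 * k))) \<in> borel_measurable \<mu>"
  proof -
    have "(\<lambda>V. det (1\<^sub>m d + V * ?A)) \<in> borel_measurable \<mu>" using bm_det_one_plus[OF A] by (simp add: bm_def)
    then show ?thesis by measurable
  qed
  have "(\<integral>\<^sup>+V. ennreal (exp (real (2 * k) * Re (w * mtrace d V))) \<partial>\<mu>)
    \<le> (\<integral>\<^sup>+V. ennreal ?E * ennreal (cmod (det (1\<^sub>m d + V * ?A)) ^ (2 * k)) \<partial>\<mu>)"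
  proof (rule nn_integral_mono)
    fix V assume "V \<in> space \<mu>"
    then have V: "V \<in> unitary_group d" by simp
    let ?x = "Re (w * mtrace d V) - 5 * (cmod w)\<^sup>2 * d"
    have "exp (real (2 * k) * Re (w * mtrace d V)) = ?E * exp ?x ^ (2 * k)"
      unfolding exp_of_nat_mult[symmetric] exp_add[symmetric] by (simp add: algebra_simps)
    also have "\<dots> \<le> ?E * cmod (det (1\<^sub>m d + V * ?A)) ^ (2 * k)"
      by (intro mult_left_mono power_mono exp_trace_le_det[OF V w]) simp_all
    finally show "ennreal (exp (real (2 * k) * Re (w * mtrace d V))) \<le> ennreal ?E * ennreal (cmod (det (1\<^sub>m d + V * ?A)) ^ (2 * k))"
      by (simp add: ennreal_mult[symmetric] ennreal_leI)
  qed
  also have "\<dots> = ennreal ?E * (\<integral>\<^sup>+V. ennreal (cmod (det (1\<^sub>m d + V * ?A)) ^ (2 * k)) \<partial>\<mu>)"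
    by (rule nn_integral_cmult[OF meas])
  also have "\<dots> \<le> ennreal ?E * ennreal (psum k (1 / 4))"
  proof (rule mult_left_mono)
    have f: "fro d ?A = (cmod w)\<^sup>2"
    proof -
      have "(\<Sum>i<d. \<Sum>j<d. (cmod (?A $$ (i, j)))\<^sup>2) = (\<Sum>i<d. \<Sum>j<d. if i = j then (cmod w)\<^sup>2 else 0)"
        by (intro sum.cong refl) auto
      also have "\<dots> = d * (cmod w)\<^sup>2" by simp
      finally show ?thesis using d by (simp add: fro_def)
    qed
    \<comment> \<open>The value 1/4 at which \<open>psum\<close> is taken is a convenient number
      between 1/64 and 1.\<close>
    have "(cmod w)\<^sup>2 \<le> (1 / 8)\<^sup>2" by (rule power_mono[OF w]) simp
    then have q: "(cmod w)\<^sup>2 \<le> 1 / 4" by (simp add: power2_eq_square)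
    have "(\<Sum>n\<le>k * d. ((cmod w)\<^sup>2) ^ n * real ((n + 1) ^ (k * k))) \<le> (\<Sum>n\<le>k * d. (1 / 4) ^ n * real ((n + 1) ^ (k * k)))"
      by (intro sum_mono mult_right_mono power_mono q) simp_all
    also have "\<dots> \<le> psum k (1 / 4)" by (rule psum_bounds) simp_all
    finally have "ennreal (\<Sum>n\<le>k * d. fro d ?A ^ n * real ((n + 1) ^ (k * k))) \<le> ennreal (psum k (1 / 4))"
      unfolding f by (rule ennreal_leI)
    then show "(\<integral>\<^sup>+V. ennreal (cmod (det (1\<^sub>m d + V * ?A)) ^ (2 * k)) \<partial>\<mu>) \<le> ennreal (psum k (1 / 4))"
      by (rule order_trans[OF moment_le[OF A d]])
  qed simp
  finally show ?thesis by (simp add: ennreal_mult[symmetric] psum_bounds(2))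
qed

lemma nn_integral_left_mult:
  assumes W: "W \<in> unitary_group d" and f: "f \<in> borel_measurable \<mu>"
  shows "(\<integral>\<^sup>+U. f (W * U) \<partial>\<mu>) = (\<integral>\<^sup>+U. f U \<partial>\<mu>)"
  using nn_integral_distr[OF left_mult_measurable[OF W], of f] f by (simp add: distr_left_mult[OF W])

section \<open>Products of Haar measures\<close>

abbreviation prodm :: "nat \<Rightarrow> (nat \<Rightarrow> complex mat) measure" where
  "prodm g \<equiv> PiM {1..g} (\<lambda>_. \<mu>)"

lemma space_prodm: "U \<in> space (PiM I (\<lambda>_. \<mu>)) \<Longrightarrow> j \<in> I \<Longrightarrow> U j \<in> unitary_group d"
  by (auto simp: space_PiM PiE_def Pi_def)

lemma component_entry_measurable:
  assumes "j \<in> I" "a < d" "b < d"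
  shows "(\<lambda>U. U j $$ (a, b)) \<in> borel_measurable (PiM I (\<lambda>_. \<mu>))"
  by (rule measurable_compose[OF measurable_component_singleton[OF assms(1)] entry_measurable[OF assms(2,3)]])

lemma comb_carrier:
  assumes "U \<in> space (prodm g)"
  shows "matrix_combination d g x U \<in> carrier_mat d d"
    "a < d \<Longrightarrow> b < d \<Longrightarrow> matrix_combination d g x U $$ (a, b) = (\<Sum>j=1..g. x j * U j $$ (a, b))"
  using matrix_combination_entries[of g U d x] unitaryD(1)[OF space_prodm[OF assms]] by auto

lemma comb_measurable:
  assumes "a < d" "b < d"
  shows "(\<lambda>U. matrix_combination d g x U $$ (a, b)) \<in> borel_measurable (prodm g)"
proof -
  have "(\<lambda>U. \<Sum>j=1..g. x j * U j $$ (a, b)) \<in> borel_measurable (prodm g)"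
    by (intro borel_measurable_sum borel_measurable_times borel_measurable_const component_entry_measurable assms)
  then show ?thesis by (rule measurable_cong[THEN iffD2, rotated]) (rule comb_carrier(2)[OF _ assms])
qed

lemma comb_left_mult:
  assumes V: "V \<in> unitary_group d" and U: "U \<in> space (prodm g)"
  shows "matrix_combination d g x (compose {1..g} (\<lambda>W. V * W) U) = V * matrix_combination d g x U"
proof (rule eq_matI)
  note Vc = unitaryD(1)[OF V]
  note c = comb_carrier(1)[OF U, of x]
  have Uc: "U j \<in> carrier_mat d d" if "j \<in> {1..g}" for j
    using unitaryD(1)[OF space_prodm[OF U that]] .
  have e: "matrix_combination d g x (compose {1..g} (\<lambda>W. V * W) U)
    = mat d d (\<lambda>ab. \<Sum>j=1..g. x j * compose {1..g} (\<lambda>W. V * W) U j $$ ab)"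
    by (rule matrix_combination_entries) (use Vc Uc in \<open>simp add: compose_def square_mat\<close>)
  show "dim_row (matrix_combination d g x (compose {1..g} (\<lambda>W. V * W) U)) = dim_row (V * matrix_combination d g x U)"
    "dim_col (matrix_combination d g x (compose {1..g} (\<lambda>W. V * W) U)) = dim_col (V * matrix_combination d g x U)"
    using e c Vc by simp_all
  fix a b assume "a < dim_row (V * matrix_combination d g x U)" "b < dim_col (V * matrix_combination d g x U)"
  then have ab: "a < d" "b < d" using c Vc by auto
  have "matrix_combination d g x (compose {1..g} (\<lambda>W. V * W) U) $$ (a, b) = (\<Sum>j=1..g. x j * (V * U j) $$ (a, b))"
    unfolding e using ab by (simp add: compose_def)
  also have "\<dots> = (\<Sum>j=1..g. \<Sum>l<d. V $$ (a, l) * (x j * U j $$ (l, b)))"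
    by (rule sum.cong[OF refl]) (simp add: mult_mat_index[OF Vc Uc ab] sum_distrib_left mult_ac del: index_mult_mat)
  also have "\<dots> = (\<Sum>l<d. V $$ (a, l) * (\<Sum>j=1..g. x j * U j $$ (l, b)))"
    by (subst sum.swap) (simp add: sum_distrib_left)
  also have "\<dots> = (\<Sum>l<d. V $$ (a, l) * matrix_combination d g x U $$ (l, b))"
    by (rule sum.cong[OF refl]) (simp add: comb_carrier(2)[OF U _ ab(2)])
  also have "\<dots> = (V * matrix_combination d g x U) $$ (a, b)" by (rule mult_mat_index[OF Vc c ab, symmetric])
  finally show "matrix_combination d g x (compose {1..g} (\<lambda>W. V * W) U) $$ (a, b) = (V * matrix_combination d g x U) $$ (a, b)" .
qed

lemma prodm_invariant:
  assumes V: "V \<in> unitary_group d" and f: "f \<in> borel_measurable (prodm g)"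
  shows "(\<integral>\<^sup>+U. f (compose {1..g} (\<lambda>W. V * W) U) \<partial>prodm g) = (\<integral>\<^sup>+U. f U \<partial>prodm g)"
proof -
  have "distr (prodm g) (prodm g) (compose {1..g} (\<lambda>W. V * W)) = PiM {1..g} (\<lambda>_. distr \<mu> \<mu> (\<lambda>W. V * W))"
    by (rule distr_PiM_finite_prob_space') (auto intro: left_mult_measurable[OF V] prob_space_axioms)
  then have "distr (prodm g) (prodm g) (compose {1..g} (\<lambda>W. V * W)) = prodm g"
    by (simp only: distr_left_mult[OF V])
  moreover have "compose {1..g} (\<lambda>W. V * W) \<in> measurable (prodm g) (prodm g)"
    unfolding compose_def[abs_def]
  proof (rule measurable_restrict)
    fix i assume "i \<in> {1..g}"
    from measurable_component_singleton[of i "{1..g}" "\<lambda>_. \<mu>", OF this] left_mult_measurable[OF V]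
    show "(\<lambda>U. V * U i) \<in> measurable (prodm g) \<mu>" by (rule measurable_compose)
  qed
  ultimately show ?thesis using nn_integral_distr[of "compose {1..g} (\<lambda>W. V * W)" "prodm g" "prodm g" f] f by simp
qed

text \<open>The product measure is invariant under simultaneous left multiplication by V, which
  multiplies the combination by V. Averaging the constant left-hand side over V and exchanging the
  integrals leaves, for fixed U, a Haar average as in \<open>moment_le\<close>.\<close>

lemma det_moment_average:
  "(\<integral>\<^sup>+U. ennreal (cmod (det (1\<^sub>m d + matrix_combination d g x U)) ^ (2 * k)) \<partial>prodm g)
    = (\<integral>\<^sup>+U. \<integral>\<^sup>+V. ennreal (cmod (det (1\<^sub>m d + V * matrix_combination d g x U)) ^ (2 * k)) \<partial>\<mu> \<partial>prodm g)"
    (is "?L = _")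
proof -
  let ?A = "matrix_combination d g x"
  let ?h = "\<lambda>V U. ennreal (cmod (det (1\<^sub>m d + V * ?A U)) ^ (2 * k))"
  interpret P: prob_space "prodm g" by (intro prob_space_PiM prob_space_axioms)
  interpret Q: pair_sigma_finite \<mu> "prodm g" by unfold_locales
  have L: "(\<lambda>U. ennreal (cmod (det (1\<^sub>m d + ?A U)) ^ (2 * k))) \<in> borel_measurable (prodm g)"
  proof -
    have "(\<lambda>U. det (1\<^sub>m d + ?A U)) \<in> borel_measurable (prodm g)"
    proof (rule det_measurable)
      show "1\<^sub>m d + ?A U \<in> carrier_mat d d" if "U \<in> space (prodm g)" for U using comb_carrier(1)[OF that] by simp
      fix i j assume ij: "i < d" "j < d"
      have "(\<lambda>U. of_bool (i = j) + ?A U $$ (i, j)) \<in> borel_measurable (prodm g)"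
        by (intro borel_measurable_add borel_measurable_const comb_measurable ij)
      then show "(\<lambda>U. (1\<^sub>m d + ?A U) $$ (i, j)) \<in> borel_measurable (prodm g)"
      proof (rule measurable_cong[THEN iffD2, rotated])
        fix U assume "U \<in> space (prodm g)"
        from comb_carrier(1)[OF this, of x] show "(1\<^sub>m d + ?A U) $$ (i, j) = of_bool (i = j) + ?A U $$ (i, j)"
          using ij by simp
      qed
    qed
    then show ?thesis by measurable
  qed
  have H: "(\<lambda>(V, U). ?h V U) \<in> borel_measurable (\<mu> \<Otimes>\<^sub>M prodm g)"
  proof -
    let ?F = "\<lambda>z. 1\<^sub>m d + fst z * ?A (snd z)"
    have "(\<lambda>z. det (?F z)) \<in> borel_measurable (\<mu> \<Otimes>\<^sub>M prodm g)"
    proof (rule det_measurable)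
      have sp: "fst z \<in> carrier_mat d d" "snd z \<in> space (prodm g)" if "z \<in> space (\<mu> \<Otimes>\<^sub>M prodm g)" for z
        using that unitaryD(1) by (auto simp: space_pair_measure)
      show "?F z \<in> carrier_mat d d" if "z \<in> space (\<mu> \<Otimes>\<^sub>M prodm g)" for z
        using mult_carrier_mat[OF sp(1)[OF that] comb_carrier(1)[OF sp(2)[OF that], of x]] by simp
      fix i j assume ij: "i < d" "j < d"
      have "(\<lambda>z. of_bool (i = j) + (\<Sum>l<d. fst z $$ (i, l) * ?A (snd z) $$ (l, j))) \<in> borel_measurable (\<mu> \<Otimes>\<^sub>M prodm g)"
        by (intro borel_measurable_add borel_measurable_const borel_measurable_sum borel_measurable_times
            measurable_compose[OF measurable_fst entry_measurable] measurable_compose[OF measurable_snd comb_measurable])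
          (use ij in auto)
      then show "(\<lambda>z. ?F z $$ (i, j)) \<in> borel_measurable (\<mu> \<Otimes>\<^sub>M prodm g)"
      proof (rule measurable_cong[THEN iffD2, rotated])
        fix z assume z: "z \<in> space (\<mu> \<Otimes>\<^sub>M prodm g)"
        note c = sp(1)[OF z] comb_carrier(1)[OF sp(2)[OF z], of x]
        show "?F z $$ (i, j) = of_bool (i = j) + (\<Sum>l<d. fst z $$ (i, l) * ?A (snd z) $$ (l, j))"
          unfolding mult_mat_index[OF c ij, symmetric] by (rule one_plus_index[OF mult_carrier_mat[OF c] ij])
      qed
    qed
    then have "(\<lambda>z. ennreal (cmod (det (?F z)) ^ (2 * k))) \<in> borel_measurable (\<mu> \<Otimes>\<^sub>M prodm g)" by measurable
    then show ?thesis by (simp add: case_prod_unfold)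
  qed
  have "?L = (\<integral>\<^sup>+V. ?L \<partial>\<mu>)" by (simp add: emeasure_space_1 del: space_haar)
  also have "\<dots> = (\<integral>\<^sup>+V. \<integral>\<^sup>+U. ?h V U \<partial>prodm g \<partial>\<mu>)"
  proof (rule nn_integral_cong)
    fix V assume "V \<in> space \<mu>"
    then have V: "V \<in> unitary_group d" by simp
    have "?L = (\<integral>\<^sup>+U. ennreal (cmod (det (1\<^sub>m d + ?A (compose {1..g} (\<lambda>W. V * W) U))) ^ (2 * k)) \<partial>prodm g)"
      by (rule prodm_invariant[OF V L, symmetric])
    also have "\<dots> = (\<integral>\<^sup>+U. ?h V U \<partial>prodm g)"
      by (rule nn_integral_cong) (simp only: comb_left_mult[OF V])
    finally show "?L = (\<integral>\<^sup>+U. ?h V U \<partial>prodm g)" .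
  qed
  also have "\<dots> = (\<integral>\<^sup>+U. \<integral>\<^sup>+V. ?h V U \<partial>\<mu> \<partial>prodm g)"
    using Q.Fubini'[OF H] by simp
  finally show ?thesis .
qed

lemma relative_trace_measurable:
  assumes "i \<in> I" "j \<in> I"
  shows "(\<lambda>U. mtrace d (mat_adjoint (U i) * U j)) \<in> borel_measurable (PiM I (\<lambda>_. \<mu>))"
proof -
  have "(\<lambda>U. \<Sum>a<d. \<Sum>b<d. cnj (U i $$ (b, a)) * U j $$ (b, a)) \<in> borel_measurable (PiM I (\<lambda>_. \<mu>))"
    by (intro borel_measurable_sum borel_measurable_times component_entry_measurable assms
        measurable_compose[OF component_entry_measurable borel_measurable_continuous_onI[OF continuous_on_cnj[OF continuous_on_id]]])
      auto
  then show ?thesis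
  proof (rule measurable_cong[THEN iffD2, rotated])
    fix U assume "U \<in> space (PiM I (\<lambda>_. \<mu>))"
    note c = unitaryD(1)[OF space_prodm[OF this assms(1)]] unitaryD(1)[OF space_prodm[OF this assms(2)]]
    show "mtrace d (mat_adjoint (U i) * U j) = (\<Sum>a<d. \<Sum>b<d. cnj (U i $$ (b, a)) * U j $$ (b, a))"
      unfolding mtrace_mult_eq[OF mat_adjoint_carrier[OF c(1)] c(2)]
      by (intro sum.cong refl) (simp add: mat_adjoint_index[OF c(1)])
  qed
qed

text \<open>Integrate over U j first: with U i fixed, its adjoint times U j is Haar distributed by
  left invariance.\<close>

lemma nn_integral_relative_trace:
  assumes ij: "i \<in> {1..g}" "j \<in> {1..g}" "i \<noteq> j" and F: "F \<in> borel_measurable borel"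
  shows "(\<integral>\<^sup>+U. F (mtrace d (mat_adjoint (U i) * U j)) \<partial>prodm g) = (\<integral>\<^sup>+V. F (mtrace d V) \<partial>\<mu>)"
proof -
  let ?I = "{1..g} - {j}"
  interpret product_sigma_finite "\<lambda>_. \<mu>" by unfold_locales
  interpret P: prob_space "PiM ?I (\<lambda>_. \<mu>)" by (intro prob_space_PiM prob_space_axioms)
  have ins: "insert j ?I = {1..g}" using ij by auto
  have fin: "finite ?I" "j \<notin> ?I" by auto
  have meas: "(\<lambda>U. F (mtrace d (mat_adjoint (U i) * U j))) \<in> borel_measurable (PiM (insert j ?I) (\<lambda>_. \<mu>))"
    unfolding ins by (rule measurable_compose[OF relative_trace_measurable[OF ij(1,2)] F])
  have "(\<integral>\<^sup>+U. F (mtrace d (mat_adjoint (U i) * U j)) \<partial>prodm g)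
    = (\<integral>\<^sup>+x. \<integral>\<^sup>+y. F (mtrace d (mat_adjoint ((x(j := y)) i) * (x(j := y)) j)) \<partial>\<mu> \<partial>PiM ?I (\<lambda>_. \<mu>))"
    using product_nn_integral_insert[OF fin meas] unfolding ins .
  also have "\<dots> = (\<integral>\<^sup>+x. (\<integral>\<^sup>+V. F (mtrace d V) \<partial>\<mu>) \<partial>PiM ?I (\<lambda>_. \<mu>))"
  proof (rule nn_integral_cong)
    fix x assume "x \<in> space (PiM ?I (\<lambda>_. \<mu>))"
    then have "x i \<in> unitary_group d" using ij by (intro space_prodm) auto
    then have W: "mat_adjoint (x i) \<in> unitary_group d" by (rule unitary_adjoint)
    have "(\<integral>\<^sup>+y. F (mtrace d (mat_adjoint (x i) * y)) \<partial>\<mu>) = (\<integral>\<^sup>+V. F (mtrace d V) \<partial>\<mu>)"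
      by (rule nn_integral_left_mult[OF W measurable_compose[OF mtrace_measurable F]])
    then show "(\<integral>\<^sup>+y. F (mtrace d (mat_adjoint ((x(j := y)) i) * (x(j := y)) j)) \<partial>\<mu>) = (\<integral>\<^sup>+V. F (mtrace d V) \<partial>\<mu>)"
      using ij(3) by simp
  qed
  also have "\<dots> = (\<integral>\<^sup>+V. F (mtrace d V) \<partial>\<mu>)" by (simp only: nn_integral_const P.emeasure_space_1 mult_1_right)
  finally show ?thesis .
qed

text \<open>Expand the squared modulus of each entry. The diagonal terms give d * |x j|^2 because U
  j is unitary; the others are traces that by \<open>nn_integral_relative_trace\<close> are
  distributed like the trace of one Haar matrix.\<close>

lemma fro_comb:
  assumes U: "U \<in> space (prodm g)" and d: "0 < d"
  shows "d * fro d (matrix_combination d g x U) = d * (\<Sum>j=1..g. (cmod (x j))\<^sup>2) +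
    (\<Sum>p\<in>{p \<in> {1..g} \<times> {1..g}. fst p \<noteq> snd p}. Re (cnj (x (fst p)) * x (snd p) * mtrace d (mat_adjoint (U (fst p)) * U (snd p))))"
proof -
  let ?t = "\<lambda>i j. Re (cnj (x i) * x j * mtrace d (mat_adjoint (U i) * U j))"
  let ?S = "{1..g} \<times> {1..g}"
  have Uc: "U j \<in> carrier_mat d d" if "j \<in> {1..g}" for j using unitaryD(1)[OF space_prodm[OF U that]] .
  have t: "?t i j = (\<Sum>b<d. \<Sum>a<d. Re (cnj (x i * U i $$ (a, b)) * (x j * U j $$ (a, b))))"
    if "i \<in> {1..g}" "j \<in> {1..g}" for i j
  proof -
    have "mtrace d (mat_adjoint (U i) * U j) = (\<Sum>b<d. \<Sum>a<d. cnj (U i $$ (a, b)) * U j $$ (a, b))"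
      unfolding mtrace_mult_eq[OF mat_adjoint_carrier[OF Uc[OF that(1)]] Uc[OF that(2)]]
      by (intro sum.cong refl) (simp add: mat_adjoint_index[OF Uc[OF that(1)]])
    then have "cnj (x i) * x j * mtrace d (mat_adjoint (U i) * U j)
      = (\<Sum>b<d. \<Sum>a<d. cnj (x i * U i $$ (a, b)) * (x j * U j $$ (a, b)))"
      by (simp add: sum_distrib_left mult_ac)
    then show ?thesis by (simp only: Re_sum)
  qed
  have "d * fro d (matrix_combination d g x U) = (\<Sum>a<d. \<Sum>b<d. (cmod (\<Sum>j=1..g. x j * U j $$ (a, b)))\<^sup>2)"
    using d by (simp add: fro_def comb_carrier(2)[OF U])
  also have "\<dots> = (\<Sum>a<d. \<Sum>b<d. \<Sum>i=1..g. \<Sum>j=1..g. Re (cnj (x i * U i $$ (a, b)) * (x j * U j $$ (a, b))))"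
    by (simp only: norm_sum_square)
  also have "\<dots> = (\<Sum>a<d. \<Sum>b<d. \<Sum>p\<in>?S. Re (cnj (x (fst p) * U (fst p) $$ (a, b)) * (x (snd p) * U (snd p) $$ (a, b))))"
    by (rule sum.cong[OF refl], rule sum.cong[OF refl]) (simp only: sum.cartesian_product case_prod_unfold)
  also have "\<dots> = (\<Sum>b<d. \<Sum>a<d. \<Sum>p\<in>?S. Re (cnj (x (fst p) * U (fst p) $$ (a, b)) * (x (snd p) * U (snd p) $$ (a, b))))"
    by (rule sum.swap)
  also have "\<dots> = (\<Sum>b<d. \<Sum>p\<in>?S. \<Sum>a<d. Re (cnj (x (fst p) * U (fst p) $$ (a, b)) * (x (snd p) * U (snd p) $$ (a, b))))"
    by (rule sum.cong[OF refl]) (rule sum.swap)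
  also have "\<dots> = (\<Sum>p\<in>?S. \<Sum>b<d. \<Sum>a<d. Re (cnj (x (fst p) * U (fst p) $$ (a, b)) * (x (snd p) * U (snd p) $$ (a, b))))"
    by (rule sum.swap)
  also have "\<dots> = (\<Sum>p\<in>?S. ?t (fst p) (snd p))"
    by (rule sum.cong[OF refl]) (simp only: t mem_Times_iff)
  also have "\<dots> = (\<Sum>p\<in>{p \<in> ?S. fst p = snd p}. ?t (fst p) (snd p)) + (\<Sum>p\<in>{p \<in> ?S. fst p \<noteq> snd p}. ?t (fst p) (snd p))"
  proof -
    have "(\<Sum>p\<in>{p \<in> ?S. fst p = snd p} \<union> {p \<in> ?S. fst p \<noteq> snd p}. ?t (fst p) (snd p))
      = (\<Sum>p\<in>{p \<in> ?S. fst p = snd p}. ?t (fst p) (snd p)) + (\<Sum>p\<in>{p \<in> ?S. fst p \<noteq> snd p}. ?t (fst p) (snd p))"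
      by (rule sum.union_disjoint) auto
    moreover have "{p \<in> ?S. fst p = snd p} \<union> {p \<in> ?S. fst p \<noteq> snd p} = ?S" by blast
    ultimately show ?thesis by (simp only:)
  qed
  also have "(\<Sum>p\<in>{p \<in> ?S. fst p = snd p}. ?t (fst p) (snd p)) = (\<Sum>j=1..g. ?t j j)"
    by (rule sum.reindex_bij_witness[where i = "\<lambda>j. (j, j)" and j = fst]) auto
  also have "\<dots> = (\<Sum>j=1..g. d * (cmod (x j))\<^sup>2)"
  proof (rule sum.cong[OF refl])
    fix j assume "j \<in> {1..g}"
    from unitaryD(3)[OF space_prodm[OF U this]]
    have "mtrace d (mat_adjoint (U j) * U j) = of_nat d" by (simp add: mtrace_def)
    moreover have "cnj (x j) * x j = complex_of_real ((cmod (x j))\<^sup>2)" by (simp only: complex_norm_square mult.commute)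
    ultimately show "?t j j = d * (cmod (x j))\<^sup>2" by (simp del: of_real_power)
  qed
  finally show ?thesis by (simp only: sum_distrib_left)
qed

section \<open>Deviations of the mean eigenvalue and choice of constants\<close>

text \<open>\<open>weighted_sum_le\<close> costs exp (k d (\<open>fro\<close> / t - 1)), whose
  exponent by \<open>fro_comb\<close> is at most - \<delta> d plus the cross terms. After
  \<open>exp_sum_le\<close> each cross term enters with the parameter \<beta> = card P * k / t. The
  conditions on k' say that |w| \<le> \<beta> / (2 k') implies |w| \<le> 1/8 and 10 k' |w|^2 \<le>
  \<delta>, so that by \<open>exp_trace_moment\<close> the exponential moments grow at most like exp
  (\<delta> d).\<close>

theorem moment_bound:
  fixes g :: nat
  defines "P \<equiv> {p \<in> {1..g} \<times> {1..g}. fst p \<noteq> snd p}"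
  assumes d: "0 < d" and t: "0 < t" "t < 1" and x: "L2_set (\<lambda>j. cmod (x j)) {1..g} \<le> r" "r < 1"
    and \<delta>: "\<delta> = k * (1 - r\<^sup>2 / t)"
    and k': "0 < k'" "4 * (card P * k / t) \<le> real k'" "5 * (card P * k / t)\<^sup>2 \<le> 2 * \<delta> * k'"
  shows "(\<integral>\<^sup>+U. ennreal (cmod (det (1\<^sub>m d + matrix_combination d g x U)) ^ (2 * k)) \<partial>prodm g)
    \<le> ennreal ((2 + card P * psum k' (1 / 4)) * psum k t)"
proof -
  let ?A = "matrix_combination d g x"
  let ?\<beta> = "card P * k / t"
  let ?E = "\<lambda>U. exp ((k * d) * (fro d (?A U) / t - 1))"
  let ?t = "\<lambda>p U. mtrace d (mat_adjoint (U (fst p)) * U (snd p))"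
  let ?c = "\<lambda>p. cnj (x (fst p)) * x (snd p)"
  let ?e = "\<lambda>p U. ennreal (exp (?\<beta> * Re (?c p * ?t p U)))"
  interpret Q: prob_space "prodm g" by (intro prob_space_PiM prob_space_axioms)
  have finP: "finite P" by (simp add: P_def)
  have S: "0 \<le> psum k t" "0 \<le> psum k' (1 / 4)" by (rule psum_bounds(2); use t in simp)+
  have nx: "(\<Sum>j=1..g. (cmod (x j))\<^sup>2) \<le> r\<^sup>2"
  proof -
    have "sqrt (\<Sum>j=1..g. (cmod (x j))\<^sup>2) \<le> r" using x(1) by (simp add: L2_set_def)
    then show ?thesis using sqrt_le_D by blast
  qed
  have r0: "0 \<le> r" using x(1) L2_set_nonneg order_trans by blast
  have x1: "cmod (x j) \<le> 1" if "j \<in> {1..g}" for j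
    using member_le_L2_set[OF finite_atLeastAtMost that, of "\<lambda>j. cmod (x j)"] x by linarith
  have c1: "cmod (?c p) \<le> 1" if "p \<in> P" for p
  proof -
    have "cmod (x (fst p)) \<le> 1" "cmod (x (snd p)) \<le> 1" using that by (auto simp: P_def intro!: x1)
    then have "cmod (x (fst p)) * cmod (x (snd p)) \<le> 1 * 1" by (intro mult_mono) auto
    then show ?thesis by (simp add: norm_mult)
  qed
  have em: "?e p \<in> borel_measurable (prodm g)" if "p \<in> P" for p
  proof -
    have [measurable]: "?t p \<in> borel_measurable (prodm g)"
      using that by (intro relative_trace_measurable) (auto simp: P_def)
    show ?thesis by measurable
  qed
  have e_le: "(\<integral>\<^sup>+U. ?e p U \<partial>prodm g) \<le> ennreal (exp (\<delta> * d) * psum k' (1 / 4))" if p: "p \<in> P" for p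
  proof -
    \<comment> \<open>Scaled so that 2 k' * Re (w z) = \<beta> * Re (c z), where c is the
      coefficient of the pair p: a larger power k' makes w small enough for
      \<open>exp_trace_moment\<close>.\<close>
    define w where "w = complex_of_real (?\<beta> / (2 * k')) * ?c p"
    have \<beta>0: "0 \<le> ?\<beta>" using t by simp
    have nn: "0 \<le> ?\<beta> / (2 * k')" by (rule divide_nonneg_nonneg[OF \<beta>0]) simp
    have "cmod w = ?\<beta> / (2 * k') * cmod (?c p)"
      unfolding w_def norm_mult norm_of_real abs_of_nonneg[OF nn] by (rule refl)
    also have "\<dots> \<le> ?\<beta> / (2 * k')" using mult_left_mono[OF c1[OF p] nn] by (simp only: mult_1_right)
    finally have w: "cmod w \<le> ?\<beta> / (2 * k')" .
    have w8: "cmod w \<le> 1 / 8"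
    proof -
      have gen: "b / (2 * q) \<le> 1 / 8" if "0 < q" "4 * b \<le> q" for b q :: real
        using that by (simp add: field_simps)
      have "?\<beta> / (2 * real k') \<le> 1 / 8" by (rule gen[OF _ k'(2)]) (use k'(1) in simp)
      then have "?\<beta> / (2 * k') \<le> 1 / 8" by simp
      then show ?thesis using w by linarith
    qed
    have "10 * k' * (cmod w)\<^sup>2 \<le> 10 * k' * (?\<beta> / (2 * k'))\<^sup>2"
      by (intro mult_left_mono power_mono w) auto
    also have "\<dots> = 5 * ?\<beta>\<^sup>2 / (2 * k')" using k'(1) by (simp add: power2_eq_square field_simps)
    also have "\<dots> \<le> \<delta>" using k'(1,3) by (simp add: pos_divide_le_eq mult_ac)
    finally have \<delta>w: "10 * k' * (cmod w)\<^sup>2 \<le> \<delta>" .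
    have F: "(\<lambda>z. ennreal (exp (?\<beta> * Re (?c p * z)))) \<in> borel_measurable borel" by measurable
    have "(\<integral>\<^sup>+U. ?e p U \<partial>prodm g) = (\<integral>\<^sup>+V. ennreal (exp (?\<beta> * Re (?c p * mtrace d V))) \<partial>\<mu>)"
      using nn_integral_relative_trace[OF _ _ _ F, of "fst p" g "snd p"] p by (auto simp: P_def)
    also have "\<dots> = (\<integral>\<^sup>+V. ennreal (exp (real (2 * k') * Re (w * mtrace d V))) \<partial>\<mu>)"
    proof (rule nn_integral_cong)
      fix V
      have "w * mtrace d V = complex_of_real (?\<beta> / (2 * k')) * (?c p * mtrace d V)"
        unfolding w_def by (rule mult.assoc)
      moreover have "real (2 * k') * Re (complex_of_real (b / (2 * k')) * z) = b * Re z" for b z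
        using k'(1) by simp
      ultimately have "real (2 * k') * Re (w * mtrace d V) = ?\<beta> * Re (?c p * mtrace d V)"
        by (simp only:)
      then show "ennreal (exp (?\<beta> * Re (?c p * mtrace d V))) = ennreal (exp (real (2 * k') * Re (w * mtrace d V)))" by simp
    qed
    also have "\<dots> \<le> ennreal (exp (10 * k' * (cmod w)\<^sup>2 * d) * psum k' (1 / 4))"
      using exp_trace_moment[OF w8 d, of k'] by simp
    also have "\<dots> \<le> ennreal (exp (\<delta> * d) * psum k' (1 / 4))"
      by (intro ennreal_leI mult_right_mono S) (use mult_right_mono[OF \<delta>w, of d] in simp)
    finally show ?thesis .
  qed
  have E_le: "?E U \<le> exp (- \<delta> * d) * (1 + (\<Sum>p\<in>P. exp (?\<beta> * Re (?c p * ?t p U))))" if U: "U \<in> space (prodm g)" for U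
  proof -
    let ?Z = "\<lambda>p. k / t * Re (?c p * ?t p U)"
    have "(k * d) * (fro d (?A U) / t - 1) = k / t * (d * fro d (?A U)) - k * d"
      using t by (simp add: field_simps)
    also have "\<dots> = k / t * (d * (\<Sum>j=1..g. (cmod (x j))\<^sup>2)) - k * d + (\<Sum>p\<in>P. ?Z p)"
      unfolding fro_comb[OF U d] P_def by (simp add: distrib_left sum_distrib_left)
    also have "k / t * (d * (\<Sum>j=1..g. (cmod (x j))\<^sup>2)) \<le> k / t * (d * r\<^sup>2)"
      by (intro mult_left_mono nx) (use t in simp_all)
    also have "k / t * (d * r\<^sup>2) - k * d = - \<delta> * d" using t by (simp add: \<delta> field_simps)
    finally have "(k * d) * (fro d (?A U) / t - 1) \<le> - \<delta> * d + (\<Sum>p\<in>P. ?Z p)" by simp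
    then have "?E U \<le> exp (- \<delta> * d) * exp (\<Sum>p\<in>P. ?Z p)" by (simp add: exp_add[symmetric])
    \<comment> \<open>The factor card P from \<open>exp_sum_le\<close> turns k / t into
      \<beta>.\<close>
    also have "\<dots> \<le> exp (- \<delta> * d) * (1 + (\<Sum>p\<in>P. exp (card P * ?Z p)))"
      by (intro mult_left_mono exp_sum_le finP) simp
    also have "(\<Sum>p\<in>P. exp (card P * ?Z p)) = (\<Sum>p\<in>P. exp (?\<beta> * Re (?c p * ?t p U)))"
    proof -
      have "a * (b / c * z) = a * b / c * z" for a b c z :: real by simp
      then show ?thesis by (simp only: of_nat_mult)
    qed
    finally show ?thesis .
  qed
  have "(\<integral>\<^sup>+U. ennreal (?E U) \<partial>prodm g) \<le> (\<integral>\<^sup>+U. ennreal (exp (- \<delta> * d)) * (1 + (\<Sum>p\<in>P. ?e p U)) \<partial>prodm g)"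
  proof (rule nn_integral_mono)
    fix U assume U: "U \<in> space (prodm g)"
    have "ennreal (exp (- \<delta> * d) * (1 + (\<Sum>p\<in>P. exp (?\<beta> * Re (?c p * ?t p U))))) = ennreal (exp (- \<delta> * d)) * (1 + (\<Sum>p\<in>P. ?e p U))"
      by (rule ennreal_mult_one_plus_sum) simp_all
    then show "ennreal (?E U) \<le> ennreal (exp (- \<delta> * d)) * (1 + (\<Sum>p\<in>P. ?e p U))"
      using ennreal_leI[OF E_le[OF U]] by (simp only:)
  qed
  also have "\<dots> = ennreal (exp (- \<delta> * d)) * (1 + (\<Sum>p\<in>P. \<integral>\<^sup>+U. ?e p U \<partial>prodm g))"
  proof -
    have ms: "(\<lambda>U. \<Sum>p\<in>P. ?e p U) \<in> borel_measurable (prodm g)" by (intro borel_measurable_sum em)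
    have "(\<integral>\<^sup>+U. 1 + (\<Sum>p\<in>P. ?e p U) \<partial>prodm g) = (\<integral>\<^sup>+U. 1 \<partial>prodm g) + (\<integral>\<^sup>+U. (\<Sum>p\<in>P. ?e p U) \<partial>prodm g)"
      by (rule nn_integral_add[OF borel_measurable_const ms])
    also have "(\<integral>\<^sup>+U. (\<Sum>p\<in>P. ?e p U) \<partial>prodm g) = (\<Sum>p\<in>P. \<integral>\<^sup>+U. ?e p U \<partial>prodm g)"
      by (rule nn_integral_sum[OF em])
    finally have "(\<integral>\<^sup>+U. 1 + (\<Sum>p\<in>P. ?e p U) \<partial>prodm g) = 1 + (\<Sum>p\<in>P. \<integral>\<^sup>+U. ?e p U \<partial>prodm g)"
      by (simp only: nn_integral_const Q.emeasure_space_1 mult_1_right)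
    then show ?thesis
      using nn_integral_cmult[OF borel_measurable_add[OF borel_measurable_const ms], of "ennreal (exp (- \<delta> * d))" 1] by (simp only:)
  qed
  also have "\<dots> \<le> ennreal (exp (- \<delta> * d)) * (1 + (\<Sum>p\<in>P. ennreal (exp (\<delta> * d) * psum k' (1 / 4))))"
    by (intro mult_left_mono add_left_mono sum_mono e_le) simp_all
  also have "\<dots> = ennreal (exp (- \<delta> * d) * (1 + card P * (exp (\<delta> * d) * psum k' (1 / 4))))"
    using ennreal_mult_one_plus_sum[of "exp (- \<delta> * d)" P "\<lambda>_. exp (\<delta> * d) * psum k' (1 / 4)"] S(2)
    by (simp only: sum_constant exp_ge_zero mult_nonneg_nonneg)
  \<comment> \<open>exp (- \<delta> d) and exp (\<delta> d) cancel; at this point the bound becomes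
    independent of d.\<close>
  also have "\<dots> \<le> ennreal (1 + card P * psum k' (1 / 4))"
  proof (rule ennreal_leI)
    have "0 \<le> 2 * \<delta> * k'" using k'(3) zero_le_power2[of ?\<beta>] by linarith
    then have "0 \<le> \<delta>" using k'(1) by (simp add: zero_le_mult_iff)
    then have "exp (- \<delta> * d) \<le> 1" by simp
    moreover have "exp (- \<delta> * d) * (1 + card P * (exp (\<delta> * d) * psum k' (1 / 4))) = exp (- \<delta> * d) + card P * psum k' (1 / 4)"
    proof -
      have "exp (- \<delta> * d) * exp (\<delta> * d) = 1" by (simp add: exp_add[symmetric])
      moreover have "a * (1 + b * (c * z)) = a + b * z * (a * c)" for a b c z :: real
        by (simp add: algebra_simps)
      ultimately show ?thesis by (simp only: mult_1_right)
    qed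
    ultimately show "exp (- \<delta> * d) * (1 + card P * (exp (\<delta> * d) * psum k' (1 / 4))) \<le> 1 + card P * psum k' (1 / 4)" by simp
  qed
  finally have E: "(\<integral>\<^sup>+U. ennreal (?E U) \<partial>prodm g) \<le> ennreal (1 + card P * psum k' (1 / 4))" .
  have Em: "(\<lambda>U. ennreal (?E U)) \<in> borel_measurable (prodm g)"
  proof -
    have "(\<lambda>U. fro d (?A U)) \<in> borel_measurable (prodm g)"
      unfolding fro_def
      by (intro borel_measurable_divide borel_measurable_sum borel_measurable_power borel_measurable_const
          measurable_compose[OF comb_measurable borel_measurable_norm]) auto
    then show ?thesis by measurable
  qed
  have "(\<integral>\<^sup>+U. ennreal (cmod (det (1\<^sub>m d + ?A U)) ^ (2 * k)) \<partial>prodm g)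
    \<le> (\<integral>\<^sup>+U. ennreal (psum k t) * (1 + ennreal (?E U)) \<partial>prodm g)"
    unfolding det_moment_average
  proof (rule nn_integral_mono)
    fix U assume U: "U \<in> space (prodm g)"
    have "0 \<le> fro d (?A U)" by (simp add: fro_def sum_nonneg)
    from weighted_sum_le[where m = "k * d" and k = k, OF t this]
    have le: "(\<Sum>n\<le>k * d. fro d (?A U) ^ n * real ((n + 1) ^ (k * k))) \<le> (1 + ?E U) * psum k t" by simp
    have "(\<integral>\<^sup>+V. ennreal (cmod (det (1\<^sub>m d + V * ?A U)) ^ (2 * k)) \<partial>\<mu>) \<le> ennreal ((1 + ?E U) * psum k t)"
      by (rule order_trans[OF moment_le[OF comb_carrier(1)[OF U] d] ennreal_leI[OF le]])
    also have "\<dots> = ennreal (psum k t) * (1 + ennreal (?E U))"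
      using S(1) by (simp add: ennreal_mult ennreal_plus mult.commute)
    finally show "(\<integral>\<^sup>+V. ennreal (cmod (det (1\<^sub>m d + V * ?A U)) ^ (2 * k)) \<partial>\<mu>) \<le> ennreal (psum k t) * (1 + ennreal (?E U))" .
  qed
  also have "\<dots> = ennreal (psum k t) * (1 + (\<integral>\<^sup>+U. ennreal (?E U) \<partial>prodm g))"
  proof -
    have "(\<integral>\<^sup>+U. 1 + ennreal (?E U) \<partial>prodm g) = (\<integral>\<^sup>+U. 1 \<partial>prodm g) + (\<integral>\<^sup>+U. ennreal (?E U) \<partial>prodm g)"
      by (rule nn_integral_add[OF borel_measurable_const Em])
    then have "(\<integral>\<^sup>+U. 1 + ennreal (?E U) \<partial>prodm g) = 1 + (\<integral>\<^sup>+U. ennreal (?E U) \<partial>prodm g)"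
      by (simp only: nn_integral_const Q.emeasure_space_1 mult_1_right)
    then show ?thesis
      using nn_integral_cmult[OF borel_measurable_add[OF borel_measurable_const Em], of "ennreal (psum k t)" 1] by (simp only:)
  qed
  also have "\<dots> \<le> ennreal (psum k t) * (1 + ennreal (1 + card P * psum k' (1 / 4)))"
    by (intro mult_left_mono add_left_mono E) simp
  also have "\<dots> = ennreal ((2 + card P * psum k' (1 / 4)) * psum k t)"
  proof -
    have "1 + ennreal (1 + card P * psum k' (1 / 4)) = ennreal (2 + card P * psum k' (1 / 4))"
      using ennreal_plus[of 1 "1 + card P * psum k' (1 / 4)"] S(2) by simp
    moreover have "ennreal ((2 + card P * psum k' (1 / 4)) * psum k t) = ennreal (2 + card P * psum k' (1 / 4)) * ennreal (psum k t)"
      by (rule ennreal_mult) (use S in simp_all)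
    ultimately show ?thesis by (simp only: mult.commute)
  qed
  finally show ?thesis .
qed

end

theorem proposition1p6:
  fixes g :: nat
  assumes "g \<ge> 1"
  shows "\<forall>k::nat. \<forall>r::real. k \<ge> 1 \<longrightarrow> 0 \<le> r \<longrightarrow> r < 1 \<longrightarrow>
    (\<exists>C::real. \<forall>(d::nat) (\<mu> :: complex mat measure) (x :: nat \<Rightarrow> complex).
       d \<ge> 1 \<longrightarrow> is_unitary_haar d \<mu> \<longrightarrow> L2_set (\<lambda>j. cmod (x j)) {1..g} \<le> r \<longrightarrow>
       (\<integral>\<^sup>+ U. ennreal (cmod (det (1\<^sub>m d + matrix_combination d g x U)) ^ (2 * k))
          \<partial>(\<Pi>\<^sub>M j\<in>{1..g}. \<mu>)) \<le> ennreal C)"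
proof (intro allI impI)
  fix k :: nat and r :: real
  assume k: "1 \<le> k" and r: "0 \<le> r" "r < 1"
  define P where "P = {p \<in> {1..g} \<times> {1..g}. fst p \<noteq> snd p}"
  \<comment> \<open>The midpoint of r^2 and 1: t < 1 makes \<open>psum k t\<close> converge, and r^2
    < t leaves the positive gap \<delta>.\<close>
  define t where "t = (1 + r\<^sup>2) / 2"
  have r2: "0 \<le> r\<^sup>2" "r\<^sup>2 < 1" using r by (simp_all add: power_less_one_iff)
  have t: "0 < t" "t < 1" "r\<^sup>2 < t" using r2 by (simp_all add: t_def add_pos_nonneg)
  define \<delta> where "\<delta> = k * (1 - r\<^sup>2 / t)"
  have \<delta>: "0 < \<delta>" using k t by (simp add: \<delta>_def)
  let ?\<beta> = "card P * k / t"
  \<comment> \<open>k' depends on g, k and r only. The 1 in the maximum makes it positive; the other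
    two entries are the remaining conditions of \<open>moment_bound\<close>.\<close>
  obtain k' :: nat where k': "max 1 (max (4 * ?\<beta>) (5 * ?\<beta>\<^sup>2 / (2 * \<delta>))) \<le> real k'"
    using real_arch_simple by blast
  have k'1: "0 < k'" "4 * ?\<beta> \<le> real k'" using k' by auto
  have "5 * ?\<beta>\<^sup>2 / (2 * \<delta>) \<le> real k'" using k' by simp
  then have k'2: "5 * ?\<beta>\<^sup>2 \<le> 2 * \<delta> * k'" using \<delta> by (simp add: pos_divide_le_eq mult_ac)
  show "\<exists>C. \<forall>d \<mu> x. 1 \<le> d \<longrightarrow> is_unitary_haar d \<mu> \<longrightarrow> L2_set (\<lambda>j. cmod (x j)) {1..g} \<le> r \<longrightarrow>
       (\<integral>\<^sup>+ U. ennreal (cmod (det (1\<^sub>m d + matrix_combination d g x U)) ^ (2 * k))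
          \<partial>(\<Pi>\<^sub>M j\<in>{1..g}. \<mu>)) \<le> ennreal C"
  proof (intro exI[of _ "(2 + card P * psum k' (1 / 4)) * psum k t"] allI impI)
    fix d \<mu> x
    assume d: "1 \<le> d" and "is_unitary_haar d \<mu>" and x: "L2_set (\<lambda>j. cmod (x j)) {1..g} \<le> r"
    then interpret haar d \<mu> by unfold_locales
    from d have d0: "0 < d" by simp
    show "(\<integral>\<^sup>+ U. ennreal (cmod (det (1\<^sub>m d + matrix_combination d g x U)) ^ (2 * k)) \<partial>(\<Pi>\<^sub>M j\<in>{1..g}. \<mu>))
      \<le> ennreal ((2 + card P * psum k' (1 / 4)) * psum k t)"
      using moment_bound[OF d0 t(1,2) x r(2) \<delta>_def k'1(1), folded P_def] k'1(2) k'2 by blast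
  qed
qed

end
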